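(* Let $T$ be a spherically symmetric tree with spherically symmetric edge probabilities $(p_n)_{n\ge1}$ satisfying $0<\inf_n p_n\le \sup_n p_n<1$. Let $d_j$ be the number of children of a vertex at level $j$, and let $w_k$ be the expected number of vertices at level $k$ connected to the root at a fixed time. Consider dynamical percolation on $T$. (i) If $\sum_{k=1}^\infty k\,w_k^{-1}<\infty$, then almost surely the set of times $t\in[0,1]$ at which the root percolates has finitely many connected components. (This holds for example if $w_k\asymp k^\theta$ with $\theta>2$, as well as for supercritical percolation on a homogeneous tree.) (ii) If $\sup_j d_j<\infty$ and $w_k\asymp k^\theta$ where $1<\theta<2$, then with positive probability the set of times $t\in[0,1]$ at which the root percolates has infinitely many connected components. The same occurs if $w_k\asymp k(\log k)^\theta$ (for $k\ge2$) for any $\theta>1$.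
   Context: A spherically symmetric tree with spherically symmetric edge probabilities is an infinite locally finite rooted tree with root $\rho$ in which all vertices on a given level (distance from $\rho$) have the same number of children, and in which every edge joining level $n-1$ to level $n$ has the same probability $p_n$. $T_n$ denotes the set of vertices at level $n$. In static percolation each edge between levels $n-1$ and $n$ is independently open with probability $p_n$; $w_n=|T_n|\prod_{i=1}^n p_i$ is the expected number of vertices in $T_n$ connected to $\rho$ by open edges. Dynamical percolation: edges evolve independently as two-state continuous time Markov chains, an edge of probability $p$ switching from closed to open at rate $p$ and from open to closed at rate $1-p$, started from the stationary product measure. Convention: an edge is declared open at the times at which it changes state. The root percolates at time $t$ if $\rho$ belongs to an infinite open cluster at time $t$. $a_n\asymp b_n$ means that the ratio $a_n/b_n$ is bounded between two positive finite constants. *)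

theory Defs
  imports "HOL-Probability.Probability"
begin

section \<open>Rooted trees\<close>

text \<open>
  A rooted tree is given by its vertex set, its root \<open>rho\<close> and the map sending every other vertex
  to its neighbour on the path to the root; the value of \<open>parent\<close> at the root is irrelevant.
  An edge is identified with its endpoint farther from the root.
\<close>

record 'v rtree =
  verts :: "'v set"
  rho :: 'v
  parent :: "'v \<Rightarrow> 'v"

definition rooted_tree :: "'v rtree \<Rightarrow> bool" where
  "rooted_tree T \<longleftrightarrow>
     rho T \<in> verts T \<and>
     (\<forall>v \<in> verts T - {rho T}. parent T v \<in> verts T) \<and>
     (\<forall>v \<in> verts T. \<exists>n. (parent T ^^ n) v = rho T)"

definition edges :: "'v rtree \<Rightarrow> 'v set" where
  "edges T = verts T - {rho T}"

definition children :: "'v rtree \<Rightarrow> 'v \<Rightarrow> 'v set" where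
  "children T v = {u \<in> edges T. parent T u = v}"

definition level :: "'v rtree \<Rightarrow> 'v \<Rightarrow> nat" where
  "level T v = (LEAST n. (parent T ^^ n) v = rho T)"

definition level_set :: "'v rtree \<Rightarrow> nat \<Rightarrow> 'v set" where
  "level_set T n = {v \<in> verts T. level T v = n}"

definition spherically_symmetric_tree :: "'v rtree \<Rightarrow> (nat \<Rightarrow> nat) \<Rightarrow> bool" where
  "spherically_symmetric_tree T d \<longleftrightarrow>
     rooted_tree T \<and> infinite (verts T) \<and>
     (\<forall>v \<in> verts T. finite (children T v) \<and> card (children T v) = d (level T v))"

text \<open>
  Both customary conventions are allowed: either all vertices have the same degree (so that the
  root has one child more than the others), or all vertices have the same number of children.
\<close>

definition homogeneous_tree :: "'v rtree \<Rightarrow> bool" where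
  "homogeneous_tree T \<longleftrightarrow> rooted_tree T \<and> infinite (verts T) \<and>
     (\<forall>v \<in> verts T. finite (children T v)) \<and>
     (\<exists>b. (\<forall>v \<in> verts T - {rho T}. card (children T v) = b) \<and>
          card (children T (rho T)) \<in> {b, b + 1})"


section \<open>Static percolation\<close>

text \<open>A configuration is a predicate on edges: \<open>c v\<close> says that the edge from \<open>v\<close> to its parent is
  open. Its values outside \<open>edges T\<close> play no role.\<close>

definition open_adj :: "'v rtree \<Rightarrow> ('v \<Rightarrow> bool) \<Rightarrow> ('v \<times> 'v) set" where
  "open_adj T c = {(u, v). (v \<in> edges T \<and> u = parent T v \<and> c v) \<or>
                           (u \<in> edges T \<and> v = parent T u \<and> c u)}"

definition cluster :: "'v rtree \<Rightarrow> ('v \<Rightarrow> bool) \<Rightarrow> 'v \<Rightarrow> 'v set" where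
  "cluster T c v = (open_adj T c)\<^sup>* `` {v}"

definition root_percolates :: "'v rtree \<Rightarrow> ('v \<Rightarrow> bool) \<Rightarrow> bool" where
  "root_percolates T c \<longleftrightarrow> infinite (cluster T c (rho T))"

definition static_perc :: "'v rtree \<Rightarrow> (nat \<Rightarrow> real) \<Rightarrow> ('v \<Rightarrow> bool) measure" where
  "static_perc T p = (\<Pi>\<^sub>M v \<in> edges T. measure_pmf (bernoulli_pmf (p (level T v))))"

text \<open>The expected number of vertices of level \<open>n\<close> in the open cluster of the root; see
  \<open>mean_conn_eq_expectation\<close> below.\<close>

definition mean_conn :: "'v rtree \<Rightarrow> (nat \<Rightarrow> real) \<Rightarrow> nat \<Rightarrow> real" where
  "mean_conn T p n = real (card (level_set T n)) * (\<Prod>i = 1..n. p i)"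

definition critical_prob :: "'v rtree \<Rightarrow> real" where
  "critical_prob T =
     Inf {q \<in> {0..1}. \<P>(c in static_perc T (\<lambda>_. q). root_percolates T c) > 0}"


section \<open>Dynamical percolation\<close>

text \<open>
  The chain of a single edge of probability \<open>q\<close> is built from its state \<open>s\<close> at time 0 (\<open>True\<close> =
  open) and independent unit exponential variables \<open>x 0, x 1, \<dots>\<close>. The state after \<open>k\<close> switches is
  left at the rate \<open>leave_rate\<close>, that is after an exponential holding time
  \<open>x k / leave_rate q (state s k)\<close> of that parameter.
\<close>

definition leave_rate :: "real \<Rightarrow> bool \<Rightarrow> real" where
  "leave_rate q s = (if s then 1 - q else q)"

definition state :: "bool \<Rightarrow> nat \<Rightarrow> bool" where
  "state s k = (if even k then s else \<not> s)"

definition switch_time :: "real \<Rightarrow> bool \<Rightarrow> (nat \<Rightarrow> real) \<Rightarrow> nat \<Rightarrow> real" where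
  "switch_time q s x k = (\<Sum>i<k. x i / leave_rate q (state s i))"

text \<open>
  An edge is closed at time \<open>t \<ge> 0\<close> iff \<open>t\<close> lies strictly between the ends of a closed holding period
  (or in the initial one, including time 0), so it is open at its switching times. If, on a null
  event, the switching times accumulate, the edge is open from then on.
\<close>

definition edge_open :: "real \<Rightarrow> bool \<times> (nat \<Rightarrow> real) \<Rightarrow> real \<Rightarrow> bool" where
  "edge_open q = (\<lambda>(s, x) t. \<not> (\<exists>k. \<not> state s k \<and>
     (k = 0 \<or> switch_time q s x k < t) \<and> t < switch_time q s x (Suc k)))"

definition edge_law :: "real \<Rightarrow> (bool \<times> (nat \<Rightarrow> real)) measure" where
  "edge_law q = measure_pmf (bernoulli_pmf q) \<Otimes>\<^sub>M
     (\<Pi>\<^sub>M k \<in> UNIV. density lborel (\<lambda>y. ennreal (exponential_density 1 y)))"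

definition dyn_perc ::
    "'v rtree \<Rightarrow> (nat \<Rightarrow> real) \<Rightarrow> ('v \<Rightarrow> bool \<times> (nat \<Rightarrow> real)) measure" where
  "dyn_perc T p = (\<Pi>\<^sub>M v \<in> edges T. edge_law (p (level T v)))"

definition config_at ::
    "'v rtree \<Rightarrow> (nat \<Rightarrow> real) \<Rightarrow> ('v \<Rightarrow> bool \<times> (nat \<Rightarrow> real)) \<Rightarrow> real \<Rightarrow> 'v \<Rightarrow> bool" where
  "config_at T p \<omega> t v = edge_open (p (level T v)) (\<omega> v) t"

definition perc_times ::
    "'v rtree \<Rightarrow> (nat \<Rightarrow> real) \<Rightarrow> ('v \<Rightarrow> bool \<times> (nat \<Rightarrow> real)) \<Rightarrow> real set" where
  "perc_times T p \<omega> = {t \<in> {0..1}. root_percolates T (config_at T p \<omega> t)}"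


section \<open>Comparison of sequences\<close>

definition asymp_from :: "nat \<Rightarrow> (nat \<Rightarrow> real) \<Rightarrow> (nat \<Rightarrow> real) \<Rightarrow> bool" where
  "asymp_from m a b \<longleftrightarrow> (\<exists>c C. 0 < c \<and> (\<forall>n\<ge>m. c \<le> a n / b n \<and> a n / b n \<le> C))"


section \<open>\<open>mean_conn\<close> as an expectation\<close>

lemma level_parent:
  assumes "rooted_tree T" "v \<in> edges T"
  shows "level T v = Suc (level T (parent T v))"
proof -
  obtain n where n: "(parent T ^^ n) v = rho T"
    using assms by (auto simp: rooted_tree_def edges_def)
  have "v \<noteq> rho T" using assms by (auto simp: edges_def)
  then have "\<not> (parent T ^^ 0) v = rho T" by simp
  from Least_Suc[of "\<lambda>n. (parent T ^^ n) v = rho T", OF n this] show ?thesis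
    unfolding level_def by (simp only: funpow_Suc_right o_def)
qed

lemma level_rho [simp]: "level T (rho T) = 0"
  unfolding level_def by (rule Least_eq_0) simp

lemma level_0:
  assumes "rooted_tree T" "v \<in> verts T" "level T v = 0"
  shows "v = rho T"
  using level_parent[OF assms(1), of v] assms by (auto simp: edges_def)

definition ancestors :: "'v rtree \<Rightarrow> 'v \<Rightarrow> 'v set" where
  "ancestors T v = (\<lambda>i. (parent T ^^ i) v) ` {..<level T v}"

lemma ancestors_rho [simp]: "ancestors T (rho T) = {}"
  by (simp add: ancestors_def)

lemma ancestors_step:
  assumes "rooted_tree T" "v \<in> edges T"
  shows "ancestors T v = insert v (ancestors T (parent T v))"
  unfolding ancestors_def level_parent[OF assms] lessThan_Suc_eq_insert_0
  by (simp add: image_image funpow_swap1)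

lemma tree_induct [consumes 2, case_names rho step]:
  assumes "rooted_tree T" "v \<in> verts T" "P (rho T)"
    and "\<And>v. v \<in> edges T \<Longrightarrow> parent T v \<in> verts T \<Longrightarrow> P (parent T v) \<Longrightarrow> P v"
  shows "P v"
  using assms(2)
proof (induction "level T v" arbitrary: v)
  case 0
  then show ?case using level_0[OF assms(1)] assms(3) by metis
next
  case (Suc n)
  have e: "v \<in> edges T" using Suc by (auto simp: edges_def)
  then have "parent T v \<in> verts T" using assms(1) by (auto simp: rooted_tree_def edges_def)
  moreover have "level T (parent T v) = n" using level_parent[OF assms(1) e] Suc by simp
  ultimately show ?case using Suc.hyps(1) assms(4) e by blast
qed

lemma ancestors_edges:
  assumes "rooted_tree T" "v \<in> verts T"
  shows "ancestors T v \<subseteq> edges T" and "\<And>u. u \<in> ancestors T v \<Longrightarrow> level T u \<le> level T v"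
    and "finite (ancestors T v)"
    and "(\<Prod>u\<in>ancestors T v. f (level T u)) = (\<Prod>i = 1..level T v. f i :: real)"
proof -
  have "ancestors T v \<subseteq> edges T \<and> (\<forall>u \<in> ancestors T v. level T u \<le> level T v)
    \<and> finite (ancestors T v)
    \<and> (\<Prod>u\<in>ancestors T v. f (level T u)) = (\<Prod>i = 1..level T v. f i)"
    using assms
  proof (induction rule: tree_induct)
    case rho
    then show ?case by simp
  next
    case (step v)
    have "v \<notin> ancestors T (parent T v)"
      using step level_parent[OF assms(1) step(1)] by fastforce
    then show ?case
      using step by (auto simp: ancestors_step[OF assms(1)] level_parent[OF assms(1)] mult.commute)
  qed
  then show "ancestors T v \<subseteq> edges T" and "\<And>u. u \<in> ancestors T v \<Longrightarrow> level T u \<le> level T v"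
    and "finite (ancestors T v)"
    and "(\<Prod>u\<in>ancestors T v. f (level T u)) = (\<Prod>i = 1..level T v. f i :: real)"
    by auto
qed

lemma in_cluster_iff:
  assumes "rooted_tree T" "v \<in> verts T"
  shows "v \<in> cluster T c (rho T) \<longleftrightarrow> (\<forall>u \<in> ancestors T v. c u)"
proof
  assume "v \<in> cluster T c (rho T)"
  then have "(rho T, v) \<in> (open_adj T c)\<^sup>*" by (simp add: cluster_def)
  then show "\<forall>u \<in> ancestors T v. c u"
    by (induction rule: rtrancl_induct)
       (auto simp: open_adj_def ancestors_step[OF assms(1)])
next
  assume "\<forall>u \<in> ancestors T v. c u"
  with assms show "v \<in> cluster T c (rho T)"
  proof (induction rule: tree_induct)
    case rho
    then show ?case by (simp add: cluster_def)
  next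
    case (step v)
    then have "(rho T, parent T v) \<in> (open_adj T c)\<^sup>*" "c v"
      by (auto simp: cluster_def ancestors_step[OF assms(1)])
    moreover have "(parent T v, v) \<in> open_adj T c"
      using step \<open>c v\<close> by (auto simp: open_adj_def)
    ultimately show ?case by (auto simp: cluster_def)
  qed
qed

lemma finite_level_set:
  assumes "spherically_symmetric_tree T d"
  shows "finite (level_set T n)"
proof (induction n)
  case 0
  have "level_set T 0 \<subseteq> {rho T}"
    using assms level_0 by (auto simp: level_set_def spherically_symmetric_tree_def)
  then show ?case using finite_subset by blast
next
  case (Suc n)
  have rt: "rooted_tree T" using assms by (simp add: spherically_symmetric_tree_def)
  have "level_set T (Suc n) \<subseteq> (\<Union>u \<in> level_set T n. children T u)"
  proof
    fix v assume v: "v \<in> level_set T (Suc n)"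
    then have e: "v \<in> edges T" by (auto simp: level_set_def edges_def)
    then have "parent T v \<in> level_set T n"
      using v level_parent[OF rt e] rt by (auto simp: level_set_def rooted_tree_def edges_def)
    then show "v \<in> (\<Union>u \<in> level_set T n. children T u)"
      using e by (auto simp: children_def)
  qed
  moreover have "finite (\<Union>u \<in> level_set T n. children T u)"
    using Suc assms by (auto simp: level_set_def spherically_symmetric_tree_def)
  ultimately show ?case using finite_subset by blast
qed

lemma mean_conn_eq_expectation:
  assumes T: "spherically_symmetric_tree T d" and p: "\<And>n. n \<ge> 1 \<Longrightarrow> p n \<in> {0..1}"
  shows "mean_conn T p n = (\<integral>c. real (card (level_set T n \<inter> cluster T c (rho T))) \<partial>static_perc T p)"
proof -
  let ?M = "\<lambda>v. measure_pmf (bernoulli_pmf (p (level T v)))"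
  let ?E = "\<lambda>v. prod_emb (edges T) ?M (ancestors T v) (Pi\<^sub>E (ancestors T v) (\<lambda>_. {True}))"
  interpret product_prob_space ?M "edges T"
    by unfold_locales
  have rt: "rooted_tree T" using T by (simp add: spherically_symmetric_tree_def)
  have fin: "finite (level_set T n)" using finite_level_set[OF T] .
  have P: "static_perc T p = PiM (edges T) ?M" by (simp add: static_perc_def)
  have E: "?E v = {c \<in> space (static_perc T p). v \<in> cluster T c (rho T)}"
    if "v \<in> verts T" for v
  proof -
    have "?E v = Pi\<^sub>E (edges T) (\<lambda>u. if u \<in> ancestors T v then {True} else space (?M u))"
      by (rule prod_emb_PiE[OF ancestors_edges(1)[OF rt that]]) simp
    also have "\<dots> = {c \<in> Pi\<^sub>E (edges T) (\<lambda>u. space (?M u)). \<forall>u \<in> ancestors T v. c u}"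
      using ancestors_edges(1)[OF rt that]
      by (auto simp: PiE_iff split: if_splits
               dest: extensional_arb)
    finally show ?thesis
      by (simp only: P space_PiM in_cluster_iff[OF rt that])
  qed
  have pr: "measure (static_perc T p) (?E v) = (\<Prod>i = 1..n. p i)" if "v \<in> level_set T n" for v
  proof -
    have v: "v \<in> verts T" "level T v = n" using that by (auto simp: level_set_def)
    have "measure (static_perc T p) (?E v) = (\<Prod>u\<in>ancestors T v. measure (?M u) {True})"
      unfolding P using ancestors_edges(1,3)[OF rt v(1)] by (intro measure_PiM_emb) auto
    also have "\<dots> = (\<Prod>u\<in>ancestors T v. p (level T u))"
    proof (rule prod.cong[OF refl])
      fix u assume "u \<in> ancestors T v"
      then have "u \<in> edges T" using ancestors_edges(1)[OF rt v(1)] by auto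
      then have "p (level T u) \<in> {0..1}" using level_parent[OF rt, of u] p by simp
      then show "measure (?M u) {True} = p (level T u)"
        by (simp add: measure_pmf_single)
    qed
    finally show ?thesis using ancestors_edges(4)[OF rt v(1), of p] v by simp
  qed
  have meas: "?E v \<in> sets (static_perc T p)" if "v \<in> level_set T n" for v
    unfolding P using that ancestors_edges(1,3)[OF rt, of v]
    by (intro sets_PiM_I) (auto simp: level_set_def)
  have "(\<integral>c. real (card (level_set T n \<inter> cluster T c (rho T))) \<partial>static_perc T p)
      = (\<integral>c. (\<Sum>v\<in>level_set T n. indicator (?E v) c) \<partial>static_perc T p)"
  proof (rule Bochner_Integration.integral_cong[OF refl])
    fix c assume c: "c \<in> space (static_perc T p)"
    have "(\<Sum>v\<in>level_set T n. indicator (?E v) c)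
        = (\<Sum>v\<in>level_set T n. if v \<in> cluster T c (rho T) then 1 else 0 :: real)"
    proof (rule sum.cong[OF refl])
      fix v assume "v \<in> level_set T n"
      then show "indicator (?E v) c = (if v \<in> cluster T c (rho T) then 1 else 0 :: real)"
        using c E[of v] by (auto simp: level_set_def indicator_def)
    qed
    also have "\<dots> = real (card (level_set T n \<inter> cluster T c (rho T)))"
      using fin by (simp add: sum.If_cases)
    finally show "real (card (level_set T n \<inter> cluster T c (rho T)))
        = (\<Sum>v\<in>level_set T n. indicator (?E v) c)" by simp
  qed
  also have "\<dots> = (\<Sum>v\<in>level_set T n. measure (static_perc T p) (?E v))"
    using meas by (subst Bochner_Integration.integral_sum)
      (auto simp: P emeasure_eq_measure less_top[symmetric] intro!: integrable_real_indicator)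
  also have "\<dots> = mean_conn T p n" using pr by (simp add: mean_conn_def)
  finally show ?thesis by simp
qed

end

theory Submission
  imports Defs
begin

text \<open>
  Let \<open>q\<^sub>k\<close> be the probability that a vertex at level \<open>k\<close> is connected to infinity below it, so that
  \<open>q\<^sub>k = 1 - (1 - p\<^sub>k\<^sub>+\<^sub>1 q\<^sub>k\<^sub>+\<^sub>1)^d\<^sub>k\<close>, which makes \<open>q\<^sub>k\<close> comparable to the inverse of \<open>\<Sum>j\<ge>k. w\<^sub>k / w\<^sub>j\<close>.

  For the first part, truncate the tree at level \<open>n\<close> and let \<open>\<delta>\<^sub>k\<close> be the probability that a vertex of
  level \<open>k\<close> is connected to level \<open>n\<close> at time \<open>t\<close> but not at time \<open>t + h\<close>. The recursion for \<open>\<delta>\<^sub>k\<close>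
    contains the
  derivative of \<open>x \<mapsto> 1 - (1 - x)^d\<close>, and the inequality of the means turns it into
  \<open>\<delta>\<^sub>k / (w\<^sub>k q\<^sub>k\<^sup>2) \<le> \<delta>\<^sub>k\<^sub>+\<^sub>1 / (w\<^sub>k\<^sub>+\<^sub>1 q\<^sub>k\<^sub>+\<^sub>1\<^sup>2) + h / (w\<^sub>k\<^sub>+\<^sub>1 q\<^sub>k\<^sub>+\<^sub>1)\<close>. Hence \<open>\<delta>\<^sub>0
    \<le> h \<Sum>j. j / w\<^sub>j\<close> uniformly in \<open>n\<close>, and the number of
  times in \<open>[0, 1]\<close> at which the root is disconnected from level \<open>n\<close> has bounded expectation.

  For the second part, count on a fine time grid the edges that close while the root percolates only
  through them. Up to constants the rate of such closings at level \<open>k\<close> is \<open>F\<^sub>k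
    = w\<^sub>k q\<^sub>k \<Prod>i\<le>k. (1 - p\<^sub>i q\<^sub>i)^(d\<^sub>i\<^sub>-\<^sub>1 - 1)\<close>,
  comparable to \<open>1 / (w\<^sub>k q\<^sub>k) \<ge> c / k\<close>, so that the first moment diverges. Two such closings whose paths to
  the root separate at level \<open>l\<close> are correlated through the common path only: being open at both times
  costs a factor decaying exponentially in \<open>l\<close> times the time difference, and the second moment is
    bounded by a
  multiple of the square of the first as soon as \<open>\<Sum>l. w\<^sub>l q\<^sub>l\<^sup>2 / l\<close> converges, which holds
    if \<open>w\<^sub>l\<close> grows more slowly
  than \<open>l\<^sup>2\<close> by a power. The Paley-Zygmund inequality concludes.
\<close>

section \<open>The switching process of a single edge\<close>

text \<open>Two obstacles shape the argument. The chain of an edge is given by clocks, so its Markov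
  property and transition probabilities have to be derived from the lack of memory of the
  exponential law. And the percolation times form a closed set that a grid may miss: a component can
  be a single point. Components are therefore counted through \<open>sep\<close>, alternating visits
  and rational times of absence, which is measurable and detects infinitely many components. A
  downcrossing of a grid always gives one such separation, so in the second part one suitable grid
  suffices for each count. In the first part the visits must be seen on the grid, which holds in the
  truncated tree outside an event of probability \<open>O(1 / N)\<close>; so \<open>N\<close> tends
  to infinity for fixed \<open>n\<close>, and only then \<open>n\<close> does. This works because
  the bound on the number of downcrossings depends on neither. A pivotal closing in a cell
  \<open>[t, t']\<close> is tested at \<open>t\<close> on the path and below \<open>v\<close>, at
  \<open>t'\<close> on the edges leaving the path. Every edge except the closing one is then read at
  one time only, and the probability factorises exactly.\<close>

definition exp_law :: "real measure" where
  "exp_law = density lborel (\<lambda>y. ennreal (exponential_density 1 y))"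

definition clock_law :: "(nat \<Rightarrow> real) measure" where
  "clock_law = (\<Pi>\<^sub>M k \<in> UNIV. exp_law)"

lemma space_exp_law [simp]: "space exp_law = UNIV"
  and sets_exp_law [simp, measurable_cong]: "sets exp_law = sets borel"
  by (simp_all add: exp_law_def)

interpretation exp_law: prob_space exp_law
  unfolding exp_law_def using prob_space_exponential_density[of 1] by simp

interpretation clock: sequence_space exp_law
  by unfold_locales

interpretation clock_law: prob_space clock_law
  unfolding clock_law_def by (rule clock.P.prob_space_axioms)

lemma space_clock_law [simp]: "space clock_law = UNIV"
  by (simp add: clock_law_def space_PiM)

lemma measurable_clock_component [measurable]: "(\<lambda>x. x i) \<in> borel_measurable clock_law"
proof -
  have "(\<lambda>x. x i) \<in> measurable clock_law exp_law"
    unfolding clock_law_def by measurable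
  then show ?thesis using measurable_cong_sets[OF refl sets_exp_law] by blast
qed

lemma measurable_into_clock_law:
  assumes "\<And>i. (\<lambda>y. f y i) \<in> borel_measurable N"
  shows "f \<in> measurable N clock_law"
  unfolding clock_law_def
  by (rule measurable_PiM_single') (use assms in auto)

lemma clock_sets_Collect: "Measurable.pred clock_law P \<Longrightarrow> {x. P x} \<in> sets clock_law"
  unfolding pred_def by simp

text \<open>The i.i.d. sequence is a first clock followed by an independent copy of the whole
  sequence. Integrating out that first clock is the step of the induction on the number of
  switches.\<close>

lemma emeasure_clock_split:
  assumes "A \<in> sets clock_law"
  shows "emeasure clock_law A = (\<integral>\<^sup>+y. emeasure clock_law {z. case_nat y z \<in> A} \<partial>exp_law)"
proof -
  have m: "(\<lambda>(s, \<omega>). case_nat s \<omega>) \<in> measurable (exp_law \<Otimes>\<^sub>M clock_law) clock_law"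
    unfolding clock_law_def by measurable
  have "emeasure clock_law A
      = emeasure (distr (exp_law \<Otimes>\<^sub>M clock_law) clock_law (\<lambda>(s, \<omega>). case_nat s \<omega>)) A"
    using clock.PiM_iter by (simp add: clock_law_def)
  also have "\<dots> = emeasure (exp_law \<Otimes>\<^sub>M clock_law)
      ((\<lambda>(s, \<omega>). case_nat s \<omega>) -` A \<inter> space (exp_law \<Otimes>\<^sub>M clock_law))"
    using m assms by (rule emeasure_distr)
  also have "\<dots> = (\<integral>\<^sup>+y. emeasure clock_law (Pair y -`
      ((\<lambda>(s, \<omega>). case_nat s \<omega>) -` A \<inter> space (exp_law \<Otimes>\<^sub>M clock_law))) \<partial>exp_law)"
    using m assms by (intro clock_law.emeasure_pair_measure_alt measurable_sets)
  also have "\<dots> = (\<integral>\<^sup>+y. emeasure clock_law {z. case_nat y z \<in> A} \<partial>exp_law)"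
    by (intro nn_integral_cong arg_cong[where f = "emeasure clock_law"])
      (auto simp: space_pair_measure)
  finally show ?thesis .
qed

text \<open>Substitution of \<open>c + y\<close> in the exponential density. An integrand
  \<open>g\<close> is used rather than the tail event alone, because the law of the overshoot
  \<open>y - c\<close> is needed jointly with the event \<open>c \<le> y\<close>.\<close>

lemma nn_integral_exp_law_memoryless:
  assumes [measurable]: "g \<in> borel_measurable borel" and c: "0 \<le> c"
  shows "(\<integral>\<^sup>+y. indicator {c..} y * g (y - c) \<partial>exp_law) = ennreal (exp (- c)) * (\<integral>\<^sup>+y. g y \<partial>exp_law)"
proof -
  have "(\<integral>\<^sup>+y. indicator {c..} y * g (y - c) \<partial>exp_law)
      = (\<integral>\<^sup>+y. ennreal (exponential_density 1 y) * (indicator {c..} y * g (y - c)) \<partial>lborel)"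
    unfolding exp_law_def by (subst nn_integral_density) auto
  also have "\<dots> = (\<integral>\<^sup>+y. ennreal (exponential_density 1 (c + y)) * (indicator {c..} (c + y) * g y) \<partial>lborel)"
    by (subst nn_integral_real_affine[where c = 1 and t = c]) auto
  also have "\<dots> = (\<integral>\<^sup>+y. ennreal (exp (- c)) * (ennreal (exponential_density 1 y) * g y) \<partial>lborel)"
  proof (intro nn_integral_cong)
    fix y
    have "ennreal (exponential_density 1 (c + y)) = ennreal (exp (- c)) * ennreal (exponential_density 1 y)"
      if "0 \<le> y"
      using that c by (simp add: exponential_density_def exp_add exp_minus exp_diff
        ennreal_mult[symmetric] field_simps)
    then show "ennreal (exponential_density 1 (c + y)) * (indicator {c..} (c + y) * g y)
        = ennreal (exp (- c)) * (ennreal (exponential_density 1 y) * g y)"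
      by (cases "0 \<le> y") (simp_all add: indicator_def mult.assoc exponential_density_def)
  qed
  also have "\<dots> = ennreal (exp (- c)) * (\<integral>\<^sup>+y. g y \<partial>exp_law)"
    unfolding exp_law_def by (simp add: nn_integral_cmult nn_integral_density)
  finally show ?thesis .
qed

lemma emeasure_exp_law_atLeast: "0 \<le> c \<Longrightarrow> emeasure exp_law {c..} = ennreal (exp (- c))"
  using nn_integral_exp_law_memoryless[of "\<lambda>_. 1" c] exp_law.emeasure_space_1
  by simp

lemma measure_exp_law_atLeast: "0 \<le> c \<Longrightarrow> measure exp_law {c..} = exp (- c)"
  by (simp add: measure_def emeasure_exp_law_atLeast)

lemma measure_exp_law_lessThan: "0 \<le> c \<Longrightarrow> measure exp_law {..<c} = 1 - exp (- c)"
proof -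
  assume c: "0 \<le> c"
  have "{..<c} = space exp_law - {c..}" by auto
  then show ?thesis
    using exp_law.prob_compl[of "{c..}"] measure_exp_law_atLeast[OF c] by simp
qed

lemma measure_exp_law_atMost_le: "0 \<le> c \<Longrightarrow> measure exp_law {..c} \<le> c"
proof (rule field_le_epsilon)
  fix e :: real assume e: "0 < e" and c: "0 \<le> c"
  have "measure exp_law {..c} \<le> measure exp_law {..<c + e}"
    using e by (intro exp_law.finite_measure_mono) auto
  also have "\<dots> = 1 - exp (- (c + e))" using c e by (intro measure_exp_law_lessThan) auto
  also have "\<dots> \<le> c + e" using exp_ge_add_one_self[of "- (c + e)"] by linarith
  finally show "measure exp_law {..c} \<le> c + e" .
qed

lemma AE_exp_law_pos: "AE y in exp_law. 0 < y"
proof -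
  have "measure exp_law {..0} = 0" using measure_exp_law_atMost_le[of 0] measure_nonneg[of exp_law
    "{..0}"] by linarith
  then have "emeasure exp_law {..0} = 0" by (simp add: exp_law.emeasure_eq_measure)
  then show ?thesis by (intro AE_I[of _ _ "{..0}"]) (auto simp: not_less)
qed

lemma AE_clock_pos: "AE x in clock_law. \<forall>i. 0 < x i"
  unfolding AE_all_countable
proof
  fix i
  show "AE x in clock_law. 0 < x i"
    unfolding clock_law_def using AE_exp_law_pos
    by (intro AE_PiM_component[of UNIV "\<lambda>_. exp_law" i "\<lambda>y. 0 < y"]) (auto intro: exp_law.prob_space_axioms)
qed

lemma measure_clock_box:
  assumes "finite J" "\<And>i. i \<in> J \<Longrightarrow> E i \<in> sets borel"
  shows "measure clock_law {x. \<forall>i\<in>J. x i \<in> E i} = (\<Prod>i\<in>J. measure exp_law (E i))"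
proof -
  have "measure clock_law (prod_emb UNIV (\<lambda>_. exp_law) J (Pi\<^sub>E J E)) = (\<Prod>i\<in>J. measure exp_law (E i))"
    unfolding clock_law_def using assms by (intro clock.measure_PiM_emb) auto
  also have "prod_emb UNIV (\<lambda>_. exp_law) J (Pi\<^sub>E J E) = {x. \<forall>i\<in>J. x i \<in> E i}"
    by (auto simp: prod_emb_def PiE_iff)
  finally show ?thesis .
qed

lemma leave_rate_bounds:
  assumes "0 < q" "q < 1"
  shows "0 < leave_rate q s" "leave_rate q s < 1"
  using assms by (auto simp: leave_rate_def)

lemma state_0 [simp]: "state s 0 = s"
  and state_Suc: "state s (Suc k) = state (\<not> s) k"
  by (auto simp: state_def)

lemma switch_time_0 [simp]: "switch_time q s x 0 = 0"
  by (simp add: switch_time_def)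

lemma switch_time_Suc:
  "switch_time q s x (Suc k) = x 0 / leave_rate q s + switch_time q (\<not> s) (\<lambda>i. x (Suc i)) k"
  unfolding switch_time_def by (simp add: sum.lessThan_Suc_shift state_Suc del: sum.lessThan_Suc)

lemma measurable_switch_time [measurable]: "(\<lambda>x. switch_time q s x k) \<in> borel_measurable clock_law"
  unfolding switch_time_def by measurable

text \<open>\<open>stage q s x t k\<close>: the first passage of \<open>t\<close> happens in the \<open>k\<close>-th holding period. Taking that period
  closed on the right makes the restart of the edge at time \<open>t\<close> agree with \<open>edge_open\<close> even when \<open>t\<close> is a
  switching time, see \<open>edge_open_stage\<close>.\<close>

definition stage :: "real \<Rightarrow> bool \<Rightarrow> (nat \<Rightarrow> real) \<Rightarrow> real \<Rightarrow> nat \<Rightarrow> bool" where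
  "stage q s x t k \<longleftrightarrow> (\<forall>j<k. switch_time q s x (Suc j) < t) \<and> t \<le> switch_time q s x (Suc k)"

text \<open>The time left in the current holding period is multiplied by its leave rate, which turns
  it back into a unit exponential clock; the later clocks are unchanged. So this is again a clock
  sequence, to be run from the state \<open>state s k\<close>.\<close>

definition residual :: "real \<Rightarrow> bool \<Rightarrow> (nat \<Rightarrow> real) \<Rightarrow> real \<Rightarrow> nat \<Rightarrow> nat \<Rightarrow> real" where
  "residual q s x t k i =
     (if i = 0 then (switch_time q s x (Suc k) - t) * leave_rate q (state s k) else x (k + i))"

lemma stage_0: "stage q s x t 0 \<longleftrightarrow> t \<le> x 0 / leave_rate q s"
  by (simp add: stage_def switch_time_Suc)

lemma stage_Suc:
  "stage q s x t (Suc k) \<longleftrightarrow>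
     x 0 / leave_rate q s < t \<and> stage q (\<not> s) (\<lambda>i. x (Suc i)) (t - x 0 / leave_rate q s) k"
  unfolding stage_def switch_time_Suc[of q s] by (auto simp: less_Suc_eq_0_disj algebra_simps)

lemma residual_Suc:
  "residual q s x t (Suc k) = residual q (\<not> s) (\<lambda>i. x (Suc i)) (t - x 0 / leave_rate q s) k"
  by (auto simp: residual_def switch_time_Suc[of q s] state_Suc fun_eq_iff)

lemma residual_0:
  assumes "0 < q" "q < 1"
  shows "residual q s x t 0 = case_nat (x 0 - t * leave_rate q s) (\<lambda>i. x (Suc i))"
  using leave_rate_bounds[OF assms, of s]
  by (auto simp: residual_def fun_eq_iff switch_time_Suc field_simps split: nat.split)

lemma stage_unique: "stage q s x t k \<Longrightarrow> stage q s x t l \<Longrightarrow> k = l"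
  unfolding stage_def by (metis linorder_neqE_nat not_less)

lemma measurable_stage [measurable]: "Measurable.pred clock_law (\<lambda>x. stage q s x t k)"
  unfolding stage_def by measurable

lemma measurable_residual [measurable]: "(\<lambda>x. residual q s x t k) \<in> measurable clock_law clock_law"
  by (rule measurable_into_clock_law) (simp add: residual_def)

lemma measurable_emeasure_clock_section:
  assumes "B \<in> sets clock_law"
  shows "(\<lambda>y. emeasure clock_law {z. case_nat y z \<in> B}) \<in> borel_measurable borel"
proof -
  have "(\<lambda>p. case_nat (fst p) (snd p)) \<in> measurable (borel \<Otimes>\<^sub>M clock_law) clock_law"
    by (rule measurable_into_clock_law) (auto split: nat.split)
  from measurable_sets[OF this assms]
  have "(\<lambda>y. emeasure clock_law (Pair y -` ((\<lambda>p. case_nat (fst p) (snd p)) -` B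
      \<inter> space (borel \<Otimes>\<^sub>M clock_law)))) \<in> borel_measurable borel"
    by (rule clock_law.measurable_emeasure_Pair)
  then show ?thesis by (simp add: vimage_def space_pair_measure)
qed

text \<open>Lack of memory at the fixed time \<open>t\<close>: given the stage, the residual clocks
  are fresh. Stage 0 is the memoryless property of the first clock. For stage \<open>Suc k\<close>
  the first holding time \<open>y / r\<close> is integrated out, the state flips and
  \<open>t\<close> becomes \<open>t - y / r\<close>, which is why \<open>s\<close> and
  \<open>t\<close> are generalised.\<close>

lemma emeasure_stage_residual:
  assumes q: "0 < q" "q < 1" and B [measurable]: "B \<in> sets clock_law" and "0 \<le> t"
  shows "emeasure clock_law {x. stage q s x t k \<and> residual q s x t k \<in> B}
    = emeasure clock_law {x. stage q s x t k} * emeasure clock_law B"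
  using \<open>0 \<le> t\<close>
proof (induction k arbitrary: s t)
  case 0
  define c where "c = t * leave_rate q s"
  have r: "0 < leave_rate q s" using leave_rate_bounds[OF q] by simp
  have c: "0 \<le> c" using 0 r by (simp add: c_def)
  have ms: "{x. stage q s x t 0 \<and> residual q s x t 0 \<in> B'} \<in> sets clock_law"
    if [measurable]: "B' \<in> sets clock_law" for B'
    by (rule clock_sets_Collect) measurable
  \<comment> \<open>With the whole space for \<open>B'\<close> this computes the probability of the
    stage itself, so both sides of the claim come from one formula.\<close>
  have key: "emeasure clock_law {x. stage q s x t 0 \<and> residual q s x t 0 \<in> B'}
      = ennreal (exp (- c)) * emeasure clock_law B'" if B' [measurable]: "B' \<in> sets clock_law" for B'
  proof -
    have "emeasure clock_law {x. stage q s x t 0 \<and> residual q s x t 0 \<in> B'}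
      = (\<integral>\<^sup>+y. emeasure clock_law {z. case_nat y z \<in> {x. stage q s x t 0
        \<and> residual q s x t 0 \<in> B'}} \<partial>exp_law)"
      by (rule emeasure_clock_split[OF ms[OF B']])
    also have "\<dots> = (\<integral>\<^sup>+y. indicator {c..} y * emeasure clock_law {z. case_nat (y - c) z \<in> B'} \<partial>exp_law)"
      using r by (intro nn_integral_cong)
        (auto simp: stage_0 residual_0[OF q] c_def indicator_def field_simps)
    also have "\<dots> = ennreal (exp (- c)) * (\<integral>\<^sup>+y. emeasure clock_law {z. case_nat y z \<in> B'} \<partial>exp_law)"
    proof (rule nn_integral_exp_law_memoryless[OF _ c])
      show "(\<lambda>y. emeasure clock_law {z. case_nat y z \<in> B'}) \<in> borel_measurable borel"
        by (rule measurable_emeasure_clock_section[OF B'])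
    qed
    also have "(\<integral>\<^sup>+y. emeasure clock_law {z. case_nat y z \<in> B'} \<partial>exp_law) = emeasure clock_law B'"
      by (rule emeasure_clock_split[symmetric, OF B'])
    finally show ?thesis .
  qed
  from key[OF sets.top] have "emeasure clock_law {x. stage q s x t 0} = ennreal (exp (- c))"
    using clock_law.emeasure_space_1 by simp
  with key[OF B] show ?case by simp
next
  case (Suc k)
  let ?r = "leave_rate q s"
  have sec: "{z. case_nat y z \<in> {x. stage q s x t (Suc k) \<and> residual q s x t (Suc k) \<in> B'}}
      = (if y / ?r < t then {z. stage q (\<not> s) z (t - y / ?r) k
        \<and> residual q (\<not> s) z (t - y / ?r) k \<in> B'} else {})"
    for y B' by (auto simp: stage_Suc residual_Suc)
  have "{z. case_nat y z \<in> {x. stage q s x t (Suc k)}}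
      = (if y / ?r < t then {z. stage q (\<not> s) z (t - y / ?r) k} else {})" for y
    using sec[of y UNIV] by simp
  note sec' = this
  have m1: "{x. stage q s x t (Suc k) \<and> residual q s x t (Suc k) \<in> B} \<in> sets clock_law"
    and m2: "{x. stage q s x t (Suc k)} \<in> sets clock_law"
    by (rule clock_sets_Collect, measurable)+
  have "emeasure clock_law {x. stage q s x t (Suc k) \<and> residual q s x t (Suc k) \<in> B}
      = (\<integral>\<^sup>+y. emeasure clock_law {z. case_nat y z \<in> {x. stage q s x t (Suc k)
        \<and> residual q s x t (Suc k) \<in> B}} \<partial>exp_law)"
    by (rule emeasure_clock_split[OF m1])
  also have "\<dots> = (\<integral>\<^sup>+y. emeasure clock_law {z. case_nat y z \<in> {x. stage q s x t (Suc k)}} * emeasure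
    clock_law B \<partial>exp_law)"
    unfolding sec sec' by (intro nn_integral_cong) (simp add: Suc.IH)
  also have "\<dots> = (\<integral>\<^sup>+y. emeasure clock_law {z. case_nat y z \<in> {x. stage q s x t (Suc k)}} \<partial>exp_law) *
    emeasure clock_law B"
  proof (rule nn_integral_multc)
    show "(\<lambda>y. emeasure clock_law {z. case_nat y z \<in> {x. stage q s x t (Suc k)}}) \<in> borel_measurable exp_law"
      using measurable_emeasure_clock_section[OF m2] measurable_cong_sets[OF sets_exp_law refl] by blast
  qed
  also have "(\<integral>\<^sup>+y. emeasure clock_law {z. case_nat y z \<in> {x. stage q s x t (Suc k)}} \<partial>exp_law)
      = emeasure clock_law {x. stage q s x t (Suc k)}"
    by (rule emeasure_clock_split[symmetric, OF m2])
  finally show ?case .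
qed

lemma edge_open_iff:
  "edge_open q (s, x) t \<longleftrightarrow> (\<forall>k. state s k \<or> \<not> (k = 0 \<or> switch_time q s x k < t)
    \<or> switch_time q s x (Suc k) \<le> t)"
  unfolding edge_open_def by (auto simp: not_less)

lemma all_nat_split: "(\<forall>k. P k) \<longleftrightarrow> P 0 \<and> (\<forall>k. P (Suc k))"
  by (metis nat.exhaust)

text \<open>Once the first holding period is over, period \<open>Suc k\<close> of the path is period
  \<open>k\<close> of the path started afresh in the other state. The strict inequality matches the
  exception \<open>k = 0\<close> for an initial period with the condition that the first switch lies
  before \<open>t\<close>.\<close>

lemma edge_open_Suc:
  assumes "x 0 / leave_rate q s < t"
  shows "edge_open q (s, x) t = edge_open q (\<not> s, \<lambda>i. x (Suc i)) (t - x 0 / leave_rate q s)"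
proof -
  have "edge_open q (s, x) t \<longleftrightarrow> (\<forall>k. state s (Suc k) \<or> \<not> switch_time q s x (Suc k) < t
    \<or> switch_time q s x (Suc (Suc k)) \<le> t)"
    unfolding edge_open_iff using assms by (subst all_nat_split) (simp add: switch_time_Suc)
  also have "\<dots> \<longleftrightarrow> (\<forall>k. state (\<not> s) k \<or> \<not> (k = 0 \<or> switch_time q (\<not> s) (\<lambda>i. x (Suc i)) k < t - x 0 /
    leave_rate q s)
      \<or> switch_time q (\<not> s) (\<lambda>i. x (Suc i)) (Suc k) \<le> t - x 0 / leave_rate q s)"
  proof (intro all_cong1)
    fix k
    have "switch_time q s x (Suc k) < t \<longleftrightarrow> k = 0 \<or> switch_time q (\<not> s) (\<lambda>i. x (Suc i)) k < t - x 0 /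
      leave_rate q s"
      using assms by (cases k) (auto simp: switch_time_Suc)
    moreover have "switch_time q s x (Suc (Suc k)) \<le> t \<longleftrightarrow> switch_time q (\<not> s) (\<lambda>i. x (Suc i)) (Suc k)
      \<le> t - x 0 / leave_rate q s"
      by (auto simp: switch_time_Suc[of q s x])
    ultimately show "(state s (Suc k) \<or> \<not> switch_time q s x (Suc k) < t \<or> switch_time q s x (Suc (Suc k)) \<le> t)
      = (state (\<not> s) k \<or> \<not> (k = 0 \<or> switch_time q (\<not> s) (\<lambda>i. x (Suc i)) k < t - x 0 / leave_rate q s)
        \<or> switch_time q (\<not> s) (\<lambda>i. x (Suc i)) (Suc k) \<le> t - x 0 / leave_rate q s)"
      by (simp add: state_Suc)
  qed
  finally show ?thesis unfolding edge_open_iff .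
qed

lemma switch_time_residual_0:
  assumes "0 < q" "q < 1"
  shows "switch_time q s (residual q s x t 0) (Suc k) = switch_time q s x (Suc k) - t"
  using leave_rate_bounds[OF assms, of s]
  by (simp add: switch_time_Suc residual_0[OF assms] diff_divide_distrib)

lemma edge_open_stage:
  assumes q: "0 < q" "q < 1" and "stage q s x t k" and u: "0 \<le> u"
  shows "edge_open q (s, x) (t + u) = edge_open q (state s k, residual q s x t k) u"
  using assms(3)
proof (induction k arbitrary: s x t)
  case 0
  have "(k = 0 \<or> switch_time q s x k < t + u) = (k = 0 \<or> switch_time q s (residual q s x t 0) k < u)" for k
    by (cases k) (auto simp: switch_time_residual_0[OF q])
  then show ?case
    unfolding edge_open_iff by (simp add: switch_time_residual_0[OF q]) (simp add: algebra_simps)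
next
  case (Suc k)
  then have less: "x 0 / leave_rate q s < t"
    and st: "stage q (\<not> s) (\<lambda>i. x (Suc i)) (t - x 0 / leave_rate q s) k"
    by (auto simp: stage_Suc)
  have "edge_open q (s, x) (t + u) = edge_open q (\<not> s, \<lambda>i. x (Suc i)) (t + u - x 0 / leave_rate q s)"
    using less u by (intro edge_open_Suc) simp
  also have "t + u - x 0 / leave_rate q s = t - x 0 / leave_rate q s + u" by simp
  finally show ?case unfolding Suc.IH[OF st] by (simp add: state_Suc residual_Suc)
qed

lemma switch_time_mono:
  assumes "0 < q" "q < 1" "\<forall>i. 0 < x i" "k \<le> l"
  shows "switch_time q s x k \<le> switch_time q s x l"
  unfolding switch_time_def using assms leave_rate_bounds[OF assms(1,2)]
  by (intro sum_mono2) (auto intro!: divide_nonneg_pos simp: less_imp_le)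

lemma edge_open_before_switch:
  assumes q: "0 < q" "q < 1" and pos: "\<forall>i. 0 < x i" and u: "u < switch_time q s x 1"
  shows "edge_open q (s, x) u = s"
proof -
  have "\<not> switch_time q s x k < u" if "k \<noteq> 0" for k
    using switch_time_mono[OF q pos, of 1 k s] that u by (simp add: not_less)
  then show ?thesis
    unfolding edge_open_iff using u
    by (metis One_nat_def linorder_not_le state_0)
qed

lemma switch_time_1: "switch_time q s x 1 = x 0 / leave_rate q s"
  using switch_time_Suc[of q s x 0] by simp

lemma edge_open_0:
  assumes "0 < q" "q < 1" "\<forall>i. 0 < x i"
  shows "edge_open q (s, x) 0 = s"
  using assms(3) leave_rate_bounds[OF assms(1,2)]
  by (intro edge_open_before_switch assms) (simp_all add: switch_time_1[unfolded One_nat_def])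

lemma measurable_edge_open_clock [measurable]:
  "Measurable.pred clock_law (\<lambda>x. edge_open q (s, x) t)"
  unfolding edge_open_iff by measurable

text \<open>No explosion. Leave rates are below 1, so a holding time is at least its clock; if the
  switching times never reached \<open>t\<close>, every clock would be below \<open>t\<close>, an
  event of probability at most \<open>(1 - exp (- t)) ^ n\<close> for all \<open>n\<close>.\<close>

lemma AE_stage:
  assumes q: "0 < q" "q < 1" and t: "0 \<le> t"
  shows "AE x in clock_law. \<exists>k. stage q s x t k"
proof -
  let ?N = "{x :: nat \<Rightarrow> real. \<forall>i. x i < t}"
  have N: "?N \<in> sets clock_law" by (rule clock_sets_Collect) measurable
  have "measure clock_law ?N \<le> (1 - exp (- t)) ^ n" for n
  proof -
    have "measure clock_law ?N \<le> measure clock_law {x. \<forall>i\<in>{..<n}. x i \<in> {..<t}}"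
    proof (intro clock_law.finite_measure_mono)
      show "{x. \<forall>i\<in>{..<n}. x i \<in> {..<t}} \<in> sets clock_law"
        by (rule clock_sets_Collect) (simp, measurable)
    qed auto
    also have "\<dots> = (1 - exp (- t)) ^ n"
      by (subst measure_clock_box) (auto simp: measure_exp_law_lessThan t)
    finally show ?thesis .
  qed
  moreover have "(\<lambda>n. (1 - exp (- t)) ^ n) \<longlonglongrightarrow> 0"
    using t by (intro LIMSEQ_power_zero) auto
  ultimately have "measure clock_law ?N \<le> 0"
    by (intro LIMSEQ_le_const) auto
  then have "emeasure clock_law ?N = 0"
    by (simp add: clock_law.emeasure_eq_measure measure_le_0_iff)
  then have "AE x in clock_law. x \<notin> ?N"
    using N by (intro AE_not_in) (auto simp: null_sets_def)
  then show ?thesis using AE_clock_pos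
  proof eventually_elim
    case (elim x)
    show ?case
    proof (rule ccontr)
      assume no: "\<nexists>k. stage q s x t k"
      have less: "switch_time q s x (Suc k) < t" for k
      proof (induction k rule: less_induct)
        case (less k)
        then show ?case using no unfolding stage_def by (metis not_less)
      qed
      have "x k < t" for k
      proof -
        have "x k \<le> x k / leave_rate q (state s k)"
          using elim(2) leave_rate_bounds[OF q, of "state s k"]
            by (simp add: field_simps less_imp_le mult_left_le)
        also have "\<dots> \<le> switch_time q s x (Suc k)"
          unfolding switch_time_def using elim(2) leave_rate_bounds[OF q]
          by (intro member_le_sum) (auto intro!: divide_nonneg_pos simp: less_imp_le)
        also have "\<dots> < t" by (rule less)
        finally show ?thesis .
      qed
      then show False using elim(1) by simp
    qed
  qed
qed

text \<open>Transferred from the original clocks by \<open>emeasure_stage_residual\<close>. A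
  positive residual means that the current period extends beyond \<open>t\<close>, so the state seen
  at \<open>t\<close> is that of the current stage.\<close>

lemma AE_residual_pos:
  assumes q: "0 < q" "q < 1" and t: "0 \<le> t"
  shows "AE x in clock_law. \<forall>k. stage q s x t k \<longrightarrow> (\<forall>i. 0 < residual q s x t k i)"
  unfolding AE_all_countable
proof
  fix k
  let ?B = "{y :: nat \<Rightarrow> real. \<not> (\<forall>i. 0 < y i)}"
  have B: "?B \<in> sets clock_law" by (rule clock_sets_Collect) measurable
  have "emeasure clock_law ?B = 0"
    using AE_clock_pos B by (subst (asm) AE_iff_measurable[OF B]) auto
  then have "emeasure clock_law {x. stage q s x t k \<and> residual q s x t k \<in> ?B} = 0"
    using emeasure_stage_residual[OF q B t] by simp
  moreover have "{x. stage q s x t k \<and> residual q s x t k \<in> ?B} \<in> sets clock_law"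
    using B by (intro clock_sets_Collect) measurable
  ultimately show "AE x in clock_law. stage q s x t k \<longrightarrow> (\<forall>i. 0 < residual q s x t k i)"
    by (intro AE_I[where N = "{x. stage q s x t k \<and> residual q s x t k \<in> ?B}"]) auto
qed

lemma AE_edge_open_state:
  assumes q: "0 < q" "q < 1" and t: "0 \<le> t"
  shows "AE x in clock_law. \<exists>k. stage q s x t k \<and> edge_open q (s, x) t = state s k
    \<and> (\<forall>i. 0 < residual q s x t k i)"
  using AE_stage[OF assms, of s] AE_residual_pos[OF assms, of s]
proof eventually_elim
  case (elim x)
  then obtain k where k: "stage q s x t k" by blast
  have "edge_open q (s, x) (t + 0) = edge_open q (state s k, residual q s x t k) 0"
    by (rule edge_open_stage[OF q k]) simp
  then show ?case using k elim(2) edge_open_0[OF q, of "residual q s x t k" "state s k"]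
    by (intro exI[of _ k]) simp
qed

text \<open>The stages are disjoint and almost surely exhaust the space; summing over those whose
  state is \<open>b\<close> gives independence of the residual clocks from the state at
  \<open>t\<close>. Taking the whole space for the residual event identifies the remaining
  sum.\<close>

lemma measure_edge_open_residual:
  assumes q: "0 < q" "q < 1" and t: "0 \<le> t" and B [measurable]: "B \<in> sets clock_law"
  shows "measure clock_law {x. edge_open q (s, x) t = b \<and> (\<exists>k. stage q s x t k \<and> residual q s x t k \<in> B)}
    = measure clock_law {x. edge_open q (s, x) t = b} * measure clock_law B"
proof -
  let ?S = "\<lambda>B' k. {x. stage q s x t k \<and> residual q s x t k \<in> B' \<and> state s k = b}"
  have m: "?S B' k \<in> sets clock_law" if [measurable]: "B' \<in> sets clock_law" for B' k
    by (rule clock_sets_Collect) measurable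
  have d: "disjoint_family (?S B')" for B'
    unfolding disjoint_family_on_def using stage_unique by blast
  have key: "emeasure clock_law {x. edge_open q (s, x) t = b \<and> (\<exists>k. stage q s x t k
    \<and> residual q s x t k \<in> B')}
     = (\<Sum>k. emeasure clock_law {x. stage q s x t k \<and> state s k = b}) * emeasure clock_law B'"
    if B' [measurable]: "B' \<in> sets clock_law" for B'
  proof -
    have "emeasure clock_law {x. edge_open q (s, x) t = b \<and> (\<exists>k. stage q s x t k \<and> residual q s x t k \<in> B')}
        = emeasure clock_law (\<Union>k. ?S B' k)"
    proof (rule emeasure_eq_AE)
      show "AE x in clock_law. (x \<in> {x. edge_open q (s, x) t = b \<and> (\<exists>k. stage q s x t k
        \<and> residual q s x t k \<in> B')})
          = (x \<in> (\<Union>k. ?S B' k))"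
        using AE_edge_open_state[OF q t, of s]
        by eventually_elim (auto dest: stage_unique)
      show "{x. edge_open q (s, x) t = b \<and> (\<exists>k. stage q s x t k \<and> residual q s x t k \<in> B')} \<in> sets clock_law"
        by (rule clock_sets_Collect) measurable
      show "(\<Union>k. ?S B' k) \<in> sets clock_law" using m[OF B'] by blast
    qed
    also have "\<dots> = (\<Sum>k. emeasure clock_law (?S B' k))"
      using m[OF B'] d by (intro suminf_emeasure[symmetric]) auto
    also have "\<dots> = (\<Sum>k. emeasure clock_law {x. stage q s x t k \<and> state s k = b} * emeasure clock_law B')"
    proof (rule suminf_cong)
      fix k
      show "emeasure clock_law (?S B' k) = emeasure clock_law {x. stage q s x t k \<and> state s k
        = b} * emeasure clock_law B'"
        using emeasure_stage_residual[OF q B' t, of s k] by (cases "state s k = b") auto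
    qed
    finally show ?thesis by (simp add: ennreal_suminf_multc)
  qed
  have "emeasure clock_law {x. edge_open q (s, x) t = b}
      = emeasure clock_law {x. edge_open q (s, x) t = b \<and> (\<exists>k. stage q s x t k \<and> residual q s x t k \<in> UNIV)}"
  proof (rule emeasure_eq_AE)
    show "AE x in clock_law. (x \<in> {x. edge_open q (s, x) t = b})
       = (x \<in> {x. edge_open q (s, x) t = b \<and> (\<exists>k. stage q s x t k \<and> residual q s x t k \<in> UNIV)})"
      using AE_stage[OF q t, of s] by eventually_elim auto
  qed (rule clock_sets_Collect, measurable)+
  also have "\<dots> = (\<Sum>k. emeasure clock_law {x. stage q s x t k \<and> state s k = b})"
    using key[of UNIV] sets.top[of clock_law] clock_law.emeasure_space_1 by simp
  finally have "emeasure clock_law {x. edge_open q (s, x) t = b \<and> (\<exists>k. stage q s x t k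
    \<and> residual q s x t k \<in> B)}
    = emeasure clock_law {x. edge_open q (s, x) t = b} * emeasure clock_law B"
    using key[OF B] by simp
  then show ?thesis by (simp add: measure_def enn2real_mult)
qed

text \<open>Markov property for an event \<open>\<psi>\<close> of the path after \<open>t\<close>.
  The congruence hypothesis confines \<open>\<psi>\<close> to nonnegative times, where the restarted
  path agrees with the shifted one.\<close>

lemma measure_edge_open_markov:
  assumes q: "0 < q" "q < 1" and t: "0 \<le> t"
    and \<psi>: "\<And>f g :: real \<Rightarrow> bool. (\<And>u. 0 \<le> u \<Longrightarrow> f u = g u) \<Longrightarrow> \<psi> f = \<psi> g"
    and m [measurable]: "Measurable.pred clock_law (\<lambda>x. \<psi> (edge_open q (b, x)))"
    and m' [measurable]: "Measurable.pred clock_law (\<lambda>x. \<psi> (\<lambda>u. edge_open q (s, x) (t + u)))"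
  shows "measure clock_law {x. edge_open q (s, x) t = b \<and> \<psi> (\<lambda>u. edge_open q (s, x) (t + u))}
    = measure clock_law {x. edge_open q (s, x) t = b} * measure clock_law {x. \<psi> (edge_open q (b, x))}"
proof -
  let ?B = "{x. \<psi> (edge_open q (b, x))}"
  have B [measurable]: "?B \<in> sets clock_law" by (rule clock_sets_Collect) measurable
  have "measure clock_law {x. edge_open q (s, x) t = b \<and> \<psi> (\<lambda>u. edge_open q (s, x) (t + u))}
      = measure clock_law {x. edge_open q (s, x) t = b \<and> (\<exists>k. stage q s x t k \<and> residual q s x t k \<in> ?B)}"
  proof (rule measure_eq_AE)
    show "AE x in clock_law. (x \<in> {x. edge_open q (s, x) t = b \<and> \<psi> (\<lambda>u. edge_open q (s, x) (t + u))})
        = (x \<in> {x. edge_open q (s, x) t = b \<and> (\<exists>k. stage q s x t k \<and> residual q s x t k \<in> ?B)})"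
      using AE_edge_open_state[OF q t, of s]
    proof eventually_elim
      case (elim x)
      then obtain k where k: "stage q s x t k" "edge_open q (s, x) t = state s k" by blast
      have "\<psi> (\<lambda>u. edge_open q (s, x) (t + u)) = \<psi> (edge_open q (state s k, residual q s x t k))"
        using edge_open_stage[OF q k(1)] by (intro \<psi>) auto
      then show ?case using k stage_unique[of q s x t] by auto
    qed
    show "{x. edge_open q (s, x) t = b \<and> \<psi> (\<lambda>u. edge_open q (s, x) (t + u))} \<in> sets clock_law"
      by (rule clock_sets_Collect) measurable
    show "{x. edge_open q (s, x) t = b \<and> (\<exists>k. stage q s x t k \<and> residual q s x t k \<in> ?B)} \<in> sets clock_law"
      by (rule clock_sets_Collect) measurable
  qed
  then show ?thesis using measure_edge_open_residual[OF q t B, of s b] by simp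
qed

section \<open>Transition probabilities of the two-state chain\<close>

definition trans_prob :: "real \<Rightarrow> bool \<Rightarrow> real \<Rightarrow> real" where
  "trans_prob q s t = measure clock_law {x. edge_open q (s, x) t}"

lemma measure_edge_open_eq:
  "measure clock_law {x. edge_open q (s, x) t = b} = (if b then trans_prob q s t else 1 - trans_prob q s t)"
proof -
  have "{x. edge_open q (s, x) t} \<in> sets clock_law" by (rule clock_sets_Collect) measurable
  then have "measure clock_law (space clock_law - {x. edge_open q (s, x) t}) = 1 - trans_prob q s t"
    unfolding trans_prob_def by (rule clock_law.prob_compl)
  moreover have "space clock_law - {x. edge_open q (s, x) t} = {x. \<not> edge_open q (s, x) t}" by auto
  ultimately show ?thesis by (cases b) (simp_all add: trans_prob_def)
qed

lemma trans_prob_bounds: "0 \<le> trans_prob q s t" "trans_prob q s t \<le> 1"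
  by (simp_all add: trans_prob_def)

lemma measure_clock_split_bool:
  assumes [measurable]: "Measurable.pred clock_law P" "Measurable.pred clock_law R"
  shows "measure clock_law {x. P x}
    = measure clock_law {x. R x = True \<and> P x} + measure clock_law {x. R x = False \<and> P x}"
proof -
  have "measure clock_law ({x. R x = True \<and> P x} \<union> {x. R x = False \<and> P x})
      = measure clock_law {x. R x = True \<and> P x} + measure clock_law {x. R x = False \<and> P x}"
    by (rule clock_law.finite_measure_Union; (rule clock_sets_Collect, measurable)?) auto
  moreover have "{x. R x = True \<and> P x} \<union> {x. R x = False \<and> P x} = {x. P x}" by auto
  ultimately show ?thesis by simp
qed

text \<open>Chapman-Kolmogorov at the intermediate time \<open>t\<close>.\<close>

lemma trans_prob_add:
  assumes q: "0 < q" "q < 1" and t: "0 \<le> t" and u: "0 \<le> u"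
  shows "trans_prob q s (t + u)
    = trans_prob q s t * trans_prob q True u + (1 - trans_prob q s t) * trans_prob q False u"
proof -
  have "measure clock_law {x. edge_open q (s, x) t = b \<and> edge_open q (s, x) (t + u)}
      = measure clock_law {x. edge_open q (s, x) t = b} * trans_prob q b u" for b
    unfolding trans_prob_def
    by (rule measure_edge_open_markov[OF q t, where \<psi> = "\<lambda>f. f u"]) (use u in auto)
  from this[of True] this[of False] show ?thesis
    using measure_edge_open_eq[of q s t True] measure_edge_open_eq[of q s t False]
    unfolding trans_prob_def[of q s "t + u"]
    by (subst measure_clock_split_bool[where R = "\<lambda>x. edge_open q (s, x) t"]) auto
qed

lemma trans_prob_0: "0 < q \<Longrightarrow> q < 1 \<Longrightarrow> trans_prob q s 0 = (if s then 1 else 0)"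
proof -
  assume q: "0 < q" "q < 1"
  have "measure clock_law {x. edge_open q (s, x) 0} = measure clock_law {x. s}"
  proof (rule measure_eq_AE)
    show "AE x in clock_law. (x \<in> {x. edge_open q (s, x) 0}) = (x \<in> {x. s})"
      using AE_clock_pos by eventually_elim (auto simp: edge_open_0[OF q])
  qed (rule clock_sets_Collect, measurable)+
  then show ?thesis
    using clock_law.prob_space by (auto simp: trans_prob_def)
qed

lemma one_minus_exp_lower: "0 \<le> y \<Longrightarrow> y - y\<^sup>2 \<le> 1 - exp (- y :: real)"
proof -
  assume y: "0 \<le> y"
  have "exp (- y) \<le> 1 / (1 + y)"
    using exp_ge_add_one_self[of y] y by (simp add: exp_minus field_simps)
  also have "1 / (1 + y) \<le> 1 - y + y\<^sup>2"
  proof -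
    have "1 \<le> (1 - y + y\<^sup>2) * (1 + y)" using y by (simp add: algebra_simps power2_eq_square)
    then show ?thesis using y by (simp add: divide_le_eq)
  qed
  finally show ?thesis by simp
qed

text \<open>To have changed state by time \<open>h\<close> the first clock must ring within
  \<open>r * h\<close>. Conversely it suffices that the first clock rings before
  \<open>r * h\<close> and the second, run at the other rate, lasts at least \<open>r' * h\<close>:
  then exactly one switch occurs. The two probabilities differ by \<open>O(h^2)\<close>.\<close>

lemma leave_prob_bounds:
  fixes s :: bool and h :: real
  assumes q: "0 < q" "q < 1" and h: "0 \<le> h" "h \<le> 1"
  defines "r \<equiv> leave_rate q s"
  shows "measure clock_law {x. edge_open q (s, x) h = (\<not> s)} \<le> r * h"
    and "r * h - 2 * h\<^sup>2 \<le> measure clock_law {x. edge_open q (s, x) h = (\<not> s)}"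
proof -
  let ?L = "{x. edge_open q (s, x) h = (\<not> s)}"
  have r: "0 < r" "r < 1" using leave_rate_bounds[OF q] by (auto simp: r_def)
  define r' where "r' = leave_rate q (\<not> s)"
  have r': "0 < r'" "r' < 1" using leave_rate_bounds[OF q] by (auto simp: r'_def)
  have mL: "?L \<in> sets clock_law" by (rule clock_sets_Collect) measurable
  have "measure clock_law ?L \<le> measure clock_law {x. \<forall>i\<in>{0::nat}. x i \<in> {..r * h}}"
  proof (rule clock_law.finite_measure_mono_AE)
    show "AE x in clock_law. x \<in> ?L \<longrightarrow> x \<in> {x. \<forall>i\<in>{0::nat}. x i \<in> {..r * h}}"
      using AE_clock_pos
    proof eventually_elim
      case (elim x)
      have "edge_open q (s, x) h = s" if "r * h < x 0"
        using edge_open_before_switch[OF q elim, of h s] r that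
        by (auto simp: switch_time_1[unfolded One_nat_def] r_def[symmetric] field_simps)
      then show ?case by (cases "x 0 \<le> r * h") (auto simp: not_le)
    qed
    show "{x. \<forall>i\<in>{0::nat}. x i \<in> {..r * h}} \<in> sets clock_law"
      by (rule clock_sets_Collect) (simp, measurable)
  qed
  also have "\<dots> = measure exp_law {..r * h}" by (subst measure_clock_box) auto
  also have "\<dots> \<le> r * h" using r h by (intro measure_exp_law_atMost_le) auto
  finally show "measure clock_law ?L \<le> r * h" .
  define E where "E = (\<lambda>i::nat. if i = 0 then {..<r * h} else {r' * h..})"
  have "(r * h - (r * h)\<^sup>2) * (1 - r' * h) \<le> (1 - exp (- (r * h))) * exp (- (r' * h))"
  proof (rule mult_mono)
    show "r * h - (r * h)\<^sup>2 \<le> 1 - exp (- (r * h))" using r h by (intro one_minus_exp_lower) auto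
    show "1 - r' * h \<le> exp (- (r' * h))" using exp_ge_add_one_self[of "- (r' * h)"] by simp
    show "0 \<le> 1 - exp (- (r * h))" using r h by simp
    show "0 \<le> 1 - r' * h" using r' h by (simp add: mult_le_one)
  qed
  moreover have "r * h - 2 * h\<^sup>2 \<le> (r * h - (r * h)\<^sup>2) * (1 - r' * h)"
  proof -
    have "(r * h)\<^sup>2 \<le> 1 * h\<^sup>2" using r h power_le_one[of r 2] mult_right_mono[of "r\<^sup>2" 1 "h\<^sup>2"]
      by (simp add: power_mult_distrib)
    moreover have "r * h * (r' * h) \<le> h\<^sup>2"
      using r r' h mult_le_one[of r r'] mult_right_mono[of "r * r'" 1 "h * h"]
      by (simp add: power2_eq_square mult_ac)
    moreover have "0 \<le> (r * h)\<^sup>2 * (r' * h)" using r' h by simp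
    ultimately show ?thesis by (simp add: algebra_simps)
  qed
  moreover have "(1 - exp (- (r * h))) * exp (- (r' * h)) = measure clock_law {x. \<forall>i\<in>{0, 1}. x i \<in> E i}"
    using r r' h by (subst measure_clock_box) (auto simp: E_def measure_exp_law_lessThan
      measure_exp_law_atLeast)
  moreover have "measure clock_law {x. \<forall>i\<in>{0, 1}. x i \<in> E i} \<le> measure clock_law ?L"
  proof (rule clock_law.finite_measure_mono_AE[OF _ mL])
    show "AE x in clock_law. x \<in> {x. \<forall>i\<in>{0, 1}. x i \<in> E i} \<longrightarrow> x \<in> ?L"
      using AE_clock_pos
    proof eventually_elim
      case (elim x)
      show ?case
      proof
        assume "x \<in> {x. \<forall>i\<in>{0, 1}. x i \<in> E i}"
        then have x: "x 0 < r * h" "r' * h \<le> x 1" by (auto simp: E_def)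
        have less: "x 0 / leave_rate q s < h" using x(1) r by (simp add: r_def[symmetric] field_simps)
        have "h \<le> x 1 / r'" using x(2) r' by (simp add: field_simps)
        moreover have "0 < x 0 / leave_rate q s" using elim r by (simp add: r_def[symmetric])
        ultimately have "edge_open q (\<not> s, \<lambda>i. x (Suc i)) (h - x 0 / leave_rate q s) = (\<not> s)"
          using elim by (intro edge_open_before_switch[OF q])
            (auto simp: switch_time_1[unfolded One_nat_def] r'_def)
        then show "x \<in> ?L" using edge_open_Suc[of x, OF less] by simp
      qed
    qed
  qed
  ultimately show "r * h - 2 * h\<^sup>2 \<le> measure clock_law ?L" by linarith
qed

text \<open>Replacing the two short-time transition probabilities by \<open>1 - (1 - q) * h\<close>
  and \<open>q * h\<close> gives an Euler step of \<open>f' = q - f\<close>. The two errors are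
  weighted by numbers that add up to 1, so their size does not grow.\<close>

lemma trans_prob_increment:
  assumes q: "0 < q" "q < 1" and t: "0 \<le> t" and h: "0 \<le> h" "h \<le> 1"
  shows "\<bar>trans_prob q s (t + h) - (trans_prob q s t * (1 - h) + q * h)\<bar> \<le> 2 * h\<^sup>2"
proof -
  let ?f = "trans_prob q s t"
  have 1: "\<bar>trans_prob q True h - (1 - (1 - q) * h)\<bar> \<le> 2 * h\<^sup>2"
    using leave_prob_bounds[OF q h, of True] measure_edge_open_eq[of q True h False] h
    by (auto simp: leave_rate_def)
  have 2: "\<bar>trans_prob q False h - q * h\<bar> \<le> 2 * h\<^sup>2"
    using leave_prob_bounds[OF q h, of False] measure_edge_open_eq[of q False h True] h
    by (auto simp: leave_rate_def)
  have "trans_prob q s (t + h) - (?f * (1 - h) + q * h)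
      = ?f * (trans_prob q True h - (1 - (1 - q) * h)) + (1 - ?f) * (trans_prob q False h - q * h)"
    unfolding trans_prob_add[OF q t h(1)] by (simp add: algebra_simps)
  also have "\<bar>\<dots>\<bar> \<le> ?f * (2 * h\<^sup>2) + (1 - ?f) * (2 * h\<^sup>2)"
    using 1 2 trans_prob_bounds[of q s t]
    by (intro order.trans[OF abs_triangle_ineq] add_mono) (auto simp: abs_mult intro!: mult_left_mono)
  also have "\<dots> = 2 * h\<^sup>2" by (simp add: algebra_simps)
  finally show ?thesis .
qed

text \<open>The exact transition probability follows by comparing the Euler schemes of \<open>f' = q - f\<close>
  for \<open>trans_prob\<close> and for the claimed solution.\<close>

lemma trans_prob_eq:
  assumes q: "0 < q" "q < 1" and t: "0 \<le> t"
  shows "trans_prob q s t = q + ((if s then 1 else 0) - q) * exp (- t)"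
proof -
  define c where "c = (if s then 1 else 0) - q"
  define D where "D t = trans_prob q s t - (q + c * exp (- t))" for t
  have c: "\<bar>c\<bar> \<le> 1" using q by (auto simp: c_def)
  \<comment> \<open>The old error is multiplied by \<open>1 - h\<close>, hence not amplified;
    \<open>2 * h\<^sup>2\<close> comes from the chain and \<open>h\<^sup>2\<close> from the Euler
    step of the exponential.\<close>
  have step: "\<bar>D (t + h)\<bar> \<le> \<bar>D t\<bar> + 3 * h\<^sup>2" if t: "0 \<le> t" and h: "0 \<le> h" "h \<le> 1" for t h
  proof -
    have e: "\<bar>exp (- h) - 1 + h\<bar> \<le> h\<^sup>2"
      using one_minus_exp_lower[OF h(1)] exp_ge_add_one_self[of "- h"] by (auto simp: abs_le_iff)
    have "D (t + h) = (trans_prob q s (t + h) - (trans_prob q s t * (1 - h) + q * h)) + D t * (1 - h)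
        - c * exp (- t) * (exp (- h) - 1 + h)"
      by (simp add: D_def algebra_simps exp_add[symmetric])
    also have "\<bar>\<dots>\<bar> \<le> 2 * h\<^sup>2 + \<bar>D t\<bar> + 1 * 1 * h\<^sup>2"
    proof -
      have "\<bar>D t * (1 - h)\<bar> \<le> \<bar>D t\<bar>" using h by (simp add: abs_mult mult_left_le)
      moreover have "\<bar>c * exp (- t) * (exp (- h) - 1 + h)\<bar> \<le> 1 * 1 * h\<^sup>2"
        unfolding abs_mult using c e t by (intro mult_mono) auto
      ultimately show ?thesis using trans_prob_increment[OF q t h, of s] by linarith
    qed
    finally show ?thesis by simp
  qed
  have D0: "D 0 = 0" using trans_prob_0[OF q] by (simp add: D_def c_def)
  have iter: "\<bar>D (real k * h)\<bar> \<le> real k * (3 * h\<^sup>2)" if h: "0 \<le> h" "h \<le> 1" for k h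
  proof (induction k)
    case 0
    then show ?case by (simp add: D0)
  next
    case (Suc k)
    then show ?case using step[of "real k * h" h] h by (simp add: algebra_simps)
  qed
  \<comment> \<open>Taking \<open>n \<ge> t\<close> steps of length \<open>t / n\<close>, so that
    each is at most 1, leaves an error \<open>3 * t\<^sup>2 / n\<close>.\<close>
  have "eventually (\<lambda>n. \<bar>D t\<bar> \<le> 3 * t\<^sup>2 / real n) sequentially"
    using eventually_ge_at_top[of "nat \<lceil>t\<rceil> + 1"]
  proof eventually_elim
    case (elim n)
    then have n: "0 < n" "t \<le> real n" by linarith+
    then have "\<bar>D (real n * (t / real n))\<bar> \<le> real n * (3 * (t / real n)\<^sup>2)"
      using t by (intro iter) (auto simp: field_simps)
    then show ?case using n by (simp add: power2_eq_square field_simps)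
  qed
  moreover have "(\<lambda>n. 3 * t\<^sup>2 / real n) \<longlonglongrightarrow> 0" by real_asymp
  ultimately have "\<bar>D t\<bar> \<le> 0" by (intro tendsto_lowerbound[of _ 0 sequentially]) auto
  then show ?thesis by (simp add: D_def c_def)
qed

section \<open>A single edge started from stationarity\<close>

lemma edge_law_eq: "edge_law q = measure_pmf (bernoulli_pmf q) \<Otimes>\<^sub>M clock_law"
  by (simp add: edge_law_def clock_law_def exp_law_def)

interpretation edge_law: prob_space "edge_law q"
  unfolding edge_law_eq
  by (simp add: prob_space_pair measure_pmf.prob_space_axioms clock_law.prob_space_axioms)

lemma space_edge_law [simp]: "space (edge_law q) = UNIV"
  by (simp add: edge_law_eq space_pair_measure)

text \<open>The first factor has two points and carries the discrete sigma-algebra, so measurability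
  can be checked separately for each initial state.\<close>

lemma edge_law_sets_iff: "A \<in> sets (edge_law q) \<longleftrightarrow> (\<forall>s. {x. (s, x) \<in> A} \<in> sets clock_law)"
proof
  assume "A \<in> sets (edge_law q)"
  then show "\<forall>s. {x. (s, x) \<in> A} \<in> sets clock_law"
    using sets_Pair1[of A "measure_pmf (bernoulli_pmf q)" clock_law]
    by (auto simp: edge_law_eq vimage_def)
next
  assume "\<forall>s. {x. (s, x) \<in> A} \<in> sets clock_law"
  then have "{s} \<times> {x. (s, x) \<in> A} \<in> sets (edge_law q)" for s
    by (auto simp: edge_law_eq)
  then have "(\<Union>s. {s} \<times> {x. (s, x) \<in> A}) \<in> sets (edge_law q)" by auto
  moreover have "(\<Union>s. {s} \<times> {x. (s, x) \<in> A}) = A" by auto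
  ultimately show "A \<in> sets (edge_law q)" by simp
qed

lemma measure_edge_law:
  assumes q: "0 < q" "q < 1" and A: "A \<in> sets (edge_law q)"
  shows "measure (edge_law q) A
    = q * measure clock_law {x. (True, x) \<in> A} + (1 - q) * measure clock_law {x. (False, x) \<in> A}"
proof -
  have "emeasure (edge_law q) A
      = (\<integral>\<^sup>+s. emeasure clock_law (Pair s -` A) \<partial>measure_pmf (bernoulli_pmf q))"
    using A unfolding edge_law_eq by (rule clock_law.emeasure_pair_measure_alt)
  also have "\<dots> = ennreal q * emeasure clock_law {x. (True, x) \<in> A}
      + ennreal (1 - q) * emeasure clock_law {x. (False, x) \<in> A}"
    using q by (simp add: vimage_def mult.commute)
  also have "\<dots> = ennreal (q * measure clock_law {x. (True, x) \<in> A} + (1 - q) * measure clock_law {x.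
    (False, x) \<in> A})"
    using q by (simp add: clock_law.emeasure_eq_measure ennreal_mult[symmetric] ennreal_plus[symmetric]
      del: ennreal_plus)
  finally show ?thesis using q by (simp add: measure_def[of "edge_law q"] del: ennreal_plus)
qed

lemma edge_law_sets_Collect:
  "(\<And>s. Measurable.pred clock_law (\<lambda>x. P (s, x))) \<Longrightarrow> {e. P e} \<in> sets (edge_law q)"
  unfolding edge_law_sets_iff by (auto intro: clock_sets_Collect)

lemma measurable_edge_open [measurable]: "Measurable.pred (edge_law q) (\<lambda>e. edge_open q' e t)"
  unfolding pred_def space_edge_law using edge_law_sets_Collect[of "\<lambda>e. edge_open q' e t" q] by simp

text \<open>By the explicit transition probability, averaging over the stationary initial state
  makes the edge open with probability \<open>q\<close> at every time \<open>t\<close>; the rest is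
  the Markov property.\<close>

lemma measure_edge_law_markov:
  assumes q: "0 < q" "q < 1" and t: "0 \<le> t"
    and \<psi>: "\<And>f g :: real \<Rightarrow> bool. (\<And>u. 0 \<le> u \<Longrightarrow> f u = g u) \<Longrightarrow> \<psi> f = \<psi> g"
    and m [measurable]: "\<And>s. Measurable.pred clock_law (\<lambda>x. \<psi> (edge_open q (s, x)))"
    and m' [measurable]: "\<And>s. Measurable.pred clock_law (\<lambda>x. \<psi> (\<lambda>u. edge_open q (s, x) (t + u)))"
  shows "measure (edge_law q) {e. edge_open q e t = b \<and> \<psi> (\<lambda>u. edge_open q e (t + u))}
    = (if b then q else 1 - q) * measure clock_law {x. \<psi> (edge_open q (b, x))}"
proof -
  have "{e. edge_open q e t = b \<and> \<psi> (\<lambda>u. edge_open q e (t + u))} \<in> sets (edge_law q)"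
    by (rule edge_law_sets_Collect) measurable
  note measure_edge_law[OF q this]
  also have "q * measure clock_law {x. (True, x) \<in> {e. edge_open q e t = b \<and> \<psi> (\<lambda>u. edge_open q e (t + u))}}
    + (1 - q) * measure clock_law {x. (False, x) \<in> {e. edge_open q e t = b \<and> \<psi> (\<lambda>u. edge_open q e (t + u))}}
    = (q * measure clock_law {x. edge_open q (True, x) t
      = b} + (1 - q) * measure clock_law {x. edge_open q (False, x) t = b})
      * measure clock_law {x. \<psi> (edge_open q (b, x))}"
    using measure_edge_open_markov[OF q t, of \<psi> b, OF \<psi> m m'] by (simp add: algebra_simps)
  also have "q * measure clock_law {x. edge_open q (True, x) t
    = b} + (1 - q) * measure clock_law {x. edge_open q (False, x) t = b}
      = (if b then q else 1 - q)"
    by (simp add: measure_edge_open_eq trans_prob_eq[OF q t] algebra_simps)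
  finally show ?thesis .
qed

lemma measure_edge_open:
  assumes q: "0 < q" "q < 1" and t: "0 \<le> t"
  shows "measure (edge_law q) {e. edge_open q e t} = q"
  using measure_edge_law_markov[OF q t, where \<psi> = "\<lambda>_. True" and b = True] clock_law.prob_space
  by simp

lemma measure_edge_open_open:
  assumes q: "0 < q" "q < 1" and t: "0 \<le> s" "s \<le> t"
  shows "measure (edge_law q) {e. edge_open q e s \<and> edge_open q e t} = q * (q + (1 - q) * exp (- (t - s)))"
  using measure_edge_law_markov[OF q t(1), where \<psi> = "\<lambda>f. f (t - s)" and b = True] t
  by (simp add: trans_prob_def[symmetric] trans_prob_eq[OF q])

lemma measure_edge_open_closed:
  assumes q: "0 < q" "q < 1" and t: "0 \<le> s" "s \<le> t"
  shows "measure (edge_law q) {e. edge_open q e s \<and> \<not> edge_open q e t} = q * (1 - q) * (1 - exp (- (t - s)))"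
proof -
  have "measure clock_law {x. \<not> edge_open q (True, x) (t - s)} = (1 - q) * (1 - exp (- (t - s)))"
    using measure_edge_open_eq[of q True "t - s" False] t by (simp add: trans_prob_eq[OF q] algebra_simps)
  then show ?thesis
    using measure_edge_law_markov[OF q t(1), where \<psi> = "\<lambda>f. \<not> f (t - s)" and b = True] t
    by simp
qed

text \<open>Conditioning in turn at \<open>s\<close>, \<open>s'\<close> and \<open>t\<close>: each
  closing costs at most the length of its interval, and the reopening in between is bounded by 1. It
  serves the pairs formed by two closings of the same edge.\<close>

lemma measure_two_closings_le:
  assumes q: "0 < q" "q < 1" and t: "0 \<le> s" "s \<le> s'" "s' \<le> t" "t \<le> t'"
  shows "measure (edge_law q) {e. edge_open q e s \<and> \<not> edge_open q e s' \<and> edge_open q e t \<and> \<not> edge_open q e t'}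
    \<le> q * ((s' - s) * (t' - t))"
proof -
  have close: "measure clock_law {x. edge_open q (True, x) u = False} \<le> u" if "0 \<le> u" for u
  proof -
    have "measure clock_law {x. edge_open q (True, x) u = False} = (1 - q) * (1 - exp (- u))"
      unfolding measure_edge_open_eq by (simp add: trans_prob_eq[OF q that] algebra_simps)
    also have "\<dots> \<le> 1 * u"
      using q that exp_ge_add_one_self[of "- u"] by (intro mult_mono) auto
    finally show ?thesis by simp
  qed
  have "measure (edge_law q) {e. edge_open q e s = True \<and> \<not> edge_open q e (s + (s' - s))
    \<and> edge_open q e (s + (t - s)) \<and> \<not> edge_open q e (s + (t' - s))}
      = q * measure clock_law {x. edge_open q (True, x) (s' - s) = False \<and> edge_open q (True, x) (t - s)
        \<and> \<not> edge_open q (True, x) (t' - s)}"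
    using measure_edge_law_markov[OF q t(1), where \<psi> = "\<lambda>f. \<not> f (s' - s) \<and> f (t - s)
      \<and> \<not> f (t' - s)" and b = True] t
    by simp
  also have "measure clock_law {x. edge_open q (True, x) (s' - s) = False
    \<and> edge_open q (True, x) (t - s) \<and> \<not> edge_open q (True, x) (t' - s)}
      = measure clock_law {x. edge_open q (True, x) (s' - s) = False}
        * measure clock_law {x. edge_open q (False, x) (t - s') = True \<and> \<not> edge_open q (False, x) (t' - s')}"
    using measure_edge_open_markov[OF q, where t = "s' - s" and s = True and \<psi> = "\<lambda>f. f (t - s')
      \<and> \<not> f (t' - s')" and b = False] t
    by simp
  also have "measure clock_law {x. edge_open q (False, x) (t - s') = True
    \<and> \<not> edge_open q (False, x) (t' - s')}
      = measure clock_law {x. edge_open q (False, x) (t - s')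
        = True} * measure clock_law {x. edge_open q (True, x) (t' - t) = False}"
    using measure_edge_open_markov[OF q, where t = "t - s'" and s = False and \<psi>
      = "\<lambda>f. \<not> f (t' - t)" and b = True] t
    by simp
  also have "q * (measure clock_law {x. edge_open q (True, x) (s' - s) = False}
      * (measure clock_law {x. edge_open q (False, x) (t - s')
        = True} * measure clock_law {x. edge_open q (True, x) (t' - t) = False}))
      \<le> q * ((s' - s) * (1 * (t' - t)))"
    using q t by (intro mult_left_mono mult_mono close mult_nonneg_nonneg) auto
  finally show ?thesis by simp
qed

text \<open>The event \<open>G\<close> may depend on the state at \<open>t\<close>, because the
  switches shortly after \<open>t\<close> are read off clocks run at state-dependent rates.\<close>

lemma measure_edge_law_residual:
  assumes q: "0 < q" "q < 1" and t: "0 \<le> t" and G: "\<And>b. G b \<in> sets clock_law"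
  shows "{e. \<exists>k. stage q (fst e) (snd e) t k \<and> residual q (fst e) (snd e) t k \<in> G (edge_open q e t)} \<in>
    sets (edge_law q)" (is "?A \<in> _")
    and "measure (edge_law q) {e. \<exists>k. stage q (fst e) (snd e) t k
      \<and> residual q (fst e) (snd e) t k \<in> G (edge_open q e t)}
      = q * measure clock_law (G True) + (1 - q) * measure clock_law (G False)"
proof -
  note G [measurable]
  let ?P = "\<lambda>s x. \<exists>k. stage q s x t k \<and> residual q s x t k \<in> G (edge_open q (s, x) t)"
  have eq: "?P s x \<longleftrightarrow> (edge_open q (s, x) t = True \<and> (\<exists>k. stage q s x t k \<and> residual q s x t k \<in> G True))
      \<or> (edge_open q (s, x) t = False \<and> (\<exists>k. stage q s x t k \<and> residual q s x t k \<in> G False))" for s x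
    by (cases "edge_open q (s, x) t") auto
  have m: "Measurable.pred clock_law (?P s)" for s
    unfolding eq by measurable
  show A: "?A \<in> sets (edge_law q)"
    by (rule edge_law_sets_Collect) (use m in simp)
  have key: "measure clock_law {x. ?P s x}
      = trans_prob q s t * measure clock_law (G True) + (1 - trans_prob q s t) * measure clock_law (G
        False)" for s
  proof -
    have "measure clock_law {x. ?P s x} = measure clock_law {x. edge_open q (s, x) t = True \<and> ?P s x}
        + measure clock_law {x. edge_open q (s, x) t = False \<and> ?P s x}"
      by (rule measure_clock_split_bool[OF m]) measurable
    moreover have "measure clock_law {x. edge_open q (s, x) t = b \<and> ?P s x}
        = measure clock_law {x. edge_open q (s, x) t = b} * measure clock_law (G b)" for b
      unfolding measure_edge_open_residual[OF q t G, symmetric]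
      by (rule arg_cong[where f = "measure clock_law"]) auto
    ultimately show ?thesis by (simp only: measure_edge_open_eq if_True if_False)
  qed
  show "measure (edge_law q) ?A = q * measure clock_law (G True) + (1 - q) * measure clock_law (G False)"
    unfolding measure_edge_law[OF q A] mem_Collect_eq fst_conv snd_conv key
      by (simp add: trans_prob_eq[OF q t] algebra_simps)
qed

lemma AE_clock_measure_1:
  "measure clock_law {x. \<forall>i. 0 < x i} = 1" "{x. \<forall>i. 0 < x i} \<in> sets clock_law"
proof -
  show m: "{x. \<forall>i. 0 < x i} \<in> sets clock_law" by (rule clock_sets_Collect) measurable
  then show "measure clock_law {x. \<forall>i. 0 < x i} = 1"
    using AE_clock_pos clock_law.prob_eq_1[OF m] by simp
qed

text \<open>The exceptional events are enclosed in measurable sets \<open>F\<close>, since constancy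
  over an interval is not visibly measurable. Outside the first no switch happens; outside the
  second at most one does, so every intermediate state is the initial or the final one.\<close>

lemma edge_flips:
  assumes q: "0 < q" "q < 1" and t: "0 \<le> t" and h: "0 \<le> h"
  shows "\<exists>F \<in> sets (edge_law q). measure (edge_law q) F \<le> h \<and>
      (\<forall>e. e \<notin> F \<longrightarrow> (\<forall>u\<in>{0..h}. edge_open q e (t + u) = edge_open q e t))"
    and "\<exists>F \<in> sets (edge_law q). measure (edge_law q) F \<le> h\<^sup>2 \<and>
      (\<forall>e. e \<notin> F \<longrightarrow> (\<forall>u\<in>{0..h}. edge_open q e (t + u) \<in> {edge_open q e t, edge_open q e (t + h)}))"
proof -
  let ?r = "leave_rate q"
  have r: "0 < ?r b" "?r b < 1" "?r b * h \<le> h" "0 \<le> ?r b * h" for b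
    using leave_rate_bounds[OF q, of b] h by (auto intro!: mult_left_le_one_le)
  \<comment> \<open>\<open>J i b\<close> is the value up to which clock \<open>i\<close> fits its
    holding period into length \<open>h\<close>; the first two periods run at the rates of
    \<open>b\<close> and \<open>\<not> b\<close>.\<close>
  define J where "J n b = (if n = (0::nat) then ?r b * h else ?r (\<not> b) * h)" for n b
  have J: "0 \<le> J n b" "J n b \<le> h" for n b using r by (auto simp: J_def)
  define G where "G n b = {y :: nat \<Rightarrow> real. (\<forall>i. 0 < y i) \<and> \<not> (\<forall>i\<in>{..n}. y i \<in> {..J i b})}" for n b
  have mG: "G n b \<in> sets clock_law" for n b
    unfolding G_def by (rule clock_sets_Collect) (simp, measurable)
  have pG: "1 - h ^ Suc n \<le> measure clock_law (G n b)" for n b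
  proof -
    let ?B = "{y :: nat \<Rightarrow> real. \<forall>i\<in>{..n}. y i \<in> {..J i b}}"
    have B: "?B \<in> sets clock_law" by (rule clock_sets_Collect) (simp, measurable)
    have "measure clock_law ?B = (\<Prod>i\<in>{..n}. measure exp_law {..J i b})"
      by (rule measure_clock_box) auto
    also have "\<dots> \<le> (\<Prod>i\<in>{..n}. h)"
      using J by (intro prod_mono) (auto intro!: order.trans[OF measure_exp_law_atMost_le])
    finally have le: "measure clock_law ?B \<le> h ^ Suc n" by simp
    have "1 = measure clock_law {x. \<forall>i. 0 < x i}" by (simp add: AE_clock_measure_1)
    also have "\<dots> \<le> measure clock_law (G n b \<union> ?B)"
      using B mG by (intro clock_law.finite_measure_mono) (auto simp: G_def)
    also have "\<dots> \<le> measure clock_law (G n b) + measure clock_law ?B"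
      using B mG by (intro measure_Un_le)
    finally show ?thesis using le by simp
  qed
  define A where "A n = {e. \<exists>k. stage q (fst e) (snd e) t k
    \<and> residual q (fst e) (snd e) t k \<in> G n (edge_open q e t)}" for n
  have mA: "A n \<in> sets (edge_law q)" for n
    unfolding A_def by (rule measure_edge_law_residual(1)[OF q t mG])
  have pA: "measure (edge_law q) (space (edge_law q) - A n) \<le> h ^ Suc n" for n
  proof -
    have "q * (1 - h ^ Suc n) + (1 - q) * (1 - h ^ Suc n) \<le> measure (edge_law q) (A n)"
      unfolding A_def measure_edge_law_residual(2)[OF q t, of "G n", OF mG]
      using q pG[of n] by (intro add_mono mult_left_mono) auto
    then show ?thesis
      unfolding edge_law.prob_compl[OF mA] by (simp add: algebra_simps)
  qed
  have path: "\<exists>y. y \<in> G n (edge_open q e t) \<and> (\<forall>u\<ge>0. edge_open q e (t + u)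
    = edge_open q (edge_open q e t, y) u)"
    if e: "e \<in> A n" for e n
  proof -
    obtain s x where ex: "e = (s, x)" by (cases e)
    obtain k where k: "stage q s x t k" "residual q s x t k \<in> G n (edge_open q e t)"
      using e by (auto simp: A_def ex)
    have "edge_open q e (t + 0) = state s k"
      unfolding ex edge_open_stage[OF q k(1) order.refl]
      using k(2) by (intro edge_open_0[OF q]) (simp add: G_def)
    then show ?thesis
      using edge_open_stage[OF q k(1)] k(2) by (intro exI[of _ "residual q s x t k"]) (simp add: ex)
  qed
  show "\<exists>F \<in> sets (edge_law q). measure (edge_law q) F \<le> h \<and>
      (\<forall>e. e \<notin> F \<longrightarrow> (\<forall>u\<in>{0..h}. edge_open q e (t + u) = edge_open q e t))"
  proof (intro bexI conjI allI impI ballI)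
    fix e u assume "e \<notin> space (edge_law q) - A 0" and u: "u \<in> {0..h}"
    then have "e \<in> A 0" by simp
    from path[OF this] obtain y where y: "y \<in> G 0 (edge_open q e t)"
      and eq: "\<forall>u\<ge>0. edge_open q e (t + u) = edge_open q (edge_open q e t, y) u" by blast
    have "h < y 0 / ?r (edge_open q e t)"
      using y r[of "edge_open q e t"] by (auto simp: G_def J_def field_simps)
    then have "edge_open q (edge_open q e t, y) u = edge_open q e t"
      using u y by (intro edge_open_before_switch[OF q])
        (auto simp: G_def switch_time_1[unfolded One_nat_def])
    then show "edge_open q e (t + u) = edge_open q e t" using eq u by simp
  qed (use pA[of 0] sets.compl_sets[OF mA, of 0] in auto)
  show "\<exists>F \<in> sets (edge_law q). measure (edge_law q) F \<le> h\<^sup>2 \<and>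
      (\<forall>e. e \<notin> F \<longrightarrow> (\<forall>u\<in>{0..h}. edge_open q e (t + u) \<in> {edge_open q e t, edge_open q e (t + h)}))"
  proof (intro bexI conjI allI impI ballI)
    fix e u assume "e \<notin> space (edge_law q) - A 1" and u: "u \<in> {0..h}"
    then have "e \<in> A 1" by simp
    from path[OF this] obtain y where y: "y \<in> G 1 (edge_open q e t)"
      and eq: "\<forall>u\<ge>0. edge_open q e (t + u) = edge_open q (edge_open q e t, y) u" by blast
    define b where "b = edge_open q e t"
    define \<tau> where "\<tau> = y 0 / ?r b"
    have pos: "\<forall>i. 0 < y i" using y by (simp add: G_def)
    have before: "edge_open q (b, y) u = b" if "u < \<tau>" for u
      using that by (intro edge_open_before_switch[OF q pos])
        (auto simp: switch_time_1[unfolded One_nat_def] \<tau>_def)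
    have "edge_open q (b, y) u \<in> {b, edge_open q (b, y) h}"
    proof (cases "\<tau> < h")
      case False
      then show ?thesis using before[of u] u by (cases "u = h") auto
    next
      case True
      have "h - \<tau> < y 1 / ?r (\<not> b)"
      proof -
        have "\<not> (y 0 \<le> ?r b * h \<and> y 1 \<le> ?r (\<not> b) * h)"
          using y by (auto simp: G_def J_def b_def le_Suc_eq)
        moreover have "y 0 \<le> ?r b * h" using True r[of b] by (simp add: \<tau>_def field_simps)
        ultimately have "h < y 1 / ?r (\<not> b)" using r[of "\<not> b"] by (simp add: field_simps)
        moreover have "0 < \<tau>" using pos r by (simp add: \<tau>_def)
        ultimately show ?thesis by simp
      qed
      then have "edge_open q (\<not> b, \<lambda>i. y (Suc i)) (h - \<tau>) = (\<not> b)"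
        using pos by (intro edge_open_before_switch[OF q]) (auto simp: switch_time_1[unfolded One_nat_def])
      then have "edge_open q (b, y) h = (\<not> b)"
        using edge_open_Suc[of y q b h] True by (simp add: \<tau>_def)
      then show ?thesis by auto
    qed
    then show "edge_open q e (t + u) \<in> {edge_open q e t, edge_open q e (t + h)}"
      using eq u h by (simp add: b_def)
  qed (use pA[of 1] sets.compl_sets[OF mA, of 1] in \<open>auto simp: power2_eq_square\<close>)
qed

section \<open>Connections in the tree\<close>

primrec conn :: "'v rtree \<Rightarrow> nat \<Rightarrow> ('v \<Rightarrow> bool) \<Rightarrow> 'v \<Rightarrow> bool" where
  "conn T 0 c v = True"
| "conn T (Suc m) c v = (\<exists>w\<in>children T v. c w \<and> conn T m c w)"

primrec conn_prob :: "(nat \<Rightarrow> nat) \<Rightarrow> (nat \<Rightarrow> real) \<Rightarrow> nat \<Rightarrow> nat \<Rightarrow> real" where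
  "conn_prob d p 0 k = 1"
| "conn_prob d p (Suc m) k = 1 - (1 - p (Suc k) * conn_prob d p m (Suc k)) ^ d k"

text \<open>The level condition matters: \<open>parent\<close> at the root is arbitrary, so
  iterating it past the root could lead to \<open>v\<close> from vertices that are not below
  \<open>v\<close>.\<close>

definition subtree :: "'v rtree \<Rightarrow> 'v \<Rightarrow> 'v set" where
  "subtree T v = {u \<in> verts T. \<exists>n. (parent T ^^ n) u = v \<and> level T u = n + level T v}"

lemma subtree_unique:
  "u \<in> subtree T v \<Longrightarrow> u \<in> subtree T w \<Longrightarrow> level T v = level T w \<Longrightarrow> v = w"
  by (auto simp: subtree_def)

lemma subtree_level: "u \<in> subtree T v \<Longrightarrow> level T v \<le> level T u"
  by (auto simp: subtree_def)

lemma subtree_refl: "v \<in> verts T \<Longrightarrow> v \<in> subtree T v"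
  by (auto simp: subtree_def intro: exI[of _ 0])

lemma subtree_level_eq: "u \<in> subtree T v \<Longrightarrow> level T u = level T v \<Longrightarrow> u = v"
  by (auto simp: subtree_def)

locale spherical_percolation =
  fixes T :: "'v rtree" and d :: "nat \<Rightarrow> nat" and p :: "nat \<Rightarrow> real" and \<epsilon> :: real
  assumes sst: "spherically_symmetric_tree T d"
    and eps: "0 < \<epsilon>"
    and p_ge: "\<And>n. n \<ge> 1 \<Longrightarrow> \<epsilon> \<le> p n"
    and p_le: "\<And>n. n \<ge> 1 \<Longrightarrow> p n \<le> 1 - \<epsilon>"
begin

lemma rt: "rooted_tree T"
  using sst by (simp add: spherically_symmetric_tree_def)

lemma rho_verts: "rho T \<in> verts T"
  using rt by (simp add: rooted_tree_def)

lemma p_pos: "n \<ge> 1 \<Longrightarrow> 0 < p n" and p_less: "n \<ge> 1 \<Longrightarrow> p n < 1"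
  using p_ge[of n] p_le[of n] eps by auto

lemma edges_verts: "v \<in> edges T \<Longrightarrow> v \<in> verts T"
  by (simp add: edges_def)

lemma level_edges: "v \<in> edges T \<Longrightarrow> 1 \<le> level T v"
  using level_parent[OF rt, of v] by simp

lemma parent_verts: "v \<in> edges T \<Longrightarrow> parent T v \<in> verts T"
  using rt by (auto simp: rooted_tree_def edges_def)

lemma childrenD:
  assumes "w \<in> children T v"
  shows "w \<in> edges T" "w \<in> verts T" "parent T w = v" "level T w = Suc (level T v)" "v \<in> verts T"
  using assms level_parent[OF rt, of w] parent_verts[of w]
  by (auto simp: children_def edges_def)

lemma finite_children: "v \<in> verts T \<Longrightarrow> finite (children T v)"
  and card_children: "v \<in> verts T \<Longrightarrow> card (children T v) = d (level T v)"
  using sst by (auto simp: spherically_symmetric_tree_def)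

lemma subtree_child_iff:
  assumes v: "v \<in> verts T"
  shows "u \<in> subtree T v \<longleftrightarrow> u = v \<or> (\<exists>w\<in>children T v. u \<in> subtree T w)"
proof
  assume "u \<in> subtree T v"
  then obtain n where n: "u \<in> verts T" "(parent T ^^ n) u = v" "level T u = n + level T v"
    by (auto simp: subtree_def)
  show "u = v \<or> (\<exists>w\<in>children T v. u \<in> subtree T w)"
  proof (cases n)
    case 0
    then show ?thesis using n by simp
  next
    case (Suc m)
    let ?w = "(parent T ^^ m) u"
    have lev: "(parent T ^^ i) u \<in> verts T \<and> level T ((parent T ^^ i) u) = level T u - i" if "i
      \<le> level T u" for i
      using that
    proof (induction i)
      case 0
      then show ?case using n by simp
    next
      case (Suc i)
      then have "(parent T ^^ i) u \<in> edges T"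
        by (auto simp: edges_def)
      then show ?case using Suc level_parent[OF rt, of "(parent T ^^ i) u"] parent_verts by auto
    qed
    have w: "?w \<in> verts T" "level T ?w = Suc (level T v)"
      using lev[of m] n(3) Suc by auto
    then have "?w \<in> edges T" by (auto simp: edges_def)
    then have "?w \<in> children T v" using n Suc by (simp add: children_def)
    moreover have "u \<in> subtree T ?w" using n w Suc by (auto simp: subtree_def)
    ultimately show ?thesis by blast
  qed
next
  assume "u = v \<or> (\<exists>w\<in>children T v. u \<in> subtree T w)"
  then show "u \<in> subtree T v"
  proof
    assume "u = v" then show ?thesis using v subtree_refl[OF v] by simp
  next
    assume "\<exists>w\<in>children T v. u \<in> subtree T w"
    then obtain w n where w: "w \<in> children T v" "u \<in> verts T" "(parent T ^^ n) u = w" "level T u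
      = n + level T w"
      by (auto simp: subtree_def)
    then show ?thesis using childrenD[OF w(1)] by (auto simp: subtree_def intro!: exI[of _ "Suc n"])
  qed
qed

lemma subtree_child_subset: "w \<in> children T v \<Longrightarrow> subtree T w \<subseteq> subtree T v - {v}"
  using subtree_child_iff[of v] childrenD[of w v] subtree_level[of v T w] by fastforce

lemma subtree_edges: "v \<in> verts T \<Longrightarrow> subtree T v - {v} \<subseteq> edges T"
  using subtree_level_eq[of "rho T" T v] subtree_level[of "rho T" T v] by (auto simp: edges_def subtree_def)

lemma subtree_edges': "v \<in> edges T \<Longrightarrow> subtree T v \<subseteq> edges T"
  using subtree_edges[of v] by (auto simp: edges_def)

lemma disjoint_subtree_children: "disjoint_family_on (subtree T) (children T v)"
  unfolding disjoint_family_on_def using subtree_unique[of _ T] childrenD(4) by fastforce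

lemma subtree_ancestors:
  assumes "u \<in> verts T"
  shows "v \<in> ancestors T u \<longleftrightarrow> v \<in> edges T \<and> u \<in> subtree T v"
  using rt assms
proof (induction rule: tree_induct)
  case rho
  then show ?case using level_edges[of v] subtree_level[of "rho T" T v] by auto
next
  case (step u)
  have "u \<in> subtree T v \<longleftrightarrow> u = v \<or> parent T u \<in> subtree T v" if v: "v \<in> edges T"
  proof
    assume "u \<in> subtree T v"
    then obtain n where n: "u \<in> verts T" "(parent T ^^ n) u = v" "level T u = n + level T v"
      by (auto simp: subtree_def)
    show "u = v \<or> parent T u \<in> subtree T v"
    proof (cases n)
      case (Suc m)
      then show ?thesis
        using n step level_parent[OF rt step(1)] by (auto simp: subtree_def funpow_swap1 intro!: exI[of _ m])
    qed (use n in simp)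
  next
    assume "u = v \<or> parent T u \<in> subtree T v"
    then show "u \<in> subtree T v"
    proof
      assume "u = v" then show ?thesis using subtree_refl[OF edges_verts[OF step(1)]] by simp
    next
      assume "parent T u \<in> subtree T v"
      then obtain n where n: "(parent T ^^ n) (parent T u) = v" "level T (parent T u) = n + level T v"
        by (auto simp: subtree_def)
      then show ?thesis using level_parent[OF rt step(1)] edges_verts[OF step(1)]
        by (auto simp: subtree_def funpow_swap1 intro!: exI[of _ "Suc n"])
    qed
  qed
  then show ?case using step ancestors_step[OF rt step(1)] by auto
qed

lemma level_set_Suc: "level_set T (Suc k) = (\<Union>v\<in>level_set T k. children T v)"
proof safe
  fix w assume w: "w \<in> level_set T (Suc k)"
  then have e: "w \<in> edges T" by (auto simp: level_set_def edges_def)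
  then have "parent T w \<in> level_set T k"
    using w level_parent[OF rt e] parent_verts by (auto simp: level_set_def)
  then show "w \<in> (\<Union>v\<in>level_set T k. children T v)" using e by (auto simp: children_def)
next
  fix v w assume v: "v \<in> level_set T k" and w: "w \<in> children T v"
  show "w \<in> level_set T (Suc k)" using v childrenD(2,4)[OF w] by (simp add: level_set_def)
qed

lemma finite_level: "finite (level_set T k)"
  using finite_level_set[OF sst] .

lemma level_set_0: "level_set T 0 = {rho T}"
  using rho_verts by (auto simp: level_set_def dest: level_0[OF rt])

lemma card_level_set_Suc: "card (level_set T (Suc k)) = card (level_set T k) * d k"
proof -
  have "card (level_set T (Suc k)) = (\<Sum>v\<in>level_set T k. card (children T v))"
    unfolding level_set_Suc using finite_level
    by (intro card_UN_disjoint) (auto simp: level_set_def finite_children dest: childrenD)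
  also have "\<dots> = (\<Sum>v\<in>level_set T k. d k)"
    by (intro sum.cong) (auto simp: level_set_def card_children)
  finally show ?thesis by simp
qed

text \<open>An empty level would empty all deeper ones, so the tree would consist of finitely many
  finite levels. Consequently every vertex has a child.\<close>

lemma level_set_nonempty: "level_set T k \<noteq> {}"
proof
  assume e: "level_set T k = {}"
  have "level_set T (k + j) = {}" for j
    by (induction j) (simp_all add: e level_set_Suc)
  then have "level_set T j = {}" if "k \<le> j" for j
    using that by (metis le_Suc_ex)
  then have "verts T \<subseteq> (\<Union>j<k. level_set T j)"
    by (force simp: level_set_def not_le[symmetric])
  then have "finite (verts T)" using finite_level by (meson finite_UN finite_lessThan finite_subset)
  then show False using sst by (simp add: spherically_symmetric_tree_def)
qed

lemma d_pos: "1 \<le> d k"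
proof -
  have "0 < card (level_set T (Suc k))" using level_set_nonempty finite_level by (simp add: card_gt_0_iff)
  then show ?thesis unfolding card_level_set_Suc by simp
qed

abbreviation w :: "nat \<Rightarrow> real" where "w \<equiv> mean_conn T p"

lemma w_0: "w 0 = 1" by (simp add: mean_conn_def level_set_0)

lemma w_Suc: "w (Suc k) = w k * (real (d k) * p (Suc k))"
  by (simp add: mean_conn_def card_level_set_Suc)

lemma w_pos: "0 < w k"
  by (induction k) (use d_pos p_pos in \<open>auto simp: w_0 w_Suc intro!: mult_pos_pos simp: less_le_trans[OF
    zero_less_one]\<close>)

lemma conn_prob_bounds: "0 < conn_prob d p m k \<and> conn_prob d p m k \<le> 1"
proof (induction m arbitrary: k)
  case (Suc m)
  let ?x = "p (Suc k) * conn_prob d p m (Suc k)"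
  have x: "0 < ?x" "?x < 1"
    using Suc[of "Suc k"] p_pos[of "Suc k"] p_less[of "Suc k"] by (auto intro: le_less_trans[OF mult_left_le])
  then have "(1 - ?x) ^ d k \<le> (1 - ?x) ^ 1" using d_pos by (intro power_decreasing) auto
  then show ?case using x by auto
qed simp

lemma conn_Suc_imp: "conn T (Suc m) c v \<Longrightarrow> conn T m c v"
  by (induction m arbitrary: v) auto

lemma conn_antimono: "m \<le> n \<Longrightarrow> conn T n c v \<Longrightarrow> conn T m c v"
  by (induction rule: dec_induct) (use conn_Suc_imp in blast)+

lemma conn_imp_cluster:
  assumes "v \<in> cluster T c (rho T)" "v \<in> verts T" "conn T m c v"
  shows "\<exists>u\<in>level_set T (level T v + m). u \<in> cluster T c (rho T)"
  using assms
proof (induction m arbitrary: v)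
  case 0
  then show ?case by (auto simp: level_set_def)
next
  case (Suc m)
  then obtain u where u: "u \<in> children T v" "c u" "conn T m c u" by auto
  have "u \<in> cluster T c (rho T)"
    using Suc.prems u childrenD[OF u(1)] by (auto simp: in_cluster_iff[OF rt] ancestors_step[OF rt])
  then show ?case using Suc.IH[of u] u childrenD[OF u(1)] by auto
qed

lemma cluster_imp_conn:
  assumes "u \<in> verts T" "u \<in> cluster T c (rho T)" "conn T m c u"
  shows "conn T (level T u + m) c (rho T)"
  using rt assms
proof (induction arbitrary: m rule: tree_induct)
  case (step u)
  then have "c u" "parent T u \<in> cluster T c (rho T)"
    using edges_verts[OF step(1)] by (auto simp: in_cluster_iff[OF rt] ancestors_step[OF rt])
  moreover have "conn T (Suc m) c (parent T u)"
    using step \<open>c u\<close> by (auto simp: children_def)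
  ultimately show ?case using step.IH[of "Suc m"] level_parent[OF rt step(1)] by simp
qed simp

lemma cluster_verts: "u \<in> cluster T c (rho T) \<Longrightarrow> u \<in> verts T"
proof -
  assume "u \<in> cluster T c (rho T)"
  then have "(rho T, u) \<in> (open_adj T c)\<^sup>*" by (simp add: cluster_def)
  then show ?thesis
    by (induction rule: rtrancl_induct) (auto simp: open_adj_def rho_verts edges_verts parent_verts)
qed

text \<open>Local finiteness enters here: a cluster that does not reach level \<open>m\<close> lies
  in finitely many finite levels, and one that reaches all levels is infinite. This replaces
  clusters by downward connections to finite levels.\<close>

lemma root_percolates_iff: "root_percolates T c \<longleftrightarrow> (\<forall>m. conn T m c (rho T))"
proof
  assume inf: "root_percolates T c"
  show "\<forall>m. conn T m c (rho T)"
  proof (rule ccontr)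
    assume "\<not> (\<forall>m. conn T m c (rho T))"
    then obtain m where m: "\<not> conn T m c (rho T)" by blast
    have "cluster T c (rho T) \<subseteq> (\<Union>j<m. level_set T j)"
    proof
      fix u assume u: "u \<in> cluster T c (rho T)"
      have "conn T (level T u + 0) c (rho T)" using cluster_imp_conn[OF cluster_verts[OF u] u, of 0] by simp
      then have "level T u < m" using m conn_antimono[of m "level T u" c "rho T"] by
        (auto simp: not_less[symmetric])
      then show "u \<in> (\<Union>j<m. level_set T j)" using cluster_verts[OF u] by (auto simp: level_set_def)
    qed
    then have "finite (cluster T c (rho T))" using finite_level
      by (meson finite_UN finite_lessThan finite_subset)
    then show False using inf by (simp add: root_percolates_def)
  qed
next
  assume all: "\<forall>m. conn T m c (rho T)"
  have rho: "rho T \<in> cluster T c (rho T)" by (simp add: cluster_def)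
  have "\<exists>u\<in>cluster T c (rho T). level T u = m" for m
    using conn_imp_cluster[OF rho rho_verts, of m] all by (auto simp: level_set_def)
  then have "UNIV = level T ` cluster T c (rho T)" by (metis UNIV_eq_I imageI)
  then show "root_percolates T c"
    unfolding root_percolates_def using infinite_UNIV_nat by (metis finite_imageI)
qed

end

section \<open>Independence of disjoint sets of edges\<close>

definition perc :: "'v rtree \<Rightarrow> ('v \<Rightarrow> bool) \<Rightarrow> 'v \<Rightarrow> bool" where
  "perc T c v \<longleftrightarrow> (\<forall>m. conn T m c v)"

text \<open>This is \<open>q\<^sub>k\<close>. Convergence is obtained in
  \<open>conn_prob_limit\<close> from the decreasing events that a vertex is connected
  \<open>m\<close> levels down.\<close>

definition perc_prob :: "(nat \<Rightarrow> nat) \<Rightarrow> (nat \<Rightarrow> real) \<Rightarrow> nat \<Rightarrow> real" where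
  "perc_prob d p k = lim (\<lambda>m. conn_prob d p m k)"

context spherical_percolation
begin

abbreviation edge_meas :: "'v \<Rightarrow> (bool \<times> (nat \<Rightarrow> real)) measure" where
  "edge_meas v \<equiv> edge_law (p (level T v))"

abbreviation M :: "('v \<Rightarrow> bool \<times> (nat \<Rightarrow> real)) measure" where
  "M \<equiv> dyn_perc T p"

lemma M_eq: "M = PiM (edges T) edge_meas"
  by (simp add: dyn_perc_def)

sublocale edge_prod: product_prob_space edge_meas "edges T"
  by unfold_locales

sublocale M: prob_space M
  unfolding M_eq by (rule prob_space_PiM) (rule edge_law.prob_space_axioms)

text \<open>Membership in the sigma-algebra generated by the edges of \<open>S\<close>, phrased for
  predicates so that it passes through connectives and countable quantifiers. The first clause lets
  one predicate be read on every product over a set containing \<open>S\<close>.\<close>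

definition dep :: "'v set \<Rightarrow> (('v \<Rightarrow> bool \<times> (nat \<Rightarrow> real)) \<Rightarrow> bool) \<Rightarrow> bool" where
  "dep S P \<longleftrightarrow> (\<forall>\<omega>. P (restrict \<omega> S) = P \<omega>) \<and> Measurable.pred (PiM S edge_meas) P"

definition pr :: "(('v \<Rightarrow> bool \<times> (nat \<Rightarrow> real)) \<Rightarrow> bool) \<Rightarrow> real" where
  "pr P = measure M {\<omega> \<in> space M. P \<omega>}"

lemma dep_mono:
  assumes "dep S P" "S \<subseteq> S'"
  shows "dep S' P"
proof -
  have "(\<lambda>\<omega>. restrict \<omega> S) \<in> measurable (PiM S' edge_meas) (PiM S edge_meas)"
    using assms(2) by (rule measurable_restrict_subset)
  then have "(\<lambda>\<omega>. P (restrict \<omega> S)) \<in> measurable (PiM S' edge_meas) (count_space UNIV)"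
    by (rule measurable_compose) (use assms(1) in \<open>simp add: dep_def\<close>)
  moreover have "P (restrict \<omega> S') = P \<omega>" for \<omega>
  proof -
    have D: "P (restrict \<omega>' S) = P \<omega>'" for \<omega>' using assms(1) by (simp add: dep_def)
    have "restrict (restrict \<omega> S') S = restrict \<omega> S" using assms(2) by (auto simp: restrict_def fun_eq_iff)
    then show ?thesis using D[of "restrict \<omega> S'"] D[of \<omega>] by simp
  qed
  ultimately show ?thesis using assms(1) by (simp add: dep_def)
qed

lemma dep_const: "dep S (\<lambda>_. c)" by (simp add: dep_def)

lemma dep_not: "dep S P \<Longrightarrow> dep S (\<lambda>\<omega>. \<not> P \<omega>)"
  unfolding dep_def by (auto intro: pred_intros_logic)

lemma dep_conj: "dep S P \<Longrightarrow> dep S R \<Longrightarrow> dep S (\<lambda>\<omega>. P \<omega> \<and> R \<omega>)"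
  unfolding dep_def by (auto intro: pred_intros_logic)

lemma dep_all: "(\<And>i :: 'i :: countable. dep S (P i)) \<Longrightarrow> dep S (\<lambda>\<omega>. \<forall>i. P i \<omega>)"
  unfolding dep_def by (auto intro: pred_intros_countable)

lemma dep_ex: "(\<And>i :: 'i :: countable. dep S (P i)) \<Longrightarrow> dep S (\<lambda>\<omega>. \<exists>i. P i \<omega>)"
  unfolding dep_def by (auto intro: pred_intros_countable)

lemma dep_ball: "finite C \<Longrightarrow> (\<And>i. i \<in> C \<Longrightarrow> dep S (P i)) \<Longrightarrow> dep S (\<lambda>\<omega>. \<forall>i\<in>C. P i \<omega>)"
  unfolding dep_def by (auto intro: pred_intros_finite)

lemma dep_bex: "finite C \<Longrightarrow> (\<And>i. i \<in> C \<Longrightarrow> dep S (P i)) \<Longrightarrow> dep S (\<lambda>\<omega>. \<exists>i\<in>C. P i \<omega>)"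
  unfolding dep_def by (auto intro: pred_intros_finite)

lemma dep_edge:
  assumes "Measurable.pred (edge_meas v) \<phi>" "v \<in> S"
  shows "dep S (\<lambda>\<omega>. \<phi> (\<omega> v))"
proof -
  have "(\<lambda>\<omega>. \<omega> v) \<in> measurable (PiM S edge_meas) (edge_meas v)"
    using assms(2) by (rule measurable_component_singleton)
  then have "(\<lambda>\<omega>. \<phi> (\<omega> v)) \<in> measurable (PiM S edge_meas) (count_space UNIV)"
    using assms(1) by (rule measurable_compose)
  then show ?thesis using assms(2) by (simp add: dep_def)
qed

lemma dep_events: "dep S P \<Longrightarrow> S \<subseteq> edges T \<Longrightarrow> {\<omega> \<in> space M. P \<omega>} \<in> sets M"
  using dep_mono[of S P "edges T"] unfolding dep_def M_eq pred_def by simp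

lemma pr_nonneg: "0 \<le> pr P" by (simp add: pr_def)

lemma pr_mono:
  assumes "\<And>\<omega>. \<omega> \<in> space M \<Longrightarrow> P \<omega> \<Longrightarrow> R \<omega>" "dep S R" "S \<subseteq> edges T"
  shows "pr P \<le> pr R"
  unfolding pr_def using assms dep_events by (intro M.finite_measure_mono) auto

lemma pr_not: "dep S P \<Longrightarrow> S \<subseteq> edges T \<Longrightarrow> pr (\<lambda>\<omega>. \<not> P \<omega>) = 1 - pr P"
  unfolding pr_def using M.prob_neg[of P] dep_events[of S P] by simp

lemma pr_bex_le:
  assumes "finite J" "\<And>j. j \<in> J \<Longrightarrow> dep (S j) (P j) \<and> S j \<subseteq> edges T"
  shows "pr (\<lambda>\<omega>. \<exists>j\<in>J. P j \<omega>) \<le> (\<Sum>j\<in>J. pr (P j))"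
proof -
  have "{\<omega> \<in> space M. \<exists>j\<in>J. P j \<omega>} = (\<Union>j\<in>J. {\<omega> \<in> space M. P j \<omega>})" by auto
  moreover have "{\<omega> \<in> space M. P j \<omega>} \<in> sets M" if "j \<in> J" for j
    using assms(2)[OF that] dep_events by blast
  ultimately show ?thesis
    unfolding pr_def using assms(1) by (simp, intro M.finite_measure_subadditive_finite)
      (auto simp: image_subset_iff)
qed

lemma edges_nonempty: "edges T \<noteq> {}"
  using d_pos[of 0] card_children[OF rho_verts] childrenD(1)[of _ "rho T"] by fastforce

lemma indep_coordinates: "M.indep_vars edge_meas (\<lambda>v \<omega>. \<omega> v) (edges T)"
proof (subst M.indep_vars_iff_distr_eq_PiM')
  show "M.random_variable (edge_meas v) (\<lambda>\<omega>. \<omega> v)" if "v \<in> edges T" for v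
    using that unfolding M_eq by (rule measurable_component_singleton)
  have "distr M (PiM (edges T) edge_meas) (\<lambda>\<omega>. \<lambda>v\<in>edges T. \<omega> v) = distr M M (\<lambda>\<omega>. \<omega>)"
    unfolding M_eq by (intro distr_cong) (auto simp: space_PiM restrict_PiE)
  also have "\<dots> = PiM (edges T) edge_meas" by (simp add: distr_id[unfolded id_def] M_eq)
  also have "\<dots> = PiM (edges T) (\<lambda>v. distr M (edge_meas v) (\<lambda>\<omega>. \<omega> v))"
    unfolding M_eq by (intro PiM_cong refl) (simp add: edge_prod.PiM_component)
  finally show "distr M (PiM (edges T) edge_meas) (\<lambda>\<omega>. \<lambda>v\<in>edges T. \<omega> v)
      = PiM (edges T) (\<lambda>v. distr M (edge_meas v) (\<lambda>\<omega>. \<omega> v))" .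
qed (rule edges_nonempty)

text \<open>The coordinates are independent, hence so are their restrictions to the disjoint blocks
  \<open>S j\<close>, and each event is a preimage under its own block.\<close>

lemma pr_indep:
  assumes J: "finite J" "disjoint_family_on S J"
    and P: "\<And>j. j \<in> J \<Longrightarrow> S j \<subseteq> edges T" "\<And>j. j \<in> J \<Longrightarrow> dep (S j) (P j)"
  shows "pr (\<lambda>\<omega>. \<forall>j\<in>J. P j \<omega>) = (\<Prod>j\<in>J. pr (P j))"
proof (cases "J = {}")
  case True
  then show ?thesis by (simp add: pr_def M.prob_space)
next
  case False
  have ind: "M.indep_vars (\<lambda>j. PiM (S j) edge_meas) (\<lambda>j \<omega>. restrict (\<lambda>v. \<omega> v) (S j)) J"
    using M.indep_vars_restrict[OF indep_coordinates P(1) J(2)] .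
  let ?A = "\<lambda>j. {\<omega> \<in> space (PiM (S j) edge_meas). P j \<omega>}"
  have A: "?A j \<in> sets (PiM (S j) edge_meas)" if "j \<in> J" for j
    using P(2)[OF that] by (simp add: dep_def pred_def)
  have eq: "(\<lambda>\<omega>. restrict (\<lambda>v. \<omega> v) (S j)) -` ?A j \<inter> space M = {\<omega> \<in> space M. P j \<omega>}" if "j \<in> J" for j
    using P[OF that] unfolding M_eq by (auto simp: dep_def space_PiM PiE_iff extensional_def)
  have "pr (\<lambda>\<omega>. \<forall>j\<in>J. P j \<omega>) = measure M (\<Inter>j\<in>J. (\<lambda>\<omega>. restrict (\<lambda>v. \<omega> v) (S j)) -` ?A j \<inter> space M)"
    unfolding pr_def using False eq by (intro arg_cong[where f = "measure M"]) auto
  also have "\<dots> = (\<Prod>j\<in>J. measure M ((\<lambda>\<omega>. restrict (\<lambda>v. \<omega> v) (S j)) -` ?A j \<inter> space M))"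
    by (rule M.indep_varsD_finite[OF ind False J(1) A])
  also have "\<dots> = (\<Prod>j\<in>J. pr (P j))"
    using eq unfolding pr_def by (intro prod.cong) auto
  finally show ?thesis .
qed

lemma pr_indep2:
  assumes "dep A P" "dep B R" "A \<inter> B = {}" "A \<subseteq> edges T" "B \<subseteq> edges T"
  shows "pr (\<lambda>\<omega>. P \<omega> \<and> R \<omega>) = pr P * pr R"
proof -
  have "pr (\<lambda>\<omega>. \<forall>j\<in>UNIV. (if j then P else R) \<omega>) = (\<Prod>j\<in>UNIV. pr (if j then P else R))"
    using assms by (intro pr_indep[where S = "\<lambda>j. if j then A else B"])
      (auto simp: disjoint_family_on_def split: if_splits)
  moreover have "(\<forall>j\<in>UNIV. (if j then P else R) \<omega>) \<longleftrightarrow> P \<omega> \<and> R \<omega>" for \<omega>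
    unfolding UNIV_bool by auto
  ultimately show ?thesis by (simp only: UNIV_bool) (simp add: mult.commute)
qed

lemma pr_edge:
  assumes "v \<in> edges T" and \<phi>: "Measurable.pred (edge_meas v) \<phi>"
  shows "pr (\<lambda>\<omega>. \<phi> (\<omega> v)) = measure (edge_meas v) {e. \<phi> e}"
proof -
  have A: "{e. \<phi> e} \<in> sets (edge_meas v)" using \<phi> unfolding pred_def by simp
  have "measure (edge_meas v) {e. \<phi> e} = measure (distr M (edge_meas v) (\<lambda>\<omega>. \<omega> v)) {e. \<phi> e}"
    unfolding M_eq using assms(1) by (simp add: edge_prod.PiM_component)
  also have "\<dots> = measure M ((\<lambda>\<omega>. \<omega> v) -` {e. \<phi> e} \<inter> space M)"
    using A assms(1) unfolding M_eq by (intro measure_distr) (auto intro: measurable_component_singleton)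
  also have "(\<lambda>\<omega>. \<omega> v) -` {e. \<phi> e} \<inter> space M = {\<omega> \<in> space M. \<phi> (\<omega> v)}" by auto
  finally show ?thesis by (simp add: pr_def)
qed

lemma dep_open: "v \<in> S \<Longrightarrow> dep S (\<lambda>\<omega>. config_at T p \<omega> t v)"
  unfolding config_at_def by (rule dep_edge) measurable

lemma pr_open: "v \<in> edges T \<Longrightarrow> 0 \<le> t \<Longrightarrow> pr (\<lambda>\<omega>. config_at T p \<omega> t v) = p (level T v)"
  unfolding config_at_def
  using measure_edge_open[of "p (level T v)" t] p_pos[OF level_edges] p_less[OF level_edges]
  by (subst pr_edge) auto

text \<open>An edge is named by its lower endpoint, so removing \<open>v\<close> from the subtree
  removes the edge above \<open>v\<close>. This separates that edge from the connections below
  it.\<close>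

lemma dep_conn: "v \<in> verts T \<Longrightarrow> dep (subtree T v - {v}) (\<lambda>\<omega>. conn T m (config_at T p \<omega> t) v)"
proof (induction m arbitrary: v)
  case 0
  then show ?case by (simp add: dep_const)
next
  case (Suc m)
  show ?case
    unfolding conn.simps
  proof (intro dep_bex dep_conj finite_children Suc.prems)
    fix u assume u: "u \<in> children T v"
    show "dep (subtree T v - {v}) (\<lambda>\<omega>. config_at T p \<omega> t u)"
      using subtree_child_subset[OF u] subtree_refl[OF childrenD(2)[OF u]] by (intro dep_open) auto
    show "dep (subtree T v - {v}) (\<lambda>\<omega>. conn T m (config_at T p \<omega> t) u)"
      using subtree_child_subset[OF u] by (intro dep_mono[OF Suc.IH[OF childrenD(2)[OF u]]]) auto
  qed
qed

lemma dep_perc: "v \<in> verts T \<Longrightarrow> dep (subtree T v - {v}) (\<lambda>\<omega>. perc T (config_at T p \<omega> t) v)"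
  unfolding perc_def by (intro dep_all dep_conn)

lemma dep_open_conn:
  "v \<in> edges T \<Longrightarrow> dep (subtree T v) (\<lambda>\<omega>. config_at T p \<omega> t v \<and> conn T m (config_at T p \<omega> t) v)"
  using subtree_refl[OF edges_verts, of v]
  by (intro dep_conj dep_open dep_mono[OF dep_conn]) (auto simp: edges_verts)

lemma dep_open_perc:
  "v \<in> edges T \<Longrightarrow> dep (subtree T v) (\<lambda>\<omega>. config_at T p \<omega> t v \<and> perc T (config_at T p \<omega> t) v)"
  using subtree_refl[OF edges_verts, of v]
  by (intro dep_conj dep_open dep_mono[OF dep_perc]) (auto simp: edges_verts)

text \<open>The subtrees of the children, with the edges leading to them, are disjoint, so the
  failures of the children multiply.\<close>

lemma pr_conn: "v \<in> verts T \<Longrightarrow> 0 \<le> t \<Longrightarrow> pr (\<lambda>\<omega>. conn T m (config_at T p \<omega> t) v) = conn_prob d p m (level T v)"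
proof (induction m arbitrary: v)
  case 0
  then show ?case by (simp add: pr_def M.prob_space)
next
  case (Suc m)
  let ?P = "\<lambda>u \<omega>. config_at T p \<omega> t u \<and> conn T m (config_at T p \<omega> t) u"
  let ?x = "p (Suc (level T v)) * conn_prob d p m (Suc (level T v))"
  have P: "pr (?P u) = ?x" if u: "u \<in> children T v" for u
  proof -
    have "pr (?P u) = pr (\<lambda>\<omega>. config_at T p \<omega> t u) * pr (\<lambda>\<omega>. conn T m (config_at T p \<omega> t) u)"
      using childrenD[OF u] subtree_edges by (intro pr_indep2[where A = "{u}" and B
        = "subtree T u - {u}"] dep_open dep_conn) auto
    then show ?thesis
      using childrenD[OF u] Suc by (simp add: pr_open)
  qed
  have "pr (\<lambda>\<omega>. \<forall>u\<in>children T v. \<not> ?P u \<omega>) = (\<Prod>u\<in>children T v. pr (\<lambda>\<omega>. \<not> ?P u \<omega>))"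
    using Suc.prems subtree_edges' childrenD(1)[of _ v]
    by (intro pr_indep[where S = "subtree T"] finite_children disjoint_subtree_children dep_not
      dep_open_conn) auto
  also have "\<dots> = (\<Prod>u\<in>children T v. 1 - ?x)"
  proof (intro prod.cong refl)
    fix u assume u: "u \<in> children T v"
    note e = childrenD(1)[OF u]
    show "pr (\<lambda>\<omega>. \<not> ?P u \<omega>) = 1 - ?x"
      using pr_not[OF dep_open_conn[OF e] subtree_edges'[OF e], of t m] P[OF u] by simp
  qed
  also have "\<dots> = (1 - ?x) ^ d (level T v)" by (simp add: card_children Suc.prems)
  finally have *: "pr (\<lambda>\<omega>. \<not> conn T (Suc m) (config_at T p \<omega> t) v) = (1 - ?x) ^ d (level T v)" by simp
  then show ?case
    using pr_not[OF dep_conn[OF Suc.prems(1), of "Suc m" t] subtree_edges[OF Suc.prems(1)]] by simp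
qed

lemma pr_perc_limit:
  assumes v: "v \<in> verts T" and t: "0 \<le> t"
  shows "(\<lambda>m. conn_prob d p m (level T v)) \<longlonglongrightarrow> pr (\<lambda>\<omega>. perc T (config_at T p \<omega> t) v)"
proof -
  let ?A = "\<lambda>m. {\<omega> \<in> space M. conn T m (config_at T p \<omega> t) v}"
  have "(\<lambda>m. measure M (?A m)) \<longlonglongrightarrow> measure M (\<Inter>m. ?A m)"
    using dep_events[OF dep_conn[OF v] subtree_edges[OF v]]
    by (intro M.finite_Lim_measure_decseq) (auto simp: decseq_def intro: conn_antimono)
  also have "(\<Inter>m. ?A m) = {\<omega> \<in> space M. perc T (config_at T p \<omega> t) v}" by (auto simp: perc_def)
  finally show ?thesis using pr_conn[OF v t] by (simp add: pr_def)
qed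

lemma conn_prob_limit: "(\<lambda>m. conn_prob d p m k) \<longlonglongrightarrow> perc_prob d p k"
proof -
  obtain v where v: "v \<in> level_set T k" using level_set_nonempty by blast
  then have "convergent (\<lambda>m. conn_prob d p m k)"
    using pr_perc_limit[of v 0] by (auto simp: level_set_def convergent_def)
  then show ?thesis unfolding perc_prob_def by (rule convergent_LIMSEQ_iff[THEN iffD1])
qed

lemma pr_perc:
  "v \<in> verts T \<Longrightarrow> 0 \<le> t \<Longrightarrow> pr (\<lambda>\<omega>. perc T (config_at T p \<omega> t) v) = perc_prob d p (level T v)"
  using LIMSEQ_unique[OF pr_perc_limit conn_prob_limit] by blast

lemma perc_prob_bounds: "0 \<le> perc_prob d p k" "perc_prob d p k \<le> 1"
  using conn_prob_limit[of k] conn_prob_bounds[of _ k]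
  by (auto intro: LIMSEQ_le_const[OF conn_prob_limit] LIMSEQ_le_const2[OF conn_prob_limit] less_imp_le)

lemma perc_prob_rec: "perc_prob d p k = 1 - (1 - p (Suc k) * perc_prob d p (Suc k)) ^ d k"
proof (rule LIMSEQ_unique)
  show "(\<lambda>m. conn_prob d p (Suc m) k) \<longlonglongrightarrow> perc_prob d p k"
    using conn_prob_limit[of k] by (rule LIMSEQ_Suc)
  show "(\<lambda>m. conn_prob d p (Suc m) k) \<longlonglongrightarrow> 1 - (1 - p (Suc k) * perc_prob d p (Suc k)) ^ d k"
    unfolding conn_prob.simps by (intro tendsto_intros conn_prob_limit)
qed

lemma pr_open_conn: "v \<in> edges T \<Longrightarrow> 0 \<le> t \<Longrightarrow>
    pr (\<lambda>\<omega>. config_at T p \<omega> t v \<and> conn T m (config_at T p \<omega> t) v)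
      = p (level T v) * conn_prob d p m (level T v)"
  using subtree_edges[OF edges_verts]
  by (subst pr_indep2[where A = "{v}" and B = "subtree T v - {v}"])
    (auto intro: dep_open dep_conn[OF edges_verts] simp: pr_open pr_conn edges_verts)

lemma pr_open_perc: "v \<in> edges T \<Longrightarrow> 0 \<le> t \<Longrightarrow>
    pr (\<lambda>\<omega>. config_at T p \<omega> t v \<and> perc T (config_at T p \<omega> t) v) = p (level T v) * perc_prob d p (level T v)"
  using subtree_edges[OF edges_verts]
  by (subst pr_indep2[where A = "{v}" and B = "subtree T v - {v}"])
    (auto intro: dep_open dep_perc[OF edges_verts] simp: pr_open pr_perc edges_verts)

lemma pr_open_closed_le:
  assumes "v \<in> edges T" "0 \<le> t" "0 \<le> h"
  shows "pr (\<lambda>\<omega>. config_at T p \<omega> t v \<and> \<not> config_at T p \<omega> (t + h) v) \<le> p (level T v) * h"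
proof -
  let ?q = "p (level T v)"
  have q: "0 < ?q" "?q < 1" using p_pos[OF level_edges] p_less[OF level_edges] assms by auto
  have "pr (\<lambda>\<omega>. config_at T p \<omega> t v \<and> \<not> config_at T p \<omega> (t + h) v)
      = measure (edge_law ?q) {e. edge_open ?q e t \<and> \<not> edge_open ?q e (t + h)}"
    unfolding config_at_def by (rule pr_edge[OF assms(1)]) measurable
  also have "\<dots> = ?q * ((1 - ?q) * (1 - exp (- h)))"
    using measure_edge_open_closed[OF q, of t "t + h"] assms by simp
  also have "\<dots> \<le> ?q * (1 * h)"
    using q assms(3) exp_ge_add_one_self[of "- h"] by (intro mult_left_mono mult_mono) auto
  finally show ?thesis by simp
qed

end

section \<open>The rate at which the root is disconnected\<close>

text \<open>Inequality of the means for the powers of \<open>y\<close> with exponents below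
  \<open>n\<close>, whose geometric mean is \<open>y\<close> to the power
  \<open>(n - 1) / 2\<close>. With \<open>z = sqrt y\<close>, the exponents \<open>i\<close> and
  \<open>n - 1 - i\<close> are paired.\<close>

lemma power_am_gm:
  fixes y :: real
  assumes y: "0 \<le> y" "y \<le> 1"
  shows "(real n)\<^sup>2 * y ^ (n - 1) \<le> (\<Sum>i<n. y ^ i)\<^sup>2"
proof -
  define z where "z = sqrt y"
  have z: "0 \<le> z" "y = z\<^sup>2" using y by (auto simp: z_def)
  have "2 * (real n * z ^ (n - 1)) = (\<Sum>i<n. 2 * z ^ (n - 1))" by simp
  also have "\<dots> \<le> (\<Sum>i<n. y ^ i + y ^ (n - Suc i))"
  proof (rule sum_mono)
    fix i assume "i \<in> {..<n}"
    then have "z ^ (n - 1) = z ^ i * z ^ (n - Suc i)" by (simp add: power_add[symmetric])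
    then have "2 * z ^ (n - 1) \<le> (z ^ i)\<^sup>2 + (z ^ (n - Suc i))\<^sup>2"
      using sum_squares_bound[of "z ^ i" "z ^ (n - Suc i)"] by simp
    then show "2 * z ^ (n - 1) \<le> y ^ i + y ^ (n - Suc i)"
      unfolding z(2) by (simp add: power_mult[symmetric] mult.commute)
  qed
  also have "\<dots> = 2 * (\<Sum>i<n. y ^ i)"
    by (simp add: sum.distrib sum.nat_diff_reindex[of "\<lambda>i. y ^ i"])
  finally have "real n * z ^ (n - 1) \<le> (\<Sum>i<n. y ^ i)" by simp
  then have "(real n * z ^ (n - 1))\<^sup>2 \<le> (\<Sum>i<n. y ^ i)\<^sup>2"
    using z by (intro power_mono) auto
  then show ?thesis unfolding z(2) by (simp add: power_mult_distrib power_mult[symmetric] mult.commute)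
qed

lemma one_minus_power_eq: "1 - (1 - x) ^ n = x * (\<Sum>i<n. (1 - x :: real) ^ i)"
  using one_diff_power_eq[of "1 - x" n] by simp

text \<open>For \<open>f x = 1 - (1 - x) ^ n\<close> this reads
  \<open>n * x\<^sup>2 * f' x \<le> (f x)\<^sup>2\<close>. It absorbs the derivative that appears
  when a single child is responsible for the loss of connection.\<close>

lemma power_derivative_le:
  fixes x :: real
  assumes "0 \<le> x" "x \<le> 1"
  shows "(1 - x) ^ (n - 1) * (real n * x)\<^sup>2 \<le> (1 - (1 - x) ^ n)\<^sup>2"
proof -
  have "(1 - x) ^ (n - 1) * (real n * x)\<^sup>2 = x\<^sup>2 * ((real n)\<^sup>2 * (1 - x) ^ (n - 1))"
    by (simp add: power_mult_distrib)
  also have "\<dots> \<le> x\<^sup>2 * (\<Sum>i<n. (1 - x) ^ i)\<^sup>2"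
    using assms by (intro mult_left_mono power_am_gm) auto
  finally show ?thesis unfolding one_minus_power_eq by (simp add: power_mult_distrib)
qed

text \<open>By Bernoulli,
  \<open>(1 - x) ^ n * (1 + n * x) \<le> (1 - x\<^sup>2) ^ n \<le> 1\<close>. It makes the recursion
  for the connection probabilities additive in their inverses.\<close>

lemma inverse_one_minus_power_le:
  fixes x :: real
  assumes x: "0 < x" "x \<le> 1" and n: "1 \<le> n"
  shows "1 / (1 - (1 - x) ^ n) \<le> 1 + 1 / (real n * x)"
proof -
  have "(1 - x) ^ n * (1 + real n * x) \<le> (1 - x) ^ n * (1 + x) ^ n"
    using x Bernoulli_inequality[of x n] by (intro mult_left_mono) (auto simp: mult.commute)
  also have "\<dots> = (1 - x\<^sup>2) ^ n" by (simp add: power_mult_distrib[symmetric] algebra_simps power2_eq_square)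
  also have "\<dots> \<le> 1" using x by (intro power_le_one) (auto simp: power_le_one)
  finally have le: "(1 - x) ^ n * (1 + real n * x) \<le> 1" .
  have nx: "0 < real n * x" using x n by simp
  have "(1 - x) ^ n \<le> (1 - x) ^ 1" using x n by (intro power_decreasing) auto
  then have "0 < 1 - (1 - x) ^ n" using x by simp
  then show ?thesis using le nx by (simp add: field_simps)
qed

text \<open>The interchange that produces the weight \<open>k\<close> in the hypothesis on
  \<open>k / w\<^sub>k\<close>.\<close>

lemma sum_tails_eq: "(\<Sum>j=1..n. \<Sum>i=j..n. a i) = (\<Sum>i=1..n. real i * a i)"
proof (induction n)
  case (Suc n)
  have "(\<Sum>j=1..Suc n. \<Sum>i=j..Suc n. a i) = (\<Sum>j=1..Suc n. (\<Sum>i=j..n. a i) + a (Suc n))"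
    by (intro sum.cong refl) simp
  also have "\<dots> = (\<Sum>j=1..Suc n. \<Sum>i=j..n. a i) + real (Suc n) * a (Suc n)"
    by (simp add: sum.distrib del: sum.cl_ivl_Suc)
  also have "(\<Sum>j=1..Suc n. \<Sum>i=j..n. a i) = (\<Sum>j=1..n. \<Sum>i=j..n. a i)" by simp
  finally show ?case using Suc by simp
qed simp

context spherical_percolation
begin

lemma inverse_conn_prob_le: "1 / (w k * conn_prob d p m k) \<le> (\<Sum>j=k..k+m. 1 / w j)"
proof (induction m arbitrary: k)
  case (Suc m)
  let ?Q = "conn_prob d p m (Suc k)"
  have Q: "0 < ?Q" "?Q \<le> 1" using conn_prob_bounds by auto
  have pk: "0 < p (Suc k)" "p (Suc k) < 1" using p_pos p_less by auto
  have "1 / conn_prob d p (Suc m) k \<le> 1 + 1 / (real (d k) * (p (Suc k) * ?Q))"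
    unfolding conn_prob.simps using Q pk d_pos mult_le_one[of "p (Suc k)" ?Q]
    by (intro inverse_one_minus_power_le) auto
  then have "1 / w k * (1 / conn_prob d p (Suc m) k) \<le> 1 / w k * (1 + 1 / (real (d k) * (p (Suc k) * ?Q)))"
    using w_pos[of k] by (intro mult_left_mono) auto
  also have "\<dots> = 1 / w k + 1 / (w (Suc k) * ?Q)"
    by (simp add: w_Suc algebra_simps)
  also have "\<dots> \<le> 1 / w k + (\<Sum>j=Suc k..Suc k+m. 1 / w j)" by (intro add_left_mono Suc.IH)
  also have "\<dots> = (\<Sum>j=k..k+Suc m. 1 / w j)" using sum.atLeast_Suc_atMost[of k "k + Suc m" "\<lambda>j. 1 / w j"]
    by simp
  finally show ?case by simp
qed simp

text \<open>Either the connection below \<open>u\<close> is lost (\<open>A\<close>) or the edge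
  above \<open>u\<close> closes (\<open>B\<close>). In both cases the edge and the subtree below it
  are independent; in \<open>B\<close> only the connection at time \<open>t\<close> is kept.\<close>

lemma pr_succ_then_fail_le:
  assumes u: "u \<in> edges T" and t: "0 \<le> t" "0 \<le> h"
  defines "c \<equiv> \<lambda>t \<omega>. config_at T p \<omega> t"
  shows "pr (\<lambda>\<omega>. (c t \<omega> u \<and> conn T m (c t \<omega>) u) \<and> \<not> (c (t + h) \<omega> u \<and> conn T m (c (t + h) \<omega>) u))
    \<le> p (level T u) * (pr (\<lambda>\<omega>. conn T m (c t \<omega>) u \<and> \<not> conn T m (c (t + h) \<omega>) u) + h * conn_prob d p m
      (level T u))"
proof -
  note v = edges_verts[OF u]
  let ?D = "subtree T u - {u}"
  have sub: "{u} \<subseteq> edges T" "?D \<subseteq> edges T" "subtree T u \<subseteq> edges T" "{u} \<inter> ?D = {}"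
    using u subtree_edges[OF v] subtree_edges'[OF u] by auto
  define A where "A \<omega> \<longleftrightarrow> c t \<omega> u \<and> (conn T m (c t \<omega>) u \<and> \<not> conn T m (c (t + h) \<omega>) u)" for \<omega>
  define B where "B \<omega> \<longleftrightarrow> (c t \<omega> u \<and> \<not> c (t + h) \<omega> u) \<and> conn T m (c t \<omega>) u" for \<omega>
  have u': "{u} \<subseteq> subtree T u" using subtree_refl[OF v] by simp
  have dD: "dep ?D (\<lambda>\<omega>. conn T m (c t \<omega>) u \<and> \<not> conn T m (c (t + h) \<omega>) u)"
    unfolding c_def by (intro dep_conj dep_not dep_conn v)
  have d1: "dep {u} (\<lambda>\<omega>. c t \<omega> u \<and> \<not> c (t + h) \<omega> u)"
    unfolding c_def by (intro dep_conj dep_not dep_open) auto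
  have dA: "dep (subtree T u) A" unfolding A_def[abs_def]
    by (intro dep_conj[OF dep_mono[OF _ u'] dep_mono[OF dD]]) (auto simp: c_def intro: dep_open)
  have dB: "dep (subtree T u) B" unfolding B_def[abs_def]
  proof (rule dep_conj[OF dep_mono[OF d1 u']])
    show "dep (subtree T u) (\<lambda>\<omega>. conn T m (c t \<omega>) u)"
      unfolding c_def by (rule dep_mono[OF dep_conn[OF v]]) auto
  qed
  have "pr (\<lambda>\<omega>. (c t \<omega> u \<and> conn T m (c t \<omega>) u) \<and> \<not> (c (t + h) \<omega> u \<and> conn T m (c (t + h) \<omega>) u))
      \<le> pr (\<lambda>\<omega>. \<exists>j\<in>UNIV. (if j then A else B) \<omega>)"
  proof (rule pr_mono)
    show "dep (subtree T u) (\<lambda>\<omega>. \<exists>j\<in>UNIV. (if j then A else B) \<omega>)"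
      using dA dB by (intro dep_bex) auto
  qed (use sub in \<open>auto simp: A_def B_def UNIV_bool\<close>)
  also have "\<dots> \<le> (\<Sum>j\<in>UNIV. pr (if j then A else B))"
    using dA dB sub by (intro pr_bex_le[where S = "\<lambda>_. subtree T u"]) auto
  also have "\<dots> = pr A + pr B" by (simp add: UNIV_bool)
  also have "pr A = p (level T u) * pr (\<lambda>\<omega>. conn T m (c t \<omega>) u \<and> \<not> conn T m (c (t + h) \<omega>) u)"
    unfolding A_def[abs_def] using sub pr_open[OF u t(1)]
    by (subst pr_indep2[OF _ dD, of "{u}"]) (auto simp: c_def intro: dep_open)
  also have "pr B \<le> p (level T u) * h * conn_prob d p m (level T u)"
  proof -
    have "pr B = pr (\<lambda>\<omega>. c t \<omega> u \<and> \<not> c (t + h) \<omega> u) * conn_prob d p m (level T u)"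
      unfolding B_def[abs_def] using sub pr_conn[OF v t(1)]
      by (subst pr_indep2[OF d1, of ?D]) (auto simp: c_def intro: dep_conn v)
    also have "\<dots> \<le> p (level T u) * h * conn_prob d p m (level T u)"
      using pr_open_closed_le[OF u t] conn_prob_bounds[of m "level T u"]
      by (intro mult_right_mono) (auto simp: c_def)
    finally show ?thesis .
  qed
  finally show ?thesis by (simp add: algebra_simps)
qed

text \<open>If the connection is lost, some child \<open>u\<close> that served at \<open>t\<close>
  fails at \<open>t + h\<close>, and so do all other children at \<open>t + h\<close>. A union bound
  over \<open>u\<close> yields \<open>d * (1 - x) ^ (d - 1)\<close>, the derivative of
  \<open>1 - (1 - x) ^ d\<close>, times the bound for one branch.\<close>

lemma pr_conn_then_fail_le:
  assumes v: "v \<in> verts T" and t: "0 \<le> t" "0 \<le> h"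
  shows "pr (\<lambda>\<omega>. conn T m (config_at T p \<omega> t) v \<and> \<not> conn T m (config_at T p \<omega> (t + h)) v)
    \<le> w (level T v) * (conn_prob d p m (level T v))\<^sup>2 * h
       * (\<Sum>j=1..m. 1 / (w (level T v + j) * conn_prob d p (m - j) (level T v + j)))"
  using v
proof (induction m arbitrary: v)
  case 0
  then show ?case by (simp add: pr_def)
next
  case (Suc m)
  define k where "k = level T v"
  define Q where "Q = conn_prob d p m (Suc k)"
  define Q' where "Q' = conn_prob d p (Suc m) k"
  define x where "x = p (Suc k) * Q"
  define S where "S = (\<Sum>j=1..m. 1 / (w (Suc k + j) * conn_prob d p (m - j) (Suc k + j)))"
  define s where "s t u \<omega> \<longleftrightarrow> config_at T p \<omega> t u \<and> conn T m (config_at T p \<omega> t) u" for t u \<omega>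
  let ?C = "children T v"
  have Q: "0 < Q" "Q \<le> 1" "0 < Q'" using conn_prob_bounds[of m "Suc k"] conn_prob_bounds[of "Suc m" k]
    by (auto simp: Q_def Q'_def)
  have pk: "0 < p (Suc k)" "p (Suc k) < 1" using p_pos p_less by auto
  have x: "0 < x" "x \<le> 1" using pk Q by (auto simp: x_def intro: mult_le_one)
  have th: "0 \<le> t + h" using t by simp
  have lev: "level T u = Suc k" if "u \<in> ?C" for u using childrenD(4)[OF that] by (simp add: k_def)
  have ds: "dep (subtree T u) (s t u)" if "u \<in> ?C" for u t
    unfolding s_def[abs_def] using childrenD(1)[OF that] by (rule dep_open_conn)
  have sub: "subtree T u \<subseteq> edges T" if "u \<in> ?C" for u using subtree_edges'[OF childrenD(1)[OF that]] .
  have ps: "pr (s (t + h) u) = x" if "u \<in> ?C" for u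
    unfolding s_def[abs_def] using pr_open_conn[OF childrenD(1)[OF that] th] lev[OF that]
      by (simp add: x_def Q_def)
  define E where "E = p (Suc k) * (w (Suc k) * Q\<^sup>2 * h * S + h * Q)"
  have pe: "pr (\<lambda>\<omega>. s t u \<omega> \<and> \<not> s (t + h) u \<omega>) \<le> E" if u: "u \<in> ?C" for u
  proof -
    have "pr (\<lambda>\<omega>. s t u \<omega> \<and> \<not> s (t + h) u \<omega>)
      \<le> p (level T u) * (pr (\<lambda>\<omega>. conn T m (config_at T p \<omega> t) u \<and> \<not> conn T m (config_at T p \<omega> (t + h)) u)
          + h * conn_prob d p m (level T u))"
      unfolding s_def by (rule pr_succ_then_fail_le[OF childrenD(1)[OF u] t])
    also have "\<dots> \<le> E"
      using Suc.IH[OF childrenD(2)[OF u]] pk t unfolding E_def lev[OF u] Q_def S_def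
      by (intro mult_left_mono add_mono) auto
    finally show ?thesis .
  qed
  let ?R = "\<lambda>u \<omega>. (s t u \<omega> \<and> \<not> s (t + h) u \<omega>) \<and> (\<forall>u'\<in>?C - {u}. \<not> s (t + h) u' \<omega>)"
  have tm: "pr (?R u) \<le> E * (1 - x) ^ (d k - 1)" if u: "u \<in> ?C" for u
  proof -
    have "?R u = (\<lambda>\<omega>. \<forall>u'\<in>?C. if u' = u then s t u \<omega> \<and> \<not> s (t + h) u \<omega> else \<not> s (t + h) u' \<omega>)"
      using u by (auto simp: fun_eq_iff)
    then have "pr (?R u) = pr (\<lambda>\<omega>. \<forall>u'\<in>?C. (if u' = u then (\<lambda>\<omega>. s t u \<omega>
      \<and> \<not> s (t + h) u \<omega>) else (\<lambda>\<omega>. \<not> s (t + h) u' \<omega>)) \<omega>)"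
      by (simp add: if_distrib cong: if_cong)
    also have "\<dots> = (\<Prod>u'\<in>?C. pr (if u' = u then (\<lambda>\<omega>. s t u \<omega> \<and> \<not> s (t + h) u \<omega>) else (\<lambda>\<omega>. \<not> s (t + h) u' \<omega>)))"
      by (rule pr_indep[OF finite_children[OF Suc.prems] disjoint_subtree_children sub])
        (auto intro!: dep_conj dep_not ds)
    also have "\<dots> = pr (\<lambda>\<omega>. s t u \<omega> \<and> \<not> s (t + h) u \<omega>) * (\<Prod>u'\<in>?C - {u}. 1 - x)"
      using u finite_children[OF Suc.prems] pr_not[OF ds sub] ps
      by (subst prod.remove[of _ u]) (auto intro!: prod.cong)
    also have "\<dots> = pr (\<lambda>\<omega>. s t u \<omega> \<and> \<not> s (t + h) u \<omega>) * (1 - x) ^ (d k - 1)"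
      using u finite_children[OF Suc.prems] card_children[OF Suc.prems] by (simp add: k_def)
    also have "\<dots> \<le> E * (1 - x) ^ (d k - 1)"
      using pe[OF u] x by (intro mult_right_mono) auto
    finally show ?thesis .
  qed
  have dR: "dep (edges T) (?R u)" if u: "u \<in> ?C" for u
    using u finite_children[OF Suc.prems] sub
    by (intro dep_conj dep_not dep_ball) (auto intro: dep_mono[OF ds])
  have "pr (\<lambda>\<omega>. conn T (Suc m) (config_at T p \<omega> t) v \<and> \<not> conn T (Suc m) (config_at T p \<omega> (t + h)) v)
      \<le> pr (\<lambda>\<omega>. \<exists>u\<in>?C. ?R u \<omega>)"
    using dR by (intro pr_mono[where S = "edges T"] dep_bex finite_children Suc.prems) (auto simp: s_def)
  also have "\<dots> \<le> (\<Sum>u\<in>?C. pr (?R u))"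
    using dR by (intro pr_bex_le[where S = "\<lambda>_. edges T"] finite_children Suc.prems) auto
  also have "\<dots> \<le> (\<Sum>u\<in>?C. E * (1 - x) ^ (d k - 1))" by (intro sum_mono tm)
  also have "\<dots> = real (d k) * (E * (1 - x) ^ (d k - 1))"
    using card_children[OF Suc.prems] by (simp add: k_def)
  also have "\<dots> \<le> w k * Q'\<^sup>2 * h * (S + 1 / (w (Suc k) * Q))"
  proof -
    have S0: "0 \<le> S" unfolding S_def
      using w_pos conn_prob_bounds by (intro sum_nonneg) (simp add: less_imp_le)
    have dk: "0 < real (d k)" using d_pos[of k] by simp
    \<comment> \<open>After this factorisation
      \<open>d k * p (Suc k) * w (Suc k) * Q\<^sup>2\<close> equals
      \<open>w k * (d k * x)\<^sup>2\<close>, the form to which \<open>power_derivative_le\<close>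
      applies.\<close>
    have E_eq: "E = (p (Suc k) * w (Suc k) * Q\<^sup>2) * (h * (S + 1 / (w (Suc k) * Q)))"
      using Q w_pos[of "Suc k"] by (simp add: E_def field_simps power2_eq_square)
    have am: "(1 - x) ^ (d k - 1) * (real (d k) * x)\<^sup>2 \<le> Q'\<^sup>2"
      using power_derivative_le[of x "d k"] x by (simp add: Q'_def x_def Q_def)
    have "real (d k) * (E * (1 - x) ^ (d k - 1))
      = w k * ((1 - x) ^ (d k - 1) * (real (d k) * x)\<^sup>2) * h * (S + 1 / (w (Suc k) * Q))"
      unfolding E_eq x_def w_Suc by (simp only: power2_eq_square) (simp only: mult_ac)
    also have "\<dots> \<le> w k * Q'\<^sup>2 * h * (S + 1 / (w (Suc k) * Q))"
      using am S0 t w_pos[of k] w_pos[of "Suc k"] Q by (intro mult_right_mono mult_left_mono)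
        (auto simp: less_imp_le)
    finally show ?thesis .
  qed
  also have "S + 1 / (w (Suc k) * Q) = (\<Sum>j=1..Suc m. 1 / (w (k + j) * conn_prob d p (Suc m - j) (k + j)))"
  proof -
    have "(\<Sum>j=1..Suc m. 1 / (w (k + j) * conn_prob d p (Suc m - j) (k + j)))
      = 1 / (w (Suc k) * Q) + (\<Sum>j=Suc 1..Suc m. 1 / (w (k + j) * conn_prob d p (Suc m - j) (k + j)))"
      by (subst sum.atLeast_Suc_atMost) (auto simp: Q_def)
    also have "(\<Sum>j=Suc 1..Suc m. 1 / (w (k + j) * conn_prob d p (Suc m - j) (k + j))) = S"
      unfolding S_def by (subst sum.shift_bounds_cl_Suc_ivl) simp
    finally show ?thesis by simp
  qed
  finally show ?case by (simp add: k_def Q'_def)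
qed

lemma pr_root_conn_then_fail_le:
  assumes sum: "summable (\<lambda>k. real (Suc k) * inverse (w (Suc k)))" and t: "0 \<le> t" "0 \<le> h"
  shows "pr (\<lambda>\<omega>. conn T n (config_at T p \<omega> t) (rho T) \<and> \<not> conn T n (config_at T p \<omega> (t + h)) (rho T))
    \<le> h * (\<Sum>k. real (Suc k) * inverse (w (Suc k)))"
proof -
  let ?S = "\<Sum>j=1..n. 1 / (w j * conn_prob d p (n - j) j)"
  have S0: "0 \<le> ?S" using w_pos conn_prob_bounds by (intro sum_nonneg) (simp add: less_imp_le)
  have "pr (\<lambda>\<omega>. conn T n (config_at T p \<omega> t) (rho T) \<and> \<not> conn T n (config_at T p \<omega> (t + h)) (rho T))
      \<le> (conn_prob d p n 0)\<^sup>2 * h * ?S"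
    using pr_conn_then_fail_le[OF rho_verts t, of n] by (simp add: w_0)
  also have "\<dots> \<le> 1 * h * ?S"
    using conn_prob_bounds[of n 0] t S0 by (intro mult_right_mono) (auto intro!: power_le_one)
  also have "?S \<le> (\<Sum>j=1..n. \<Sum>i=j..n. 1 / w i)"
  proof (rule sum_mono)
    fix j assume "j \<in> {1..n}"
    then show "1 / (w j * conn_prob d p (n - j) j) \<le> (\<Sum>i=j..n. 1 / w i)"
      using inverse_conn_prob_le[of j "n - j"] by simp
  qed
  also have "\<dots> = (\<Sum>i=1..n. real i * (1 / w i))" by (rule sum_tails_eq)
  also have "\<dots> = (\<Sum>k<n. real (Suc k) * inverse (w (Suc k)))"
    by (rule sum.reindex_bij_witness[of _ Suc "\<lambda>i. i - 1"]) (auto simp: divide_inverse)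
  also have "\<dots> \<le> (\<Sum>k. real (Suc k) * inverse (w (Suc k)))"
    using w_pos by (intro sum_le_suminf sum) (auto simp: less_imp_le)
  finally show ?thesis using t by (simp add: mult_left_mono)
qed

end

section \<open>Components of closed sets of times\<close>

text \<open>Each round visits \<open>K\<close> and is then absent at the time \<open>r\<close>.
  Rational separators make the quantifier countable, hence \<open>sep\<close> measurable in the
  randomness, and the bound by 1 keeps them in the time window.\<close>

primrec sep :: "real set \<Rightarrow> nat \<Rightarrow> real \<Rightarrow> bool" where
  "sep K 0 a = True"
| "sep K (Suc m) a = (\<exists>r::rat. a < of_rat r \<and> of_rat r \<le> (1::real) \<and> of_rat r \<notin> K
  \<and> K \<inter> {a..of_rat r} \<noteq> {} \<and> sep K m (of_rat r))"

text \<open>The component containing the visit of the first round cannot pass \<open>r\<close>, so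
  it is counted from \<open>a\<close> on but not from \<open>r\<close> on.\<close>

lemma sep_imp_card_components:
  assumes "finite (components K)" "sep K m a"
  shows "m \<le> card {C \<in> components K. C \<inter> {a..} \<noteq> {}}"
  using assms(2)
proof (induction m arbitrary: a)
  case (Suc m)
  then obtain r :: rat and s where r: "a < of_rat r" "of_rat r \<notin> K" "sep K m (of_rat r)"
    and s: "s \<in> K" "a \<le> s" "s \<le> of_rat r" by auto
  let ?S = "\<lambda>a. {C \<in> components K. C \<inter> {a..} \<noteq> {}}"
  let ?C = "connected_component_set K s"
  have C: "?C \<in> components K" "s \<in> ?C" using s by (auto simp: components_def)
  have "?C \<inter> {of_rat r..} = {}"
  proof (rule ccontr)
    assume "?C \<inter> {of_rat r..} \<noteq> {}"
    then obtain y where y: "y \<in> ?C" "of_rat r \<le> y" by auto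
    have "{s..y} \<subseteq> ?C" using C y by (intro connected_contains_Icc) auto
    then have "of_rat r \<in> ?C" using s y by auto
    then show False using r(2) in_components_subset[OF C(1)] by blast
  qed
  then have "?C \<notin> ?S (of_rat r)" by auto
  moreover have "s \<in> ?C \<inter> {a..}" using C(2) s(2) by simp
  then have "?C \<in> ?S a" using C(1) by blast
  moreover have "?S (of_rat r) \<subseteq> ?S a" using r(1) by force
  ultimately have "?S (of_rat r) \<subset> ?S a" by blast
  then have "card (?S (of_rat r)) < card (?S a)" using assms(1) by (intro psubset_card_mono) auto
  then show ?case using Suc.IH[OF r(3)] by simp
qed simp

text \<open>Between the two smallest points the complement of \<open>K\<close> contains an open
  interval, hence a rational separator. The last point may have no separator to its right, as
  \<open>K\<close> may contain 1; so \<open>m + 1\<close> points give \<open>m\<close>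
  rounds.\<close>

lemma sep_of_points:
  assumes K: "closed K" "K \<subseteq> {..1}"
    and "finite S" "card S = Suc m" "S \<subseteq> K \<inter> {a..}"
    and "\<And>x y. x \<in> S \<Longrightarrow> y \<in> S \<Longrightarrow> x < y \<Longrightarrow> \<not> {x..y} \<subseteq> K"
  shows "sep K m a"
  using assms(3-)
proof (induction m arbitrary: S a)
  case (Suc m)
  define s where "s = Min S"
  have S: "S \<noteq> {}" using Suc.prems by auto
  have s: "s \<in> S" "\<And>x. x \<in> S \<Longrightarrow> s \<le> x" using Suc.prems(1) S by (auto simp: s_def)
  define S' where "S' = S - {s}"
  have card': "card S' = Suc m" using Suc.prems(1,2) s by (simp add: S'_def)
  have S': "finite S'" "S' \<noteq> {}" using Suc.prems(1) card' by (simp add: S'_def) (use card' in auto)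
  define s' where "s' = Min S'"
  have s': "s' \<in> S'" "\<And>x. x \<in> S' \<Longrightarrow> s' \<le> x" using S' by (auto simp: s'_def)
  have less: "s < s'" using s s' by (force simp: S'_def)
  have "s' \<in> S" using s'(1) by (simp add: S'_def)
  then have "\<not> {s..s'} \<subseteq> K" using Suc.prems(4)[OF s(1) _ less] by blast
  then obtain z where z: "z \<in> {s..s'}" "z \<notin> K" by blast
  have "s \<in> K" "s' \<in> K" "a \<le> s" using Suc.prems(3) s s' by (auto simp: S'_def)
  then have "z \<in> {s<..<s'} \<inter> - K" using z by (force simp: less_le)
  moreover have "open ({s<..<s'} \<inter> - K)" using K(1) by auto
  ultimately obtain e where e: "0 < e" "ball z e \<subseteq> {s<..<s'} \<inter> - K"
    by (auto elim: openE)
  obtain r where r: "z < of_rat r" "of_rat r < z + e" using of_rat_dense[of z "z + e"] e by auto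
  then have "of_rat r \<in> ball z e" by (auto simp: dist_real_def)
  then have r': "s < of_rat r" "of_rat r < s'" "of_rat r \<notin> K" using e(2) by auto
  have "sep K m (of_rat r)"
  proof (rule Suc.IH[OF S'(1) card'])
    show "S' \<subseteq> K \<inter> {of_rat r..}" using Suc.prems(3) s'(2) r'(2) by (force simp: S'_def)
    show "\<And>x y. x \<in> S' \<Longrightarrow> y \<in> S' \<Longrightarrow> x < y \<Longrightarrow> \<not> {x..y} \<subseteq> K" using Suc.prems(4) by (auto simp: S'_def)
  qed
  moreover have "s' \<le> 1" using \<open>s' \<in> K\<close> K(2) by auto
  then have "of_rat r \<le> (1::real)" by (rule order.trans[OF less_imp_le[OF r'(2)]])
  moreover have "s \<in> K \<inter> {a..of_rat r}" using \<open>s \<in> K\<close> \<open>a \<le> s\<close> r' by auto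
  ultimately show ?case using r' \<open>a \<le> s\<close> by (auto intro!: exI[of _ r])
qed simp

lemma infinite_components_iff_sep:
  assumes K: "closed K" "K \<subseteq> {0..1}"
  shows "infinite (components K) \<longleftrightarrow> (\<forall>m. sep K m 0)"
proof
  assume "\<forall>m. sep K m 0"
  then have "Suc (card (components K)) \<le> card (components K)" if fin: "finite (components K)"
    using order.trans[OF sep_imp_card_components[OF fin] card_mono[OF fin, of "{C \<in> components K. C \<inter>
      {0..} \<noteq> {}}"]]
    by auto
  then show "infinite (components K)" by auto
next
  assume inf: "infinite (components K)"
  show "\<forall>m. sep K m 0"
  proof
    fix m
    obtain B where B: "finite B" "card B = Suc m" "B \<subseteq> components K"
      using infinite_arbitrarily_large[OF inf] by blast
    have "\<forall>C\<in>B. \<exists>x. x \<in> C" using B(3) in_components_nonempty by blast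
    then obtain f where f: "\<And>C. C \<in> B \<Longrightarrow> f C \<in> C" by metis
    have inj: "inj_on f B"
    proof (rule inj_onI)
      fix C C' assume "C \<in> B" "C' \<in> B" "f C = f C'"
      then show "C = C'" using f components_eq[of C K C'] B(3) by (metis IntI emptyE subsetD)
    qed
    show "sep K m 0"
    proof (rule sep_of_points[where S = "f ` B"])
      show "card (f ` B) = Suc m" using inj B by (simp add: card_image)
      have "f C \<in> K" if "C \<in> B" for C using f[OF that] in_components_subset[of C K] that B(3) by blast
      then show "f ` B \<subseteq> K \<inter> {0..}" using K(2) by (fastforce simp: subset_iff)
      fix x y assume "x \<in> f ` B" "y \<in> f ` B" and less: "x < y"
      then obtain C C' where C: "C \<in> B" "C' \<in> B" "x = f C" "y = f C'" by auto
      show "\<not> {x..y} \<subseteq> K"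
      proof
        assume "{x..y} \<subseteq> K"
        then have "{x..y} \<subseteq> C"
          using C f[of C] less B(3) by (intro components_maximal[of C K]) auto
        then have "y \<in> C \<inter> C'" using f[OF C(2)] C(4) less by auto
        then have "C = C'" using components_eq[of C K C'] C B(3) by auto
        then show False using C less by simp
      qed
    qed (use K B in auto)
  qed
qed

text \<open>Grid points are rational, so the right end of a downcrossing cell is itself a separator.
  This direction is insensitive to what happens inside the cells.\<close>

lemma sep_of_downcrossings:
  assumes N: "0 < N" and "0 \<le> a"
    and "m \<le> card {i. i < N \<and> a \<le> real i / real N \<and> real i / real N \<in> K \<and> real (Suc i) / real N \<notin> K}"
  shows "sep K m a"
  using assms(2-)
proof (induction m arbitrary: a)
  case (Suc m)
  let ?D = "\<lambda>a. {i. i < N \<and> a \<le> real i / real N \<and> real i / real N \<in> K \<and> real (Suc i) / real N \<notin> K}"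
  have fin: "finite (?D a)" for a by auto
  define i where "i = Min (?D a)"
  have "0 < card (?D a)" using Suc.prems(2) by linarith
  then have ne: "?D a \<noteq> {}" using card_gt_0_iff by blast
  have i: "i \<in> ?D a" "\<And>j. j \<in> ?D a \<Longrightarrow> i \<le> j"
    unfolding i_def by (rule Min_in[OF fin ne]) (rule Min_le[OF fin])
  define r :: rat where "r = of_nat (Suc i) / of_nat N"
  have r: "(of_rat r :: real) = real (Suc i) / real N" unfolding r_def
    by (simp only: of_rat_divide of_rat_of_nat_eq)
  have "?D a - {i} \<subseteq> ?D (of_rat r)"
  proof
    fix j assume j: "j \<in> ?D a - {i}"
    then have "Suc i \<le> j" using i(2)[of j] by auto
    then have "real (Suc i) / real N \<le> real j / real N" by (intro divide_right_mono) auto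
    then show "j \<in> ?D (of_rat r)" using j by (simp add: r)
  qed
  then have "card (?D a - {i}) \<le> card (?D (of_rat r))" by (intro card_mono fin)
  then have "m \<le> card (?D (of_rat r))" using Suc.prems i(1) fin[of a] by simp
  then have "sep K m (of_rat r)" by (intro Suc.IH) (auto simp: r)
  moreover have "real i / real N \<in> K \<inter> {a..of_rat r}" using i(1) N by (auto simp: r divide_right_mono)
  moreover have "a < of_rat r"
  proof -
    have "a \<le> real i / real N" using i by simp
    also have "\<dots> < real (Suc i) / real N" using N by (intro divide_strict_right_mono) auto
    finally show ?thesis by (simp add: r)
  qed
  moreover have "of_rat r \<le> (1::real)" using i(1) N unfolding r by (simp add: divide_le_eq)
  moreover have "of_rat r \<notin> K" using i(1) unfolding r by simp
  ultimately show ?case unfolding sep.simps by blast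
qed simp

text \<open>Converse direction, for approximations \<open>F n\<close> decreasing to the set. The
  multiple \<open>J\<close> puts the finitely many separators on the grid, \<open>n0\<close> is so
  large that \<open>F n\<close> already misses them, and the condition on cells moves each visit to
  a grid point.\<close>

lemma downcrossings_of_sep:
  fixes F :: "nat \<Rightarrow> real set"
  assumes dec: "\<And>n m. n \<le> m \<Longrightarrow> F m \<subseteq> F n"
    and "sep (\<Inter>n. F n) m a" "0 \<le> a"
  shows "\<exists>J n0. 0 < J \<and> (\<forall>n\<ge>n0. \<forall>N>0. J dvd N \<and> a * real N \<in> \<nat> \<and>
      (\<forall>i<N. \<forall>s\<in>{real i / real N..real (Suc i) / real N}. s \<in> F n \<longrightarrow> real i / real N \<in> F n
        \<or> real (Suc i) / real N \<in> F n)
      \<longrightarrow> m \<le> card {i. i < N \<and> a \<le> real i / real N \<and> real i / real N \<in> F n \<and> real (Suc i) / real N \<notin> F n})"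
  using assms(2-)
proof (induction m arbitrary: a)
  case 0
  show ?case by (rule exI[of _ 1]) auto
next
  case (Suc m)
  define good where "good n N \<longleftrightarrow> (\<forall>i<N. \<forall>s\<in>{real i / real N..real (Suc i) / real N}. s \<in> F n
    \<longrightarrow> real i / real N \<in> F n \<or> real (Suc i) / real N \<in> F n)" for n N :: nat
  let ?D = "\<lambda>n N a. {i. i < N \<and> a \<le> real i / real N \<and> real i / real N \<in> F n \<and> real (Suc i) / real N \<notin> F n}"
  obtain r :: rat where r': "a < of_rat r" "of_rat r \<le> (1::real)" "of_rat r \<notin> (\<Inter>n. F n)"
      "(\<Inter>n. F n) \<inter> {a..of_rat r} \<noteq> {}" "sep (\<Inter>n. F n) m (of_rat r)"
    using Suc.prems(1) unfolding sep.simps by blast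
  then obtain n1 where r: "a < of_rat r" "of_rat r \<le> (1::real)" "of_rat r \<notin> F n1" "sep (\<Inter>n. F n) m (of_rat r)"
    by blast
  obtain s where "s \<in> (\<Inter>n. F n) \<inter> {a..of_rat r}" using r'(4) by blast
  then have s: "s \<in> F n" "a \<le> s" "s \<le> of_rat r" for n by auto
  have r0: "0 \<le> (of_rat r :: real)" by (rule order.trans[OF Suc.prems(2) less_imp_le[OF r(1)]])
  obtain J n0 where J: "0 < J" and IH: "\<And>n N. n0 \<le> n \<Longrightarrow> 0 < N \<Longrightarrow> J dvd N \<Longrightarrow> of_rat r * real N \<in> \<nat> \<Longrightarrow> good n N
      \<Longrightarrow> m \<le> card (?D n N (of_rat r))"
    using Suc.IH[OF r(4) r0] unfolding good_def by blast
  obtain A B where AB: "quotient_of r = (A, B)" by (cases "quotient_of r")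
  have B: "0 < B" "r = of_int A / of_int B" using quotient_of_denom_pos[OF AB] quotient_of_div[OF AB] by auto
  have rAB: "(of_rat r :: real) = real_of_int A / real_of_int B" unfolding B(2) by (simp add: of_rat_divide)
  have A: "0 \<le> A" using r0 B(1) unfolding rAB by (simp add: zero_le_divide_iff)
  \<comment> \<open>The denominator of \<open>r\<close> joins \<open>J\<close>, so that
    \<open>r\<close> becomes a grid point.\<close>
  define J' where "J' = J * nat B"
  have "0 < J'" using J B by (simp add: J'_def)
  moreover have "Suc m \<le> card (?D n N a)"
    if n: "max n0 n1 \<le> n" and N: "0 < N" "J' dvd N" "a * real N \<in> \<nat>" and g: "good n N" for n N
  proof -
    obtain c where c: "N = J' * c" using N(2) by blast
    have rN: "of_rat r * real N = real (nat A * J * c)"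
      using A B(1) unfolding c J'_def rAB by (simp add: of_nat_nat)
    define l where "l = nat A * J * c"
    have l: "of_rat r = real l / real N" using rN N(1) by (simp add: l_def field_simps)
    obtain b where b: "a * real N = real b" using N(3) by (auto simp: Nats_def)
    have ab: "a = real b / real N" using b N(1) by (simp add: field_simps)
    have IHm: "m \<le> card (?D n N (of_rat r))"
      using n N rN g by (intro IH) (auto simp: J'_def dest: dvd_mult_left)
    have lF: "real l / real N \<notin> F n" using r(3) dec[of n1 n] n unfolding l by auto
    have "real b / real N \<le> s" "s \<le> real l / real N" using s ab l by auto
    then have sN: "real b \<le> s * real N" "s * real N \<le> real l" using N(1) by (auto simp: field_simps)
    have lN: "l \<le> N" using r(2) N(1) unfolding l by (simp add: divide_le_eq)
    \<comment> \<open>The visit \<open>s\<close> lies in a cell between \<open>a\<close> and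
      \<open>r\<close>, one end of which is in \<open>F n\<close>. If \<open>s\<close> were
      \<open>r\<close> itself, \<open>r\<close> would be in \<open>F n\<close>, contrary to the
      choice of \<open>n1\<close>.\<close>
    have "\<exists>j. b \<le> j \<and> j \<le> l \<and> real j / real N \<in> F n"
    proof (cases "s * real N = real l")
      case True
      then have "s = real l / real N" using N(1) by (simp add: field_simps)
      then show ?thesis using lF s(1)[of n] by simp
    next
      case False
      define j where "j = nat \<lfloor>s * real N\<rfloor>"
      have j: "real j \<le> s * real N" "s * real N < real (Suc j)"
        using sN(1) unfolding j_def by linarith+
      have "b \<le> j" using sN(1) j(2) by linarith
      moreover have jl: "Suc j \<le> l" using j(1) sN(2) False by linarith
      moreover have "real j / real N \<in> F n \<or> real (Suc j) / real N \<in> F n"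
      proof -
        have "j < N" using jl lN by simp
        moreover have "s \<in> {real j / real N..real (Suc j) / real N}"
          using j N(1) by (auto simp: field_simps)
        ultimately show ?thesis using g s(1)[of n] unfolding good_def by blast
      qed
      ultimately show ?thesis by (metis Suc_leD le_SucI)
    qed
    then obtain j where j: "b \<le> j" "j \<le> l" "real j / real N \<in> F n" by blast
    \<comment> \<open>From a grid point in \<open>F n\<close> to \<open>r\<close>, which is outside,
      the grid values must drop in some cell. It lies before \<open>r\<close>, hence is not among
      those counted from \<open>r\<close> on.\<close>
    have "\<exists>i. j \<le> i \<and> i < l \<and> real i / real N \<in> F n \<and> real (Suc i) / real N \<notin> F n"
    proof (rule ccontr)
      assume no: "\<not> ?thesis"
      have "real (j + k) / real N \<in> F n" if "j + k \<le> l" for k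
        using that
      proof (induction k)
        case 0
        then show ?case using j by simp
      next
        case (Suc k)
        then show ?case using no by (metis Suc_le_eq add_Suc_right le_add1 less_imp_le)
      qed
      from this[of "l - j"] show False using lF j by simp
    qed
    then obtain i where i: "j \<le> i" "i < l" "real i / real N \<in> F n" "real (Suc i) / real N \<notin> F n" by blast
    have "i \<in> ?D n N a" using i j lN by (auto simp: ab divide_right_mono)
    moreover have "i \<notin> ?D n N (of_rat r)" using i N(1) by (auto simp: l divide_le_cancel)
    moreover have "?D n N (of_rat r) \<subseteq> ?D n N a" using r(1) by auto
    ultimately have "?D n N (of_rat r) \<subset> ?D n N a" by blast
    then have "card (?D n N (of_rat r)) < card (?D n N a)" by (intro psubset_card_mono) auto
    then show ?thesis using IHm by simp
  qed
  ultimately show ?case unfolding good_def by blast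
qed

section \<open>Measurability\<close>

text \<open>Unlike the property that an edge is closed throughout \<open>[\<alpha>, \<beta>]\<close>, this one is visibly measurable.\<close>

definition closed_on :: "real \<Rightarrow> bool \<times> (nat \<Rightarrow> real) \<Rightarrow> real \<Rightarrow> real \<Rightarrow> bool" where
  "closed_on q e \<alpha> \<beta> \<longleftrightarrow> (\<exists>k. \<not> state (fst e) k \<and> (k = 0 \<or> switch_time q (fst e) (snd e) k < \<alpha>)
     \<and> \<beta> < switch_time q (fst e) (snd e) (Suc k))"

lemma measurable_closed_on [measurable]: "Measurable.pred (edge_law q') (\<lambda>e. closed_on q e \<alpha> \<beta>)"
proof -
  have "Measurable.pred clock_law (\<lambda>x. closed_on q (s, x) \<alpha> \<beta>)" for s
    unfolding closed_on_def fst_conv snd_conv by measurable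
  then show ?thesis
    unfolding pred_def space_edge_law using edge_law_sets_Collect[of "\<lambda>e. closed_on q e \<alpha> \<beta>" q']
      by (simp add: pred_def)
qed

lemma closed_on_imp: "closed_on q e \<alpha> \<beta> \<Longrightarrow> \<alpha> \<le> t \<Longrightarrow> t \<le> \<beta> \<Longrightarrow> \<not> edge_open q e t"
proof -
  assume c: "closed_on q e \<alpha> \<beta>" and t: "\<alpha> \<le> t" "t \<le> \<beta>"
  obtain s x where e: "e = (s, x)" by (cases e)
  obtain k where "\<not> state s k" "k = 0 \<or> switch_time q s x k < \<alpha>" "\<beta> < switch_time q s x (Suc k)"
    using c unfolding closed_on_def e by auto
  then have "\<not> state s k \<and> (k = 0 \<or> switch_time q s x k < t) \<and> t < switch_time q s x (Suc k)"
    using t by auto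
  then show ?thesis unfolding e edge_open_def by auto
qed

lemma closed_on_near:
  assumes "\<not> edge_open q e t"
  shows "\<exists>\<delta>>0. \<forall>\<alpha> \<beta>. t - \<delta> < \<alpha> \<longrightarrow> \<beta> < t + \<delta> \<longrightarrow> closed_on q e \<alpha> \<beta>"
proof -
  obtain s x where e: "e = (s, x)" by (cases e)
  obtain k where k: "\<not> state s k" "k = 0 \<or> switch_time q s x k < t" "t < switch_time q s x (Suc k)"
    using assms unfolding edge_open_def e by auto
  define \<delta> where "\<delta> = min (switch_time q s x (Suc k) - t) (if k = 0 then 1 else t - switch_time q s x k)"
  have "0 < \<delta>" using k by (auto simp: \<delta>_def)
  moreover have "closed_on q e \<alpha> \<beta>" if "t - \<delta> < \<alpha>" "\<beta> < t + \<delta>" for \<alpha> \<beta>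
  proof -
    have "\<delta> \<le> switch_time q s x (Suc k) - t" and 2: "k \<noteq> 0 \<Longrightarrow> \<delta> \<le> t - switch_time q s x k" by
      (auto simp: \<delta>_def)
    moreover have "k = 0 \<or> switch_time q s x k < \<alpha>" using 2 that(1) by (cases "k = 0") auto
    ultimately show ?thesis unfolding closed_on_def e fst_conv snd_conv
      using k(1) that(2) by (intro exI[of _ k]) auto
  qed
  ultimately show ?thesis by blast
qed

context spherical_percolation
begin

text \<open>A finite certificate that \<open>v\<close> is cut off throughout
  \<open>[\<alpha>, \<beta>]\<close>: each child is blocked by one cause for the whole interval. It
  is stronger than disconnection at all these times, but measurable, and it holds on all short
  intervals around a time of disconnection.\<close>

primrec dead :: "nat \<Rightarrow> ('v \<Rightarrow> bool \<times> (nat \<Rightarrow> real)) \<Rightarrow> real \<Rightarrow> real \<Rightarrow> 'v \<Rightarrow> bool" where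
  "dead 0 \<omega> \<alpha> \<beta> v = False"
| "dead (Suc m) \<omega> \<alpha> \<beta> v = (\<forall>u\<in>children T v. closed_on (p (level T u)) (\<omega> u) \<alpha> \<beta> \<or> dead m \<omega> \<alpha> \<beta> u)"

lemma dead_imp_not_conn:
  "dead m \<omega> \<alpha> \<beta> v \<Longrightarrow> \<alpha> \<le> t \<Longrightarrow> t \<le> \<beta> \<Longrightarrow> \<not> conn T m (config_at T p \<omega> t) v"
proof (induction m arbitrary: v)
  case (Suc m)
  have "\<not> (config_at T p \<omega> t u \<and> conn T m (config_at T p \<omega> t) u)" if u: "u \<in> children T v" for u
    using Suc.prems(1) u Suc.IH[OF _ Suc.prems(2,3), of u]
      closed_on_imp[OF _ Suc.prems(2,3), of "p (level T u)" "\<omega> u"]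
    unfolding config_at_def by auto
  then show ?case by auto
qed simp

text \<open>Declaring an edge open at its switching times makes closedness an open condition in
  time. Finitely many children at each of finitely many levels are involved, so a common radius
  exists.\<close>

lemma dead_near:
  assumes "v \<in> verts T" "\<not> conn T m (config_at T p \<omega> t) v"
  shows "\<exists>\<delta>>0. \<forall>\<alpha> \<beta>. t - \<delta> < \<alpha> \<longrightarrow> \<beta> < t + \<delta> \<longrightarrow> dead m \<omega> \<alpha> \<beta> v"
  using assms
proof (induction m arbitrary: v)
  case (Suc m)
  let ?P = "\<lambda>u \<delta>. \<forall>\<alpha> \<beta>. t - \<delta> < \<alpha> \<longrightarrow> \<beta> < t + \<delta> \<longrightarrow> closed_on (p (level T u)) (\<omega> u) \<alpha> \<beta> \<or> dead m \<omega> \<alpha> \<beta> u"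
  have "\<forall>u\<in>children T v. \<exists>\<delta>>0. ?P u \<delta>"
  proof
    fix u assume u: "u \<in> children T v"
    show "\<exists>\<delta>>0. ?P u \<delta>"
    proof (cases "config_at T p \<omega> t u")
      case False
      then show ?thesis using closed_on_near[of "p (level T u)" "\<omega> u" t] unfolding config_at_def by blast
    next
      case True
      then have "\<not> conn T m (config_at T p \<omega> t) u" using Suc.prems(2) u by auto
      then show ?thesis using Suc.IH[OF childrenD(2)[OF u]] by blast
    qed
  qed
  then obtain \<delta> where \<delta>: "\<And>u. u \<in> children T v \<Longrightarrow> 0 < \<delta> u \<and> ?P u (\<delta> u)" by metis
  define D where "D = Min (insert 1 (\<delta> ` children T v))"
  have fin: "finite (children T v)" using Suc.prems by (rule_tac finite_children)
  have "0 < D" using \<delta> fin by (auto simp: D_def)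
  moreover have "dead (Suc m) \<omega> \<alpha> \<beta> v" if "t - D < \<alpha>" "\<beta> < t + D" for \<alpha> \<beta>
    unfolding dead.simps
  proof
    fix u assume u: "u \<in> children T v"
    have "D \<le> \<delta> u" using u fin by (simp add: D_def)
    then have "t - \<delta> u < \<alpha>" "\<beta> < t + \<delta> u" using that by linarith+
    then show "closed_on (p (level T u)) (\<omega> u) \<alpha> \<beta> \<or> dead m \<omega> \<alpha> \<beta> u" using \<delta>[OF u] by blast
  qed
  ultimately show ?case by blast
qed simp

lemma closed_conn_times:
  assumes "v \<in> verts T"
  shows "closed {t. conn T m (config_at T p \<omega> t) v}"
proof -
  have "open (- {t. conn T m (config_at T p \<omega> t) v})"
  proof (rule openI)
    fix t assume "t \<in> - {t. conn T m (config_at T p \<omega> t) v}"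
    then obtain \<delta> where \<delta>: "0 < \<delta>" "\<forall>\<alpha> \<beta>. t - \<delta> < \<alpha> \<longrightarrow> \<beta> < t + \<delta> \<longrightarrow> dead m \<omega> \<alpha> \<beta> v"
      using dead_near[OF assms, of m \<omega> t] by auto
    have "\<not> conn T m (config_at T p \<omega> s) v" if "s \<in> ball t \<delta>" for s
      using \<delta>(2) that by (intro dead_imp_not_conn[of m \<omega> s s]) (auto simp: dist_real_def)
    then show "\<exists>e>0. ball t e \<subseteq> - {t. conn T m (config_at T p \<omega> t) v}" using \<delta>(1) by blast
  qed
  then show ?thesis by (simp add: closed_def)
qed

text \<open>A Lebesgue number of the covering by the neighbourhoods of \<open>dead_near\<close>
  gives a uniform subdivision into certified cells. The uncountable quantifier over \<open>t\<close>
  becomes a countable one.\<close>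

lemma not_conn_interval_iff:
  assumes v: "v \<in> verts T" and ab: "a < b"
  shows "(\<forall>t\<in>{a..b}. \<not> conn T m (config_at T p \<omega> t) v) \<longleftrightarrow>
    (\<exists>N. \<forall>i\<le>N. dead m \<omega> (a + (b - a) * (real i / real (Suc N))) (a + (b - a) * (real (Suc i) / real (Suc
      N))) v)"
proof
  assume no: "\<forall>t\<in>{a..b}. \<not> conn T m (config_at T p \<omega> t) v"
  then have "\<forall>t\<in>{a..b}. \<exists>\<delta>>0. \<forall>\<alpha> \<beta>. t - \<delta> < \<alpha> \<longrightarrow> \<beta> < t + \<delta> \<longrightarrow> dead m \<omega> \<alpha> \<beta> v"
    using dead_near[OF v] by blast
  then obtain \<delta> where \<delta>: "\<And>t. t \<in> {a..b} \<Longrightarrow> 0 < \<delta> t"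
    "\<And>t \<alpha> \<beta>. t \<in> {a..b} \<Longrightarrow> t - \<delta> t < \<alpha> \<Longrightarrow> \<beta> < t + \<delta> t \<Longrightarrow> dead m \<omega> \<alpha> \<beta> v" by metis
  obtain e where e: "0 < e" "\<And>S. S \<subseteq> {a..b} \<Longrightarrow> diameter S < e \<Longrightarrow> \<exists>B\<in>(\<lambda>t. ball t (\<delta> t)) ` {a..b}. S \<subseteq> B"
  proof (rule Lebesgue_number_lemma[of "{a..b}" "(\<lambda>t. ball t (\<delta> t)) ` {a..b}"])
    show "{a..b} \<subseteq> \<Union>((\<lambda>t. ball t (\<delta> t)) ` {a..b})" using \<delta>(1) by force
  qed (use ab in auto)
  obtain N where N: "(b - a) / e < real N" using reals_Archimedean2 by blast
  show "\<exists>N. \<forall>i\<le>N. dead m \<omega> (a + (b - a) * (real i / real (Suc N))) (a + (b - a) * (real (Suc i) / real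
    (Suc N))) v"
  proof (intro exI allI impI)
    fix i assume i: "i \<le> N"
    let ?l = "a + (b - a) * (real i / real (Suc N))" and ?r = "a + (b - a) * (real (Suc i) / real (Suc N))"
    have "(b - a) < e * real (Suc N)" using N e by (simp add: field_simps)
    then have "(b - a) / real (Suc N) < e" by (simp add: divide_less_eq)
    moreover have rl: "?r - ?l = (b - a) / real (Suc N)" by (simp add: add_divide_distrib algebra_simps)
    moreover have "?l \<le> ?r" using ab by (auto intro!: mult_left_mono divide_right_mono)
    ultimately have "diameter {?l..?r} < e" by (simp add: diameter_closed_interval)
    moreover have "a \<le> ?l" using ab by simp
    moreover have "?r \<le> a + (b - a) * 1" using ab i by (intro add_left_mono mult_left_mono)
      (auto simp: divide_le_eq)
    then have "?r \<le> b" by simp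
    ultimately obtain t where t: "t \<in> {a..b}" "{?l..?r} \<subseteq> ball t (\<delta> t)" using e(2)[of "{?l..?r}"] by auto
    have "?l \<in> {?l..?r}" "?r \<in> {?l..?r}" using \<open>?l \<le> ?r\<close> by auto
    then have "?l \<in> ball t (\<delta> t)" "?r \<in> ball t (\<delta> t)" using t(2) by blast+
    then show "dead m \<omega> ?l ?r v" using t(1) by (intro \<delta>(2)[of t]) (auto simp: dist_real_def)
  qed
next
  assume "\<exists>N. \<forall>i\<le>N. dead m \<omega> (a + (b - a) * (real i / real (Suc N))) (a + (b - a) * (real (Suc i) / real
    (Suc N))) v"
  then obtain N where N: "\<And>i. i \<le> N \<Longrightarrow> dead m \<omega> (a + (b - a) * (real i / real (Suc N))) (a + (b - a) *
    (real (Suc i) / real (Suc N))) v"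
    by blast
  show "\<forall>t\<in>{a..b}. \<not> conn T m (config_at T p \<omega> t) v"
  proof
    fix t assume t: "t \<in> {a..b}"
    define x where "x = (t - a) / (b - a) * real (Suc N)"
    have x: "0 \<le> x" "x \<le> real (Suc N)" using t ab by
      (auto simp: x_def divide_le_eq mult_left_le_one_le intro!: mult_left_le_one_le)
    have tx: "t = a + (b - a) * (x / real (Suc N))" using ab by (simp add: x_def)
    \<comment> \<open>The minimum with \<open>N\<close> assigns the right end \<open>b\<close> to
      the last cell.\<close>
    define i where "i = min N (nat \<lfloor>x\<rfloor>)"
    have i: "i \<le> N" "real i \<le> x" "x \<le> real (Suc i)"
      using x unfolding i_def by (auto simp: min_def) linarith+
    have "a + (b - a) * (real i / real (Suc N)) \<le> t" "t \<le> a + (b - a) * (real (Suc i) / real (Suc N))"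
      using ab i unfolding tx by (auto intro!: mult_left_mono divide_right_mono)
    then show "\<not> conn T m (config_at T p \<omega> t) v" using dead_imp_not_conn[OF N[OF i(1)]] by blast
  qed
qed

lemma dep_dead: "v \<in> verts T \<Longrightarrow> dep (edges T) (\<lambda>\<omega>. dead m \<omega> \<alpha> \<beta> v)"
proof (induction m arbitrary: v)
  case 0
  then show ?case by (simp add: dep_const)
next
  case (Suc m)
  have "dep (edges T) (\<lambda>\<omega>. closed_on (p (level T u)) (\<omega> u) \<alpha> \<beta> \<or> dead m \<omega> \<alpha> \<beta> u)"
    if u: "u \<in> children T v" for u
  proof -
    have "dep (edges T) (\<lambda>\<omega>. \<not> (\<not> closed_on (p (level T u)) (\<omega> u) \<alpha> \<beta> \<and> \<not> dead m \<omega> \<alpha> \<beta> u))"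
      by (rule dep_not, rule dep_conj; rule dep_not)
        (auto intro!: Suc.IH childrenD(2)[OF u] childrenD(1)[OF u] dep_edge[where \<phi>
          = "\<lambda>e. closed_on (p (level T u)) e \<alpha> \<beta>"] measurable_closed_on)
    then show ?thesis by simp
  qed
  then show ?case unfolding dead.simps by (intro dep_ball finite_children Suc.prems)
qed

lemma perc_times_eq: "perc_times T p \<omega> = {0..1} \<inter> (\<Inter>m. {t. conn T m (config_at T p \<omega> t) (rho T)})"
  by (auto simp: perc_times_def root_percolates_iff)

lemma closed_perc_times: "closed (perc_times T p \<omega>)"
  unfolding perc_times_eq by (intro closed_Int closed_INT ballI closed_conn_times rho_verts) auto

lemma perc_times_subset: "perc_times T p \<omega> \<subseteq> {0..1}"
  by (auto simp: perc_times_def)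

text \<open>Compactness: the times of connection to level \<open>m\<close> form decreasing closed
  sets, so if their intersection misses \<open>[a, b]\<close>, one of them already does.\<close>

lemma perc_times_disjoint_iff:
  assumes "0 \<le> a" "b \<le> 1"
  shows "perc_times T p \<omega> \<inter> {a..b} = {} \<longleftrightarrow> (\<exists>m. \<forall>t\<in>{a..b}. \<not> conn T m (config_at T p \<omega> t) (rho T))"
proof
  assume e: "perc_times T p \<omega> \<inter> {a..b} = {}"
  show "\<exists>m. \<forall>t\<in>{a..b}. \<not> conn T m (config_at T p \<omega> t) (rho T)"
  proof (rule ccontr)
    assume no: "\<not> ?thesis"
    let ?F = "\<lambda>m. {a..b} \<inter> {t. conn T m (config_at T p \<omega> t) (rho T)}"
    have "\<Inter>(range ?F) \<noteq> {}"
    proof (rule compact_nest)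
      show "compact (?F m)" for m by (intro compact_Int_closed closed_conn_times rho_verts) auto
      show "?F m \<noteq> {}" for m using no by auto
      show "?F n \<subseteq> ?F m" if "m \<le> n" for m n using conn_antimono[OF that] by auto
    qed
    then obtain t where t: "t \<in> {a..b}" "\<And>m. conn T m (config_at T p \<omega> t) (rho T)" by blast
    then have "t \<in> perc_times T p \<omega>" using assms by (simp add: perc_times_eq)
    then show False using e t(1) by blast
  qed
next
  assume "\<exists>m. \<forall>t\<in>{a..b}. \<not> conn T m (config_at T p \<omega> t) (rho T)"
  then show "perc_times T p \<omega> \<inter> {a..b} = {}" by (auto simp: perc_times_eq)
qed

lemma dep_perc_times_disjoint:
  assumes "0 \<le> a" "a < b" "b \<le> 1"
  shows "dep (edges T) (\<lambda>\<omega>. perc_times T p \<omega> \<inter> {a..b} = {})"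
  unfolding perc_times_disjoint_iff[OF assms(1,3)] not_conn_interval_iff[OF rho_verts assms(2)]
proof (intro dep_ex)
  fix m N
  have "dep (edges T) (\<lambda>\<omega>. \<forall>i\<in>{..N}. dead m \<omega> (a + (b - a) * (real i / real (Suc N))) (a + (b - a) *
    (real (Suc i) / real (Suc N))) (rho T))"
    by (intro dep_ball dep_dead rho_verts) auto
  then show "dep (edges T) (\<lambda>\<omega>. \<forall>i\<le>N. dead m \<omega> (a + (b - a) * (real i / real (Suc N))) (a + (b - a) *
    (real (Suc i) / real (Suc N))) (rho T))"
    by (simp only: Ball_def atMost_iff)
qed

lemma dep_conn_root: "dep (edges T) (\<lambda>\<omega>. conn T m (config_at T p \<omega> t) (rho T))"
  using dep_conn[OF rho_verts] subtree_edges[OF rho_verts] by (rule dep_mono)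

lemma dep_perc_times: "dep (edges T) (\<lambda>\<omega>. t \<in> perc_times T p \<omega>)"
proof (cases "t \<in> {0..1}")
  case True
  then have "(\<lambda>\<omega>. t \<in> perc_times T p \<omega>) = (\<lambda>\<omega>. \<forall>m. conn T m (config_at T p \<omega> t) (rho T))"
    by (auto simp: perc_times_eq)
  then show ?thesis by (simp add: dep_all dep_conn_root)
next
  case False
  then have "(\<lambda>\<omega>. t \<in> perc_times T p \<omega>) = (\<lambda>\<omega>. False)" by (auto simp: perc_times_eq)
  then show ?thesis by (simp add: dep_const)
qed

lemma dep_sep: "0 \<le> a \<Longrightarrow> dep (edges T) (\<lambda>\<omega>. sep (perc_times T p \<omega>) m a)"
proof (induction m arbitrary: a)
  case 0
  then show ?case by (simp add: dep_const)
next
  case (Suc m)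
  show ?case unfolding sep.simps
  proof (rule dep_ex)
    fix r :: rat
    show "dep (edges T) (\<lambda>\<omega>. a < of_rat r \<and> of_rat r \<le> (1::real) \<and> of_rat r \<notin> perc_times T p \<omega>
        \<and> perc_times T p \<omega> \<inter> {a..of_rat r} \<noteq> {} \<and> sep (perc_times T p \<omega>) m (of_rat r))"
    proof (cases "a < of_rat r \<and> of_rat r \<le> (1::real)")
      case True
      then have "0 \<le> (of_rat r :: real)" using Suc.prems by linarith
      then show ?thesis using Suc True
        by (intro dep_conj dep_const dep_not dep_perc_times_disjoint dep_perc_times Suc.IH) auto
    next
      case False
      then have "(\<lambda>\<omega>. a < of_rat r \<and> of_rat r \<le> (1::real) \<and> of_rat r \<notin> perc_times T p \<omega>
        \<and> perc_times T p \<omega> \<inter> {a..of_rat r} \<noteq> {} \<and> sep (perc_times T p \<omega>) m (of_rat r)) = (\<lambda>\<omega>. False)"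
        by blast
      then show ?thesis by (simp only: dep_const)
    qed
  qed
qed

lemma infinite_components_perc_times: "infinite (components (perc_times T p \<omega>))
  \<longleftrightarrow> (\<forall>m. sep (perc_times T p \<omega>) m 0)"
  using infinite_components_iff_sep[OF closed_perc_times perc_times_subset] .

lemma dep_infinite_components: "dep (edges T) (\<lambda>\<omega>. infinite (components (perc_times T p \<omega>)))"
  unfolding infinite_components_perc_times by (intro dep_all dep_sep) simp

end

section \<open>Finitely many components\<close>

context spherical_percolation
begin

lemma conn_cong:
  assumes "v \<in> verts T" "\<And>u. u \<in> edges T \<Longrightarrow> level T u \<le> level T v + m \<Longrightarrow> c u = c' u"
  shows "conn T m c v = conn T m c' v"
  using assms
proof (induction m arbitrary: v)
  case (Suc m)
  have "c u \<and> conn T m c u \<longleftrightarrow> c' u \<and> conn T m c' u" if u: "u \<in> children T v" for u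
  proof -
    have "conn T m c u = conn T m c' u"
      using Suc.prems childrenD[OF u] by (intro Suc.IH) auto
    then show ?thesis using Suc.prems(2)[of u] childrenD[OF u] by simp
  qed
  then show ?case by auto
qed simp

lemma dep_disj: "dep S P \<Longrightarrow> dep S R \<Longrightarrow> dep S (\<lambda>\<omega>. P \<omega> \<or> R \<omega>)"
  unfolding dep_def by (auto intro: pred_intros_logic)

lemma pr_disj_le:
  assumes "dep (edges T) P" "dep (edges T) R"
  shows "pr (\<lambda>\<omega>. P \<omega> \<or> R \<omega>) \<le> pr P + pr R"
proof -
  have "{\<omega> \<in> space M. P \<omega> \<or> R \<omega>} = {\<omega> \<in> space M. P \<omega>} \<union> {\<omega> \<in> space M. R \<omega>}" by auto
  then show ?thesis unfolding pr_def using assms by (simp add: dep_events measure_Un_le)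
qed

text \<open>Markov's inequality for a number of events. Writing the event as a finite union over the
  index sets \<open>J\<close> gives its measurability.\<close>

lemma pr_card_ge_le:
  assumes fin: "finite I" and P: "\<And>i. i \<in> I \<Longrightarrow> dep (edges T) (P i)" and m: "0 < m"
  shows "dep (edges T) (\<lambda>\<omega>. m \<le> card {i \<in> I. P i \<omega>})"
    and "pr (\<lambda>\<omega>. m \<le> card {i \<in> I. P i \<omega>}) \<le> (\<Sum>i\<in>I. pr (P i)) / real m"
proof -
  have eq: "m \<le> card {i \<in> I. P i \<omega>} \<longleftrightarrow> (\<exists>J\<in>{J. J \<subseteq> I \<and> m \<le> card J}. \<forall>i\<in>J. P i \<omega>)" for \<omega>
  proof
    assume "m \<le> card {i \<in> I. P i \<omega>}"
    then show "\<exists>J\<in>{J. J \<subseteq> I \<and> m \<le> card J}. \<forall>i\<in>J. P i \<omega>" by (intro bexI[of _ "{i \<in> I. P i \<omega>}"]) auto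
  next
    assume "\<exists>J\<in>{J. J \<subseteq> I \<and> m \<le> card J}. \<forall>i\<in>J. P i \<omega>"
    then obtain J where J: "J \<subseteq> I" "m \<le> card J" "\<forall>i\<in>J. P i \<omega>" by blast
    then have "card J \<le> card {i \<in> I. P i \<omega>}" using fin by (intro card_mono) auto
    then show "m \<le> card {i \<in> I. P i \<omega>}" using J by simp
  qed
  show d: "dep (edges T) (\<lambda>\<omega>. m \<le> card {i \<in> I. P i \<omega>})"
    unfolding eq using fin P by (intro dep_bex dep_ball) (auto intro: finite_subset)
  let ?A = "{\<omega> \<in> space M. m \<le> card {i \<in> I. P i \<omega>}}"
  let ?B = "\<lambda>i. {\<omega> \<in> space M. P i \<omega>}"
  have A: "?A \<in> sets M" and B: "\<And>i. i \<in> I \<Longrightarrow> ?B i \<in> sets M" using dep_events[OF d] dep_events[OF P] by auto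
  have "real m * measure M ?A = (\<integral>\<omega>. real m * indicator ?A \<omega> \<partial>M)" using A by simp
  also have "\<dots> \<le> (\<integral>\<omega>. (\<Sum>i\<in>I. indicator (?B i) \<omega>) \<partial>M)"
  proof (rule integral_mono)
    fix \<omega> assume \<omega>: "\<omega> \<in> space M"
    have "(\<Sum>i\<in>I. indicator (?B i) \<omega>) = (\<Sum>i\<in>I. if P i \<omega> then 1 else (0 :: real))"
      using \<omega> by (intro sum.cong) (auto simp: indicator_def)
    also have "\<dots> = real (card {i \<in> I. P i \<omega>})" using fin by (simp add: sum.If_cases Int_def)
    finally show "real m * indicator ?A \<omega> \<le> (\<Sum>i\<in>I. indicator (?B i) \<omega> :: real)"
      by (auto simp: indicator_def)
  qed (use A B in \<open>auto intro!: Bochner_Integration.integrable_sum integrable_real_indicator simp: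
    less_top[symmetric]\<close>)
  also have "\<dots> = (\<Sum>i\<in>I. pr (P i))"
    using B by (subst Bochner_Integration.integral_sum)
      (auto simp: pr_def less_top[symmetric] intro!: integrable_real_indicator)
  finally show "pr (\<lambda>\<omega>. m \<le> card {i \<in> I. P i \<omega>}) \<le> (\<Sum>i\<in>I. pr (P i)) / real m"
    using m by (simp add: pr_def field_simps)
qed

text \<open>The probability of a lower limit of events is at most the lower limit of their
  probabilities. Used along the grids at a fixed level and again along the levels.\<close>

lemma pr_eventually_le:
  assumes A: "\<And>j::nat. dep (edges T) (A j)" and le: "\<And>j. pr (A j) \<le> c + e j" and e: "e \<longlonglongrightarrow> 0"
  shows "dep (edges T) (\<lambda>\<omega>. \<exists>i. \<forall>j\<ge>i. A j \<omega>)" "pr (\<lambda>\<omega>. \<exists>i. \<forall>j\<ge>i. A j \<omega>) \<le> c"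
proof -
  have B: "dep (edges T) (\<lambda>\<omega>. \<forall>j\<ge>i. A j \<omega>)" for i
  proof -
    have "dep (edges T) (\<lambda>\<omega>. \<forall>j. j < i \<or> A j \<omega>)" by (intro dep_all dep_disj dep_const A)
    then show ?thesis by (simp add: not_le[symmetric] disj_imp)
  qed
  then show "dep (edges T) (\<lambda>\<omega>. \<exists>i. \<forall>j\<ge>i. A j \<omega>)" by (rule dep_ex)
  have le': "pr (\<lambda>\<omega>. \<forall>j\<ge>i. A j \<omega>) \<le> c" for i
  proof (rule LIMSEQ_le_const)
    show "(\<lambda>j. c + e j) \<longlonglongrightarrow> c" using tendsto_add[OF tendsto_const e, of c] by simp
    have "pr (\<lambda>\<omega>. \<forall>j\<ge>i. A j \<omega>) \<le> c + e j" if "i \<le> j" for j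
      using that by (intro order.trans[OF pr_mono[where S = "edges T"] le[of j]] A) auto
    then show "\<exists>N. \<forall>n\<ge>N. pr (\<lambda>\<omega>. \<forall>j\<ge>i. A j \<omega>) \<le> c + e n" by blast
  qed
  let ?B = "\<lambda>i. {\<omega> \<in> space M. \<forall>j\<ge>i. A j \<omega>}"
  have "(\<lambda>i. measure M (?B i)) \<longlonglongrightarrow> measure M (\<Union>i. ?B i)"
  proof (rule M.finite_Lim_measure_incseq)
    show "range ?B \<subseteq> sets M" using dep_events[OF B order.refl] by blast
    show "incseq ?B" unfolding incseq_def using order.trans by blast
  qed
  moreover have "(\<Union>i. ?B i) = {\<omega> \<in> space M. \<exists>i. \<forall>j\<ge>i. A j \<omega>}" by auto
  ultimately show "pr (\<lambda>\<omega>. \<exists>i. \<forall>j\<ge>i. A j \<omega>) \<le> c"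
    using le' unfolding pr_def by (intro LIMSEQ_le_const2[of "\<lambda>i. measure M (?B i)"]) auto
qed

text \<open>Up to an event of probability \<open>O(h\<^sup>2)\<close> at most one of finitely many edges switches, and only once,
  during
  \<open>[t, t + h]\<close>; then each configuration on the way agrees with an endpoint.\<close>

lemma bad_cell:
  assumes E: "finite E" "E \<subseteq> edges T" and t: "0 \<le> t" "0 \<le> h"
  shows "\<exists>B. dep (edges T) B \<and> pr B \<le> (real (card E) + (real (card E))\<^sup>2) * h\<^sup>2 \<and>
    (\<forall>\<omega>. \<not> B \<omega> \<longrightarrow> (\<forall>u\<in>{0..h}. (\<forall>v\<in>E. config_at T p \<omega> (t + u) v = config_at T p \<omega> t v)
      \<or> (\<forall>v\<in>E. config_at T p \<omega> (t + u) v = config_at T p \<omega> (t + h) v)))"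
proof -
  have q: "0 < p (level T v)" "p (level T v) < 1" if "v \<in> E" for v
    using p_pos[OF level_edges] p_less[OF level_edges] that E by auto
  have "\<forall>v\<in>E. \<exists>F\<in>sets (edge_meas v). measure (edge_meas v) F \<le> h \<and>
      (\<forall>e. e \<notin> F \<longrightarrow> (\<forall>u\<in>{0..h}. edge_open (p (level T v)) e (t + u) = edge_open (p (level T v)) e t))"
    using edge_flips(1)[OF q t] by blast
  then obtain F1 where F1: "\<And>v. v \<in> E \<Longrightarrow> F1 v \<in> sets (edge_meas v)" "\<And>v. v \<in> E
    \<Longrightarrow> measure (edge_meas v) (F1 v) \<le> h"
    "\<And>v e u. v \<in> E \<Longrightarrow> e \<notin> F1 v \<Longrightarrow> u \<in> {0..h} \<Longrightarrow> edge_open (p (level T v)) e (t + u)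
      = edge_open (p (level T v)) e t"
    by metis
  have "\<forall>v\<in>E. \<exists>F\<in>sets (edge_meas v). measure (edge_meas v) F \<le> h\<^sup>2 \<and>
      (\<forall>e. e \<notin> F \<longrightarrow> (\<forall>u\<in>{0..h}. edge_open (p (level T v)) e (t + u) \<in> {edge_open (p (level T v)) e t,
        edge_open (p (level T v)) e (t + h)}))"
    using edge_flips(2)[OF q t] by blast
  then obtain F2 where F2: "\<And>v. v \<in> E \<Longrightarrow> F2 v \<in> sets (edge_meas v)" "\<And>v. v \<in> E
    \<Longrightarrow> measure (edge_meas v) (F2 v) \<le> h\<^sup>2"
    "\<And>v e u. v \<in> E \<Longrightarrow> e \<notin> F2 v \<Longrightarrow> u \<in> {0..h} \<Longrightarrow> edge_open (p (level T v)) e (t + u) \<in> {edge_open (p (level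
      T v)) e t, edge_open (p (level T v)) e (t + h)}"
    by metis
  have d1: "dep {v} (\<lambda>\<omega>. \<omega> v \<in> F1 v)" "pr (\<lambda>\<omega>. \<omega> v \<in> F1 v) \<le> h" if "v \<in> E" for v
  proof -
    have "Measurable.pred (edge_meas v) (\<lambda>e. e \<in> F1 v)" using F1(1)[OF that] by simp
    then show "dep {v} (\<lambda>\<omega>. \<omega> v \<in> F1 v)" "pr (\<lambda>\<omega>. \<omega> v \<in> F1 v) \<le> h"
      using dep_edge[where v = v and \<phi> = "\<lambda>e. e \<in> F1 v" and S = "{v}"] pr_edge[where v = v and \<phi>
        = "\<lambda>e. e \<in> F1 v"] F1(2)[OF that] that E(2) by auto
  qed
  have d2: "dep {v} (\<lambda>\<omega>. \<omega> v \<in> F2 v)" "pr (\<lambda>\<omega>. \<omega> v \<in> F2 v) \<le> h\<^sup>2" if "v \<in> E" for v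
  proof -
    have "Measurable.pred (edge_meas v) (\<lambda>e. e \<in> F2 v)" using F2(1)[OF that] by simp
    then show "dep {v} (\<lambda>\<omega>. \<omega> v \<in> F2 v)" "pr (\<lambda>\<omega>. \<omega> v \<in> F2 v) \<le> h\<^sup>2"
      using dep_edge[where v = v and \<phi> = "\<lambda>e. e \<in> F2 v" and S = "{v}"] pr_edge[where v = v and \<phi>
        = "\<lambda>e. e \<in> F2 v"] F2(2)[OF that] that E(2) by auto
  qed
  \<comment> \<open>\<open>B2\<close> covers the case that some edge switches more than once in the
    cell, \<open>B1\<close> that two different edges switch. Ordered pairs in \<open>D\<close>
    account for the square of \<open>card E\<close>.\<close>
  define B2 where "B2 \<omega> \<longleftrightarrow> (\<exists>v\<in>E. \<omega> v \<in> F2 v)" for \<omega>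
  define D where "D = {z \<in> E \<times> E. fst z \<noteq> snd z}"
  define B1 where "B1 \<omega> \<longleftrightarrow> (\<exists>z\<in>D. \<omega> (fst z) \<in> F1 (fst z) \<and> \<omega> (snd z) \<in> F1 (snd z))" for \<omega>
  have finD: "finite D" using E by (simp add: D_def)
  have dz: "dep (edges T) (\<lambda>\<omega>. \<omega> (fst z) \<in> F1 (fst z) \<and> \<omega> (snd z) \<in> F1 (snd z))" if "z \<in> D" for z
  proof -
    have "fst z \<in> E" "snd z \<in> E" using that by (auto simp: D_def)
    then show ?thesis
      using E(2) by (intro dep_conj dep_mono[OF d1(1)[of "fst z"]] dep_mono[OF d1(1)[of "snd z"]]) auto
  qed
  have dv: "dep (edges T) (\<lambda>\<omega>. \<omega> v \<in> F2 v)" if "v \<in> E" for v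
    using that E by (intro dep_mono[OF d2(1)]) auto
  have dep2: "dep (edges T) B2" unfolding B2_def[abs_def] by (intro dep_bex E dv)
  have dep1: "dep (edges T) B1" unfolding B1_def[abs_def] by (intro dep_bex finD dz)
  have "pr B2 \<le> (\<Sum>v\<in>E. pr (\<lambda>\<omega>. \<omega> v \<in> F2 v))"
    unfolding B2_def[abs_def] using dv by (intro pr_bex_le[where S = "\<lambda>_. edges T"] E) auto
  also have "\<dots> \<le> (\<Sum>v\<in>E. h\<^sup>2)" by (intro sum_mono d2)
  finally have 2: "pr B2 \<le> real (card E) * h\<^sup>2" by simp
  have "pr B1 \<le> (\<Sum>z\<in>D. pr (\<lambda>\<omega>. \<omega> (fst z) \<in> F1 (fst z) \<and> \<omega> (snd z) \<in> F1 (snd z)))"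
    unfolding B1_def[abs_def] using dz by (intro pr_bex_le[where S = "\<lambda>_. edges T"] finD) auto
  also have "\<dots> \<le> (\<Sum>z\<in>D. h\<^sup>2)"
  proof (rule sum_mono)
    fix z assume z: "z \<in> D"
    then have zE: "fst z \<in> E" "snd z \<in> E" "fst z \<noteq> snd z" by (auto simp: D_def)
    have "pr (\<lambda>\<omega>. \<omega> (fst z) \<in> F1 (fst z) \<and> \<omega> (snd z) \<in> F1 (snd z))
        = pr (\<lambda>\<omega>. \<omega> (fst z) \<in> F1 (fst z)) * pr (\<lambda>\<omega>. \<omega> (snd z) \<in> F1 (snd z))"
      using zE E(2) by (intro pr_indep2[OF d1(1) d1(1)]) auto
    also have "\<dots> \<le> h * h" using zE t by (intro mult_mono d1 pr_nonneg) auto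
    finally show "pr (\<lambda>\<omega>. \<omega> (fst z) \<in> F1 (fst z) \<and> \<omega> (snd z) \<in> F1 (snd z)) \<le> h\<^sup>2"
      by (simp add: power2_eq_square)
  qed
  also have "\<dots> = real (card D) * h\<^sup>2" by simp
  also have "\<dots> \<le> (real (card E))\<^sup>2 * h\<^sup>2"
  proof -
    have "card D \<le> card (E \<times> E)" using E by (intro card_mono) (auto simp: D_def)
    then have "real (card D) \<le> real (card E * card E)" by (simp add: card_cartesian_product del: of_nat_mult)
    then show ?thesis by (intro mult_right_mono) (auto simp: power2_eq_square)
  qed
  finally have 1: "pr B1 \<le> (real (card E))\<^sup>2 * h\<^sup>2" .
  show ?thesis
  proof (intro exI conjI allI impI ballI)
    show "dep (edges T) (\<lambda>\<omega>. B2 \<omega> \<or> B1 \<omega>)" by (intro dep_disj dep1 dep2)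
    show "pr (\<lambda>\<omega>. B2 \<omega> \<or> B1 \<omega>) \<le> (real (card E) + (real (card E))\<^sup>2) * h\<^sup>2"
      using pr_disj_le[OF dep2 dep1] 1 2 by (simp add: algebra_simps)
    fix \<omega> u assume nb: "\<not> (B2 \<omega> \<or> B1 \<omega>)" and u: "u \<in> {0..h}"
    show "(\<forall>v\<in>E. config_at T p \<omega> (t + u) v = config_at T p \<omega> t v)
      \<or> (\<forall>v\<in>E. config_at T p \<omega> (t + u) v = config_at T p \<omega> (t + h) v)"
    proof (cases "\<exists>v\<in>E. \<omega> v \<in> F1 v")
      case False
      then show ?thesis using F1(3) u unfolding config_at_def by blast
    next
      case True
      then obtain v where v: "v \<in> E" "\<omega> v \<in> F1 v" by blast
      \<comment> \<open>Only \<open>v\<close> may switch, and at most once; all other edges of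
        \<open>E\<close> are constant on the cell, so the endpoint that agrees at \<open>v\<close>
        agrees on the whole of \<open>E\<close>.\<close>
      have other: "config_at T p \<omega> (t + u') w = config_at T p \<omega> t w" if "w \<in> E" "w \<noteq> v" "u' \<in> {0..h}" for w u'
      proof -
        have "\<omega> w \<notin> F1 w" using nb v that by (force simp: B1_def D_def)
        then show ?thesis using F1(3) that unfolding config_at_def by blast
      qed
      have "\<omega> v \<notin> F2 v" using nb v by (auto simp: B2_def)
      then have "config_at T p \<omega> (t + u) v \<in> {config_at T p \<omega> t v, config_at T p \<omega> (t + h) v}"
        using F2(3)[OF v(1) _ u] unfolding config_at_def by blast
      moreover have "config_at T p \<omega> (t + u) w = config_at T p \<omega> t w \<and> config_at T p \<omega> (t + u) w
        = config_at T p \<omega> (t + h) w"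
        if "w \<in> E" "w \<noteq> v" for w
        using other[OF that, of u] other[OF that, of h] u by auto
      ultimately show ?thesis by (metis insert_iff singletonD)
    qed
  qed
qed

text \<open>There are \<open>N\<close> cells of length \<open>1 / N\<close>, each with a bad event
  of order \<open>1 / N\<^sup>2\<close>. The edges down to level \<open>n\<close> decide the
  connection to level \<open>n\<close>, so in a good cell every connection is visible at one of its
  ends.\<close>

lemma bad_grid:
  assumes N: "0 < N"
  shows "\<exists>B. dep (edges T) B \<and>
    pr B \<le> (real (card (\<Union>k\<in>{1..n}. level_set T k)) + (real (card (\<Union>k\<in>{1..n}. level_set T k)))\<^sup>2) / real N \<and>
    (\<forall>\<omega>. \<not> B \<omega> \<longrightarrow> (\<forall>i<N. \<forall>s\<in>{real i / real N..real (Suc i) / real N}. conn T n (config_at T p \<omega> s) (rho T) \<longrightarrow>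
      conn T n (config_at T p \<omega> (real i / real N)) (rho T)
        \<or> conn T n (config_at T p \<omega> (real (Suc i) / real N)) (rho T)))"
proof -
  define E where "E = (\<Union>k\<in>{1..n}. level_set T k)"
  define c where "c = real (card E) + (real (card E))\<^sup>2"
  have E: "finite E" "E \<subseteq> edges T"
    using finite_level by (auto simp: E_def level_set_def edges_def)
  have "\<forall>i. \<exists>B. dep (edges T) B \<and> pr B \<le> c * (1 / real N)\<^sup>2 \<and>
    (\<forall>\<omega>. \<not> B \<omega> \<longrightarrow> (\<forall>u\<in>{0..1 / real N}. (\<forall>v\<in>E. config_at T p \<omega> (real i / real N + u) v
      = config_at T p \<omega> (real i / real N) v)
      \<or> (\<forall>v\<in>E. config_at T p \<omega> (real i / real N + u) v = config_at T p \<omega> (real i / real N + 1 / real N) v)))"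
    unfolding c_def using bad_cell[OF E] by simp
  then obtain B where B: "\<And>i. dep (edges T) (B i)" "\<And>i. pr (B i) \<le> c * (1 / real N)\<^sup>2"
    "\<And>i \<omega> u. \<not> B i \<omega> \<Longrightarrow> u \<in> {0..1 / real N} \<Longrightarrow> (\<forall>v\<in>E. config_at T p \<omega> (real i / real N + u) v
      = config_at T p \<omega> (real i / real N) v)
      \<or> (\<forall>v\<in>E. config_at T p \<omega> (real i / real N + u) v = config_at T p \<omega> (real i / real N + 1 / real N) v)"
    by metis
  have step: "real (Suc i) / real N = real i / real N + 1 / real N" for i by (simp add: add_divide_distrib)
  show ?thesis unfolding E_def[symmetric] c_def[symmetric]
  proof (intro exI conjI allI impI ballI)
    show "dep (edges T) (\<lambda>\<omega>. \<exists>i\<in>{..<N}. B i \<omega>)" by (intro dep_bex B) auto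
    have "pr (\<lambda>\<omega>. \<exists>i\<in>{..<N}. B i \<omega>) \<le> (\<Sum>i<N. pr (B i))"
      using B(1) by (intro pr_bex_le[where S = "\<lambda>_. edges T"]) auto
    also have "\<dots> \<le> (\<Sum>i<N. c * (1 / real N)\<^sup>2)" by (intro sum_mono B)
    also have "\<dots> = c / real N" using N by (simp add: power2_eq_square)
    finally show "pr (\<lambda>\<omega>. \<exists>i\<in>{..<N}. B i \<omega>) \<le> c / real N" .
    fix \<omega> i s assume nb: "\<not> (\<exists>i\<in>{..<N}. B i \<omega>)" and i: "i < N" and s: "s \<in> {real i / real N..real (Suc
      i) / real N}"
      and conn: "conn T n (config_at T p \<omega> s) (rho T)"
    define u where "u = s - real i / real N"
    have u: "u \<in> {0..1 / real N}" "s = real i / real N + u" using s[unfolded step] by (auto simp: u_def)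
    have cong: "conn T n c (rho T) = conn T n c' (rho T)" if "\<forall>v\<in>E. c v = c' v" for c c'
    proof (rule conn_cong[OF rho_verts])
      fix u assume u: "u \<in> edges T" "level T u \<le> level T (rho T) + n"
      have "u \<in> level_set T (level T u)" using edges_verts[OF u(1)] by (simp add: level_set_def)
      moreover have "level T u \<in> {1..n}" using level_edges[OF u(1)] u(2) by simp
      ultimately show "c u = c' u" using that unfolding E_def by blast
    qed
    show "conn T n (config_at T p \<omega> (real i / real N)) (rho T)
      \<or> conn T n (config_at T p \<omega> (real (Suc i) / real N)) (rho T)"
      using B(3)[of i \<omega> u] nb i u conn cong unfolding step by auto
  qed
qed

text \<open>The grids have \<open>fact j\<close> cells, so that every \<open>J\<close> eventually
  divides the number of cells. For fixed \<open>n\<close> the bad event disappears as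
  \<open>j\<close> grows, while the expected number of downcrossings has a bound that depends on
  neither \<open>n\<close> nor \<open>j\<close>; the limit in \<open>n\<close> comes last.\<close>

lemma pr_sep_le:
  assumes sum: "summable (\<lambda>k. real (Suc k) * inverse (w (Suc k)))" and m: "0 < m"
  shows "pr (\<lambda>\<omega>. sep (perc_times T p \<omega>) m 0) \<le> (\<Sum>k. real (Suc k) * inverse (w (Suc k))) / real m"
proof -
  define C where "C = (\<Sum>k. real (Suc k) * inverse (w (Suc k)))"
  define F where "F n \<omega> = {0..1} \<inter> {t. conn T n (config_at T p \<omega> t) (rho T)}" for n \<omega>
  define c where "c n = real (card (\<Union>k\<in>{1..n}. level_set T k)) + (real (card (\<Union>k\<in>{1..n}. level_set T
    k)))\<^sup>2" for n
  define P where "P n N i \<omega> \<longleftrightarrow> conn T n (config_at T p \<omega> (real i / real N)) (rho T)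
    \<and> \<not> conn T n (config_at T p \<omega> (real (Suc i) / real N)) (rho T)" for n N i \<omega>
  have "\<forall>n j. \<exists>B. dep (edges T) B \<and> pr B \<le> c n / real (fact j) \<and>
    (\<forall>\<omega>. \<not> B \<omega> \<longrightarrow> (\<forall>i<fact j. \<forall>s\<in>{real i / real (fact j)..real (Suc i) / real (fact j)}. conn T n
      (config_at T p \<omega> s) (rho T) \<longrightarrow>
      conn T n (config_at T p \<omega> (real i / real (fact j))) (rho T)
        \<or> conn T n (config_at T p \<omega> (real (Suc i) / real (fact j))) (rho T)))"
    unfolding c_def using bad_grid[of "fact _"] by simp
  then obtain B where B: "\<And>n j. dep (edges T) (B n j)" "\<And>n j. pr (B n j) \<le> c n / real (fact j)"
    "\<And>n j \<omega> i s. \<not> B n j \<omega> \<Longrightarrow> i < fact j \<Longrightarrow> s \<in> {real i / real (fact j)..real (Suc i) / real (fact j)} \<Longrightarrow>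
      conn T n (config_at T p \<omega> s) (rho T) \<Longrightarrow> conn T n (config_at T p \<omega> (real i / real (fact j))) (rho T)
        \<or> conn T n (config_at T p \<omega> (real (Suc i) / real (fact j))) (rho T)"
    by metis
  define A where "A n j \<omega> \<longleftrightarrow> m \<le> card {i \<in> {..<fact j}. P n (fact j) i \<omega>} \<or> B n j \<omega>" for n j \<omega>
  have dP: "dep (edges T) (P n N i)" for n N i
    unfolding P_def[abs_def] by (intro dep_conj dep_not dep_conn_root)
  have dA: "dep (edges T) (A n j)" for n j
    unfolding A_def[abs_def] using m by (intro dep_disj B pr_card_ge_le dP) auto
  have pP: "pr (P n N i) \<le> C / real N" if "0 < N" for n N i
  proof -
    have "pr (P n N i) \<le> 1 / real N * C"
      unfolding P_def[abs_def] C_def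
      using pr_root_conn_then_fail_le[OF sum, of "real i / real N" "1 / real N" n]
      by (simp add: add_divide_distrib[symmetric] add.commute)
    then show ?thesis by simp
  qed
  have pA: "pr (A n j) \<le> C / real m + c n / real (fact j)" for n j
  proof -
    have "pr (A n j) \<le> pr (\<lambda>\<omega>. m \<le> card {i \<in> {..<fact j}. P n (fact j) i \<omega>}) + pr (B n j)"
      unfolding A_def[abs_def] using m by (intro pr_disj_le B pr_card_ge_le dP) auto
    also have "pr (\<lambda>\<omega>. m \<le> card {i \<in> {..<fact j}. P n (fact j) i \<omega>})
      \<le> (\<Sum>i\<in>{..<fact j}. pr (P n (fact j) i)) / real m"
      using m by (intro pr_card_ge_le dP) auto
    also have "\<dots> \<le> (\<Sum>i\<in>{..<fact j :: nat}. C / real (fact j)) / real m"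
      by (intro divide_right_mono sum_mono pP) auto
    also have "\<dots> = C / real m" by simp
    finally show ?thesis using B(2)[of n j] by simp
  qed
  have lim: "(\<lambda>j. c n / real (fact j)) \<longlonglongrightarrow> 0" for n
  proof -
    have "filterlim (\<lambda>j. real (fact j)) at_top sequentially"
    proof (rule filterlim_at_top_mono[OF filterlim_real_sequentially])
      show "\<forall>\<^sub>F j in sequentially. real j \<le> real (fact j)"
        by (intro always_eventually allI) (metis fact_ge_self of_nat_le_iff)
    qed
    then show ?thesis by (rule real_tendsto_divide_at_top[OF tendsto_const])
  qed
  define A' where "A' n \<omega> \<longleftrightarrow> (\<exists>j0. \<forall>j\<ge>j0. A n j \<omega>)" for n \<omega>
  have A': "dep (edges T) (A' n)" "pr (A' n) \<le> C / real m + 0" for n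
    unfolding A'_def[abs_def] using pr_eventually_le[OF dA pA lim] by auto
  have "pr (\<lambda>\<omega>. sep (perc_times T p \<omega>) m 0) \<le> pr (\<lambda>\<omega>. \<exists>n0. \<forall>n\<ge>n0. A' n \<omega>)"
  proof (rule pr_mono)
    show "dep (edges T) (\<lambda>\<omega>. \<exists>n0. \<forall>n\<ge>n0. A' n \<omega>)" by (rule pr_eventually_le(1)[OF A' tendsto_const])
    fix \<omega> assume "sep (perc_times T p \<omega>) m 0"
    moreover have "perc_times T p \<omega> = (\<Inter>n. F n \<omega>)" unfolding perc_times_eq F_def by auto
    ultimately have s: "sep (\<Inter>n. F n \<omega>) m 0" by simp
    have dec: "F m' \<omega> \<subseteq> F n \<omega>" if "n \<le> m'" for n m' using conn_antimono[OF that] by (auto simp: F_def)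
    obtain J n0 where J: "0 < J" and all: "\<forall>n\<ge>n0. \<forall>N>0. J dvd N \<and> 0 * real N \<in> \<nat> \<and>
      (\<forall>i<N. \<forall>s\<in>{real i / real N..real (Suc i) / real N}. s \<in> F n \<omega> \<longrightarrow> real i / real N \<in> F n \<omega>
        \<or> real (Suc i) / real N \<in> F n \<omega>)
      \<longrightarrow> m \<le> card {i. i < N \<and> 0 \<le> real i / real N \<and> real i / real N \<in> F n \<omega> \<and> real (Suc i) / real N \<notin> F n \<omega>}"
      using downcrossings_of_sep[of "\<lambda>n. F n \<omega>", OF dec s order.refl] by blast
    have dc: "m \<le> card {i. i < N \<and> 0 \<le> real i / real N \<and> real i / real N \<in> F n \<omega>
      \<and> real (Suc i) / real N \<notin> F n \<omega>}"
      if "n0 \<le> n" "0 < N" "J dvd N"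
        "\<forall>i<N. \<forall>s\<in>{real i / real N..real (Suc i) / real N}. s \<in> F n \<omega> \<longrightarrow> real i / real N \<in> F n \<omega>
          \<or> real (Suc i) / real N \<in> F n \<omega>"
      for n N
    proof -
      have "0 * real N \<in> \<nat>" by simp
      then show ?thesis using all that by blast
    qed
    have "A n j \<omega>" if n: "n0 \<le> n" and j: "J \<le> j" for n j
    proof (cases "B n j \<omega>")
      case False
      have F: "real i / real (fact j) \<in> F n \<omega> \<longleftrightarrow> conn T n (config_at T p \<omega> (real i / real (fact j))) (rho T)"
        if "i \<le> fact j" for i using that by (auto simp: F_def divide_le_eq simp flip:
          of_nat_le_iff[where 'a = real])
      have "m \<le> card {i. i < fact j \<and> 0 \<le> real i / real (fact j) \<and> real i / real (fact j) \<in> F n \<omega>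
        \<and> real (Suc i) / real (fact j) \<notin> F n \<omega>}"
      proof (rule dc[OF n fact_gt_zero dvd_fact], goal_cases)
        case 3
        show ?case
        proof (intro allI ballI impI)
          fix i s assume i: "i < fact j" and s: "s \<in> {real i / real (fact j)..real (Suc i) / real (fact
            j)}" "s \<in> F n \<omega>"
          have "conn T n (config_at T p \<omega> s) (rho T)" using s by (simp add: F_def)
          from B(3)[OF False i s(1) this] show "real i / real (fact j) \<in> F n \<omega>
            \<or> real (Suc i) / real (fact j) \<in> F n \<omega>"
            using F[of i] F[of "Suc i"] i by auto
        qed
      qed (use J j in auto)
      also have "{i. i < fact j \<and> 0 \<le> real i / real (fact j) \<and> real i / real (fact j) \<in> F n \<omega>
        \<and> real (Suc i) / real (fact j) \<notin> F n \<omega>}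
          = {i \<in> {..<fact j}. P n (fact j) i \<omega>}"
        using F unfolding P_def by (auto simp del: of_nat_Suc)
      finally show ?thesis by (simp add: A_def)
    qed (simp add: A_def)
    then show "\<exists>n0. \<forall>n\<ge>n0. A' n \<omega>" unfolding A'_def by blast
  qed auto
  also have "\<dots> \<le> C / real m" by (rule pr_eventually_le(2)[OF A' tendsto_const])
  finally show ?thesis by (simp add: C_def)
qed

theorem AE_finite_components:
  assumes sum: "summable (\<lambda>k. real (Suc k) * inverse (w (Suc k)))"
  shows "AE \<omega> in M. finite (components (perc_times T p \<omega>))"
proof -
  let ?I = "\<lambda>\<omega>. infinite (components (perc_times T p \<omega>))"
  define C where "C = (\<Sum>k. real (Suc k) * inverse (w (Suc k)))"
  have "pr ?I \<le> C / real (Suc m)" for m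
  proof -
    have "pr ?I \<le> pr (\<lambda>\<omega>. sep (perc_times T p \<omega>) (Suc m) 0)"
      by (intro pr_mono[where S = "edges T"] dep_sep)
        (auto simp: infinite_components_perc_times simp del: sep.simps)
    also have "\<dots> \<le> C / real (Suc m)" unfolding C_def by (rule pr_sep_le[OF sum]) simp
    finally show ?thesis .
  qed
  moreover have "(\<lambda>m. C / real (Suc m)) \<longlonglongrightarrow> 0"
    by (rule LIMSEQ_Suc[of "\<lambda>m. C / real m"]) (rule lim_const_over_n)
  ultimately have "pr ?I \<le> 0" by (intro LIMSEQ_le_const) auto
  then have "measure M {\<omega> \<in> space M. ?I \<omega>} = 0" using pr_nonneg[of ?I] unfolding pr_def by linarith
  moreover have "{\<omega> \<in> space M. ?I \<omega>} \<in> sets M" using dep_events[OF dep_infinite_components] by simp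
  ultimately show ?thesis
    by (intro AE_I[of _ _ "{\<omega> \<in> space M. ?I \<omega>}"]) (auto simp: M.emeasure_eq_measure)
qed

end

section \<open>Pivotal closings\<close>

context spherical_percolation
begin

lemma subtree_trans: "z \<in> subtree T y \<Longrightarrow> y \<in> subtree T x \<Longrightarrow> z \<in> subtree T x"
proof -
  assume "z \<in> subtree T y" "y \<in> subtree T x"
  then obtain m n where mn: "z \<in> verts T" "(parent T ^^ m) z = y" "level T z = m + level T y"
    "(parent T ^^ n) y = x" "level T y = n + level T x" unfolding subtree_def by blast
  have "(parent T ^^ (n + m)) z = x" "level T z = (n + m) + level T x"
    using mn by (simp_all add: funpow_add)
  then show ?thesis using mn(1) unfolding subtree_def by blast
qed

lemma subtree_rho: "v \<in> verts T \<Longrightarrow> v \<in> subtree T (rho T)"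
  using rt
proof (induction rule: tree_induct)
  case (step v)
  have "v \<in> subtree T (parent T v)"
    using step(1,2) subtree_child_iff[OF step(2), of v] subtree_refl[of v T] edges_verts[OF step(1)]
    by (auto simp: children_def)
  then show ?case using step(3) subtree_trans by blast
qed (rule subtree_refl[OF rho_verts])

lemma subtree_verts: "u \<in> subtree T v \<Longrightarrow> u \<in> verts T"
  by (simp add: subtree_def)

lemma subtree_parent:
  assumes "u \<in> subtree T v" "u \<noteq> v" "v \<in> verts T"
  shows "u \<in> edges T" "parent T u \<in> subtree T v"
proof -
  show e: "u \<in> edges T" using assms subtree_edges[of v] by blast
  obtain n where n: "(parent T ^^ n) u = v" "level T u = n + level T v" using assms by
    (auto simp: subtree_def)
  with assms(2) obtain m where "n = Suc m" by (cases n) auto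
  then show "parent T u \<in> subtree T v"
    using n level_parent[OF rt e] parent_verts[OF e] by
      (auto simp: subtree_def funpow_swap1 intro!: exI[of _ m])
qed

lemma subtree_chain:
  assumes "z \<in> subtree T x" "z \<in> subtree T y" "level T x \<le> level T y" "x \<in> verts T" "y \<in> verts T"
  shows "y \<in> subtree T x"
  using assms
proof (induction "level T z - level T y" arbitrary: z)
  case 0
  have "level T z = level T y" using "0.hyps" subtree_level[OF "0.prems"(2)] by linarith
  then have "z = y" using subtree_level_eq[OF "0.prems"(2)] by blast
  then show ?case using "0.prems"(1) by blast
next
  case (Suc n)
  have "level T y < level T z" using Suc.hyps(2) by linarith
  then have ne: "z \<noteq> y" "z \<noteq> x" using Suc.prems(3) by (blast dest: less_not_refl2 not_less[THEN iffD2])+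
  have e: "z \<in> edges T" using subtree_parent(1)[OF Suc.prems(2) ne(1) Suc.prems(5)] .
  have "n = level T (parent T z) - level T y"
    using Suc.hyps(2) level_parent[OF rt e] by linarith
  from Suc.hyps(1)[OF this subtree_parent(2)[OF Suc.prems(1) ne(2) Suc.prems(4)]
      subtree_parent(2)[OF Suc.prems(2) ne(1) Suc.prems(5)] Suc.prems(3-5)]
  show ?case .
qed

text \<open>\<open>P\<close> is a finite set of vertices closed under taking parents, \<open>V\<close> some of its leaves and \<open>Y\<close> a set of
  edges leaving \<open>P\<close>; what is prescribed on \<open>P\<close>, below \<open>V\<close> and along \<open>Y\<close> is then independent.\<close>

lemma pr_pattern:
  assumes P: "finite P" "P \<subseteq> verts T" "\<And>x. x \<in> P \<Longrightarrow> x \<in> edges T \<Longrightarrow> parent T x \<in> P"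
    and V: "V \<subseteq> P \<inter> edges T" "\<And>v. v \<in> V \<Longrightarrow> subtree T v \<inter> P = {v}"
    and Y: "finite Y" "\<And>y. y \<in> Y \<Longrightarrow> y \<in> edges T \<and> parent T y \<in> P - V \<and> y \<notin> P"
    and \<phi>: "\<And>a. a \<in> P \<inter> edges T \<Longrightarrow> Measurable.pred (edge_meas a) (\<phi> a)"
    and t: "\<And>v. 0 \<le> t v" "\<And>v. 0 \<le> s v"
  shows "pr (\<lambda>\<omega>. (\<forall>a\<in>P \<inter> edges T. \<phi> a (\<omega> a)) \<and> (\<forall>v\<in>V. perc T (config_at T p \<omega> (t v)) v)
      \<and> (\<forall>y\<in>Y. \<not> (config_at T p \<omega> (s y) y \<and> perc T (config_at T p \<omega> (s y)) y)))
    = (\<Prod>a\<in>P \<inter> edges T. measure (edge_meas a) {e. \<phi> a e}) * (\<Prod>v\<in>V. perc_prob d p (level T v))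
      * (\<Prod>y\<in>Y. 1 - p (level T y) * perc_prob d p (level T y))"
proof -
  define A where "A = P \<inter> edges T"
  have finA: "finite A" and finV: "finite V" using P V(1) by (auto simp: A_def intro: finite_subset)
  \<comment> \<open>The tags 0, 1, 2 mark the edges of \<open>P\<close>, the parts below
    \<open>V\<close> and the branches at \<open>Y\<close>; a vertex of \<open>V\<close> occurs both
    as an edge of \<open>P\<close> and with what lies below it.\<close>
  define J where "J = (\<lambda>a. (a, 0::nat)) ` A \<union> (\<lambda>v. (v, 1)) ` V \<union> (\<lambda>y. (y, 2)) ` Y"
  define S where "S = (\<lambda>(x, n). if n = (0::nat) then {x} else if n
    = 1 then subtree T x - {x} else subtree T x)"
  define R where "R = (\<lambda>(x, n) \<omega>. if n = (0::nat) then \<phi> x (\<omega> x) else if n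
    = 1 then perc T (config_at T p \<omega> (t x)) x
    else \<not> (config_at T p \<omega> (s x) x \<and> perc T (config_at T p \<omega> (s x)) x))"
  have Y': "y \<in> edges T" "y \<in> verts T" "parent T y \<in> P" "parent T y \<notin> V" "y \<notin> P" if "y \<in> Y" for y
    using Y(2)[OF that] edges_verts by auto
  have V': "v \<in> edges T" "v \<in> verts T" "v \<in> P" if "v \<in> V" for v using that V(1) edges_verts by auto
  \<comment> \<open>As \<open>P\<close> is closed under parents, climbing from a vertex of
    \<open>P\<close> below \<open>y\<close> would reach \<open>y\<close> inside
    \<open>P\<close>.\<close>
  have YP: "x \<notin> subtree T y" if y: "y \<in> Y" and x: "x \<in> P" for x y
  proof
    assume "x \<in> subtree T y"
    then show False using x
    proof (induction "level T x" arbitrary: x rule: less_induct)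
      case less
      show ?case
      proof (cases "x = y")
        case False
        note q = subtree_parent[OF less.prems(1) False Y'(2)[OF y]]
        show ?thesis using less.hyps[OF _ q(2) P(3)[OF less.prems(2) q(1)]] level_parent[OF rt q(1)] by simp
      qed (use less.prems Y'(5)[OF y] in simp)
    qed
  qed
  have YY: "subtree T y \<inter> subtree T y' = {}" if y: "y \<in> Y" "y' \<in> Y" "y \<noteq> y'" "level T y \<le> level T y'" for y y'
  proof (rule ccontr)
    assume "subtree T y \<inter> subtree T y' \<noteq> {}"
    then have "y' \<in> subtree T y" using subtree_chain[of _ y y'] y Y' by blast
    then have "parent T y' \<in> subtree T y" using subtree_parent(2)[of y' y] y Y' by auto
    then show False using YP[OF y(1) Y'(3)[OF y(2)]] by simp
  qed
  have VV: "subtree T v \<inter> subtree T v' = {}" if v: "v \<in> V" "v' \<in> V" "v \<noteq> v'" "level T v \<le> level T v'" for v v'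
  proof (rule ccontr)
    assume "subtree T v \<inter> subtree T v' \<noteq> {}"
    then have "v' \<in> subtree T v" using subtree_chain[of _ v v'] v V' by blast
    then have "v' \<in> subtree T v \<inter> P" using V'(3)[OF v(2)] by simp
    then show False using V(2)[OF v(1)] v(3) by simp
  qed
  have VY: "subtree T v \<inter> subtree T y = {}" if v: "v \<in> V" and y: "y \<in> Y" for v y
  proof (rule ccontr)
    assume "subtree T v \<inter> subtree T y \<noteq> {}"
    then obtain z where z: "z \<in> subtree T v" "z \<in> subtree T y" by blast
    show False
    proof (cases "level T v \<le> level T y")
      case True
      have ys: "y \<in> subtree T v" using subtree_chain[OF z True] v y V' Y' by blast
      moreover have "y \<noteq> v" using V'(3)[OF v] Y'(5)[OF y] by blast
      ultimately have "parent T y \<in> subtree T v \<inter> P" using subtree_parent(2)[of y v] v y V' Y' by auto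
      then show False using V(2)[OF v] Y'(4)[OF y] v by auto
    next
      case False
      then have "v \<in> subtree T y" using subtree_chain[OF z(2,1)] v y V' Y' by auto
      then show False using YP[OF y V'(3)[OF v]] by simp
    qed
  qed
  have disj: "disjoint_family_on S J"
    unfolding disjoint_family_on_def
  proof (intro ballI impI)
    have sub: "S (v, Suc 0) \<subseteq> subtree T v" for v by (auto simp: S_def)
    have AV: "S (a, 0) \<inter> S (v, Suc 0) = {}" if "a \<in> A" "v \<in> V" for a v
      using V(2)[OF that(2)] that(1) by (auto simp: S_def A_def)
    have AY: "S (a, 0) \<inter> S (y, 2) = {}" if "a \<in> A" "y \<in> Y" for a y
      using YP[OF that(2)] that(1) by (auto simp: S_def A_def)
    have VY': "S (v, Suc 0) \<inter> S (y, 2) = {}" if "v \<in> V" "y \<in> Y" for v y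
      using VY[OF that] by (auto simp: S_def)
    have VV': "S (v, Suc 0) \<inter> S (v', Suc 0) = {}" if "v \<in> V" "v' \<in> V" "v \<noteq> v'" for v v'
      using VV[OF that] VV[OF that(2,1)] that(3) sub
        by (metis (no_types, lifting) disjoint_iff nle_le subsetD)
    have YY': "S (y, 2) \<inter> S (y', 2) = {}" if "y \<in> Y" "y' \<in> Y" "y \<noteq> y'" for y y'
      using YY[OF that] YY[OF that(2,1)] that(3) by (cases "level T y \<le> level T y'") (auto simp: S_def)
    fix i j assume "i \<in> J" "j \<in> J" "i \<noteq> j"
    then show "S i \<inter> S j = {}"
      unfolding J_def using AV AY VY' VV' YY'
      by (elim UnE imageE) (auto simp: Int_commute S_def)
  qed
  have "pr (\<lambda>\<omega>. \<forall>j\<in>J. R j \<omega>) = (\<Prod>j\<in>J. pr (R j))"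
  proof (rule pr_indep[OF _ disj])
    show "finite J" using finA finV Y(1) by (simp add: J_def)
    fix j assume "j \<in> J"
    then consider (A) a where "j = (a, 0)" "a \<in> A" | (V) v where "j = (v, 1)" "v \<in> V" | (Y) y where "j
      = (y, 2)" "y \<in> Y"
      by (auto simp: J_def)
    then have "S j \<subseteq> edges T \<and> dep (S j) (R j)"
    proof cases
      case A
      then have "dep {a} (\<lambda>\<omega>. \<phi> a (\<omega> a))" using \<phi>[of a] by (intro dep_edge) (auto simp: A_def)
      then show ?thesis using A by (simp add: S_def R_def A_def)
    next
      case V
      then show ?thesis using subtree_edges[OF V'(2)[OF V(2)]] dep_perc[OF V'(2)[OF V(2)]]
        by (simp add: S_def R_def)
    next
      case Y
      then show ?thesis using subtree_edges'[OF Y'(1)[OF Y(2)]] dep_not[OF dep_open_perc[OF Y'(1)[OF Y(2)]]]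
        by (simp add: S_def R_def)
    qed
    then show "S j \<subseteq> edges T" "dep (S j) (R j)" by auto
  qed
  also have "\<dots> = (\<Prod>a\<in>A. pr (R (a, 0))) * (\<Prod>v\<in>V. pr (R (v, 1))) * (\<Prod>y\<in>Y. pr (R (y, 2)))"
  proof -
    have "(\<Prod>j\<in>J. pr (R j)) = (\<Prod>j\<in>(\<lambda>a. (a, 0)) ` A \<union> (\<lambda>v. (v, 1)) ` V. pr (R j)) * (\<Prod>j\<in>(\<lambda>y. (y, 2)) ` Y.
      pr (R j))"
      unfolding J_def using finA finV Y(1) by (intro prod.union_disjoint) auto
    also have "(\<Prod>j\<in>(\<lambda>a. (a, 0)) ` A \<union> (\<lambda>v. (v, 1)) ` V. pr (R j))
      = (\<Prod>j\<in>(\<lambda>a. (a, 0)) ` A. pr (R j)) * (\<Prod>j\<in>(\<lambda>v. (v, 1)) ` V. pr (R j))"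
      using finA finV by (intro prod.union_disjoint) auto
    finally show ?thesis by (simp add: prod.reindex inj_on_def)
  qed
  also have "(\<Prod>a\<in>A. pr (R (a, 0))) = (\<Prod>a\<in>A. measure (edge_meas a) {e. \<phi> a e})"
    using \<phi> pr_edge by (intro prod.cong refl) (auto simp: R_def A_def)
  also have "(\<Prod>v\<in>V. pr (R (v, 1))) = (\<Prod>v\<in>V. perc_prob d p (level T v))"
    using pr_perc[OF V'(2) t(1)] by (intro prod.cong refl) (auto simp: R_def)
  also have "(\<Prod>y\<in>Y. pr (R (y, 2))) = (\<Prod>y\<in>Y. 1 - p (level T y) * perc_prob d p (level T y))"
  proof (intro prod.cong refl)
    fix y assume y: "y \<in> Y"
    show "pr (R (y, 2)) = 1 - p (level T y) * perc_prob d p (level T y)"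
      using pr_not[OF dep_open_perc[OF Y'(1)[OF y]] subtree_edges'[OF Y'(1)[OF y]]] pr_open_perc[OF
        Y'(1)[OF y] t(2)]
      by (simp add: R_def)
  qed
  also have "(\<lambda>\<omega>. \<forall>j\<in>J. R j \<omega>) = (\<lambda>\<omega>. (\<forall>a\<in>A. \<phi> a (\<omega> a)) \<and> (\<forall>v\<in>V. perc T (config_at T p \<omega> (t v)) v)
      \<and> (\<forall>y\<in>Y. \<not> (config_at T p \<omega> (s y) y \<and> perc T (config_at T p \<omega> (s y)) y)))"
    by (auto simp: J_def R_def fun_eq_iff ball_Un)
  finally show ?thesis by (simp add: A_def)
qed

text \<open>\<open>ancestors\<close> consists of edges, so it lacks the root; adding the root gives
  a set of vertices closed under parents, as \<open>pr_pattern\<close> requires.\<close>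

definition path :: "'v \<Rightarrow> 'v set" where
  "path v = insert (rho T) (ancestors T v)"

definition offpath :: "'v \<Rightarrow> 'v set" where
  "offpath v = {y \<in> edges T. parent T y \<in> path v - {v} \<and> y \<notin> path v}"

lemma path_iff: "v \<in> verts T \<Longrightarrow> x \<in> path v \<longleftrightarrow> x \<in> verts T \<and> v \<in> subtree T x"
  using subtree_ancestors[of v x] subtree_rho[of v] rho_verts
  by (auto simp: path_def edges_def)

lemma finite_path: "v \<in> verts T \<Longrightarrow> finite (path v)"
  using ancestors_edges(3)[OF rt] by (simp add: path_def)

lemma path_edges: "v \<in> verts T \<Longrightarrow> path v \<inter> edges T = ancestors T v"
  using ancestors_edges(1)[OF rt, of v] by (auto simp: path_def edges_def)

lemma path_parent: "v \<in> verts T \<Longrightarrow> x \<in> path v \<Longrightarrow> x \<in> edges T \<Longrightarrow> parent T x \<in> path v"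
  using subtree_trans[of v x "parent T x"] subtree_child_iff[OF parent_verts, of x x] parent_verts[of x]
    subtree_refl[of x T]
  by (auto simp: path_iff children_def)

lemma path_level: "v \<in> verts T \<Longrightarrow> x \<in> path v \<Longrightarrow> level T x \<le> level T v"
  using subtree_level[of v T x] by (simp add: path_iff)

lemma path_refl: "v \<in> verts T \<Longrightarrow> v \<in> path v"
  by (simp add: path_iff subtree_refl)

lemma path_step: "v \<in> edges T \<Longrightarrow> path v = insert v (path (parent T v))"
  by (auto simp: path_def ancestors_step[OF rt])

lemma path_unique: "v \<in> verts T \<Longrightarrow> x \<in> path v \<Longrightarrow> y \<in> path v \<Longrightarrow> level T x = level T y \<Longrightarrow> x = y"
  using subtree_unique[of v T x y] by (simp add: path_iff)

lemma offpath_step: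
  assumes v: "v \<in> edges T"
  shows "offpath v = offpath (parent T v) \<union> (children T (parent T v) - {v})"
    and "offpath (parent T v) \<inter> (children T (parent T v) - {v}) = {}"
proof -
  let ?a = "parent T v"
  have a: "?a \<in> verts T" "v \<in> verts T" using parent_verts[OF v] edges_verts[OF v] by auto
  have vn: "v \<notin> path ?a" using path_level[OF a(1), of v] level_parent[OF rt v] by auto
  have ch: "y \<notin> path ?a" if "y \<in> edges T" "parent T y = ?a" for y
    using path_level[OF a(1), of y] level_parent[OF rt that(1)] that(2) by auto
  show "offpath v = offpath ?a \<union> (children T ?a - {v})"
    using vn ch path_refl[OF a(1)] unfolding offpath_def path_step[OF v] children_def by auto
  show "offpath ?a \<inter> (children T ?a - {v}) = {}"
    by (auto simp: offpath_def children_def)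
qed

lemma finite_offpath: "v \<in> verts T \<Longrightarrow> finite (offpath v)"
  using rt
proof (induction rule: tree_induct)
  case rho
  then show ?case by (simp add: offpath_def path_def)
next
  case (step v)
  then show ?case by (simp add: offpath_step(1) finite_children)
qed

text \<open>At level \<open>i\<close> the path is left by the \<open>d (i - 1) - 1\<close> siblings
  of its vertex at that level.\<close>

lemma prod_offpath:
  fixes f :: "nat \<Rightarrow> real"
  assumes "v \<in> verts T"
  shows "(\<Prod>y\<in>offpath v. f (level T y)) = (\<Prod>i=1..level T v. f i ^ (d (i - 1) - 1))"
  using rt assms
proof (induction rule: tree_induct)
  case rho
  then show ?case by (simp add: offpath_def path_def)
next
  case (step v)
  let ?a = "parent T v"
  have v: "v \<in> children T ?a" using step(1) by (simp add: children_def)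
  have "(\<Prod>y\<in>offpath v. f (level T y)) = (\<Prod>y\<in>offpath ?a. f (level T y)) * (\<Prod>y\<in>children T ?a - {v}. f
    (level T y))"
    unfolding offpath_step(1)[OF step(1)]
    using finite_offpath[OF step(2)] finite_children[OF step(2)] offpath_step(2)[OF step(1)]
    by (intro prod.union_disjoint) auto
  also have "(\<Prod>y\<in>children T ?a - {v}. f (level T y)) = (\<Prod>y\<in>children T ?a - {v}. f (level T v))"
    using childrenD(4) v by (intro prod.cong) auto
  also have "\<dots> = f (level T v) ^ (d (level T ?a) - 1)"
    using v card_children[OF step(2)] finite_children[OF step(2)] by simp
  finally show ?case using step(3) level_parent[OF rt step(1)] by simp
qed

text \<open>The two times are distributed so that no edge besides \<open>v\<close> is read twice:
  the path and the part below \<open>v\<close> at \<open>t\<close>, the branches off the path at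
  \<open>t'\<close>. This already implies that the root percolates at \<open>t\<close> and not at
  \<open>t'\<close>, see \<open>pivotal_close_imp\<close>.\<close>

definition pivotal_close :: "'v \<Rightarrow> real \<Rightarrow> real \<Rightarrow> ('v \<Rightarrow> bool \<times> (nat \<Rightarrow> real)) \<Rightarrow> bool" where
  "pivotal_close v t t' \<omega> \<longleftrightarrow> (\<forall>a\<in>ancestors T v. config_at T p \<omega> t a) \<and> \<not> config_at T p \<omega> t' v
     \<and> perc T (config_at T p \<omega> t) v
     \<and> (\<forall>y\<in>offpath v. \<not> (config_at T p \<omega> t' y \<and> perc T (config_at T p \<omega> t') y))"

text \<open>Koenig's argument: finitely many children that fail at individual depths all fail at the
  largest of these depths.\<close>

lemma perc_child:
  assumes "v \<in> verts T" "perc T c v"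
  shows "\<exists>u\<in>children T v. c u \<and> perc T c u"
proof (rule ccontr)
  assume "\<not> ?thesis"
  then have "\<forall>u\<in>children T v. \<exists>m. \<not> (c u \<and> conn T m c u)" by (auto simp: perc_def)
  then obtain m where m: "\<And>u. u \<in> children T v \<Longrightarrow> \<not> (c u \<and> conn T (m u) c u)" by metis
  define n where "n = Max (insert 0 (m ` children T v))"
  have "\<not> (c u \<and> conn T n c u)" if u: "u \<in> children T v" for u
  proof -
    have "m u \<le> n" using u finite_children[OF assms(1)] by (simp add: n_def)
    then show ?thesis using m[OF u] conn_antimono[of "m u" n c u] by blast
  qed
  then have "\<not> conn T (Suc n) c v" by auto
  moreover have "conn T (Suc n) c v" using assms(2) unfolding perc_def by blast
  ultimately show False by blast
qed

text \<open>An infinite open path that avoids all branches off the path to \<open>v\<close> has to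
  run through \<open>v\<close>. Contraposed, a closed edge above \<open>v\<close> then leaves the
  root without percolation.\<close>

lemma not_perc_offpath:
  assumes "v \<in> verts T" "\<forall>y\<in>offpath v. \<not> (c y \<and> perc T c y)" "perc T c (rho T)"
  shows "perc T c v \<and> (v = rho T \<or> c v)"
  using rt assms(1,2)
proof (induction rule: tree_induct)
  case rho
  then show ?case using assms(3) by simp
next
  case (step v)
  have "perc T c (parent T v)" using step(3,4) offpath_step(1)[OF step(1)] by blast
  then obtain u where "u \<in> children T (parent T v)" "c u" "perc T c u" using perc_child[OF step(2)] by blast
  moreover from this have "u = v" using step(4) offpath_step(1)[OF step(1)] by blast
  ultimately show ?case by simp
qed

lemma pivotal_close_imp:
  assumes v: "v \<in> edges T" and "pivotal_close v t t' \<omega>"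
  shows "perc T (config_at T p \<omega> t) (rho T)" "\<not> perc T (config_at T p \<omega> t') (rho T)"
proof -
  note v' = edges_verts[OF v]
  have "v \<in> cluster T (config_at T p \<omega> t) (rho T)" "\<And>m. conn T m (config_at T p \<omega> t) v"
    using assms(2) in_cluster_iff[OF rt v'] by (auto simp: pivotal_close_def perc_def)
  then have "conn T (level T v + m) (config_at T p \<omega> t) (rho T)" for m by (intro cluster_imp_conn[OF v'])
  then show "perc T (config_at T p \<omega> t) (rho T)"
    unfolding perc_def by (blast intro: conn_antimono[OF le_add2])
  show "\<not> perc T (config_at T p \<omega> t') (rho T)"
    using not_perc_offpath[OF v', of "config_at T p \<omega> t'"] assms(2) v
    by (auto simp: pivotal_close_def edges_def)
qed

end

lemma prod_indicator_power:
  fixes r :: real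
  shows "(\<Prod>i=1..n::nat. if i < k then r else 1) = r ^ min n (k - 1)"
proof -
  have "(\<Prod>i=1..n. if i < k then r else 1) = (\<Prod>i\<in>{i\<in>{1..n}. i < k}. r)"
    by (simp only: prod.inter_filter finite_atLeastAtMost)
  also have "{i\<in>{1..n}. i < k} = {1..min n (k - 1)}" by auto
  finally show ?thesis by simp
qed

lemma prod_single_factor:
  fixes h :: real
  shows "1 \<le> k \<Longrightarrow> k \<le> n \<Longrightarrow> (\<Prod>i=1..n::nat. if i = k then h else 1) = h"
  by (simp add: prod.delta)

context spherical_percolation
begin

text \<open>For a vertex \<open>v\<close> at level \<open>k\<close>: \<open>W k\<close> is the probability that its path to the root is open, \<open>NP k\<close>
  that no
  infinite open path leaves this path before \<open>v\<close>, and \<open>G k\<close> is, up to the factor \<open>1 - p k\<close>, the rate at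
    which the
  edge above \<open>v\<close> closes while being pivotal for percolation.\<close>

definition W :: "nat \<Rightarrow> real" where "W k = (\<Prod>i=1..k. p i)"

definition reach :: "nat \<Rightarrow> real" where "reach k = p k * perc_prob d p k"

definition NP :: "nat \<Rightarrow> real" where "NP k = (\<Prod>i=1..k. (1 - reach i) ^ (d (i - 1) - 1))"

definition G :: "nat \<Rightarrow> real" where "G k = W k * perc_prob d p k * NP k"

lemma W_pos: "0 < W k"
  unfolding W_def by (intro prod_pos) (use p_pos in auto)

lemma reach_bounds: "1 \<le> k \<Longrightarrow> 0 \<le> reach k" "1 \<le> k \<Longrightarrow> reach k \<le> 1 - \<epsilon>"
proof -
  assume k: "1 \<le> k"
  show "0 \<le> reach k" unfolding reach_def using p_pos[OF k] perc_prob_bounds[of k] by simp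
  have "reach k \<le> p k" unfolding reach_def using p_pos[OF k] perc_prob_bounds[of k]
    by (simp add: mult_left_le)
  then show "reach k \<le> 1 - \<epsilon>" using p_le[OF k] by simp
qed

lemma one_minus_reach: "1 \<le> k \<Longrightarrow> \<epsilon> \<le> 1 - reach k" "1 \<le> k \<Longrightarrow> 0 < 1 - reach k" "1 \<le> k \<Longrightarrow> 1 - reach k \<le> 1"
  using reach_bounds[of k] eps by auto

lemma NP_pos: "0 < NP k"
  unfolding NP_def by (intro prod_pos) (use one_minus_reach in auto)

lemma G_nonneg: "0 \<le> G k"
  unfolding G_def using W_pos[of k] NP_pos[of k] perc_prob_bounds[of k] by simp

lemma dep_pivotal_close: "v \<in> edges T \<Longrightarrow> dep (edges T) (pivotal_close v t t')"
  unfolding pivotal_close_def[abs_def]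
  using ancestors_edges(1)[OF rt edges_verts] subtree_edges[OF edges_verts, of v]
  by (intro dep_conj dep_ball dep_not dep_open ancestors_edges(3)[OF rt edges_verts] finite_offpath
    edges_verts
      dep_mono[OF dep_perc]) (auto simp: offpath_def edges_verts subset_iff dest: subtree_edges'[THEN
        subsetD] subtree_edges[THEN subsetD])

lemma measure_close_le:
  assumes a: "a \<in> edges T" and t: "0 \<le> t" "0 \<le> h"
  shows "measure (edge_meas a) {e. edge_open (p (level T a)) e t
    \<and> \<not> edge_open (p (level T a)) e (t + h)} \<le> p (level T a) * h"
  using pr_open_closed_le[OF a t] unfolding config_at_def
  by (subst (asm) pr_edge[OF a]) auto

lemma measure_open_eq:
  assumes a: "a \<in> edges T" and t: "0 \<le> t"
  shows "measure (edge_meas a) {e. edge_open (p (level T a)) e t} = p (level T a)"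
  using measure_edge_open p_pos[OF level_edges[OF a]] p_less[OF level_edges[OF a]] t by simp

text \<open>The conditional probability is \<open>1 - (1 - q) * (1 - exp (- \<tau>))\<close>, where
  \<open>1 - q \<ge> \<epsilon>\<close> and, for times in the unit interval,
  \<open>1 - exp (- \<tau>) \<ge> \<tau> / 2\<close>. This is the origin of the rate
  \<open>\<epsilon> / 2\<close>.\<close>

lemma measure_open2_le:
  assumes a: "a \<in> edges T" and t: "t \<in> {0..1}" "s \<in> {0..1}"
  shows "measure (edge_meas a) {e. edge_open (p (level T a)) e t \<and> edge_open (p (level T a)) e s}
    \<le> p (level T a) * exp (- (\<epsilon> / 2 * \<bar>t - s\<bar>))"
proof -
  let ?q = "p (level T a)"
  have q: "0 < ?q" "?q < 1" "?q \<le> 1 - \<epsilon>"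
    using p_pos[OF level_edges[OF a]] p_less[OF level_edges[OF a]] p_le[OF level_edges[OF a]] by auto
  define \<tau> where "\<tau> = \<bar>t - s\<bar>"
  have \<tau>: "0 \<le> \<tau>" "\<tau> \<le> 1" using t by (auto simp: \<tau>_def abs_if)
  have "measure (edge_meas a) {e. edge_open ?q e t \<and> edge_open ?q e s} = ?q * (?q + (1 - ?q) * exp (- \<tau>))"
  proof (cases "t \<le> s")
    case True
    then show ?thesis using measure_edge_open_open[OF q(1,2), of t s] t by (simp add: \<tau>_def)
  next
    case False
    then show ?thesis using measure_edge_open_open[OF q(1,2), of s t] t by (simp add: \<tau>_def conj_commute)
  qed
  also have "\<dots> \<le> ?q * exp (- (\<epsilon> / 2 * \<tau>))"
  proof (rule mult_left_mono)
    have "exp (- \<tau>) \<le> 1 / (1 + \<tau>)"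
      using exp_ge_add_one_self[of \<tau>] \<tau> by (simp add: exp_minus field_simps)
    also have "\<dots> \<le> 1 - \<tau> / 2"
      using \<tau> mult_left_le[of \<tau> \<tau>] by (simp add: field_simps)
    finally have e: "\<tau> / 2 \<le> 1 - exp (- \<tau>)" by simp
    have "?q + (1 - ?q) * exp (- \<tau>) = 1 - (1 - ?q) * (1 - exp (- \<tau>))" by (simp add: algebra_simps)
    also have "\<dots> \<le> 1 - \<epsilon> * (\<tau> / 2)"
      using q e eps \<tau> by (intro diff_left_mono mult_mono) auto
    also have "\<dots> \<le> exp (- (\<epsilon> / 2 * \<tau>))" using exp_ge_add_one_self[of "- (\<epsilon> / 2 * \<tau>)"] by simp
    finally show "?q + (1 - ?q) * exp (- \<tau>) \<le> exp (- (\<epsilon> / 2 * \<tau>))" .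
  qed (use q in simp)
  finally show ?thesis by (simp add: \<tau>_def)
qed

lemma measure_close2_le:
  assumes a: "a \<in> edges T" and t: "0 \<le> t" "0 \<le> s" "0 \<le> h" and sep: "t + h \<le> s \<or> s + h \<le> t"
  shows "measure (edge_meas a) {e. (edge_open (p (level T a)) e t \<and> \<not> edge_open (p (level T a)) e (t + h))
    \<and> (edge_open (p (level T a)) e s \<and> \<not> edge_open (p (level T a)) e (s + h))} \<le> p (level T a) * (h * h)"
proof -
  let ?q = "p (level T a)"
  have q: "0 < ?q" "?q < 1" using p_pos[OF level_edges[OF a]] p_less[OF level_edges[OF a]] by auto
  show ?thesis
  proof (cases "t + h \<le> s")
    case True
    then show ?thesis using measure_two_closings_le[OF q, of t "t + h" s "s + h"] t by (simp add: conj_ac)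
  next
    case False
    then have "s + h \<le> t" using sep by simp
    then show ?thesis using measure_two_closings_le[OF q, of s "s + h" t "t + h"] t by (simp add: conj_ac)
  qed
qed

text \<open>One-sided form of the product formula: of an event such as a pair of closings only
  conditions on disjoint sets of edges are kept, and the probability at each edge of
  \<open>P\<close> is replaced by a bound.\<close>

lemma pr_le_pattern:
  assumes P: "finite P" "P \<subseteq> verts T" "\<And>x. x \<in> P \<Longrightarrow> x \<in> edges T \<Longrightarrow> parent T x \<in> P"
    and V: "V \<subseteq> P \<inter> edges T" "\<And>v. v \<in> V \<Longrightarrow> subtree T v \<inter> P = {v}"
    and Y: "finite Y" "\<And>y. y \<in> Y \<Longrightarrow> y \<in> edges T \<and> parent T y \<in> P - V \<and> y \<notin> P"
    and \<phi>: "\<And>a. a \<in> P \<inter> edges T \<Longrightarrow> Measurable.pred (edge_meas a) (\<phi> a)"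
    and t: "\<And>v. 0 \<le> t v" "\<And>v. 0 \<le> s v"
    and R: "\<And>\<omega> a. R \<omega> \<Longrightarrow> a \<in> P \<inter> edges T \<Longrightarrow> \<phi> a (\<omega> a)"
      "\<And>\<omega> v. R \<omega> \<Longrightarrow> v \<in> V \<Longrightarrow> perc T (config_at T p \<omega> (t v)) v"
      "\<And>\<omega> y. R \<omega> \<Longrightarrow> y \<in> Y \<Longrightarrow> \<not> (config_at T p \<omega> (s y) y \<and> perc T (config_at T p \<omega> (s y)) y)"
    and f: "\<And>a. a \<in> P \<inter> edges T \<Longrightarrow> measure (edge_meas a) {e. \<phi> a e} \<le> f a"
  shows "pr R \<le> (\<Prod>a\<in>P \<inter> edges T. f a) * (\<Prod>v\<in>V. perc_prob d p (level T v)) * (\<Prod>y\<in>Y. 1 - reach (level T y))"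
proof -
  let ?R = "\<lambda>\<omega>. (\<forall>a\<in>P \<inter> edges T. \<phi> a (\<omega> a)) \<and> (\<forall>v\<in>V. perc T (config_at T p \<omega> (t v)) v)
      \<and> (\<forall>y\<in>Y. \<not> (config_at T p \<omega> (s y) y \<and> perc T (config_at T p \<omega> (s y)) y))"
  have "dep (edges T) (\<lambda>\<omega>. perc T (config_at T p \<omega> (t v)) v)" if "v \<in> V" for v
    using that V(1) by (intro dep_mono[OF dep_perc subtree_edges] edges_verts) auto
  moreover have "dep (edges T) (\<lambda>\<omega>. \<not> (config_at T p \<omega> (s y) y \<and> perc T (config_at T p \<omega> (s y)) y))"
    if "y \<in> Y" for y
    using Y(2)[OF that] by (intro dep_not[OF dep_mono[OF dep_open_perc subtree_edges']]) auto
  moreover have "dep (edges T) (\<lambda>\<omega>. \<phi> a (\<omega> a))" if "a \<in> P \<inter> edges T" for a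
    using that by (intro dep_edge \<phi>) auto
  moreover have "finite V" using V(1) P(1) by (auto intro: finite_subset)
  ultimately have "dep (edges T) ?R"
    using P(1) Y(1) by (intro dep_conj dep_ball) auto
  then have "pr R \<le> pr ?R" by (intro pr_mono[where S = "edges T"]) (use R in blast)+
  also have "\<dots> = (\<Prod>a\<in>P \<inter> edges T. measure (edge_meas a) {e. \<phi> a e}) * (\<Prod>v\<in>V. perc_prob d p (level T v))
      * (\<Prod>y\<in>Y. 1 - reach (level T y))"
    unfolding reach_def by (rule pr_pattern[OF P V Y \<phi> t])
  also have "\<dots> \<le> (\<Prod>a\<in>P \<inter> edges T. f a) * (\<Prod>v\<in>V. perc_prob d p (level T v)) * (\<Prod>y\<in>Y. 1 - reach (level T y))"
    using f Y(2) one_minus_reach(2)[OF level_edges] perc_prob_bounds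
    by (intro mult_right_mono prod_mono prod_nonneg) (auto simp: less_imp_le)
  finally show ?thesis .
qed

text \<open>The hypotheses of \<open>pr_pattern\<close>, in their order, for
  \<open>P = path u\<close>, \<open>V = {u}\<close> and \<open>Y = offpath u\<close>; the last item
  identifies the edges of \<open>P\<close>.\<close>

lemma path_pattern:
  assumes u: "u \<in> edges T"
  shows "finite (path u)" "path u \<subseteq> verts T" "\<And>x. x \<in> path u \<Longrightarrow> x \<in> edges T \<Longrightarrow> parent T x \<in> path u"
    "{u} \<subseteq> path u \<inter> edges T" "\<And>v. v \<in> {u} \<Longrightarrow> subtree T v \<inter> path u = {v}"
    "finite (offpath u)" "\<And>y. y \<in> offpath u \<Longrightarrow> y \<in> edges T \<and> parent T y \<in> path u - {u} \<and> y \<notin> path u"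
    "path u \<inter> edges T = ancestors T u"
proof -
  note u' = edges_verts[OF u]
  show "finite (path u)" by (rule finite_path[OF u'])
  show "path u \<subseteq> verts T" using path_iff[OF u'] by blast
  show "parent T x \<in> path u" if "x \<in> path u" "x \<in> edges T" for x by (rule path_parent[OF u' that])
  show "{u} \<subseteq> path u \<inter> edges T" using path_refl[OF u'] u by simp
  show "subtree T v \<inter> path u = {v}" if "v \<in> {u}" for v
  proof -
    have "y = u" if "y \<in> subtree T u" "y \<in> path u" for y
      using subtree_level[OF that(1)] path_level[OF u' that(2)] subtree_level_eq[OF that(1)] by simp
    then show ?thesis using that path_refl[OF u'] subtree_refl[OF u'] by blast
  qed
  show "finite (offpath u)" by (rule finite_offpath[OF u'])
  show "y \<in> edges T \<and> parent T y \<in> path u - {u} \<and> y \<notin> path u" if "y \<in> offpath u" for y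
    using that by (simp add: offpath_def)
  show "path u \<inter> edges T = ancestors T u" by (rule path_edges[OF u'])
qed

lemma prod_offpath_reach: "v \<in> verts T \<Longrightarrow> (\<Prod>y\<in>offpath v. 1 - p (level T y) * perc_prob d p (level T y))
  = NP (level T v)"
  using prod_offpath[of v "\<lambda>i. 1 - reach i"] by (simp add: NP_def reach_def)

lemma ancestors_level_eq: "u \<in> verts T \<Longrightarrow> a \<in> ancestors T u \<Longrightarrow> level T a = level T u \<longleftrightarrow> a = u"
  using subtree_ancestors[of u a] subtree_level_eq[of u T a] by auto

lemma pr_pivotal_close:
  assumes v: "v \<in> edges T" and t: "0 \<le> t" "0 \<le> h"
  shows "pr (pivotal_close v t (t + h)) = (1 - p (level T v)) * (1 - exp (- h)) * G (level T v)"
proof -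
  let ?k = "level T v"
  define \<phi> where "\<phi> a e \<longleftrightarrow> edge_open (p (level T a)) e t \<and> (a = v
    \<longrightarrow> \<not> edge_open (p (level T a)) e (t + h))" for a e
  note P = path_pattern[OF v] and v' = edges_verts[OF v]
  have m\<phi>: "Measurable.pred (edge_meas a) (\<phi> a)" for a unfolding \<phi>_def by measurable
  have v_anc: "v \<in> ancestors T v" using P(4,8) by auto
  have "pr (pivotal_close v t (t + h)) = pr (\<lambda>\<omega>. (\<forall>a\<in>path v \<inter> edges T. \<phi> a (\<omega> a))
    \<and> (\<forall>v\<in>{v}. perc T (config_at T p \<omega> t) v)
      \<and> (\<forall>y\<in>offpath v. \<not> (config_at T p \<omega> (t + h) y \<and> perc T (config_at T p \<omega> (t + h)) y)))"
    unfolding P(8) pivotal_close_def[abs_def] \<phi>_def config_at_def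
    by (rule arg_cong[where f = pr]) (use v_anc in \<open>auto simp: fun_eq_iff\<close>)
  also have "\<dots> = (\<Prod>a\<in>path v \<inter> edges T. measure (edge_meas a) {e. \<phi> a e}) * (\<Prod>v\<in>{v}. perc_prob d p (level T v))
      * (\<Prod>y\<in>offpath v. 1 - p (level T y) * perc_prob d p (level T y))"
    by (rule pr_pattern[OF P(1-7) m\<phi>]) (use t in auto)
  also have "(\<Prod>a\<in>path v \<inter> edges T. measure (edge_meas a) {e. \<phi> a e})
      = (\<Prod>a\<in>ancestors T v. p (level T a) * (if level T a = ?k then (1 - p ?k) * (1 - exp (- h)) else 1))"
    unfolding P(8)
  proof (rule prod.cong[OF refl])
    fix a assume a: "a \<in> ancestors T v"
    then have e: "a \<in> edges T" using subtree_ancestors[OF v'] by simp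
    show "measure (edge_meas a) {e. \<phi> a e} = p (level T a) * (if level T a
      = ?k then (1 - p ?k) * (1 - exp (- h)) else 1)"
      using measure_open_eq[OF e t(1)] ancestors_level_eq[OF v' a] t
        measure_edge_open_closed[OF p_pos[OF level_edges[OF v]] p_less[OF level_edges[OF v]], of t "t + h"]
      by (auto simp: \<phi>_def)
  qed
  also have "\<dots> = W ?k * ((1 - p ?k) * (1 - exp (- h)))"
    unfolding ancestors_edges(4)[OF rt v', of "\<lambda>i. p i * (if i
      = ?k then (1 - p ?k) * (1 - exp (- h)) else 1)"]
    using level_edges[OF v] by (simp add: prod.distrib W_def prod.delta)
  finally show ?thesis by (simp add: prod_offpath_reach[OF v'] G_def)
qed

lemma pr_pivotal_close_le:
  assumes v: "v \<in> edges T" and t: "0 \<le> t" "0 \<le> h"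
  shows "pr (pivotal_close v t (t + h)) \<le> h * G (level T v)"
proof -
  have "(1 - p (level T v)) * (1 - exp (- h)) \<le> 1 * h"
    using p_pos[OF level_edges[OF v]] p_less[OF level_edges[OF v]] t exp_ge_add_one_self[of "- h"]
    by (intro mult_mono) auto
  then show ?thesis unfolding pr_pivotal_close[OF assms] using G_nonneg[of "level T v"]
    by (intro mult_right_mono) auto
qed

text \<open>Of the closing at \<open>v\<close> only the open path and the switch at \<open>v\<close>
  are kept; percolation and the branches are taken from the closing at \<open>u\<close>. The
  \<open>level T v - 1\<close> edges strictly above \<open>v\<close> are open at both times, each
  giving a decay factor. For \<open>v = u\<close> the cells must not overlap, so that one edge
  closes twice.\<close>

lemma pr_pivotal_close_comparable:
  assumes u: "u \<in> edges T" and v: "v \<in> ancestors T u" and t: "t \<in> {0..1}" "s \<in> {0..1}" "0 \<le> h"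
    and sep: "v \<noteq> u \<or> t + h \<le> s \<or> s + h \<le> t"
  shows "pr (\<lambda>\<omega>. pivotal_close v t (t + h) \<omega> \<and> pivotal_close u s (s + h) \<omega>)
    \<le> h\<^sup>2 * exp (- (\<epsilon> / 2 * \<bar>t - s\<bar>)) ^ (level T v - 1) * G (level T u)"
proof -
  let ?k = "level T v" and ?k' = "level T u"
  define r where "r = exp (- (\<epsilon> / 2 * \<bar>t - s\<bar>))"
  note P = path_pattern[OF u] and u' = edges_verts[OF u]
  have ve: "v \<in> edges T" "u \<in> subtree T v" using v subtree_ancestors[OF u'] by auto
  have kk: "1 \<le> ?k" "?k \<le> ?k'" using level_edges[OF ve(1)] subtree_level[OF ve(2)] by auto
  define \<phi> where "\<phi> a e \<longleftrightarrow> (a = v \<longrightarrow> edge_open (p (level T a)) e t \<and> \<not> edge_open (p (level T a)) e (t + h))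
    \<and> (a = u \<longrightarrow> edge_open (p (level T a)) e s \<and> \<not> edge_open (p (level T a)) e (s + h))
    \<and> (level T a < ?k \<longrightarrow> edge_open (p (level T a)) e t \<and> edge_open (p (level T a)) e s)
    \<and> (?k < level T a \<longrightarrow> edge_open (p (level T a)) e s)" for a e
  have m\<phi>: "Measurable.pred (edge_meas a) (\<phi> a)" for a unfolding \<phi>_def by measurable
  have anc_v: "a \<in> ancestors T v" if "a \<in> ancestors T u" "level T a < ?k" for a
  proof -
    have "a \<in> edges T" "u \<in> subtree T a" using that(1) subtree_ancestors[OF u'] by auto
    then show ?thesis using subtree_chain[of u a v] ve that(2) edges_verts subtree_ancestors[of v a] by auto
  qed
  have va: "v \<in> ancestors T v" using subtree_ancestors[of v v] subtree_refl[OF edges_verts] ve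
    edges_verts by blast
  \<comment> \<open>The two factors \<open>h\<close> are kept separate so that for
    \<open>v = u\<close>, where the levels coincide, both apply to the same edge.\<close>
  define g where "g i = p i * ((if i < ?k then r else 1) * ((if i = ?k then h else 1) * (if i
    = ?k' then h else 1)))" for i
  have r: "0 < r" by (simp add: r_def)
  have meas: "measure (edge_meas a) {e. \<phi> a e} \<le> g (level T a)" if a: "a \<in> path u \<inter> edges T" for a
  proof -
    have ae: "a \<in> edges T" "a \<in> ancestors T u" using a P(8) by auto
    let ?q = "p (level T a)"
    have av: "level T a = ?k \<longleftrightarrow> a = v"
      using path_unique[OF u', of a v] a P(8) v by auto
    note au = ancestors_level_eq[OF u' ae(2)]
    have mono: "measure (edge_meas a) {e. \<phi> a e} \<le> measure (edge_meas a) {e. \<psi> e}"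
      if "\<And>e. \<phi> a e \<Longrightarrow> \<psi> e" "Measurable.pred (edge_meas a) \<psi>" for \<psi>
      using that by (intro edge_law.finite_measure_mono) (auto simp: pred_def)
    consider (lt) "level T a < ?k" | (uv) "a = v" "a = u" | (v) "a = v" "a \<noteq> u" | (u) "a \<noteq> v" "a
      = u" | (else) "?k < level T a" "a \<noteq> u"
      using av by linarith
    then show ?thesis
    proof cases
      case lt
      then have "a \<noteq> v" "a \<noteq> u" using kk av au by auto
      then have "g (level T a) = ?q * r" using lt kk av au by (simp add: g_def)
      then show ?thesis using measure_open2_le[OF ae(1) t(1,2)] lt
        by (intro order.trans[OF mono]) (auto simp: \<phi>_def r_def)
    next
      case uv
      then have "g (level T a) = ?q * (h * h)" by (simp add: g_def)
      moreover have "t + h \<le> s \<or> s + h \<le> t" using sep uv by auto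
      then have "measure (edge_meas a) {e. (edge_open ?q e t \<and> \<not> edge_open ?q e (t + h))
        \<and> (edge_open ?q e s \<and> \<not> edge_open ?q e (s + h))} \<le> ?q * (h * h)"
        using t by (intro measure_close2_le[OF ae(1)]) auto
      moreover have "measure (edge_meas a) {e. \<phi> a e} \<le> measure (edge_meas a) {e. (edge_open ?q e t
        \<and> \<not> edge_open ?q e (t + h)) \<and> (edge_open ?q e s \<and> \<not> edge_open ?q e (s + h))}"
        by (rule mono) (use uv in \<open>auto simp: \<phi>_def\<close>)
      ultimately show ?thesis by simp
    next
      case v
      then have "g (level T a) = ?q * h" using au by (simp add: g_def)
      moreover have "measure (edge_meas a) {e. edge_open ?q e t \<and> \<not> edge_open ?q e (t + h)} \<le> ?q * h"
        using t by (intro measure_close_le[OF ae(1)]) auto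
      moreover have "measure (edge_meas a) {e. \<phi> a e} \<le> measure (edge_meas a) {e. edge_open ?q e t
        \<and> \<not> edge_open ?q e (t + h)}"
        by (rule mono) (use v in \<open>auto simp: \<phi>_def\<close>)
      ultimately show ?thesis by simp
    next
      case u
      then have "?k < level T a" using kk av by (metis le_neq_implies_less)
      then have "g (level T a) = ?q * h" using u by (simp add: g_def)
      moreover have "measure (edge_meas a) {e. edge_open ?q e s \<and> \<not> edge_open ?q e (s + h)} \<le> ?q * h"
        using t by (intro measure_close_le[OF ae(1)]) auto
      moreover have "measure (edge_meas a) {e. \<phi> a e} \<le> measure (edge_meas a) {e. edge_open ?q e s
        \<and> \<not> edge_open ?q e (s + h)}"
        by (rule mono) (use u in \<open>auto simp: \<phi>_def\<close>)
      ultimately show ?thesis by simp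
    next
      case else
      then have "g (level T a) = ?q" using au by (simp add: g_def)
      moreover have "measure (edge_meas a) {e. edge_open ?q e s} = ?q"
        using t by (intro measure_open_eq[OF ae(1)]) auto
      ultimately show ?thesis using mono[of "\<lambda>e. edge_open ?q e s"] else by (auto simp: \<phi>_def)
    qed
  qed
  have "pr (\<lambda>\<omega>. pivotal_close v t (t + h) \<omega> \<and> pivotal_close u s (s + h) \<omega>)
    \<le> (\<Prod>a\<in>path u \<inter> edges T. g (level T a)) * (\<Prod>v\<in>{u}. perc_prob d p (level T v)) * (\<Prod>y\<in>offpath u. 1 -
      reach (level T y))"
  proof (rule pr_le_pattern[OF P(1-7) m\<phi>, where t = "\<lambda>_. s" and s = "\<lambda>_. s + h"])
    fix \<omega> a assume pc: "pivotal_close v t (t + h) \<omega> \<and> pivotal_close u s (s + h) \<omega>" and "a \<in> path u \<inter> edges T"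
    then have a: "a \<in> ancestors T u" using P(8) by simp
    show "\<phi> a (\<omega> a)"
      using a anc_v[OF a] va pc unfolding \<phi>_def pivotal_close_def config_at_def by auto
  qed (use t meas in \<open>auto simp: pivotal_close_def\<close>)
  also have "(\<Prod>a\<in>path u \<inter> edges T. g (level T a)) = W ?k' * (r ^ (?k - 1) * (h * h))"
    unfolding P(8) ancestors_edges(4)[OF rt u', of g] unfolding g_def
    using prod_indicator_power[where n = ?k' and k = ?k and r = r] prod_single_factor[where n
      = ?k' and k = ?k and h = h]
      prod_single_factor[where n = ?k' and k = ?k' and h = h] kk
    by (simp add: prod.distrib W_def)
  also have "(\<Prod>y\<in>offpath u. 1 - reach (level T y)) = NP ?k'"
    using prod_offpath_reach[OF u'] by (simp add: reach_def)
  finally show ?thesis by (simp add: G_def r_def power2_eq_square mult_ac)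
qed

text \<open>\<open>a\<close> is the last common vertex. The product of two single probabilities
  counts the common path and its branches twice, hence the division by \<open>W\<close> and
  \<open>NP\<close> at the level of \<open>a\<close>; the common edges are open at both times, which
  gives the decay. The branches at \<open>a\<close> are left out, since they would be read at two
  times or contain one of the two paths; each of the two factors lost is at least
  \<open>\<epsilon> ^ (d (level T a) - 1)\<close>.\<close>

lemma pr_pivotal_close_meet:
  assumes v: "v \<in> edges T" and u: "u \<in> edges T" and a: "v \<in> subtree T a" "u \<in> subtree T a" "a \<in> verts T"
    and l: "level T a < level T v" "level T a < level T u"
    and meet: "\<And>z. z \<in> ancestors T v \<Longrightarrow> z \<in> ancestors T u \<Longrightarrow> level T z \<le> level T a"
    and t: "t \<in> {0..1}" "s \<in> {0..1}" "0 \<le> h"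
  shows "pr (\<lambda>\<omega>. pivotal_close v t (t + h) \<omega> \<and> pivotal_close u s (s + h) \<omega>)
    \<le> h\<^sup>2 * exp (- (\<epsilon> / 2 * \<bar>t - s\<bar>)) ^ level T a * (G (level T v) * G (level T u) / (W (level T a) * NP
      (level T a) * \<epsilon> ^ (2 * (d (level T a) - 1))))"
proof -
  let ?k = "level T v" and ?k' = "level T u" and ?l = "level T a"
  define r where "r = exp (- (\<epsilon> / 2 * \<bar>t - s\<bar>))"
  have r: "0 < r" by (simp add: r_def)
  have h0: "0 \<le> h" using t by simp
  note Pv = path_pattern[OF v] and Pu = path_pattern[OF u] and v' = edges_verts[OF v] and u'
    = edges_verts[OF u]
  have low: "z \<in> path v" if "z \<in> path u" "level T z \<le> ?l" for z
  proof -
    have z: "z \<in> verts T" "u \<in> subtree T z" using that(1) path_iff[OF u'] by auto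
    then have "a \<in> subtree T z" using subtree_chain[OF z(2) a(2) that(2) z(1) a(3)] by simp
    then show ?thesis using subtree_trans[OF a(1)] z(1) path_iff[OF v'] by blast
  qed
  have low': "z \<in> path u" if "z \<in> path v" "level T z \<le> ?l" for z
  proof -
    have z: "z \<in> verts T" "v \<in> subtree T z" using that(1) path_iff[OF v'] by auto
    then have "a \<in> subtree T z" using subtree_chain[OF z(2) a(1) that(2) z(1) a(3)] by simp
    then show ?thesis using subtree_trans[OF a(2)] z(1) path_iff[OF u'] by blast
  qed
  have meet': "level T z \<le> ?l" if "z \<in> path v" "z \<in> path u" for z
    using that meet[of z] by (auto simp: path_def)
  have vu: "v \<notin> path u" "u \<notin> path v"
    using meet'[of v] meet'[of u] path_refl[OF v'] path_refl[OF u'] l by auto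
  define P where "P = path v \<union> path u"
  \<comment> \<open>Up to level \<open>?l\<close> the two paths share their branches, which are
    tested only at the time belonging to \<open>v\<close>; level \<open>Suc ?l\<close>, where the
    paths part, is skipped.\<close>
  define Y where "Y = {y \<in> offpath v. level T y \<noteq> Suc ?l} \<union> {y \<in> offpath u. Suc ?l < level T y}"
  have par: "level T y = Suc (level T (parent T y))" if "y \<in> edges T" for y using level_parent[OF rt that] .
  have Y1: "y \<notin> path u" "parent T y \<noteq> u" if "y \<in> offpath v" "level T y \<noteq> Suc ?l" for y
  proof -
    have y: "y \<in> edges T" "parent T y \<in> path v" "parent T y \<noteq> v" "y \<notin> path v" using that by
      (auto simp: offpath_def)
    show "parent T y \<noteq> u" using y(2) vu by auto
    show "y \<notin> path u"
    proof
      assume yu: "y \<in> path u"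
      then have "parent T y \<in> path u" using Pu(3) y(1) by blast
      then have "level T (parent T y) \<le> ?l" using meet'[OF y(2)] by simp
      then have "level T y \<le> ?l" using par[OF y(1)] that(2) by simp
      then show False using low[OF yu] y(4) by simp
    qed
  qed
  have Y2: "y \<notin> path v" "parent T y \<noteq> v" "y \<notin> offpath v" if "y \<in> offpath u" "Suc ?l < level T y" for y
  proof -
    have y: "y \<in> edges T" "parent T y \<in> path u" "parent T y \<noteq> u" "y \<notin> path u" using that by
      (auto simp: offpath_def)
    show "parent T y \<noteq> v" using y(2) vu by auto
    have pv: "parent T y \<notin> path v" using meet'[OF _ y(2)] par[OF y(1)] that(2) by auto
    then show "y \<notin> path v" using Pv(3) y(1) by blast
    show "y \<notin> offpath v" using pv by (auto simp: offpath_def)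
  qed
  define \<phi> where "\<phi> z e \<longleftrightarrow> (z = v \<longrightarrow> edge_open (p (level T z)) e t \<and> \<not> edge_open (p (level T z)) e (t + h))
    \<and> (z = u \<longrightarrow> edge_open (p (level T z)) e s \<and> \<not> edge_open (p (level T z)) e (s + h))
    \<and> (z \<in> path v \<longrightarrow> edge_open (p (level T z)) e t) \<and> (z \<in> path u \<longrightarrow> edge_open (p (level T z)) e s)" for z e
  have m\<phi>: "Measurable.pred (edge_meas z) (\<phi> z)" for z unfolding \<phi>_def by measurable
  define gv where "gv i = p i * ((if i < Suc ?l then r else 1) * (if i = ?k then h else 1))" for i
  \<comment> \<open>\<open>gu\<close> is 1 on the common part, whose edges are already counted in
    \<open>gv\<close>.\<close>
  define gu where "gu i = (if i \<le> ?l then 1 else p i) * (if i = ?k' then h else 1)" for i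
  define f where "f z = (if z \<in> path v then gv (level T z) else gu (level T z))" for z
  have meas: "measure (edge_meas z) {e. \<phi> z e} \<le> f z" if z: "z \<in> P \<inter> edges T" for z
  proof -
    have ze: "z \<in> edges T" using z by simp
    let ?q = "p (level T z)"
    have mono: "measure (edge_meas z) {e. \<phi> z e} \<le> measure (edge_meas z) {e. \<psi> e}"
      if "\<And>e. \<phi> z e \<Longrightarrow> \<psi> e" "Measurable.pred (edge_meas z) \<psi>" for \<psi>
      using that by (intro edge_law.finite_measure_mono) (auto simp: pred_def)
    show ?thesis
    proof (cases "z \<in> path v")
      case True
      have zk: "level T z = ?k \<longleftrightarrow> z = v" using path_unique[OF v' True path_refl[OF v']] by auto
      consider (lt) "level T z \<le> ?l" | (v) "z = v" | (else) "?l < level T z" "z \<noteq> v" by linarith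
      then show ?thesis
      proof cases
        case lt
        then have "f z = ?q * r" using True l by (simp add: f_def gv_def)
        then show ?thesis using measure_open2_le[OF ze t(1,2)] True low'[OF True lt]
          by (intro order.trans[OF mono]) (auto simp: \<phi>_def r_def)
      next
        case v
        then have "f z = ?q * h" using True l by (simp add: f_def gv_def)
        moreover have "measure (edge_meas z) {e. edge_open ?q e t \<and> \<not> edge_open ?q e (t + h)} \<le> ?q * h"
          using t by (intro measure_close_le[OF ze]) auto
        moreover have "measure (edge_meas z) {e. \<phi> z e} \<le> measure (edge_meas z) {e. edge_open ?q e t
          \<and> \<not> edge_open ?q e (t + h)}"
          by (rule mono) (use v in \<open>auto simp: \<phi>_def\<close>)
        ultimately show ?thesis by simp
      next
        case else
        then have "f z = ?q" using True zk by (simp add: f_def gv_def)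
        moreover have "measure (edge_meas z) {e. edge_open ?q e t} = ?q"
          using t by (intro measure_open_eq[OF ze]) auto
        ultimately show ?thesis using mono[of "\<lambda>e. edge_open ?q e t"] True by (auto simp: \<phi>_def)
      qed
    next
      case False
      then have zu: "z \<in> path u" using z by (simp add: P_def)
      then have zl: "?l < level T z" using low[of z] False by (meson not_le)
      have zk: "level T z = ?k' \<longleftrightarrow> z = u" using path_unique[OF u' zu path_refl[OF u']] by auto
      show ?thesis
      proof (cases "z = u")
        case True
        then have "f z = ?q * h" using False l zl by (simp add: f_def gu_def)
        moreover have "measure (edge_meas z) {e. edge_open ?q e s \<and> \<not> edge_open ?q e (s + h)} \<le> ?q * h"
          using t by (intro measure_close_le[OF ze]) auto
        moreover have "measure (edge_meas z) {e. \<phi> z e} \<le> measure (edge_meas z) {e. edge_open ?q e s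
          \<and> \<not> edge_open ?q e (s + h)}"
          by (rule mono) (use True in \<open>auto simp: \<phi>_def\<close>)
        ultimately show ?thesis by simp
      next
        case nu: False
        then have "f z = ?q" using False zl zk by (simp add: f_def gu_def)
        moreover have "measure (edge_meas z) {e. edge_open ?q e s} = ?q"
          using t by (intro measure_open_eq[OF ze]) auto
        ultimately show ?thesis using mono[of "\<lambda>e. edge_open ?q e s"] zu by (auto simp: \<phi>_def)
      qed
    qed
  qed
  have Vsub: "subtree T z \<inter> P = {z}" if z: "z \<in> {v, u}" for z
  proof -
    have "subtree T v \<inter> path u = {}"
    proof -
      have "v \<in> path u" if "y \<in> subtree T v" "y \<in> path u" for y
        using that subtree_trans[of u y v] v' path_iff[OF u'] by blast
      then show ?thesis using vu by blast
    qed
    moreover have "subtree T u \<inter> path v = {}"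
    proof -
      have "u \<in> path v" if "y \<in> subtree T u" "y \<in> path v" for y
        using that subtree_trans[of v y u] u' path_iff[OF v'] by blast
      then show ?thesis using vu by blast
    qed
    ultimately show ?thesis using z Pv(5)[of v] Pu(5)[of u] unfolding P_def by auto
  qed
  have "pr (\<lambda>\<omega>. pivotal_close v t (t + h) \<omega> \<and> pivotal_close u s (s + h) \<omega>)
    \<le> (\<Prod>z\<in>P \<inter> edges T. f z) * (\<Prod>z\<in>{v, u}. perc_prob d p (level T z)) * (\<Prod>y\<in>Y. 1 - reach (level T y))"
  proof (rule pr_le_pattern[where \<phi> = \<phi> and t = "\<lambda>z. if z = v then t else s" and s = "\<lambda>y.
    if y \<in> offpath v then t + h else s + h"])
    show "finite P" "P \<subseteq> verts T" using Pv(1,2) Pu(1,2) by (auto simp: P_def)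
    show "\<And>z. z \<in> P \<Longrightarrow> z \<in> edges T \<Longrightarrow> parent T z \<in> P" using Pv(3) Pu(3) by (auto simp: P_def)
    show "{v, u} \<subseteq> P \<inter> edges T" using Pv(4) Pu(4) by (auto simp: P_def)
    show "\<And>z. z \<in> {v, u} \<Longrightarrow> subtree T z \<inter> P = {z}" by (rule Vsub)
    show "finite Y" using Pv(6) Pu(6) by (auto simp: Y_def)
    show "y \<in> edges T \<and> parent T y \<in> P - {v, u} \<and> y \<notin> P" if "y \<in> Y" for y
      using that Pv(7)[of y] Pu(7)[of y] Y1[of y] Y2[of y] by (auto simp: Y_def P_def)
    show "\<And>z. z \<in> P \<inter> edges T \<Longrightarrow> measure (edge_meas z) {e. \<phi> z e} \<le> f z" by (rule meas)
    fix \<omega> assume pc: "pivotal_close v t (t + h) \<omega> \<and> pivotal_close u s (s + h) \<omega>"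
    show "\<phi> z (\<omega> z)" if "z \<in> P \<inter> edges T" for z
      using that pc Pv(8) Pu(8) path_refl[OF v'] path_refl[OF u']
        unfolding \<phi>_def pivotal_close_def config_at_def by auto
    show "perc T (config_at T p \<omega> (if z = v then t else s)) z" if "z \<in> {v, u}" for z
      using that pc unfolding pivotal_close_def by auto
    show "\<not> (config_at T p \<omega> (if y \<in> offpath v then t + h else s + h) y
      \<and> perc T (config_at T p \<omega> (if y \<in> offpath v then t + h else s + h)) y)"
      if "y \<in> Y" for y
      using that pc unfolding pivotal_close_def Y_def by auto
  qed (use m\<phi> t in auto)
  also have "(\<Prod>z\<in>P \<inter> edges T. f z) = (W ?k * (r ^ ?l * h)) * (W ?k' * h / W ?l)"
  proof -
    have "P \<inter> edges T = ancestors T v \<union> (ancestors T u - path v)"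
      using Pv(8) Pu(8) by (auto simp: P_def)
    then have "(\<Prod>z\<in>P \<inter> edges T. f z) = (\<Prod>z\<in>ancestors T v. f z) * (\<Prod>z\<in>ancestors T u - path v. f z)"
      using Pv(8) ancestors_edges(3)[OF rt v'] ancestors_edges(3)[OF rt u']
        by (simp only:) (intro prod.union_disjoint, auto)
    also have "(\<Prod>z\<in>ancestors T v. f z) = (\<Prod>z\<in>ancestors T v. gv (level T z))"
      using Pv(8) by (intro prod.cong) (auto simp: f_def)
    also have "\<dots> = W ?k * (r ^ ?l * h)"
      unfolding ancestors_edges(4)[OF rt v', of gv] unfolding gv_def
      using prod_indicator_power[where n = ?k and k = "Suc ?l" and r = r] prod_single_factor[where n
        = ?k and k = ?k and h = h] l
      by (simp add: prod.distrib W_def)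
    also have "(\<Prod>z\<in>ancestors T u - path v. f z) = (\<Prod>z\<in>ancestors T u - path v. gu (level T z))"
      by (intro prod.cong) (auto simp: f_def)
    also have "\<dots> = (\<Prod>z\<in>ancestors T u. gu (level T z))"
    proof (rule prod.mono_neutral_left[OF ancestors_edges(3)[OF rt u']])
      show "\<forall>z\<in>ancestors T u - (ancestors T u - path v). gu (level T z) = 1"
      proof
        fix z assume "z \<in> ancestors T u - (ancestors T u - path v)"
        then have "z \<in> path u" "z \<in> path v" using Pu(8) by auto
        then have "level T z \<le> ?l" using meet' by blast
        then show "gu (level T z) = 1" using l by (simp add: gu_def)
      qed
    qed auto
    also have "\<dots> = (\<Prod>i=1..?k'. if i \<le> ?l then 1 else p i) * h"
      unfolding ancestors_edges(4)[OF rt u', of gu] unfolding gu_def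
      using prod_single_factor[where n = ?k' and k = ?k' and h = h] l by (simp add: prod.distrib)
    also have "(\<Prod>i=1..?k'. if i \<le> ?l then 1 else p i) = W ?k' / W ?l"
    proof -
      have "W ?k' = (\<Prod>i=1..?k'. (if i \<le> ?l then p i else 1) * (if i \<le> ?l then 1 else p i))"
        unfolding W_def by (intro prod.cong) auto
      also have "\<dots> = (\<Prod>i=1..?k'. if i \<le> ?l then p i else 1) * (\<Prod>i=1..?k'. if i \<le> ?l then 1 else p i)"
        by (rule prod.distrib)
      also have "(\<Prod>i=1..?k'. if i \<le> ?l then p i else 1) = W ?l"
      proof -
        have "(\<Prod>i=1..?k'. if i \<le> ?l then p i else 1) = (\<Prod>i\<in>{i\<in>{1..?k'}. i \<le> ?l}. p i)"
          by (simp only: prod.inter_filter finite_atLeastAtMost)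
        also have "{i\<in>{1..?k'}. i \<le> ?l} = {1..?l}" using l by auto
        finally show ?thesis by (simp add: W_def)
      qed
      finally show ?thesis using W_pos[of ?l] by (simp add: field_simps)
    qed
    finally show ?thesis by (simp add: mult_ac)
  qed
  also have "(\<Prod>z\<in>{v, u}. perc_prob d p (level T z)) = perc_prob d p ?k * perc_prob d p ?k'"
    using vu path_refl[OF v'] by (subst prod.insert) auto
  also have "(W ?k * (r ^ ?l * h)) * (W ?k' * h / W ?l) * (perc_prob d p ?k * perc_prob d p ?k') *
    (\<Prod>y\<in>Y. 1 - reach (level T y))
    \<le> (W ?k * (r ^ ?l * h)) * (W ?k' * h / W ?l) * (perc_prob d p ?k * perc_prob d p ?k') * (NP ?k * NP
      ?k' / (NP ?l * \<epsilon> ^ (2 * (d ?l - 1))))"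
  proof (rule mult_left_mono)
    let ?c = "(1 - reach (Suc ?l)) ^ (d ?l - 1)"
    have c: "0 < ?c" "\<epsilon> ^ (d ?l - 1) \<le> ?c" using one_minus_reach[of "Suc ?l"] eps by (auto intro: power_mono)
    have NPl: "NP (Suc ?l) = NP ?l * ?c" by (simp add: NP_def)
    have split: "(\<Prod>y\<in>{y \<in> offpath z. R (level T y)}. 1 - reach (level T y)) * (\<Prod>i=1..level T z. (if R i
      then 1 else 1 - reach i) ^ (d (i - 1) - 1)) = NP (level T z)"
      if z: "z \<in> verts T" for z R
    proof -
      have "(\<Prod>y\<in>{y \<in> offpath z. R (level T y)}. 1 - reach (level T y)) = (\<Prod>y\<in>offpath z.
        if R (level T y) then 1 - reach (level T y) else 1)"
        using finite_offpath[OF z] by (simp only: prod.inter_filter)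
      also have "\<dots> = (\<Prod>i=1..level T z. (if R i then 1 - reach i else 1) ^ (d (i - 1) - 1))"
        by (rule prod_offpath[OF z, of "\<lambda>i. if R i then 1 - reach i else 1"])
      finally show ?thesis
        by (simp add: prod.distrib[symmetric] power_mult_distrib[symmetric] NP_def) (intro prod.cong, auto)
    qed
    have e1: "(\<Prod>i=1..?k. (if i \<noteq> Suc ?l then 1 else 1 - reach i) ^ (d (i - 1) - 1)) = ?c"
    proof -
      have "(\<Prod>i=1..?k. (if i \<noteq> Suc ?l then 1 else 1 - reach i) ^ (d (i - 1) - 1)) = (\<Prod>i=1..?k. if i
        = Suc ?l then ?c else 1)"
        by (intro prod.cong) auto
      then show ?thesis using prod_single_factor[where n = ?k and k = "Suc ?l" and h = ?c] l by simp
    qed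
    have e2: "(\<Prod>i=1..?k'. (if Suc ?l < i then 1 else 1 - reach i) ^ (d (i - 1) - 1)) = NP (Suc ?l)"
    proof -
      have "NP (Suc ?l) = (\<Prod>i\<in>{i\<in>{1..?k'}. i \<le> Suc ?l}. (1 - reach i) ^ (d (i - 1) - 1))"
        unfolding NP_def using l by (intro prod.cong) auto
      also have "\<dots> = (\<Prod>i=1..?k'. if i \<le> Suc ?l then (1 - reach i) ^ (d (i - 1) - 1) else 1)"
        by (simp only: prod.inter_filter finite_atLeastAtMost)
      also have "\<dots> = (\<Prod>i=1..?k'. (if Suc ?l < i then 1 else 1 - reach i) ^ (d (i - 1) - 1))"
        by (intro prod.cong) auto
      finally show ?thesis by simp
    qed
    have "(\<Prod>y\<in>Y. 1 - reach (level T y)) = (\<Prod>y\<in>{y \<in> offpath v. level T y \<noteq> Suc ?l}. 1 - reach (level T y))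
        * (\<Prod>y\<in>{y \<in> offpath u. Suc ?l < level T y}. 1 - reach (level T y))"
      unfolding Y_def using Pv(6) Pu(6) Y2(3) by (intro prod.union_disjoint) auto
    also have "\<dots> = (NP ?k / ?c) * (NP ?k' / (NP ?l * ?c))"
    proof (rule arg_cong2[where f = "(*)"])
      show "(\<Prod>y\<in>{y \<in> offpath v. level T y \<noteq> Suc ?l}. 1 - reach (level T y)) = NP ?k / ?c"
        by (rule eq_divide_imp[OF less_imp_neq[OF c(1), symmetric] split[OF v', of "\<lambda>i. i \<noteq> Suc ?l",
          unfolded e1]])
      show "(\<Prod>y\<in>{y \<in> offpath u. Suc ?l < level T y}. 1 - reach (level T y)) = NP ?k' / (NP ?l * ?c)"
        by (rule eq_divide_imp[OF less_imp_neq[OF mult_pos_pos[OF NP_pos c(1)], symmetric] split[OF u',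
          of "\<lambda>i. Suc ?l < i", unfolded e2 NPl]])
    qed
    also have "\<dots> = NP ?k * NP ?k' / (NP ?l * (?c * ?c))" by simp
    also have "\<dots> \<le> NP ?k * NP ?k' / (NP ?l * \<epsilon> ^ (2 * (d ?l - 1)))"
    proof -
      have "\<epsilon> ^ (2 * (d ?l - 1)) \<le> ?c * ?c"
        using c eps by (simp add: mult_2 power_add mult_mono)
      then show ?thesis using NP_pos eps c(1) by (intro divide_left_mono mult_left_mono mult_pos_pos)
        (auto simp: less_imp_le c)
    qed
    finally show "(\<Prod>y\<in>Y. 1 - reach (level T y)) \<le> NP ?k * NP ?k' / (NP ?l * \<epsilon> ^ (2 * (d ?l - 1)))" .
  qed (use W_pos perc_prob_bounds r h0 in \<open>auto intro!: mult_nonneg_nonneg divide_nonneg_nonneg simp: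
    less_imp_le\<close>)
  finally show ?thesis by (simp add: G_def r_def power2_eq_square field_simps)
qed

end

section \<open>The second moment\<close>

lemma sum_geometric_distance_le:
  fixes r :: real
  assumes r: "0 \<le> r" "r < 1" and i: "i < N"
  shows "(\<Sum>j<N. r ^ (if j \<le> i then i - j else j - i)) \<le> 2 / (1 - r)"
proof -
  have geo: "(\<Sum>m\<in>A. r ^ m) \<le> 1 / (1 - r)" if "finite A" for A
    using sum_le_suminf[OF summable_geometric[of r] that] r suminf_geometric[of r] by simp
  have "(\<Sum>j<N. r ^ (if j \<le> i then i - j else j - i))
      = (\<Sum>j\<in>{..i}. r ^ (if j \<le> i then i - j else j - i)) + (\<Sum>j\<in>{i<..<N}. r ^ (if j
        \<le> i then i - j else j - i))"
    using i by (subst sum.union_disjoint[symmetric]) (auto intro!: sum.cong)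
  also have "(\<Sum>j\<in>{..i}. r ^ (if j \<le> i then i - j else j - i)) = (\<Sum>m\<in>{..i}. r ^ m)"
    by (rule sum.reindex_bij_witness[of _ "\<lambda>m. i - m" "\<lambda>j. i - j"]) auto
  also have "(\<Sum>j\<in>{i<..<N}. r ^ (if j \<le> i then i - j else j - i)) = (\<Sum>m\<in>{0<..<N - i}. r ^ m)"
    by (rule sum.reindex_bij_witness[of _ "\<lambda>m. i + m" "\<lambda>j. j - i"]) auto
  finally show ?thesis using geo[of "{..i}"] geo[of "{0<..<N - i}"] by simp
qed

text \<open>A Riemann sum for the integral of \<open>exp (- c * l * \<bar>t - s\<bar>)\<close> over
  the unit square, which is of order \<open>1 / l\<close>. The inner sum is geometric with ratio
  \<open>exp (- c * l / N)\<close>; a grid with \<open>l \<le> N\<close> keeps the discretisation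
  error of the same order. \<open>Suc l\<close> on the right includes \<open>l = 0\<close>.\<close>

lemma sum_time_decay_le:
  fixes c :: real
  assumes c: "0 < c" and N: "0 < N" "l \<le> N"
  shows "(\<Sum>i<N. \<Sum>j<N. (1 / real N)\<^sup>2 * exp (- (c * \<bar>real i / real N - real j / real N\<bar>)) ^ l)
    \<le> (4 + 4 / c) / real (Suc l)"
proof (cases "l = 0")
  case True
  then show ?thesis using c N by (simp add: power2_eq_square)
next
  case False
  define y where "y = c * real l / real N"
  define r where "r = exp (- y)"
  have y: "0 < y" using c N False by (simp add: y_def)
  have r: "0 \<le> r" "r < 1" using y by (auto simp: r_def)
  have term_eq: "exp (- (c * \<bar>real i / real N - real j / real N\<bar>)) ^ l = r ^ (if j
    \<le> i then i - j else j - i)" for i j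
  proof -
    have "real (if j \<le> i then i - j else j - i) = \<bar>real i - real j\<bar>" by auto
    moreover have "\<bar>real i / real N - real j / real N\<bar> = \<bar>real i - real j\<bar> / real N"
      by (simp add: diff_divide_distrib[symmetric])
    ultimately have "real l * (- (c * \<bar>real i / real N - real j / real N\<bar>)) = real (if j
      \<le> i then i - j else j - i) * (- y)"
      unfolding y_def by (simp only:) (simp add: field_simps)
    then show ?thesis unfolding r_def exp_of_nat_mult[symmetric] by simp
  qed
  have "r \<le> 1 / (1 + y)" using exp_ge_add_one_self[of y] y by (simp add: r_def exp_minus field_simps)
  then have "y / (1 + y) \<le> 1 - r" using y by (simp add: field_simps)
  then have "1 / (1 - r) \<le> (1 + y) / y"
    using y r by (simp add: field_simps)
  also have "(1 + y) / y = 1 + 1 / y" using y by (simp add: add_divide_distrib)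
  also have "\<dots> = 1 + real N / (c * real l)" by (simp add: y_def)
  finally have ir: "1 / (1 - r) \<le> 1 + real N / (c * real l)" .
  have "(\<Sum>i<N. \<Sum>j<N. (1 / real N)\<^sup>2 * exp (- (c * \<bar>real i / real N - real j / real N\<bar>)) ^ l)
      = (\<Sum>i<N. (1 / real N)\<^sup>2 * (\<Sum>j<N. r ^ (if j \<le> i then i - j else j - i)))"
    unfolding term_eq by (simp add: sum_distrib_left)
  also have "\<dots> \<le> (\<Sum>i<N. (1 / real N)\<^sup>2 * (2 / (1 - r)))"
    by (intro sum_mono mult_left_mono sum_geometric_distance_le r) auto
  also have "\<dots> = 2 / real N * (1 / (1 - r))" using N by (simp add: power2_eq_square)
  also have "\<dots> \<le> 2 / real N * (1 + real N / (c * real l))" using ir by (intro mult_left_mono) auto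
  also have "\<dots> = 2 / real N + 2 / c / real l" using N by (simp add: field_simps)
  also have "\<dots> \<le> 2 / real l + 2 / c / real l" using N False by (intro add_right_mono divide_left_mono) auto
  also have "\<dots> = (2 + 2 / c) * (1 / real l)" by (simp add: add_divide_distrib)
  also have "\<dots> \<le> (2 + 2 / c) * (2 / real (Suc l))" using c False by (intro mult_left_mono)
    (auto simp: field_simps)
  also have "\<dots> = (4 + 4 / c) / real (Suc l)" by (simp add: field_simps)
  finally show ?thesis .
qed

lemma sep_Suc_imp: "sep K (Suc m) a \<Longrightarrow> sep K m a"
proof (induction m arbitrary: a)
  case (Suc m)
  then show ?case unfolding sep.simps(2)[of K "Suc m"] sep.simps(2)[of K m] by blast
qed simp

context spherical_percolation
begin

lemma pr_paley_zygmund: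
  assumes fin: "finite I" and U: "\<And>i. i \<in> I \<Longrightarrow> dep (edges T) (U i)"
    and \<mu>: "\<mu> = (\<Sum>i\<in>I. pr (U i))" "0 < \<mu>" and C: "0 < C"
    and second: "(\<Sum>i\<in>I. \<Sum>j\<in>I. pr (\<lambda>\<omega>. U i \<omega> \<and> U j \<omega>)) \<le> C * \<mu>\<^sup>2"
    and m: "0 < m" "real m \<le> \<mu> / 2"
  shows "1 / (4 * C) \<le> pr (\<lambda>\<omega>. m \<le> card {i \<in> I. U i \<omega>})"
proof -
  let ?A = "{\<omega> \<in> space M. m \<le> card {i \<in> I. U i \<omega>}}"
  let ?B = "\<lambda>i. {\<omega> \<in> space M. U i \<omega>}"
  define Y :: "_ \<Rightarrow> real" where "Y \<omega> = (\<Sum>i\<in>I. indicator (?B i) \<omega>)" for \<omega>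
  have A: "?A \<in> sets M" using dep_events[OF pr_card_ge_le(1)[OF fin U m(1)]] by simp
  have B: "?B i \<in> sets M" if "i \<in> I" for i using dep_events[OF U[OF that]] by simp
  have intB: "integrable M (indicator S :: _ \<Rightarrow> real)" if "S \<in> sets M" for S
    using that by (intro integrable_real_indicator) (auto simp: less_top[symmetric])
  have Ysq: "(Y \<omega>)\<^sup>2 = (\<Sum>i\<in>I. \<Sum>j\<in>I. indicator (?B i \<inter> ?B j) \<omega>)" for \<omega>
    unfolding Y_def power2_eq_square sum_product by (simp add: indicator_inter_arith)
  have intY: "integrable M Y" unfolding Y_def using B by (intro Bochner_Integration.integrable_sum intB)
  have intY2: "integrable M (\<lambda>\<omega>. (Y \<omega>)\<^sup>2)"
    unfolding Ysq using B by (intro Bochner_Integration.integrable_sum intB) auto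
  have EY: "(\<integral>\<omega>. Y \<omega> \<partial>M) = \<mu>"
    unfolding Y_def \<mu>(1) pr_def using B intB by (subst Bochner_Integration.integral_sum) auto
  have "(\<integral>\<omega>. (Y \<omega>)\<^sup>2 \<partial>M) = (\<Sum>i\<in>I. \<Sum>j\<in>I. measure M (?B i \<inter> ?B j))"
    unfolding Ysq using B intB
    by (subst Bochner_Integration.integral_sum, force intro!: Bochner_Integration.integrable_sum intB)
      (intro sum.cong refl, subst Bochner_Integration.integral_sum, auto intro!: intB)
  also have "\<dots> = (\<Sum>i\<in>I. \<Sum>j\<in>I. pr (\<lambda>\<omega>. U i \<omega> \<and> U j \<omega>))"
    unfolding pr_def by (intro sum.cong refl arg_cong[where f = "measure M"]) auto
  finally have EY2: "(\<integral>\<omega>. (Y \<omega>)\<^sup>2 \<partial>M) \<le> C * \<mu>\<^sup>2" using second by simp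
  have Ycard: "Y \<omega> = real (card {i \<in> I. U i \<omega>})" if "\<omega> \<in> space M" for \<omega>
  proof -
    have "Y \<omega> = (\<Sum>i\<in>I. if U i \<omega> then 1 else 0)"
      unfolding Y_def using that by (intro sum.cong) (auto simp: indicator_def)
    then show ?thesis using fin by (simp add: sum.If_cases Int_def)
  qed
  \<comment> \<open>Chosen so that integrating the pointwise bound below leaves
    \<open>\<mu> / 4\<close> from the second moment, half of what remains after truncation at
    \<open>\<mu> / 2\<close>.\<close>
  define q where "q = 1 / (2 * C * \<mu>)"
  have q: "0 < q" using \<mu> C by (simp add: q_def)
  \<comment> \<open>On \<open>?A\<close> this follows from
    \<open>(q * Y \<omega> - 1)\<^sup>2 \<ge> 0\<close>, which plays the part of the Cauchy-Schwarz
    inequality; off \<open>?A\<close> the count is below \<open>\<mu> / 2\<close>.\<close>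
  have pt: "Y \<omega> \<le> \<mu> / 2 + (q / 2 * (Y \<omega>)\<^sup>2 + 1 / (2 * q) * indicator ?A \<omega>)" if "\<omega> \<in> space M" for \<omega>
  proof (cases "\<omega> \<in> ?A")
    case True
    have "0 \<le> (q * Y \<omega> - 1)\<^sup>2 / (2 * q)" using q by simp
    also have "\<dots> = q / 2 * (Y \<omega>)\<^sup>2 + 1 / (2 * q) - Y \<omega>" using q by (simp add: field_simps power2_eq_square)
    finally show ?thesis using True \<mu> by simp
  next
    case False
    then have "card {i \<in> I. U i \<omega>} < m" using that by auto
    then have "Y \<omega> \<le> \<mu> / 2" using Ycard[OF that] m(2) by simp
    moreover have "0 \<le> q / 2 * (Y \<omega>)\<^sup>2" using q by simp
    ultimately show ?thesis using False by simp
  qed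
  have "(\<integral>\<omega>. Y \<omega> \<partial>M) \<le> (\<integral>\<omega>. \<mu> / 2 + (q / 2 * (Y \<omega>)\<^sup>2 + 1 / (2 * q) * indicator ?A \<omega>) \<partial>M)"
  proof (rule integral_mono[OF intY _ pt])
    show "integrable M (\<lambda>\<omega>. \<mu> / 2 + (q / 2 * (Y \<omega>)\<^sup>2 + 1 / (2 * q) * indicator ?A \<omega>))"
      by (intro Bochner_Integration.integrable_add integrable_mult_right intY2 intB A) auto
  qed
  then have "\<mu> \<le> (\<integral>\<omega>. \<mu> / 2 + (q / 2 * (Y \<omega>)\<^sup>2 + 1 / (2 * q) * indicator ?A \<omega>) \<partial>M)" unfolding EY .
  also have "\<dots> = \<mu> / 2 + (q / 2 * (\<integral>\<omega>. (Y \<omega>)\<^sup>2 \<partial>M) + 1 / (2 * q) * measure M ?A)"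
    using intY2 intB[OF A] A by (simp add: Bochner_Integration.integral_add M.prob_space)
  also have "\<dots> \<le> \<mu> / 2 + (q / 2 * (C * \<mu>\<^sup>2) + 1 / (2 * q) * measure M ?A)"
    using EY2 q by (intro add_left_mono add_right_mono mult_left_mono) auto
  also have "q / 2 * (C * \<mu>\<^sup>2) = \<mu> / 4" using \<mu> C by (simp add: q_def power2_eq_square)
  also have "1 / (2 * q) = C * \<mu>" using \<mu> C by (simp add: q_def)
  finally have "\<mu> * (1 / 4) \<le> \<mu> * (C * measure M ?A)" by (simp add: algebra_simps)
  then have "1 / 4 \<le> C * measure M ?A" using \<mu>(2) by (simp only: mult_le_cancel_left_pos)
  then show ?thesis using C by (simp add: pr_def field_simps)
qed

section \<open>Counting along paths and within subtrees\<close>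

lemma sum_ancestors:
  fixes f :: "nat \<Rightarrow> real"
  assumes "v \<in> verts T"
  shows "(\<Sum>a\<in>ancestors T v. f (level T a)) = (\<Sum>i=1..level T v. f i)"
  using rt assms
proof (induction rule: tree_induct)
  case (step v)
  have "v \<notin> ancestors T (parent T v)"
    using ancestors_edges(2)[OF rt step(2), of v] level_parent[OF rt step(1)] by auto
  then show ?case
    using step(3) ancestors_edges(3)[OF rt step(2)] level_parent[OF rt step(1)]
    by (simp add: ancestors_step[OF rt step(1)])
qed simp

lemma card_level_subtree:
  assumes a: "a \<in> level_set T l" and k: "l \<le> k"
  shows "card (level_set T k \<inter> subtree T a) * card (level_set T l) = card (level_set T k)"
  using k
proof (induction k rule: dec_induct)
  case base
  have "level_set T l \<inter> subtree T a = {a}"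
    using a subtree_level_eq[of _ T a] subtree_refl[of a T] by (auto simp: level_set_def)
  then show ?case by simp
next
  case (step k)
  have av: "a \<in> verts T" "level T a = l" using a by (auto simp: level_set_def)
  have eq: "level_set T (Suc k) \<inter> subtree T a = (\<Union>v\<in>level_set T k \<inter> subtree T a. children T v)"
  proof safe
    fix y assume y: "y \<in> level_set T (Suc k)" "y \<in> subtree T a"
    then have ne: "y \<noteq> a" using av step by (auto simp: level_set_def)
    note q = subtree_parent[OF y(2) ne av(1)]
    have "parent T y \<in> level_set T k" using y(1) level_parent[OF rt q(1)] subtree_verts[OF q(2)]
      by (simp add: level_set_def)
    moreover have "y \<in> children T (parent T y)" using q(1) by (simp add: children_def)
    ultimately show "y \<in> (\<Union>v\<in>level_set T k \<inter> subtree T a. children T v)" using q(2) by blast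
  next
    fix v y assume v: "v \<in> level_set T k" "v \<in> subtree T a" and y: "y \<in> children T v"
    show "y \<in> level_set T (Suc k)" using v(1) y unfolding level_set_Suc by blast
    have "y \<in> subtree T v" using subtree_child_iff[OF childrenD(5)[OF y], of y] y subtree_refl[OF
      childrenD(2)[OF y]] by blast
    then show "y \<in> subtree T a" using subtree_trans v(2) by blast
  qed
  have "card (level_set T (Suc k) \<inter> subtree T a) = (\<Sum>v\<in>level_set T k \<inter> subtree T a. card (children T v))"
    unfolding eq using finite_level[of k]
    by (intro card_UN_disjoint) (auto simp: level_set_def finite_children dest: childrenD(3))
  also have "\<dots> = (\<Sum>v\<in>level_set T k \<inter> subtree T a. d k)"
    by (intro sum.cong) (auto simp: level_set_def card_children)
  finally show ?case using step.IH by (simp add: card_level_set_Suc)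
qed

lemma card_level_subtree_le:
  assumes a: "a \<in> level_set T l"
  shows "real (card (level_set T k \<inter> subtree T a)) \<le> real (card (level_set T k)) / real (card (level_set
    T l))"
proof (cases "l \<le> k")
  case True
  have "0 < card (level_set T l)" using a finite_level by (auto simp: card_gt_0_iff)
  moreover have "real (card (level_set T k \<inter> subtree T a)) * real (card (level_set T l))
    = real (card (level_set T k))"
    using card_level_subtree[OF a True] by (metis of_nat_mult)
  ultimately show ?thesis by (simp add: field_simps)
next
  case False
  have "level_set T k \<inter> subtree T a = {}"
    using subtree_level[of _ T a] a False by (fastforce simp: level_set_def)
  then show ?thesis by simp
qed

text \<open>The deepest common vertex of the two paths, which share at least the root. Neither of
  \<open>v\<close> and \<open>u\<close> lies on the path of the other, so it is strictly above
  both.\<close>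

lemma meet_exists:
  assumes v: "v \<in> edges T" "u \<in> edges T" and n: "v \<notin> ancestors T u" "u \<notin> ancestors T v"
  shows "\<exists>a\<in>verts T. v \<in> subtree T a \<and> u \<in> subtree T a \<and> level T a < level T v \<and> level T a < level T u
    \<and> (\<forall>z. z \<in> ancestors T v \<longrightarrow> z \<in> ancestors T u \<longrightarrow> level T z \<le> level T a)"
proof -
  note v' = edges_verts[OF v(1)] and u' = edges_verts[OF v(2)]
  let ?C = "path v \<inter> path u"
  have fin: "finite (level T ` ?C)" using finite_path[OF v'] by simp
  have ne: "level T ` ?C \<noteq> {}" by (auto simp: path_def)
  obtain a where a: "a \<in> ?C" "level T a = Max (level T ` ?C)" using Max_in[OF fin ne] by auto
  have a': "a \<in> verts T" "v \<in> subtree T a" "u \<in> subtree T a" using a(1) path_iff[OF v'] path_iff[OF u']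
    by auto
  have "v \<notin> path u" "u \<notin> path v" using n v by (auto simp: path_def edges_def)
  then have "a \<noteq> v" "a \<noteq> u" using a(1) by auto
  then have "level T a < level T v" "level T a < level T u"
    using subtree_level[OF a'(2)] subtree_level[OF a'(3)] subtree_level_eq[OF a'(2)] subtree_level_eq[OF
      a'(3)]
    by (auto simp: order.order_iff_strict)
  moreover have "level T z \<le> level T a" if "z \<in> ancestors T v" "z \<in> ancestors T u" for z
    unfolding a(2) using that by (intro Max_ge[OF fin]) (auto simp: path_def)
  ultimately show ?thesis using a' by blast
qed

end

lemma sum_swap3:
  "(\<Sum>v\<in>V. \<Sum>l\<in>L. \<Sum>a\<in>A l. f v l a) = (\<Sum>l\<in>L. \<Sum>a\<in>A l. \<Sum>v\<in>V. f v l a)"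
  by (subst sum.swap) (intro sum.cong refl sum.swap)

lemma one_minus_exp_ge_half: "0 \<le> h \<Longrightarrow> h \<le> 1 \<Longrightarrow> h / 2 \<le> 1 - exp (- h :: real)"
proof -
  assume h: "0 \<le> h" "h \<le> 1"
  have "exp (- h) \<le> 1 / (1 + h)" using exp_ge_add_one_self[of h] h by (simp add: exp_minus field_simps)
  also have "\<dots> \<le> 1 - h / 2" using h mult_left_le[of h h] by (simp add: field_simps)
  finally show ?thesis by simp
qed

context spherical_percolation
begin

definition F :: "nat \<Rightarrow> real" where "F k = w k * perc_prob d p k * NP k"

lemma w_eq: "w k = real (card (level_set T k)) * W k"
  by (simp add: mean_conn_def W_def)

lemma F_eq: "F k = real (card (level_set T k)) * G k"
  by (simp add: F_def G_def w_eq)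

lemma F_nonneg: "0 \<le> F k"
  by (simp add: F_eq G_nonneg)

definition upto_level :: "nat \<Rightarrow> 'v set" where
  "upto_level m = (\<Union>k\<in>{1..m}. level_set T k)"

lemma upto_levelD:
  assumes "v \<in> upto_level m"
  shows "v \<in> edges T" "v \<in> verts T" "1 \<le> level T v" "level T v \<le> m"
  using assms by (auto simp: upto_level_def level_set_def edges_def)

lemma upto_levelI: "v \<in> edges T \<Longrightarrow> level T v \<le> m \<Longrightarrow> v \<in> upto_level m"
  using level_edges[of v] edges_verts[of v] by (auto simp: upto_level_def level_set_def)

lemma finite_upto_level: "finite (upto_level m)"
  using finite_level by (simp add: upto_level_def)

lemma sum_upto_level:
  "(\<Sum>v\<in>upto_level m. f v) = (\<Sum>k=1..m. \<Sum>v\<in>level_set T k. f v)"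
  unfolding upto_level_def
  by (rule sum.UNION_disjoint) (auto simp: finite_level, auto simp: level_set_def)

lemma sum_upto_level_G: "(\<Sum>v\<in>upto_level m. G (level T v)) = (\<Sum>k=1..m. F k)"
proof -
  have "(\<Sum>v\<in>level_set T k. G (level T v)) = F k" for k
  proof -
    have "(\<Sum>v\<in>level_set T k. G (level T v)) = (\<Sum>v\<in>level_set T k. G k)"
      by (intro sum.cong) (auto simp: level_set_def)
    then show ?thesis by (simp add: F_eq)
  qed
  then show ?thesis unfolding sum_upto_level by simp
qed

text \<open>The constant of \<open>sum_time_decay_le\<close> at the decay rate
  \<open>\<epsilon> / 2\<close> of an edge open at two times.\<close>

definition decay_const :: real where "decay_const = 4 + 4 / (\<epsilon> / 2)"

lemma decay_const_pos: "0 < decay_const"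
  using eps by (simp add: decay_const_def add_pos_pos)

definition pair_sum :: "nat \<Rightarrow> 'v \<Rightarrow> 'v \<Rightarrow> real" where
  "pair_sum n v u = (\<Sum>i<n. \<Sum>j<n. pr (\<lambda>\<omega>. pivotal_close v (real i / real n) (real i / real n + 1 / real n) \<omega>
     \<and> pivotal_close u (real j / real n) (real j / real n + 1 / real n) \<omega>))"

lemma pair_sum_sym: "pair_sum n v u = pair_sum n u v"
  unfolding pair_sum_def by (subst sum.swap) (simp add: conj_commute)

text \<open>Summing over the grid turns \<open>level T v - 1\<close> decay factors into
  \<open>1 / level T v\<close>. Only for \<open>v = u\<close> and equal cells is the pair a single
  event, of order \<open>1 / n\<close> in place of \<open>1 / n\<^sup>2\<close>; these
  \<open>n\<close> cells give the extra \<open>G\<close>.\<close>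

lemma pair_sum_comparable:
  assumes u: "u \<in> edges T" and v: "v \<in> ancestors T u" and n: "0 < n" "level T v \<le> n"
  shows "pair_sum n v u \<le> decay_const / real (level T v) * G (level T u) + (if v
    = u then G (level T u) else 0)"
proof -
  let ?h = "1 / real n" and ?k = "level T v" and ?G = "G (level T u)"
  let ?e = "\<lambda>i j. exp (- (\<epsilon> / 2 * \<bar>real i / real n - real j / real n\<bar>))"
  have ve: "v \<in> edges T" using v subtree_ancestors[OF edges_verts[OF u]] by simp
  have k: "1 \<le> ?k" using level_edges[OF ve] .
  have le: "pr (\<lambda>\<omega>. pivotal_close v (real i / real n) (real i / real n + ?h) \<omega>
    \<and> pivotal_close u (real j / real n) (real j / real n + ?h) \<omega>)
      \<le> ?h\<^sup>2 * ?e i j ^ (?k - 1) * ?G + (if i = j then (if v = u then ?h * ?G else 0) else 0)"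
        if ij: "i < n" "j < n" for i j
  proof (cases "v = u \<and> i = j")
    case True
    then have "pr (\<lambda>\<omega>. pivotal_close v (real i / real n) (real i / real n + ?h) \<omega>
      \<and> pivotal_close u (real j / real n) (real j / real n + ?h) \<omega>)
        \<le> ?h * ?G" using pr_pivotal_close_le[OF u, of "real i / real n" ?h] by simp
    also have "\<dots> \<le> ?h\<^sup>2 * ?e i j ^ (?k - 1) * ?G + ?h * ?G" using G_nonneg by simp
    finally show ?thesis using True by simp
  next
    case False
    have "pr (\<lambda>\<omega>. pivotal_close v (real i / real n) (real i / real n + ?h) \<omega>
      \<and> pivotal_close u (real j / real n) (real j / real n + ?h) \<omega>)
        \<le> ?h\<^sup>2 * ?e i j ^ (?k - 1) * ?G"
    proof (rule pr_pivotal_close_comparable[OF u v])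
      show "v \<noteq> u \<or> real i / real n + ?h \<le> real j / real n \<or> real j / real n + ?h \<le> real i / real n"
      proof (cases "v = u")
        case True
        then have "Suc i \<le> j \<or> Suc j \<le> i" using False by auto
        then have "real (Suc i) / real n \<le> real j / real n \<or> real (Suc j) / real n \<le> real i / real n"
          using n(1) by (auto simp: divide_le_cancel simp del: of_nat_Suc)
        then show ?thesis by (simp add: add_divide_distrib add.commute)
      qed simp
    qed (use ij in auto)
    then show ?thesis using False G_nonneg by auto
  qed
  have "pair_sum n v u \<le> (\<Sum>i<n. \<Sum>j<n. ?h\<^sup>2 * ?e i j ^ (?k - 1) * ?G + (if i = j then (if v
    = u then ?h * ?G else 0) else 0))"
    unfolding pair_sum_def by (intro sum_mono le) auto
  also have "\<dots> = (\<Sum>i<n. \<Sum>j<n. ?h\<^sup>2 * ?e i j ^ (?k - 1)) * ?G + (if v = u then ?G else 0)"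
    using n(1) by (simp add: sum.distrib sum_distrib_right)
  also have "\<dots> \<le> decay_const / real (Suc (?k - 1)) * ?G + (if v = u then ?G else 0)"
    unfolding decay_const_def using eps n k
    by (intro add_right_mono mult_right_mono sum_time_decay_le G_nonneg) auto
  finally show ?thesis using k by simp
qed

lemma pair_sum_meet:
  assumes v: "v \<in> edges T" and u: "u \<in> edges T" and a: "v \<in> subtree T a" "u \<in> subtree T a" "a \<in> verts T"
    and l: "level T a < level T v" "level T a < level T u"
    and meet: "\<And>z. z \<in> ancestors T v \<Longrightarrow> z \<in> ancestors T u \<Longrightarrow> level T z \<le> level T a"
    and n: "0 < n" "level T a \<le> n"
  shows "pair_sum n v u \<le> decay_const / real (Suc (level T a))
    * (G (level T v) * G (level T u) / (W (level T a) * NP (level T a) * \<epsilon> ^ (2 * (d (level T a) - 1))))"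
proof -
  let ?h = "1 / real n" and ?G = "G (level T v) * G (level T u) / (W (level T a) * NP (level T a) * \<epsilon> ^
    (2 * (d (level T a) - 1)))"
  let ?e = "\<lambda>i j. exp (- (\<epsilon> / 2 * \<bar>real i / real n - real j / real n\<bar>))"
  have G0: "0 \<le> ?G" using G_nonneg W_pos NP_pos eps by (simp add: less_imp_le)
  have "pair_sum n v u \<le> (\<Sum>i<n. \<Sum>j<n. ?h\<^sup>2 * ?e i j ^ level T a * ?G)"
    unfolding pair_sum_def by (intro sum_mono pr_pivotal_close_meet[OF v u a l meet]) auto
  also have "\<dots> = (\<Sum>i<n. \<Sum>j<n. ?h\<^sup>2 * ?e i j ^ level T a) * ?G" by (simp only: sum_distrib_right)
  also have "\<dots> \<le> decay_const / real (Suc (level T a)) * ?G"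
    unfolding decay_const_def using eps n
    by (intro mult_right_mono sum_time_decay_le G0) auto
  finally show ?thesis .
qed

text \<open>Two vertices are comparable or separate at a vertex \<open>a\<close>. In the second case
  the term of that \<open>a\<close> is bounded by the sum over all \<open>a\<close> above both: the
  overcount is harmless, and each term factorises in \<open>v\<close> and \<open>u\<close>.\<close>

lemma pair_sum_le:
  assumes D: "\<And>k. d k \<le> D" and v: "v \<in> upto_level m" and u: "u \<in> upto_level m" and n: "0 < n" "m \<le> n"
  shows "pair_sum n v u
    \<le> (\<Sum>l<m. \<Sum>a\<in>level_set T l. decay_const / (real (Suc l) * (W l * NP l * \<epsilon> ^ (2 * D)))
          * ((if v \<in> subtree T a then G (level T v) else 0) * (if u \<in> subtree T a then G (level T u) else 0)))
      + (if v \<in> ancestors T u then decay_const / real (level T v) * G (level T u) else 0)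
      + (if u \<in> ancestors T v then decay_const / real (level T u) * G (level T v) else 0)
      + (if v = u then G (level T u) else 0)" (is "_ \<le> ?A + ?B + ?C + ?E")
proof -
  note v' = upto_levelD[OF v] and u' = upto_levelD[OF u]
  have e1: "\<epsilon> \<le> 1" using p_ge[of 1] p_le[of 1] eps by simp
  let ?X = "\<lambda>l. decay_const / (real (Suc l) * (W l * NP l * \<epsilon> ^ (2 * D)))"
  have X0: "0 \<le> ?X l" for l using decay_const_pos W_pos[of l] NP_pos[of l] eps by simp
  have t0: "0 \<le> ?X l * ((if v \<in> subtree T a then G (level T v) else 0) * (if u \<in> subtree T a then G
    (level T u) else 0))" for l a
    by (intro mult_nonneg_nonneg X0) (auto simp: G_nonneg)
  have A0: "0 \<le> ?A" by (intro sum_nonneg t0)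
  have BC0: "0 \<le> ?B" "0 \<le> ?C" "0 \<le> ?E" using decay_const_pos G_nonneg by auto
  consider (vu) "v \<in> ancestors T u" | (uv) "u \<in> ancestors T v" | (no) "v \<notin> ancestors T u" "u \<notin> ancestors
    T v" by blast
  then show ?thesis
  proof cases
    case vu
    then show ?thesis using pair_sum_comparable[OF u'(1) vu n(1)] v'(4) n(2) A0 BC0 by auto
  next
    case uv
    have "pair_sum n v u \<le> ?C + ?E"
      using pair_sum_comparable[OF v'(1) uv n(1)] u'(4) n(2) uv unfolding pair_sum_sym[of n v u] by auto
    then show ?thesis using A0 BC0 by linarith
  next
    case no
    obtain a where a: "a \<in> verts T" "v \<in> subtree T a" "u \<in> subtree T a" "level T a < level T v" "level T
      a < level T u"
      "\<And>z. z \<in> ancestors T v \<Longrightarrow> z \<in> ancestors T u \<Longrightarrow> level T z \<le> level T a"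
      using meet_exists[OF v'(1) u'(1) no] by blast
    let ?l = "level T a"
    have am: "a \<in> level_set T ?l" "?l < m" using a v' by (auto simp: level_set_def)
    have "pair_sum n v u \<le> decay_const / real (Suc ?l) * (G (level T v) * G (level T u) / (W ?l * NP ?l
      * \<epsilon> ^ (2 * (d ?l - 1))))"
      using a n am(2) by (intro pair_sum_meet[OF v'(1) u'(1)]) auto
    also have "\<dots> \<le> decay_const / real (Suc ?l) * (G (level T v) * G (level T u) / (W ?l * NP ?l * \<epsilon> ^ (2
      * D)))"
    proof -
      have "\<epsilon> ^ (2 * D) \<le> \<epsilon> ^ (2 * (d ?l - 1))"
        using eps e1 D[of ?l] by (intro power_decreasing) auto
      then show ?thesis
        using decay_const_pos G_nonneg W_pos[of ?l] NP_pos[of ?l] eps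
        by (intro mult_left_mono divide_left_mono mult_nonneg_nonneg) auto
    qed
    also have "\<dots> = ?X ?l * ((if v \<in> subtree T a then G (level T v) else 0) * (if u \<in> subtree T a then G
      (level T u) else 0))"
      using a by simp
    also have "\<dots> \<le> (\<Sum>a\<in>level_set T ?l. ?X ?l
          * ((if v \<in> subtree T a then G (level T v) else 0) * (if u \<in> subtree T a then G (level T u)
            else 0)))"
      by (rule member_le_sum[OF am(1) t0 finite_level])
    also have "\<dots> \<le> ?A"
      using am(2) by (intro member_le_sum[where f = "\<lambda>l. \<Sum>a\<in>level_set T l. ?X l
          * ((if v \<in> subtree T a then G (level T v) else 0) * (if u \<in> subtree T a then G (level T u)
            else 0))"] sum_nonneg t0) auto
    finally show ?thesis using BC0 by linarith
  qed
qed

text \<open>By symmetry the mass of each deeper level is spread evenly over the vertices of level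
  \<open>l\<close>; levels closer to the root contribute nothing.\<close>

lemma sum_subtree_G_le:
  assumes a: "a \<in> level_set T l"
  shows "(\<Sum>v\<in>upto_level m. if v \<in> subtree T a then G (level T v) else 0)
    \<le> (\<Sum>k=1..m. F k) / real (card (level_set T l))"
proof -
  have "(\<Sum>v\<in>level_set T k. if v \<in> subtree T a then G (level T v) else 0)
    \<le> F k / real (card (level_set T l))" for k
  proof -
    have "(\<Sum>v\<in>level_set T k. if v \<in> subtree T a then G (level T v) else 0)
      = (\<Sum>v\<in>level_set T k \<inter> subtree T a. G (level T v))"
      using finite_level by (simp add: sum.inter_restrict)
    also have "\<dots> = (\<Sum>v\<in>level_set T k \<inter> subtree T a. G k)" by (intro sum.cong) (auto simp: level_set_def)
    also have "\<dots> = real (card (level_set T k \<inter> subtree T a)) * G k" by simp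
    also have "\<dots> \<le> real (card (level_set T k)) / real (card (level_set T l)) * G k"
      by (intro mult_right_mono card_level_subtree_le[OF a] G_nonneg)
    finally show ?thesis by (simp add: F_eq)
  qed
  then show ?thesis unfolding sum_upto_level sum_divide_distrib by (intro sum_mono)
qed

text \<open>A vertex has one ancestor at each level down to its own, so the comparable pairs cost a
  harmonic factor. It is unbounded, but will be absorbed by a first moment of at least the same
  order.\<close>

lemma sum_ancestors_G_le:
  "(\<Sum>v\<in>upto_level m. \<Sum>u\<in>upto_level m. if v \<in> ancestors T u then decay_const / real (level T v) * G
    (level T u) else 0)
    \<le> decay_const * (\<Sum>k=1..m. 1 / real k) * (\<Sum>k=1..m. F k)"
proof -
  have "(\<Sum>v\<in>upto_level m. if v \<in> ancestors T u then decay_const / real (level T v) * G (level T u) else 0)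
      \<le> decay_const * (\<Sum>k=1..m. 1 / real k) * G (level T u)" if u: "u \<in> upto_level m" for u
  proof -
    note u' = upto_levelD[OF u]
    have "ancestors T u \<subseteq> upto_level m"
      using ancestors_edges(1,2)[OF rt u'(2)] u'(4) by (blast intro: upto_levelI order.trans)
    then have eq: "{v \<in> upto_level m. v \<in> ancestors T u} = ancestors T u" by blast
    have "(\<Sum>v\<in>upto_level m. if v \<in> ancestors T u then decay_const / real (level T v) * G (level T u) else 0)
       = (\<Sum>v\<in>ancestors T u. decay_const / real (level T v) * G (level T u))"
      unfolding sum.inter_filter[OF finite_upto_level, symmetric] eq ..
    also have "\<dots> = (\<Sum>k=1..level T u. decay_const / real k * G (level T u))"
      by (rule sum_ancestors[OF u'(2)])
    also have "\<dots> = decay_const * (\<Sum>k=1..level T u. 1 / real k) * G (level T u)"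
      by (simp add: sum_distrib_left sum_distrib_right)
    also have "\<dots> \<le> decay_const * (\<Sum>k=1..m. 1 / real k) * G (level T u)"
      using u'(4) decay_const_pos by (intro mult_right_mono mult_left_mono sum_mono2 G_nonneg) auto
    finally show ?thesis .
  qed
  then have "(\<Sum>u\<in>upto_level m. \<Sum>v\<in>upto_level m. if v \<in> ancestors T u then decay_const / real (level T v)
    * G (level T u) else 0)
      \<le> (\<Sum>u\<in>upto_level m. decay_const * (\<Sum>k=1..m. 1 / real k) * G (level T u))"
    by (intro sum_mono)
  then show ?thesis
    by (subst sum.swap) (simp add: sum_distrib_left[symmetric] sum_upto_level_G)
qed

text \<open>The sum over \<open>a\<close> at level \<open>l\<close> is bounded by
  \<open>card (level_set T l)\<close> equal terms, each with the inverse square of that number; one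
  inverse factor remains and joins \<open>W l\<close> to form \<open>w l\<close>.\<close>

lemma sum_pair_sum_le:
  assumes D: "\<And>k. d k \<le> D" and n: "0 < n" "m \<le> n"
  shows "(\<Sum>v\<in>upto_level m. \<Sum>u\<in>upto_level m. pair_sum n v u)
    \<le> decay_const / \<epsilon> ^ (2 * D) * (\<Sum>l<m. 1 / (real (Suc l) * (w l * NP l))) * (\<Sum>k=1..m. F k)\<^sup>2
      + 2 * (decay_const * (\<Sum>k=1..m. 1 / real k) * (\<Sum>k=1..m. F k)) + (\<Sum>k=1..m. F k)"
proof -
  let ?V = "upto_level m" and ?S = "\<Sum>k=1..m. F k"
  let ?X = "\<lambda>l. decay_const / (real (Suc l) * (W l * NP l * \<epsilon> ^ (2 * D)))"
  let ?g = "\<lambda>a v. if v \<in> subtree T a then G (level T v) else 0"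
  have X0: "0 \<le> ?X l" for l using decay_const_pos W_pos[of l] NP_pos[of l] eps by simp
  have "(\<Sum>v\<in>?V. \<Sum>u\<in>?V. pair_sum n v u) \<le> (\<Sum>v\<in>?V. \<Sum>u\<in>?V.
      (\<Sum>l<m. \<Sum>a\<in>level_set T l. ?X l * (?g a v * ?g a u))
      + (if v \<in> ancestors T u then decay_const / real (level T v) * G (level T u) else 0)
      + (if u \<in> ancestors T v then decay_const / real (level T u) * G (level T v) else 0)
      + (if v = u then G (level T u) else 0))"
    by (intro sum_mono pair_sum_le[OF D _ _ n])
  also have "\<dots> = (\<Sum>v\<in>?V. \<Sum>u\<in>?V. \<Sum>l<m. \<Sum>a\<in>level_set T l. ?X l * (?g a v * ?g a u))
      + (\<Sum>v\<in>?V. \<Sum>u\<in>?V. if v \<in> ancestors T u then decay_const / real (level T v) * G (level T u) else 0)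
      + (\<Sum>v\<in>?V. \<Sum>u\<in>?V. if u \<in> ancestors T v then decay_const / real (level T u) * G (level T v) else 0)
      + (\<Sum>v\<in>?V. \<Sum>u\<in>?V. if v = u then G (level T u) else 0)"
    by (simp only: sum.distrib)
  also have "(\<Sum>v\<in>?V. \<Sum>u\<in>?V. if v = u then G (level T u) else 0) = ?S"
    using sum_upto_level_G[of m] by (simp add: finite_upto_level)
  also have "(\<Sum>v\<in>?V. \<Sum>u\<in>?V. if u \<in> ancestors T v then decay_const / real (level T u) * G (level T v) else 0)
      = (\<Sum>v\<in>?V. \<Sum>u\<in>?V. if v \<in> ancestors T u then decay_const / real (level T v) * G (level T u) else 0)"
    by (rule sum.swap)
  also have "(\<Sum>v\<in>?V. \<Sum>u\<in>?V. \<Sum>l<m. \<Sum>a\<in>level_set T l. ?X l * (?g a v * ?g a u))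
      = (\<Sum>l<m. \<Sum>a\<in>level_set T l. ?X l * ((\<Sum>v\<in>?V. ?g a v) * (\<Sum>u\<in>?V. ?g a u)))"
  proof -
    have "(\<Sum>v\<in>?V. \<Sum>u\<in>?V. \<Sum>l<m. \<Sum>a\<in>level_set T l. ?X l * (?g a v * ?g a u))
        = (\<Sum>v\<in>?V. \<Sum>l<m. \<Sum>a\<in>level_set T l. \<Sum>u\<in>?V. ?X l * (?g a v * ?g a u))"
      by (intro sum.cong refl sum_swap3)
    also have "\<dots> = (\<Sum>l<m. \<Sum>a\<in>level_set T l. \<Sum>v\<in>?V. \<Sum>u\<in>?V. ?X l * (?g a v * ?g a u))"
      by (rule sum_swap3)
    finally show ?thesis by (simp only: sum_distrib_left[symmetric] sum_distrib_right[symmetric])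
  qed
  also have "\<dots> \<le> (\<Sum>l<m. \<Sum>a\<in>level_set T l. ?X l * ((?S / real (card (level_set T l))) * (?S / real (card
    (level_set T l)))))"
    using X0 G_nonneg F_nonneg
    by (intro sum_mono mult_left_mono mult_mono sum_subtree_G_le)
      (auto intro!: sum_nonneg divide_nonneg_nonneg)
  also have "\<dots> = (\<Sum>l<m. decay_const / \<epsilon> ^ (2 * D) * (1 / (real (Suc l) * (w l * NP l))) * ?S\<^sup>2)"
  proof (intro sum.cong refl)
    fix l
    have "0 < real (card (level_set T l))" using level_set_nonempty finite_level by (simp add: card_gt_0_iff)
    then show "(\<Sum>a\<in>level_set T l. ?X l * ((?S / real (card (level_set T l))) * (?S / real (card
      (level_set T l)))))
      = decay_const / \<epsilon> ^ (2 * D) * (1 / (real (Suc l) * (w l * NP l))) * ?S\<^sup>2"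
      using W_pos[of l] NP_pos[of l] eps by (simp add: w_eq power2_eq_square)
  qed
  also have "\<dots> = decay_const / \<epsilon> ^ (2 * D) * (\<Sum>l<m. 1 / (real (Suc l) * (w l * NP l))) * ?S\<^sup>2"
    by (simp only: sum_distrib_left sum_distrib_right)
  finally show ?thesis using sum_ancestors_G_le[of m] by simp
qed

section \<open>First and second moment of the number of cells with a pivotal closing\<close>

lemma pr_bonferroni:
  assumes "finite V" "\<And>v. v \<in> V \<Longrightarrow> dep (edges T) (P v)"
  shows "(\<Sum>v\<in>V. pr (P v)) - (\<Sum>v\<in>V. \<Sum>u\<in>V - {v}. pr (\<lambda>\<omega>. P v \<omega> \<and> P u \<omega>)) \<le> pr (\<lambda>\<omega>. \<exists>v\<in>V. P v \<omega>)"
  using assms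
proof (induction V rule: finite_induct)
  case empty
  then show ?case by (simp add: pr_def)
next
  case (insert y V)
  let ?E = "\<lambda>\<omega>. \<exists>v\<in>V. P v \<omega>"
  have dE: "dep (edges T) ?E" using insert by (intro dep_bex) auto
  have dy: "dep (edges T) (P y)" using insert by auto
  have "{\<omega> \<in> space M. \<exists>v\<in>insert y V. P v \<omega>} = {\<omega> \<in> space M. P y \<omega>} \<union> {\<omega> \<in> space M. ?E \<omega>}" by auto
  then have "pr (\<lambda>\<omega>. \<exists>v\<in>insert y V. P v \<omega>) = measure M ({\<omega> \<in> space M. P y \<omega>} \<union> {\<omega> \<in> space M. ?E \<omega>})"
    by (simp add: pr_def)
  also have "\<dots> = pr (P y) + pr ?E - measure M ({\<omega> \<in> space M. P y \<omega>} \<inter> {\<omega> \<in> space M. ?E \<omega>})"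
    using M.finite_measure_Union'[OF dep_events[OF dy] dep_events[OF dE]]
      M.finite_measure_Diff'[OF dep_events[OF dE] dep_events[OF dy]] by (simp add: pr_def Int_commute)
  also have "{\<omega> \<in> space M. P y \<omega>} \<inter> {\<omega> \<in> space M. ?E \<omega>} = {\<omega> \<in> space M. \<exists>v\<in>V. P y \<omega> \<and> P v \<omega>}" by auto
  finally have eq: "pr (\<lambda>\<omega>. \<exists>v\<in>insert y V. P v \<omega>) = pr (P y) + pr ?E - pr (\<lambda>\<omega>. \<exists>v\<in>V. P y \<omega> \<and> P v \<omega>)"
    by (simp add: pr_def)
  have "pr (\<lambda>\<omega>. \<exists>v\<in>V. P y \<omega> \<and> P v \<omega>) \<le> (\<Sum>v\<in>V. pr (\<lambda>\<omega>. P y \<omega> \<and> P v \<omega>))"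
    using insert by (intro pr_bex_le[where S = "\<lambda>_. edges T"]) (auto intro: dep_conj)
  moreover have "(\<Sum>v\<in>V. \<Sum>u\<in>V - {v}. pr (\<lambda>\<omega>. P v \<omega> \<and> P u \<omega>)) \<le> (\<Sum>v\<in>V. \<Sum>u\<in>insert y V - {v}. pr (\<lambda>\<omega>. P v \<omega>
    \<and> P u \<omega>))"
    using insert.hyps(1) pr_nonneg by (intro sum_mono sum_mono2) auto
  moreover have "insert y V - {y} = V" using insert.hyps by auto
  ultimately show ?case using insert.IH insert.prems insert.hyps unfolding eq by simp
qed

lemma pr_pivotal_close_same_time:
  assumes v: "v \<in> edges T" "u \<in> edges T" "v \<noteq> u" and t: "0 \<le> t" "0 \<le> h"
  shows "pr (\<lambda>\<omega>. pivotal_close v t (t + h) \<omega> \<and> pivotal_close u t (t + h) \<omega>) \<le> h\<^sup>2"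
proof -
  let ?c = "\<lambda>v \<omega>. config_at T p \<omega> t v \<and> \<not> config_at T p \<omega> (t + h) v"
  have dc: "dep {v} (?c v)" for v by (intro dep_conj dep_not dep_open) auto
  have anc: "z \<in> ancestors T z" if "z \<in> edges T" for z
    using that subtree_ancestors[OF edges_verts[OF that], of z] subtree_refl[OF edges_verts[OF that]] by simp
  have le: "pr (?c z) \<le> h" if z: "z \<in> edges T" for z
    using pr_open_closed_le[OF z t] mult_left_le_one_le[of h "p (level T z)"] t p_pos[OF level_edges[OF
      z]] p_less[OF level_edges[OF z]]
    by (auto intro: order.trans)
  have "pr (\<lambda>\<omega>. pivotal_close v t (t + h) \<omega> \<and> pivotal_close u t (t + h) \<omega>) \<le> pr (\<lambda>\<omega>. ?c v \<omega> \<and> ?c u \<omega>)"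
    using v anc[OF v(1)] anc[OF v(2)]
    by (intro pr_mono[where S = "edges T"] dep_conj[OF dep_mono[OF dc] dep_mono[OF dc]])
      (auto simp: pivotal_close_def)
  also have "\<dots> = pr (?c v) * pr (?c u)" using v by (intro pr_indep2[OF dc dc]) auto
  also have "\<dots> \<le> h * h" using v t by (intro mult_mono le pr_nonneg)
  finally show ?thesis by (simp add: power2_eq_square)
qed

text \<open>A cell counts once even if several edges close in it, so the sum over vertices is
  corrected by Bonferroni; two different closings in one cell have probability at most
  \<open>1 / n\<^sup>2\<close>. The factor \<open>\<epsilon> / 2\<close> combines
  \<open>1 - p k \<ge> \<epsilon>\<close> with \<open>1 - exp (- h) \<ge> h / 2\<close>.\<close>

lemma sum_pr_closing_ge:
  assumes n: "0 < n"
  shows "\<epsilon> / 2 * (\<Sum>k=1..m. F k) - (real (card (upto_level m)))\<^sup>2 / real n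
    \<le> (\<Sum>i<n. pr (\<lambda>\<omega>. \<exists>v\<in>upto_level m. pivotal_close v (real i / real n) (real i / real n + 1 / real n) \<omega>))"
proof -
  let ?V = "upto_level m" and ?h = "1 / real n"
  have h: "0 \<le> ?h" "?h \<le> 1" using n by auto
  have "?h * (\<epsilon> / 2 * (\<Sum>k=1..m. F k)) - (real (card ?V))\<^sup>2 * ?h\<^sup>2
      \<le> pr (\<lambda>\<omega>. \<exists>v\<in>?V. pivotal_close v t (t + ?h) \<omega>)" if t: "0 \<le> t" for t
  proof -
    have "?h * (\<epsilon> / 2 * (\<Sum>k=1..m. F k)) = \<epsilon> * (?h / 2) * (\<Sum>v\<in>?V. G (level T v))"
      unfolding sum_upto_level_G by simp
    also have "\<dots> = (\<Sum>v\<in>?V. \<epsilon> * (?h / 2) * G (level T v))"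
      by (rule sum_distrib_left)
    also have "\<dots> \<le> (\<Sum>v\<in>?V. pr (pivotal_close v t (t + ?h)))"
    proof (rule sum_mono)
      fix v assume v: "v \<in> ?V"
      note v' = upto_levelD[OF v]
      show "\<epsilon> * (?h / 2) * G (level T v) \<le> pr (pivotal_close v t (t + ?h))"
        unfolding pr_pivotal_close[OF v'(1) t h(1)]
        using p_le[OF v'(3)] eps h one_minus_exp_ge_half[OF h]
        by (intro mult_right_mono mult_mono G_nonneg) auto
    qed
    finally have 1: "?h * (\<epsilon> / 2 * (\<Sum>k=1..m. F k)) \<le> (\<Sum>v\<in>?V. pr (pivotal_close v t (t + ?h)))" .
    have "(\<Sum>v\<in>?V. \<Sum>u\<in>?V - {v}. pr (\<lambda>\<omega>. pivotal_close v t (t + ?h) \<omega> \<and> pivotal_close u t (t + ?h) \<omega>))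
        \<le> (\<Sum>v\<in>?V. \<Sum>u\<in>?V - {v}. ?h\<^sup>2)"
      using t h by (intro sum_mono pr_pivotal_close_same_time) (auto dest: upto_levelD)
    also have "\<dots> \<le> (\<Sum>v\<in>?V. \<Sum>u\<in>?V. ?h\<^sup>2)"
      using finite_upto_level by (intro sum_mono sum_mono2) auto
    also have "\<dots> = (real (card ?V))\<^sup>2 * ?h\<^sup>2" by (simp add: power2_eq_square)
    finally have 2: "(\<Sum>v\<in>?V. \<Sum>u\<in>?V - {v}. pr (\<lambda>\<omega>. pivotal_close v t (t + ?h) \<omega>
      \<and> pivotal_close u t (t + ?h) \<omega>))
        \<le> (real (card ?V))\<^sup>2 * ?h\<^sup>2" .
    show ?thesis
      using pr_bonferroni[OF finite_upto_level, of m "\<lambda>v. pivotal_close v t (t + ?h)"] 1 2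
        dep_pivotal_close[OF upto_levelD(1)] by (smt (verit))
  qed
  then have "(\<Sum>i<n. ?h * (\<epsilon> / 2 * (\<Sum>k=1..m. F k)) - (real (card ?V))\<^sup>2 * ?h\<^sup>2)
    \<le> (\<Sum>i<n. pr (\<lambda>\<omega>. \<exists>v\<in>?V. pivotal_close v (real i / real n) (real i / real n + ?h) \<omega>))"
    by (intro sum_mono) simp
  then show ?thesis using n by (simp add: right_diff_distrib power2_eq_square)
qed

lemma sum_pr_closing_pairs_le:
  "(\<Sum>i<n. \<Sum>j<n. pr (\<lambda>\<omega>. (\<exists>v\<in>upto_level m. pivotal_close v (real i / real n) (real i / real n + 1 / real n) \<omega>)
      \<and> (\<exists>u\<in>upto_level m. pivotal_close u (real j / real n) (real j / real n + 1 / real n) \<omega>)))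
    \<le> (\<Sum>v\<in>upto_level m. \<Sum>u\<in>upto_level m. pair_sum n v u)"
proof -
  let ?V = "upto_level m"
  let ?P = "\<lambda>i v. pivotal_close v (real i / real n) (real i / real n + 1 / real n)"
  have "pr (\<lambda>\<omega>. (\<exists>v\<in>?V. ?P i v \<omega>) \<and> (\<exists>u\<in>?V. ?P j u \<omega>)) \<le> (\<Sum>v\<in>?V. \<Sum>u\<in>?V. pr (\<lambda>\<omega>. ?P i v \<omega> \<and> ?P j u \<omega>))" for i j
  proof -
    have "pr (\<lambda>\<omega>. (\<exists>v\<in>?V. ?P i v \<omega>) \<and> (\<exists>u\<in>?V. ?P j u \<omega>)) = pr (\<lambda>\<omega>. \<exists>z\<in>?V \<times> ?V. ?P i (fst z) \<omega>
      \<and> ?P j (snd z) \<omega>)"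
      by (rule arg_cong[where f = pr]) (auto simp: fun_eq_iff)
    also have "\<dots> \<le> (\<Sum>z\<in>?V \<times> ?V. pr (\<lambda>\<omega>. ?P i (fst z) \<omega> \<and> ?P j (snd z) \<omega>))"
      using finite_upto_level
      by (intro pr_bex_le[where S = "\<lambda>_. edges T"]) (auto intro!: dep_conj dep_pivotal_close upto_levelD(1))
    also have "\<dots> = (\<Sum>v\<in>?V. \<Sum>u\<in>?V. pr (\<lambda>\<omega>. ?P i v \<omega> \<and> ?P j u \<omega>))"
      by (simp add: sum.cartesian_product split_beta)
    finally show ?thesis .
  qed
  then have "(\<Sum>i<n. \<Sum>j<n. pr (\<lambda>\<omega>. (\<exists>v\<in>?V. ?P i v \<omega>) \<and> (\<exists>u\<in>?V. ?P j u \<omega>)))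
     \<le> (\<Sum>i<n. \<Sum>j<n. \<Sum>v\<in>?V. \<Sum>u\<in>?V. pr (\<lambda>\<omega>. ?P i v \<omega> \<and> ?P j u \<omega>))" by (intro sum_mono)
  also have "\<dots> = (\<Sum>v\<in>?V. \<Sum>u\<in>?V. pair_sum n v u)"
    unfolding pair_sum_def sum_swap3[where V = "{..<n}" and L = ?V and A = "\<lambda>_. ?V"] ..
  finally show ?thesis .
qed

lemma perc_times_iff: "t \<in> {0..1} \<Longrightarrow> t \<in> perc_times T p \<omega> \<longleftrightarrow> perc T (config_at T p \<omega> t) (rho T)"
  by (simp add: perc_times_def root_percolates_iff perc_def)

lemma sep_of_closings:
  assumes n: "0 < n"
    and m: "m \<le> card {i \<in> {..<n}. \<exists>v\<in>upto_level k. pivotal_close v (real i / real n) (real i / real n +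
      1 / real n) \<omega>}"
  shows "sep (perc_times T p \<omega>) m 0"
proof (rule sep_of_downcrossings[OF n order.refl])
  note m
  also have "card {i \<in> {..<n}. \<exists>v\<in>upto_level k. pivotal_close v (real i / real n) (real i / real n + 1 /
    real n) \<omega>}
    \<le> card {i. i < n \<and> 0 \<le> real i / real n \<and> real i / real n \<in> perc_times T p \<omega>
      \<and> real (Suc i) / real n \<notin> perc_times T p \<omega>}"
  proof (rule card_mono)
    show "{i \<in> {..<n}. \<exists>v\<in>upto_level k. pivotal_close v (real i / real n) (real i / real n + 1 / real n) \<omega>}
      \<subseteq> {i. i < n \<and> 0 \<le> real i / real n \<and> real i / real n \<in> perc_times T p \<omega>
        \<and> real (Suc i) / real n \<notin> perc_times T p \<omega>}"
    proof safe
      fix i v assume i: "i < n" and v: "v \<in> upto_level k" and pc: "pivotal_close v (real i / real n)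
        (real i / real n + 1 / real n) \<omega>"
      have s: "real (Suc i) / real n = real i / real n + 1 / real n" by (simp add: add_divide_distrib)
      have "real i / real n \<in> {0..1}" "real (Suc i) / real n \<in> {0..1}" using i by auto
      then show "real i / real n \<in> perc_times T p \<omega>" "real (Suc i) / real n \<in> perc_times T p \<omega> \<Longrightarrow> False"
        using pivotal_close_imp[OF upto_levelD(1)[OF v] pc] perc_times_iff[of "real i / real n" \<omega>]
          perc_times_iff[of "real (Suc i) / real n" \<omega>]
        unfolding s by blast+
    qed auto
  qed auto
  finally show "m \<le> card {i. i < n \<and> 0 \<le> real i / real n \<and> real i / real n \<in> perc_times T p \<omega>
    \<and> real (Suc i) / real n \<notin> perc_times T p \<omega>}" .
qed

text \<open>The lower bound \<open>1 / (4 * C)\<close> for \<open>k\<close> separations does not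
  depend on \<open>k\<close>, so it survives the intersection over \<open>k\<close>. The hypothesis
  on \<open>F\<close> makes the first moment diverge like a harmonic sum and absorb the harmonic
  factor of the comparable pairs; \<open>B\<close> controls the pairs that separate.\<close>

theorem pr_infinite_components_pos:
  assumes D: "\<And>k. d k \<le> D"
    and c: "0 < c" "\<And>k. 1 \<le> k \<Longrightarrow> c / real k \<le> F k"
    and B: "\<And>m. (\<Sum>l<m. 1 / (real (Suc l) * (w l * NP l))) \<le> B"
  shows "0 < pr (\<lambda>\<omega>. infinite (components (perc_times T p \<omega>)))"
proof -
  define S where "S m = (\<Sum>k=1..m. F k)" for m
  define H where "H m = (\<Sum>k=1..m. 1 / real k)" for m :: nat
  \<comment> \<open>The three terms bound the separating pairs, the comparable pairs and the
    diagonal, each relative to the square of \<open>S m\<close>.\<close>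
  define Q where "Q = decay_const / \<epsilon> ^ (2 * D) * B + 2 * (decay_const / c) + 1 / c"
  \<comment> \<open>\<open>16 / \<epsilon>\<^sup>2\<close> converts the square of \<open>S m\<close>
    into that of the true first moment, which is at least
    \<open>\<epsilon> / 4 * S m\<close>.\<close>
  define C where "C = Q * (16 / \<epsilon>\<^sup>2)"
  have B0: "0 \<le> B" using B[of 0] by simp
  have Q: "0 < Q" unfolding Q_def using decay_const_pos c(1) eps B0
    by (intro add_nonneg_pos add_nonneg_nonneg) auto
  have C: "0 < C" using Q eps by (simp add: C_def)
  have HS: "c * H m \<le> S m" for m
    unfolding H_def S_def sum_distrib_left using c(2) by (intro sum_mono) auto
  have key: "1 / (4 * C) \<le> pr (\<lambda>\<omega>. sep (perc_times T p \<omega>) k 0)" if k: "0 < k" for k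
  proof -
    \<comment> \<open>Since \<open>S m \<ge> c * H m\<close>, this makes \<open>k\<close> at most
      half of \<open>\<epsilon> / 4 * S m\<close>.\<close>
    obtain m where m: "8 * real k / (\<epsilon> * c) < H m" "1 \<le> m"
    proof -
      have "filterlim (\<lambda>m. harm m :: real) at_top sequentially" by (rule harm_at_top)
      then have "eventually (\<lambda>m. 8 * real k / (\<epsilon> * c) < harm m) sequentially"
        by (simp add: filterlim_at_top_dense)
      then have "eventually (\<lambda>m. 8 * real k / (\<epsilon> * c) < harm m \<and> 1 \<le> m) sequentially"
        using eventually_ge_at_top[of 1] by eventually_elim simp
      then obtain m :: nat where "8 * real k / (\<epsilon> * c) < harm m" "1 \<le> m" by
        (auto simp: eventually_sequentially)
      then show ?thesis using that by (simp add: H_def harm_def divide_inverse)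
    qed
    have H1: "1 \<le> H m"
      unfolding H_def using m(2) member_le_sum[of 1 "{1..m}" "\<lambda>k. 1 / real k"] by simp
    have "c * 1 \<le> c * H m" using H1 c(1) by (intro mult_left_mono) auto
    then have S: "c \<le> S m" "0 < S m" using HS[of m] c(1) by linarith+
    have Sk: "real k \<le> \<epsilon> / 4 * S m / 2"
    proof -
      have "8 * real k < H m * (\<epsilon> * c)" using m(1) eps c(1) by (simp add: divide_less_eq)
      also have "\<dots> \<le> \<epsilon> * S m" using HS[of m] eps by (simp add: mult_ac mult_left_mono)
      finally show ?thesis by simp
    qed
    \<comment> \<open>The grid is refined until the Bonferroni correction uses up at most half of
      \<open>\<epsilon> / 2 * S m\<close>; \<open>m \<le> n\<close> serves the decay sums.\<close>
    obtain n :: nat where n: "m \<le> n" "0 < n" "(real (card (upto_level m)))\<^sup>2 / (\<epsilon> / 4 * S m) \<le> real n"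
    proof -
      obtain n0 :: nat where "(real (card (upto_level m)))\<^sup>2 / (\<epsilon> / 4 * S m) \<le> real n0"
        using real_arch_simple by blast
      then have "(real (card (upto_level m)))\<^sup>2 / (\<epsilon> / 4 * S m) \<le> real (max n0 (max m 1))" by
        (auto intro: order.trans)
      then show ?thesis by (intro that[of "max n0 (max m 1)"]) auto
    qed
    define U where "U i \<omega> \<longleftrightarrow> (\<exists>v\<in>upto_level m. pivotal_close v (real i / real n) (real i / real n + 1 /
      real n) \<omega>)" for i \<omega>
    define \<mu> where "\<mu> = (\<Sum>i<n. pr (U i))"
    have dU: "dep (edges T) (U i)" for i
      unfolding U_def[abs_def] by (intro dep_bex finite_upto_level dep_pivotal_close upto_levelD(1))
    have "(real (card (upto_level m)))\<^sup>2 / real n \<le> \<epsilon> / 4 * S m"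
      using n eps S(2) by (simp add: divide_le_eq mult_ac)
    then have \<mu>: "\<epsilon> / 4 * S m \<le> \<mu>"
      using sum_pr_closing_ge[OF n(2), of m] unfolding \<mu>_def U_def S_def[symmetric] by simp
    have "0 < \<epsilon> / 4 * S m" using eps S(2) by simp
    then have \<mu>0: "0 < \<mu>" using \<mu> by linarith
    have "(\<Sum>i<n. \<Sum>j<n. pr (\<lambda>\<omega>. U i \<omega> \<and> U j \<omega>))
      \<le> decay_const / \<epsilon> ^ (2 * D) * (\<Sum>l<m. 1 / (real (Suc l) * (w l * NP l))) * (S m)\<^sup>2
        + 2 * (decay_const * H m * S m) + S m"
      unfolding U_def S_def H_def by (rule order.trans[OF sum_pr_closing_pairs_le sum_pair_sum_le[OF D
        n(2,1)]])
    also have "\<dots> \<le> decay_const / \<epsilon> ^ (2 * D) * B * (S m)\<^sup>2 + 2 * (decay_const * (S m / c) * S m) + S m /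
      c * S m"
    proof (intro add_mono mult_right_mono mult_left_mono B)
      show "H m \<le> S m / c" using HS[of m] c(1) by (simp add: le_divide_eq mult.commute)
      show "S m \<le> S m / c * S m" using S c(1) by (simp add: le_divide_eq)
    qed (use decay_const_pos eps S(2) in auto)
    also have "\<dots> = Q * (S m)\<^sup>2" by (simp add: Q_def power2_eq_square algebra_simps)
    also have "\<dots> \<le> Q * (16 / \<epsilon>\<^sup>2 * \<mu>\<^sup>2)"
    proof -
      have "(\<epsilon> / 4 * S m)\<^sup>2 \<le> \<mu>\<^sup>2" using \<mu> eps S(2) by (intro power_mono) auto
      then have "(S m)\<^sup>2 \<le> 16 / \<epsilon>\<^sup>2 * \<mu>\<^sup>2" using eps by (simp add: power2_eq_square field_simps)
      then show ?thesis using Q by (intro mult_left_mono) auto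
    qed
    finally have second: "(\<Sum>i<n. \<Sum>j<n. pr (\<lambda>\<omega>. U i \<omega> \<and> U j \<omega>)) \<le> C * \<mu>\<^sup>2" by (simp add: C_def)
    have "real k \<le> \<mu> / 2" using Sk \<mu> by simp
    then have "1 / (4 * C) \<le> pr (\<lambda>\<omega>. k \<le> card {i \<in> {..<n}. U i \<omega>})"
      using pr_paley_zygmund[of "{..<n}" U \<mu> C k] dU \<mu>_def \<mu>0 C second k by simp
    also have "\<dots> \<le> pr (\<lambda>\<omega>. sep (perc_times T p \<omega>) k 0)"
      unfolding U_def by (rule pr_mono[OF sep_of_closings[OF n(2)] dep_sep]) auto
    finally show ?thesis .
  qed
  let ?E = "\<lambda>k. {\<omega> \<in> space M. sep (perc_times T p \<omega>) k 0}"
  have "(\<lambda>k. measure M (?E k)) \<longlonglongrightarrow> measure M (\<Inter>k. ?E k)"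
  proof (rule M.finite_Lim_measure_decseq)
    show "range ?E \<subseteq> sets M" using dep_events[OF dep_sep] by auto
    show "decseq ?E" unfolding decseq_Suc_iff using sep_Suc_imp by blast
  qed
  also have "(\<Inter>k. ?E k) = {\<omega> \<in> space M. infinite (components (perc_times T p \<omega>))}"
    by (auto simp: infinite_components_perc_times)
  finally have "(\<lambda>k. measure M (?E k)) \<longlonglongrightarrow> pr (\<lambda>\<omega>. infinite (components (perc_times T p \<omega>)))"
    by (simp add: pr_def)
  then have "1 / (4 * C) \<le> pr (\<lambda>\<omega>. infinite (components (perc_times T p \<omega>)))"
  proof (rule LIMSEQ_le_const)
    have "1 / (4 * C) \<le> measure M (?E k)" if "1 \<le> k" for k using key[of k] that by (simp add: pr_def)
    then show "\<exists>N. \<forall>k\<ge>N. 1 / (4 * C) \<le> measure M (?E k)" by blast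
  qed
  moreover have "0 < 1 / (4 * C)" using C by simp
  ultimately show ?thesis by linarith
qed

end

section \<open>Growth of the mean cluster size\<close>

lemma one_minus_power_second_order:
  fixes x :: real
  assumes "0 \<le> x" "x \<le> 1"
  shows "(1 - x) ^ i \<le> 1 - real i * x + (real i)\<^sup>2 * x\<^sup>2"
proof (induction i)
  case (Suc i)
  have "(1 - x) ^ Suc i \<le> (1 - x) * (1 - real i * x + (real i)\<^sup>2 * x\<^sup>2)"
    using assms Suc by (simp add: mult_left_mono)
  also have "\<dots> = 1 - real (Suc i) * x + ((real i)\<^sup>2 + real i) * x\<^sup>2 - (real i)\<^sup>2 * x ^ 3"
    by (simp add: algebra_simps power2_eq_square power3_eq_cube)
  also have "\<dots> \<le> 1 - real (Suc i) * x + (real (Suc i))\<^sup>2 * x\<^sup>2"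
  proof -
    have "((real i)\<^sup>2 + real i) * x\<^sup>2 \<le> (real (Suc i))\<^sup>2 * x\<^sup>2"
      by (intro mult_right_mono) (auto simp: power2_eq_square algebra_simps)
    moreover have "0 \<le> (real i)\<^sup>2 * x ^ 3" using assms by simp
    ultimately show ?thesis by linarith
  qed
  finally show ?case .
qed simp

lemma average_powers_le:
  fixes x :: real
  assumes x: "0 \<le> x" "x \<le> 1" and n: "1 \<le> n"
  shows "(\<Sum>i<n. (1 - x) ^ i) / real n \<le> 1 - real (n - 1) * x / 2 + (real n)\<^sup>2 * x\<^sup>2"
proof -
  have s1: "(\<Sum>i<n. real i) = real n * real (n - 1) / 2"
  proof -
    have "2 * (\<Sum>i<n. real i) = real n * (real n - 1)" by (induction n) (auto simp: algebra_simps)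
    then show ?thesis using n by (simp add: of_nat_diff)
  qed
  have "(\<Sum>i<n. (1 - x) ^ i) \<le> (\<Sum>i<n. 1 - real i * x + (real n)\<^sup>2 * x\<^sup>2)"
  proof (rule sum_mono)
    fix i assume "i \<in> {..<n}"
    then have "(real i)\<^sup>2 * x\<^sup>2 \<le> (real n)\<^sup>2 * x\<^sup>2" by (intro mult_right_mono power_mono) auto
    then show "(1 - x) ^ i \<le> 1 - real i * x + (real n)\<^sup>2 * x\<^sup>2"
      using one_minus_power_second_order[OF x, of i] by linarith
  qed
  also have "\<dots> = real n - (\<Sum>i<n. real i * x) + real n * ((real n)\<^sup>2 * x\<^sup>2)"
    by (simp add: sum.distrib sum_subtractf)
  also have "(\<Sum>i<n. real i * x) = real n * real (n - 1) / 2 * x"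
    unfolding sum_distrib_right[symmetric] s1 ..
  also have "real n - real n * real (n - 1) / 2 * x + real n * ((real n)\<^sup>2 * x\<^sup>2)
      = real n * (1 - real (n - 1) * x / 2 + (real n)\<^sup>2 * x\<^sup>2)"
    by (simp add: algebra_simps)
  finally show ?thesis using n by (simp add: divide_le_eq mult.commute)
qed

text \<open>Converse of \<open>power_derivative_le\<close> up to a factor
  \<open>exp (O(x^2))\<close>: the square of the mean \<open>A\<close> of the powers and
  \<open>(1 - x) ^ (n - 1)\<close> agree to first order in \<open>x\<close>. The quadratic error
  becomes a relative one because \<open>(1 - x) ^ (n - 1) \<ge> e ^ D\<close>.\<close>

lemma power_derivative_ge:
  fixes x e :: real
  assumes e: "0 < e" "e \<le> 1" and x: "0 \<le> x" "x \<le> 1 - e" and n: "1 \<le> n" "n \<le> D"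
  shows "(1 - (1 - x) ^ n)\<^sup>2
    \<le> (1 - x) ^ (n - 1) * (real n * x)\<^sup>2 * exp ((3 * (real D)\<^sup>2 + (real D) ^ 4) / e ^ D * x\<^sup>2)"
proof -
  define A where "A = (\<Sum>i<n. (1 - x) ^ i) / real n"
  define z where "z = real (n - 1) * x / 2"
  define b where "b = (real n)\<^sup>2 * x\<^sup>2"
  define C where "C = 3 * (real D)\<^sup>2 + (real D) ^ 4"
  have x1: "x \<le> 1" using x e by simp
  have A: "0 \<le> A" "A \<le> 1 - z + b"
    unfolding A_def z_def b_def using x x1 average_powers_le[OF x(1) x1 n(1)] by
      (auto intro!: divide_nonneg_nonneg sum_nonneg)
  have zb: "0 \<le> z" "0 \<le> b" using x by (auto simp: z_def b_def)
  have "A\<^sup>2 \<le> (1 - z + b)\<^sup>2" using A by (intro power_mono) auto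
  also have "\<dots> = 1 - 2 * z + z\<^sup>2 + 2 * b - 2 * b * z + b\<^sup>2" by (simp add: power2_eq_square algebra_simps)
  also have "\<dots> \<le> 1 - 2 * z + (z\<^sup>2 + 2 * b + b\<^sup>2)" using zb mult_nonneg_nonneg[of b z] by simp
  also have "z\<^sup>2 + 2 * b + b\<^sup>2 \<le> C * x\<^sup>2"
  proof -
    have "real (n - 1) * x \<le> real n * x" using x by (intro mult_right_mono) auto
    moreover have "0 \<le> real n * x" using x by simp
    ultimately have "z \<le> real n * x" unfolding z_def by linarith
    then have "z\<^sup>2 \<le> b" unfolding b_def power_mult_distrib[symmetric] using zb by (intro power_mono) auto
    moreover have "b \<le> (real D)\<^sup>2 * x\<^sup>2" unfolding b_def using n by (intro mult_right_mono power_mono) auto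
    moreover have "b\<^sup>2 \<le> (real D) ^ 4 * x\<^sup>2"
    proof -
      have "b\<^sup>2 = (real n) ^ 4 * x\<^sup>2 * x\<^sup>2" by (simp add: b_def power_mult_distrib power2_eq_square
        power4_eq_xxxx)
      also have "\<dots> \<le> (real D) ^ 4 * x\<^sup>2 * 1"
        using n x x1 by (intro mult_mono power_mono) (auto intro: power_le_one)
      finally show ?thesis by simp
    qed
    ultimately show ?thesis by (simp add: C_def algebra_simps)
  qed
  also have "1 - 2 * z \<le> (1 - x) ^ (n - 1)"
    using Bernoulli_inequality[of "- x" "n - 1"] x1 by (simp add: z_def)
  finally have le: "A\<^sup>2 \<le> (1 - x) ^ (n - 1) + C * x\<^sup>2" by simp
  have eD: "e ^ D \<le> (1 - x) ^ (n - 1)"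
  proof -
    have "e ^ D \<le> e ^ (n - 1)" using e n by (intro power_decreasing) auto
    also have "\<dots> \<le> (1 - x) ^ (n - 1)" using e x by (intro power_mono) auto
    finally show ?thesis .
  qed
  have C0: "0 \<le> C" by (simp add: C_def)
  have "C * x\<^sup>2 = e ^ D * (C / e ^ D * x\<^sup>2)" using e by simp
  also have "\<dots> \<le> (1 - x) ^ (n - 1) * (C / e ^ D * x\<^sup>2)" using eD C0 e by (intro mult_right_mono) auto
  finally have "A\<^sup>2 \<le> (1 - x) ^ (n - 1) * (1 + C / e ^ D * x\<^sup>2)" using le by (simp add: algebra_simps)
  also have "\<dots> \<le> (1 - x) ^ (n - 1) * exp (C / e ^ D * x\<^sup>2)"
    using x1 by (intro mult_left_mono exp_ge_add_one_self) auto
  finally have A2: "A\<^sup>2 \<le> (1 - x) ^ (n - 1) * exp (C / e ^ D * x\<^sup>2)" .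
  have "(1 - (1 - x) ^ n)\<^sup>2 = (real n * x)\<^sup>2 * A\<^sup>2"
    unfolding one_minus_power_eq A_def using n by (simp add: power_mult_distrib power_divide)
  also have "\<dots> \<le> (real n * x)\<^sup>2 * ((1 - x) ^ (n - 1) * exp (C / e ^ D * x\<^sup>2))"
    using A2 by (intro mult_left_mono) auto
  finally show ?thesis by (simp add: C_def mult_ac)
qed

text \<open>The gain \<open>1 / (2 * D)\<close> over the linear approximation exists only at a
  branching vertex; for \<open>n = 1\<close> the inverse is exactly \<open>1 / x\<close>.\<close>

lemma inverse_one_minus_power_ge:
  fixes x :: real
  assumes x: "0 < x" "x \<le> 1" and n: "2 \<le> n" "n \<le> D"
  shows "1 / (real n * x) + 1 / (2 * real D) \<le> 1 / (1 - (1 - x) ^ n)"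
proof -
  define S where "S = (\<Sum>i<n. (1 - x) ^ i)"
  have "S = 1 + (\<Sum>i\<in>{1..<n}. (1 - x) ^ i)"
    unfolding S_def lessThan_atLeast0 using n by (subst sum.atLeast_Suc_lessThan) auto
  also have "(\<Sum>i\<in>{1..<n}. (1 - x) ^ i) \<le> (\<Sum>i\<in>{1..<n}. (1 - x) ^ 1)"
    using x by (intro sum_mono power_decreasing) auto
  also have "1 + (\<Sum>i\<in>{1..<n}. (1 - x) ^ 1) = real n - real (n - 1) * x"
    using n by (simp add: of_nat_diff algebra_simps)
  also have "\<dots> \<le> real n * (1 - x / 2)"
  proof -
    have "real n / 2 \<le> real (n - 1)" using n by (simp add: of_nat_diff)
    then have "real n / 2 * x \<le> real (n - 1) * x" using x by (intro mult_right_mono) auto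
    then show ?thesis by (simp add: algebra_simps)
  qed
  finally have S: "S \<le> real n * (1 - x / 2)" by simp
  have "1 \<le> S" unfolding S_def using member_le_sum[of 0 "{..<n}" "\<lambda>i. (1 - x) ^ i"] x n by simp
  then have S0: "0 < S" by simp
  have nx: "0 < real n * x" using x n by simp
  have "(1 + x / 2) * S \<le> (1 + x / 2) * (real n * (1 - x / 2))" using S x by (intro mult_left_mono) auto
  also have "\<dots> = real n * (1 - (x / 2)\<^sup>2)" by (simp add: algebra_simps power2_eq_square)
  also have "\<dots> \<le> real n * 1" by (intro mult_left_mono) auto
  finally have "(1 + x / 2) / real n \<le> 1 / S" using S0 n by (simp add: field_simps)
  then have "(1 + x / 2) / real n / x \<le> 1 / S / x" using x by (intro divide_right_mono) auto
  moreover have "(1 + x / 2) / real n / x = 1 / (real n * x) + 1 / (2 * real n)" using x n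
    by (simp add: field_simps)
  moreover have "1 / S / x = 1 / (1 - (1 - x) ^ n)" unfolding one_minus_power_eq S_def
    by (simp add: mult.commute)
  moreover have "1 / (2 * real D) \<le> 1 / (2 * real n)" using n by (intro divide_left_mono) auto
  ultimately show ?thesis by linarith
qed

context spherical_percolation
begin

text \<open>At a level without branching \<open>w (Suc j) \<le> (1 - \<epsilon>) * w j\<close>, so
  its term is at most \<open>1 - \<epsilon>\<close> times the next one. Such levels therefore carry
  at most that share of the sum, up to the boundary term \<open>1 / w n\<close>.\<close>

lemma sum_branching_ge:
  assumes "k \<le> n"
  shows "\<epsilon> * (\<Sum>j=k..<n. 1 / w j) - 1 / w n \<le> (\<Sum>j=k..<n. if 2 \<le> d j then 1 / w j else 0)"
proof -
  have "(\<Sum>j=k..<n. 1 / w j) \<le> (\<Sum>j=k..<n. (if 2 \<le> d j then 1 / w j else 0) + (1 - \<epsilon>) * (1 / w (Suc j)))"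
  proof (rule sum_mono)
    fix j assume "j \<in> {k..<n}"
    have e: "0 \<le> (1 - \<epsilon>) * (1 / w (Suc j))" using w_pos[of "Suc j"] p_ge[of 1] p_le[of 1] eps by simp
    show "1 / w j \<le> (if 2 \<le> d j then 1 / w j else 0) + (1 - \<epsilon>) * (1 / w (Suc j))"
    proof (cases "2 \<le> d j")
      case True
      then show ?thesis using e by simp
    next
      case False
      then have "d j = 1" using d_pos[of j] by simp
      then have "1 / w j = p (Suc j) * (1 / w (Suc j))"
        using w_pos[of j] p_pos[of "Suc j"] by (simp add: w_Suc)
      also have "\<dots> \<le> (1 - \<epsilon>) * (1 / w (Suc j))"
        using p_le[of "Suc j"] w_pos[of "Suc j"] by (intro mult_right_mono) auto
      finally show ?thesis using False by simp
    qed
  qed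
  also have "\<dots> = (\<Sum>j=k..<n. if 2 \<le> d j then 1 / w j else 0) + (1 - \<epsilon>) * (\<Sum>j=k..<n. 1 / w (Suc j))"
    by (simp add: sum.distrib sum_distrib_left)
  also have "(\<Sum>j=k..<n. 1 / w (Suc j)) = (\<Sum>j=k..<n. 1 / w j) + 1 / w n - 1 / w k"
    using assms sum_Suc_diff'[of k n "\<lambda>j. 1 / w j"] by (simp add: sum_subtractf)
  also have "(1 - \<epsilon>) * ((\<Sum>j=k..<n. 1 / w j) + 1 / w n - 1 / w k) \<le> (1 - \<epsilon>) * (\<Sum>j=k..<n. 1 / w j) + 1 / w n"
  proof -
    have e1: "0 \<le> 1 - \<epsilon>" "1 - \<epsilon> \<le> 1" using eps p_ge[of 1] p_le[of 1] by auto
    have "(1 - \<epsilon>) * (1 / w n - 1 / w k) \<le> (1 - \<epsilon>) * (1 / w n)"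
      using e1 w_pos[of k] by (intro mult_left_mono) auto
    also have "\<dots> \<le> 1 * (1 / w n)" using e1 w_pos[of n] by (intro mult_right_mono) auto
    finally have "(1 - \<epsilon>) * (1 / w n - 1 / w k) \<le> 1 / w n" by simp
    then show ?thesis by (simp add: algebra_simps)
  qed
  finally show ?thesis by (simp add: algebra_simps)
qed

section \<open>Percolation probabilities and tail sums\<close>

definition tail :: "nat \<Rightarrow> real" where "tail k = (\<Sum>j. 1 / w (j + k))"

context
  assumes summ: "summable (\<lambda>k. 1 / w k)"
begin

lemma summable_tail: "summable (\<lambda>j. 1 / w (j + k))"
  using summ by (subst summable_iff_shift)

lemma sum_le_tail: "(\<Sum>j=k..<n. 1 / w j) \<le> tail k"
proof -
  have "(\<Sum>j=k..<n. 1 / w j) = (\<Sum>j<n - k. 1 / w (j + k))"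
    by (rule sum.reindex_bij_witness[of _ "\<lambda>j. j + k" "\<lambda>j. j - k"]) auto
  also have "\<dots> \<le> tail k"
    unfolding tail_def using w_pos by (intro sum_le_suminf summable_tail) (auto simp: less_imp_le)
  finally show ?thesis .
qed

lemma tail_pos: "0 < tail k"
proof -
  have "0 < (\<Sum>j=k..<Suc k. 1 / w j)" using w_pos[of k] by simp
  then show ?thesis using sum_le_tail[of k "Suc k"] by linarith
qed

lemma sum_tends_tail: "(\<lambda>n. \<Sum>j=k..<n. 1 / w j) \<longlonglongrightarrow> tail k"
proof (rule LIMSEQ_offset[of _ k])
  have "(\<lambda>n. \<Sum>j<n. 1 / w (j + k)) \<longlonglongrightarrow> tail k"
    unfolding tail_def using summable_LIMSEQ[OF summable_tail] .
  moreover have "(\<Sum>j<n. 1 / w (j + k)) = (\<Sum>j=k..<n + k. 1 / w j)" for n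
    by (rule sum.reindex_bij_witness[of _ "\<lambda>j. j - k" "\<lambda>j. j + k"]) auto
  ultimately show "(\<lambda>n. \<Sum>j=k..<n + k. 1 / w j) \<longlonglongrightarrow> tail k" by simp
qed

lemma perc_prob_ge: "1 / (w k * tail k) \<le> perc_prob d p k"
proof (rule LIMSEQ_le_const[OF conn_prob_limit], intro exI allI impI)
  fix m
  have "1 / (w k * conn_prob d p m k) \<le> (\<Sum>j=k..<Suc (k + m). 1 / w j)"
    using inverse_conn_prob_le[of k m] by (simp only: atLeastLessThanSuc_atLeastAtMost)
  also have "\<dots> \<le> tail k" by (rule sum_le_tail)
  finally show "1 / (w k * tail k) \<le> conn_prob d p m k"
    using w_pos[of k] tail_pos[of k] conn_prob_bounds[of m k] by (simp add: field_simps)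
qed

lemma perc_prob_pos: "0 < perc_prob d p k"
proof -
  have "0 < 1 / (w k * tail k)" using w_pos[of k] tail_pos[of k] by simp
  then show ?thesis using perc_prob_ge[of k] by linarith
qed

lemma reach_pos: "1 \<le> k \<Longrightarrow> 0 < reach k"
  using perc_prob_pos p_pos by (simp add: reach_def)

text \<open>\<open>1 / (w k * perc_prob d p k)\<close> does not increase along the levels, and drops
  by at least \<open>1 / (2 * D * w j)\<close> at each branching level. Telescoping and
  \<open>sum_branching_ge\<close> recover a fixed share of the whole tail, and the boundary term
  \<open>1 / w n\<close> tends to 0.\<close>

lemma inverse_perc_prob_ge:
  assumes D: "\<And>k. d k \<le> D"
  shows "\<epsilon> / (2 * real D) * tail k \<le> 1 / (w k * perc_prob d p k)"
proof -
  let ?a = "\<lambda>k. 1 / (w k * perc_prob d p k)"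
  have D1: "1 \<le> D" using d_pos[of 0] D[of 0] by simp
  have step: "?a (Suc j) + 1 / (2 * real D) * (if 2 \<le> d j then 1 / w j else 0) \<le> ?a j" for j
  proof -
    have x: "0 < reach (Suc j)" "reach (Suc j) \<le> 1"
      using reach_pos[of "Suc j"] reach_bounds(2)[of "Suc j"] eps by auto
    have q: "perc_prob d p j = 1 - (1 - reach (Suc j)) ^ d j" unfolding reach_def by (rule perc_prob_rec)
    have eq: "1 / (real (d j) * reach (Suc j)) / w j = ?a (Suc j)"
      by (simp add: w_Suc reach_def mult_ac)
    have "1 / (real (d j) * reach (Suc j)) + (if 2 \<le> d j then 1 / (2 * real D) else 0) \<le> 1 / perc_prob d p j"
    proof (cases "2 \<le> d j")
      case True
      then show ?thesis unfolding q using inverse_one_minus_power_ge[OF x True D] by simp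
    next
      case False
      then have "d j = 1" using d_pos[of j] by simp
      then show ?thesis unfolding q by simp
    qed
    then have "(1 / (real (d j) * reach (Suc j)) + (if 2 \<le> d j then 1 / (2 * real D) else 0)) / w j
      \<le> 1 / perc_prob d p j / w j"
      using w_pos[of j] by (intro divide_right_mono) auto
    then show ?thesis unfolding add_divide_distrib eq by (simp add: mult.commute split: if_splits)
  qed
  have tel: "?a n + 1 / (2 * real D) * (\<Sum>j=k..<n. if 2 \<le> d j then 1 / w j else 0) \<le> ?a k" if "k \<le> n" for n
    using that
  proof (induction n rule: dec_induct)
    case (step n)
    then show ?case using \<open>\<And>j. ?a (Suc j) + 1 / (2 * real D) * (if 2 \<le> d j then 1 / w j else 0) \<le> ?a j\<close>[of n]
      by (simp add: distrib_left)
  qed simp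
  have bound: "1 / (2 * real D) * (\<epsilon> * (\<Sum>j=k..<n. 1 / w j) - 1 / w n) \<le> ?a k" if "k \<le> n" for n
  proof -
    have "0 \<le> ?a n" using w_pos[of n] perc_prob_pos[of n] by simp
    moreover have "1 / (2 * real D) * (\<epsilon> * (\<Sum>j=k..<n. 1 / w j) - 1 / w n)
        \<le> 1 / (2 * real D) * (\<Sum>j=k..<n. if 2 \<le> d j then 1 / w j else 0)"
      by (intro mult_left_mono sum_branching_ge that) simp
    ultimately show ?thesis using tel[OF that] by linarith
  qed
  have "(\<lambda>n. 1 / (2 * real D) * (\<epsilon> * (\<Sum>j=k..<n. 1 / w j) - 1 / w n)) \<longlonglongrightarrow> 1 / (2 * real D) * (\<epsilon> * tail k - 0)"
    by (intro tendsto_intros sum_tends_tail summable_LIMSEQ_zero summ)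
  then have "1 / (2 * real D) * (\<epsilon> * tail k - 0) \<le> ?a k"
    by (rule LIMSEQ_le_const2) (use bound in blast)
  then show ?thesis by (simp add: mult_ac)
qed

text \<open>With \<open>x = reach (Suc k)\<close>, passing from \<open>k\<close> to
  \<open>Suc k\<close> multiplies \<open>NP k * (w k * perc_prob d p k)\<^sup>2\<close> by \<open>(1
  - x) ^ (d k - 1) * (d k * x)\<^sup>2 / (1 - (1 - x) ^ d k)\<^sup>2\<close>, which
  \<open>power_derivative_ge\<close> bounds from below. So \<open>NP\<close> is at least a multiple
  of the inverse square as soon as the squares of \<open>reach\<close> are summable.\<close>

lemma NP_ge:
  assumes D: "\<And>k. d k \<le> D"
  shows "(perc_prob d p 0)\<^sup>2 * exp (- ((3 * (real D)\<^sup>2 + (real D) ^ 4) / \<epsilon> ^ D * (\<Sum>i=1..k. (reach i)\<^sup>2)))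
    \<le> NP k * (w k * perc_prob d p k)\<^sup>2"
proof (induction k)
  case 0
  then show ?case by (simp add: NP_def w_0)
next
  case (Suc k)
  let ?C = "(3 * (real D)\<^sup>2 + (real D) ^ 4) / \<epsilon> ^ D" and ?x = "reach (Suc k)"
  have e1: "\<epsilon> \<le> 1" using p_ge[of 1] p_le[of 1] eps by simp
  have q: "perc_prob d p k = 1 - (1 - ?x) ^ d k" unfolding reach_def by (rule perc_prob_rec)
  have "(perc_prob d p k)\<^sup>2 \<le> (1 - ?x) ^ (d k - 1) * (real (d k) * ?x)\<^sup>2 * exp (?C * ?x\<^sup>2)"
    unfolding q by (rule power_derivative_ge[OF eps e1 reach_bounds d_pos D]) auto
  then have le: "(perc_prob d p k)\<^sup>2 * exp (- (?C * ?x\<^sup>2)) \<le> (1 - ?x) ^ (d k - 1) * (real (d k) * ?x)\<^sup>2"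
    by (simp add: exp_minus field_simps)
  have "(perc_prob d p 0)\<^sup>2 * exp (- (?C * (\<Sum>i=1..Suc k. (reach i)\<^sup>2)))
      = (perc_prob d p 0)\<^sup>2 * exp (- (?C * (\<Sum>i=1..k. (reach i)\<^sup>2))) * exp (- (?C * ?x\<^sup>2))"
    by (simp add: exp_add[symmetric] distrib_left)
  also have "\<dots> \<le> NP k * (w k * perc_prob d p k)\<^sup>2 * exp (- (?C * ?x\<^sup>2))"
    using Suc by (intro mult_right_mono) auto
  also have "\<dots> = NP k * (w k)\<^sup>2 * ((perc_prob d p k)\<^sup>2 * exp (- (?C * ?x\<^sup>2)))"
    by (simp add: power_mult_distrib)
  also have "\<dots> \<le> NP k * (w k)\<^sup>2 * ((1 - ?x) ^ (d k - 1) * (real (d k) * ?x)\<^sup>2)"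
    using le NP_pos[of k] by (intro mult_left_mono) auto
  also have "\<dots> = NP (Suc k) * (w (Suc k) * perc_prob d p (Suc k))\<^sup>2"
    by (simp add: NP_def w_Suc reach_def power_mult_distrib mult_ac)
  finally show ?case .
qed

end

end

section \<open>From growth conditions to infinitely many components\<close>

lemma sum_inverse_squares_le: "(\<Sum>i=1..n. 1 / (real i)\<^sup>2) \<le> 2"
proof -
  have "(\<Sum>i=1..n. 1 / (real i)\<^sup>2) \<le> 2 - 1 / real n" if "1 \<le> n"
    using that
  proof (induction n rule: dec_induct)
    case (step n)
    have "1 / (real (Suc n))\<^sup>2 \<le> 1 / (real n * real (Suc n))"
      unfolding power2_eq_square using step(1) by (intro divide_left_mono mult_right_mono mult_pos_pos) auto
    also have "\<dots> = 1 / real n - 1 / real (Suc n)" using step(1) by (simp add: field_simps)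
    finally show ?case using step by simp
  qed simp
  then show ?thesis by (cases "1 \<le> n") (auto intro: order.trans)
qed

lemma sums_powr_le:
  assumes "\<beta> < -1"
  shows "(\<Sum>l<m. real l powr \<beta>) \<le> (\<Sum>l. real l powr \<beta>)"
  using assms by (intro sum_le_suminf) (auto simp: summable_real_powr_iff)

context spherical_percolation
begin

text \<open>\<open>w (Suc k) / w k = d k * p (Suc k) \<ge> \<epsilon> * d k\<close>, so growth by a
  bounded factor bounds the degrees. The growth condition starts at level 1, so \<open>d 0\<close>
  enters separately.\<close>

lemma bounded_degree_of_doubling:
  assumes K: "\<And>k. 1 \<le> k \<Longrightarrow> w (Suc k) \<le> K * w k"
  shows "\<exists>D. \<forall>k. d k \<le> D"
proof -
  define D where "D = max (d 0) (nat \<lceil>K / \<epsilon>\<rceil>)"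
  have "d k \<le> D" for k
  proof (cases "k = 0")
    case False
    have "w k * (real (d k) * \<epsilon>) \<le> w (Suc k)"
      unfolding w_Suc using w_pos[of k] p_ge[of "Suc k"] by (intro mult_left_mono) auto
    also have "\<dots> \<le> w k * K" using K[of k] False by (simp add: mult.commute)
    finally have "real (d k) * \<epsilon> \<le> K" using w_pos[of k] by (simp only: mult_le_cancel_left_pos)
    then have "real (d k) \<le> K / \<epsilon>" using eps by (simp add: le_divide_eq)
    then have "d k \<le> nat \<lceil>K / \<epsilon>\<rceil>" by linarith
    then show ?thesis by (simp add: D_def)
  qed (simp add: D_def)
  then show ?thesis by blast
qed

text \<open>Doubling gives \<open>tail k \<ge> k / (K * w k)\<close>, hence
  \<open>q\<^sub>k = O(1 / k)\<close> and summable squares of \<open>reach\<close>; so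
  \<open>F k\<close> is at least a multiple of \<open>tail k\<close>, which is at least of order
  \<open>1 / k\<close> since \<open>w k = O(k^2)\<close>. The terms of the pair sum are at most of
  order \<open>w k * q\<^sub>k\<^sup>2 / k\<close>, hence of order
  \<open>k powr (\<alpha> - 3)\<close>, summable for \<open>\<alpha> < 2\<close>.\<close>

theorem pr_infinite_components_pos_of_growth:
  assumes summ: "summable (\<lambda>k. 1 / w k)"
    and K: "\<And>k j. 1 \<le> k \<Longrightarrow> k \<le> j \<Longrightarrow> j \<le> 2 * k \<Longrightarrow> w j \<le> K * w k"
    and C: "\<And>k. 1 \<le> k \<Longrightarrow> w k \<le> C * real k powr \<alpha>" and \<alpha>: "\<alpha> < 2"
  shows "0 < pr (\<lambda>\<omega>. infinite (components (perc_times T p \<omega>)))"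
proof -
  have "w (Suc k) \<le> K * w k" if "1 \<le> k" for k using that by (intro K) auto
  then obtain D where D: "\<And>k. d k \<le> D" using bounded_degree_of_doubling by blast
  have D1: "1 \<le> D" using D[of 0] d_pos[of 0] by simp
  have "w 1 \<le> K * w 1" using K[of 1 1] by simp
  then have K1: "1 \<le> K" using w_pos[of 1] by simp
  have "0 < C * real 1 powr \<alpha>" using less_le_trans[OF w_pos C[OF order.refl]] .
  then have C0: "0 < C" by simp
  let ?q = "perc_prob d p"
  note qpos = perc_prob_pos[OF summ] and tpos = tail_pos[OF summ]
  have tail_ge: "real k / (K * w k) \<le> tail k" if k: "1 \<le> k" for k
  proof -
    have "real k / (K * w k) = (\<Sum>j=k..<2 * k. 1 / (K * w k))" by simp
    also have "\<dots> \<le> (\<Sum>j=k..<2 * k. 1 / w j)"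
      using K[OF k] w_pos K1 by (intro sum_mono divide_left_mono mult_pos_pos) auto
    also have "\<dots> \<le> tail k" by (rule sum_le_tail[OF summ])
    finally show ?thesis .
  qed
  define c0 where "c0 = \<epsilon> / (2 * real D)"
  have c0: "0 < c0" using eps D1 by (simp add: c0_def)
  have iq: "c0 * tail k \<le> 1 / (w k * ?q k)" for k
    unfolding c0_def by (rule inverse_perc_prob_ge[OF summ D])
  have q_le: "?q k \<le> K / c0 / real k" if k: "1 \<le> k" for k
  proof -
    have "c0 * (real k / (K * w k)) \<le> c0 * tail k" using tail_ge[OF k] c0 by (intro mult_left_mono) auto
    also have "\<dots> \<le> 1 / (w k * ?q k)" by (rule iq)
    finally show ?thesis using c0 K1 w_pos[of k] qpos[of k] k by (simp add: field_simps)
  qed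
  define C1 where "C1 = (3 * (real D)\<^sup>2 + (real D) ^ 4) / \<epsilon> ^ D"
  have C1: "0 \<le> C1" using eps by (simp add: C1_def)
  \<comment> \<open>\<open>2 * (K / c0)\<^sup>2\<close> bounds the sum of the squares of
    \<open>reach\<close>, by \<open>q\<^sub>i \<le> K / (c0 * i)\<close> and the sum of inverse
    squares.\<close>
  define c1 where "c1 = (?q 0)\<^sup>2 * exp (- (C1 * (2 * (K / c0)\<^sup>2)))"
  have c1: "0 < c1" using qpos[of 0] by (simp add: c1_def)
  have NPl: "c1 \<le> NP k * (w k * ?q k)\<^sup>2" for k
  proof -
    have "(\<Sum>i=1..k. (reach i)\<^sup>2) \<le> (\<Sum>i=1..k. (K / c0)\<^sup>2 * (1 / (real i)\<^sup>2))"
    proof (rule sum_mono)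
      fix i assume i: "i \<in> {1..k}"
      have "reach i \<le> ?q i" unfolding reach_def using p_pos[of i] p_less[of i] qpos[of i] i by simp
      also have "\<dots> \<le> K / c0 / real i" using q_le i by simp
      finally have "(reach i)\<^sup>2 \<le> (K / c0 / real i)\<^sup>2" using reach_bounds(1)[of i] i
        by (intro power_mono) auto
      then show "(reach i)\<^sup>2 \<le> (K / c0)\<^sup>2 * (1 / (real i)\<^sup>2)" by (simp add: power_divide power_mult_distrib)
    qed
    also have "\<dots> = (K / c0)\<^sup>2 * (\<Sum>i=1..k. 1 / (real i)\<^sup>2)" by (rule sum_distrib_left[symmetric])
    also have "\<dots> \<le> (K / c0)\<^sup>2 * 2" by (intro mult_left_mono sum_inverse_squares_le) auto
    finally have "C1 * (\<Sum>i=1..k. (reach i)\<^sup>2) \<le> C1 * (2 * (K / c0)\<^sup>2)" using C1 by (intro mult_left_mono) auto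
    then have "c1 \<le> (?q 0)\<^sup>2 * exp (- (C1 * (\<Sum>i=1..k. (reach i)\<^sup>2)))"
      unfolding c1_def by (intro mult_left_mono) auto
    also have "\<dots> \<le> NP k * (w k * ?q k)\<^sup>2" unfolding C1_def by (rule NP_ge[OF summ D])
    finally show ?thesis .
  qed
  show ?thesis
  proof (rule pr_infinite_components_pos[OF D])
    define c where "c = c1 * c0 / (K * C)"
    show "0 < c" using c1 c0 K1 C0 by (simp add: c_def)
    show "c / real k \<le> F k" if k: "1 \<le> k" for k
    proof -
      have wq: "0 < w k * ?q k" using w_pos[of k] qpos[of k] by simp
      have k2: "w k \<le> C * (real k)\<^sup>2"
      proof -
        have "real k powr \<alpha> \<le> real k powr 2" using k \<alpha> by (intro powr_mono) auto
        also have "\<dots> = (real k)\<^sup>2" using k by (simp add: powr_numeral)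
        finally show ?thesis using C[OF k] C0 by (meson mult_left_mono order.trans less_imp_le)
      qed
      have "c / real k = c1 * (c0 * (real k / (K * (C * (real k)\<^sup>2))))"
        using k by (simp add: c_def power2_eq_square)
      also have "\<dots> \<le> c1 * (c0 * (real k / (K * w k)))"
        using k2 c1 c0 K1 C0 w_pos[of k] k by (intro mult_left_mono divide_left_mono) auto
      also have "\<dots> \<le> c1 * (c0 * tail k)"
        using tail_ge[OF k] c0 c1 by (intro mult_left_mono) auto
      also have "\<dots> \<le> c1 * (1 / (w k * ?q k))"
        using iq[of k] c1 by (intro mult_left_mono) auto
      also have "\<dots> \<le> NP k * (w k * ?q k)\<^sup>2 * (1 / (w k * ?q k))"
        using NPl[of k] wq by (intro mult_right_mono) auto
      also have "\<dots> = F k" using wq by (simp add: F_def power2_eq_square)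
      finally show ?thesis .
    qed
    define B where "B = C * (K / c0)\<^sup>2 / c1"
    have B0: "0 \<le> B" using C0 c1 by (simp add: B_def)
    show "(\<Sum>l<m. 1 / (real (Suc l) * (w l * NP l))) \<le> 1 + B * (\<Sum>l. real l powr (\<alpha> - 3))" for m
    proof -
      \<comment> \<open>\<open>powr\<close> at base 0 is 0, so the term \<open>l = 0\<close> is
        covered by the separate 1.\<close>
      have "1 / (real (Suc l) * (w l * NP l)) \<le> (if l = 0 then 1 else 0) + B * real l powr (\<alpha> - 3)" for l
      proof (cases "l = 0")
        case True
        then show ?thesis using B0 by (simp add: w_0 NP_def)
      next
        case False
        then have l: "1 \<le> l" by simp
        have "1 / NP l \<le> (w l * ?q l)\<^sup>2 / c1"
          using NPl[of l] NP_pos[of l] c1 by (simp add: field_simps)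
        then have "1 / NP l * (1 / (real (Suc l) * w l)) \<le> (w l * ?q l)\<^sup>2 / c1 * (1 / (real (Suc l) * w l))"
          using w_pos[of l] by (intro mult_right_mono) auto
        also have "\<dots> = w l * (?q l)\<^sup>2 / (c1 * real (Suc l))"
          using w_pos[of l] by (simp add: power2_eq_square)
        also have "\<dots> \<le> (C * real l powr \<alpha>) * (K / c0 / real l)\<^sup>2 / (c1 * real l)"
          using C[OF l] q_le[OF l] qpos[of l] w_pos[of l] c1 l C0
          by (intro frac_le mult_mono power_mono) (auto intro!: mult_pos_pos simp: less_imp_le)
        also have "\<dots> = B * (real l powr \<alpha> / real l ^ 3)"
          by (simp add: B_def power_divide power3_eq_cube power2_eq_square mult_ac)
        also have "real l powr \<alpha> / real l ^ 3 = real l powr (\<alpha> - 3)"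
          using l by (simp add: powr_diff powr_numeral)
        finally show ?thesis using False by (simp add: mult_ac)
      qed
      then have "(\<Sum>l<m. 1 / (real (Suc l) * (w l * NP l))) \<le> (\<Sum>l<m. (if l
        = 0 then 1 else 0) + B * real l powr (\<alpha> - 3))"
        by (intro sum_mono)
      also have "\<dots> = (\<Sum>l<m. if l = 0 then 1 else 0) + B * (\<Sum>l<m. real l powr (\<alpha> - 3))"
        by (simp add: sum.distrib sum_distrib_left)
      also have "\<dots> \<le> 1 + B * (\<Sum>l. real l powr (\<alpha> - 3))"
        using B0 \<alpha> by (intro add_mono mult_left_mono sums_powr_le) auto
      finally show ?thesis .
    qed
  qed
qed

end

text \<open>Cauchy condensation turns the series into one comparable to the sum of
  \<open>n powr (- \<theta>)\<close>.\<close>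

lemma summable_log_powr:
  assumes \<theta>: "1 < \<theta>"
  shows "summable (\<lambda>k. 1 / (real k * ln (real k) powr \<theta>))"
proof -
  \<comment> \<open>Below 2 the formula would give 0, by \<open>ln 1 = 0\<close> and division by 0,
    and destroy monotonicity; the value at 2 is used there.\<close>
  define f where "f n = (if n < 2 then 1 / (2 * ln 2 powr \<theta>) else 1 / (real n * ln (real n) powr \<theta>))" for n
  have "summable f \<longleftrightarrow> summable (\<lambda>n. 2 ^ n * f (2 ^ n))"
  proof (rule condensation_test)
    show "f (Suc n) \<le> f n" if "0 < n" for n
    proof (cases "n < 2")
      case True
      then have "n = 1" using that by simp
      then show ?thesis by (simp add: f_def numeral_2_eq_2)
    next
      case False
      then have "real n * ln (real n) powr \<theta> \<le> real (Suc n) * ln (real (Suc n)) powr \<theta>"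
        using \<theta> by (intro mult_mono powr_mono2) auto
      moreover have "0 < real n * ln (real n) powr \<theta>" using False by simp
      ultimately have "1 / (real (Suc n) * ln (real (Suc n)) powr \<theta>) \<le> 1 / (real n * ln (real n) powr \<theta>)"
        by (intro divide_left_mono) (auto intro!: mult_pos_pos)
      then show ?thesis using False by (simp add: f_def)
    qed
    show "0 \<le> f n" for n by (simp add: f_def)
  qed
  moreover have "summable (\<lambda>n. 2 ^ n * f (2 ^ n))"
  proof (rule summable_comparison_test_ev)
    show "\<forall>\<^sub>F n in sequentially. norm (2 ^ n * f (2 ^ n)) \<le> (1 / ln 2 powr \<theta>) * real n powr (- \<theta>)"
      using eventually_ge_at_top[of 1]
    proof eventually_elim
      case (elim n)
      have "(2::nat) ^ 1 \<le> 2 ^ n" using elim by (intro power_increasing) auto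
      then have "f (2 ^ n) = 1 / (2 ^ n * (real n * ln 2) powr \<theta>)"
        by (simp add: f_def ln_realpow)
      then show ?case using elim by (simp add: powr_mult powr_minus divide_inverse)
    qed
    show "summable (\<lambda>n. (1 / ln 2 powr \<theta>) * real n powr (- \<theta>))"
      using \<theta> by (intro summable_mult) (simp add: summable_real_powr_iff)
  qed
  ultimately have "summable f" by simp
  then show ?thesis
    by (rule summable_cong[THEN iffD1, rotated]) (use eventually_ge_at_top[of 2] in eventually_elim,
      simp add: f_def)
qed

context spherical_percolation
begin

lemma pr_infinite_components_power:
  assumes \<theta>: "1 < \<theta>" "\<theta> < 2" and as: "asymp_from 1 w (\<lambda>k. real k powr \<theta>)"
  shows "0 < pr (\<lambda>\<omega>. infinite (components (perc_times T p \<omega>)))"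
proof -
  obtain c C where c: "0 < c" "\<And>n. 1 \<le> n \<Longrightarrow> c \<le> w n / real n powr \<theta>" "\<And>n. 1 \<le> n \<Longrightarrow> w n / real n powr \<theta> \<le> C"
    using as unfolding asymp_from_def by blast
  have lo: "c * real n powr \<theta> \<le> w n" and hi: "w n \<le> C * real n powr \<theta>" if "1 \<le> n" for n
    using c(2,3)[OF that] that by (auto simp: field_simps)
  have C0: "0 < C" using c(1) c(2,3)[of 1] by simp
  show ?thesis
  proof (rule pr_infinite_components_pos_of_growth[OF _ _ hi \<theta>(2)])
    show "summable (\<lambda>k. 1 / w k)"
    proof (rule summable_comparison_test_ev)
      show "\<forall>\<^sub>F n in sequentially. norm (1 / w n) \<le> 1 / c * real n powr (- \<theta>)"
        using eventually_ge_at_top[of 1]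
      proof eventually_elim
        case (elim n)
        have "1 / w n \<le> 1 / (c * real n powr \<theta>)"
          using lo[OF elim] c(1) elim w_pos[of n] by (intro divide_left_mono mult_pos_pos) auto
        then show ?case using w_pos[of n] by (simp add: powr_minus divide_inverse less_imp_le)
      qed
      show "summable (\<lambda>n. 1 / c * real n powr (- \<theta>))"
        using \<theta> by (intro summable_mult) (simp add: summable_real_powr_iff)
    qed
    show "w j \<le> C * 2 powr \<theta> / c * w k" if k: "1 \<le> k" "k \<le> j" "j \<le> 2 * k" for k j
    proof -
      have "w j \<le> C * real j powr \<theta>" using hi k by simp
      also have "\<dots> \<le> C * (2 * real k) powr \<theta>"
        using C0 k \<theta> by (intro mult_left_mono powr_mono2) auto
      also have "\<dots> = C * 2 powr \<theta> / c * (c * real k powr \<theta>)" using c(1) by (simp add: powr_mult)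
      also have "\<dots> \<le> C * 2 powr \<theta> / c * w k" using lo[OF k(1)] C0 c(1) by (intro mult_left_mono) auto
      finally show ?thesis .
    qed
  qed
qed

lemma pr_infinite_components_log:
  assumes \<theta>: "1 < \<theta>" and as: "asymp_from 2 w (\<lambda>k. real k * (ln (real k)) powr \<theta>)"
  shows "0 < pr (\<lambda>\<omega>. infinite (components (perc_times T p \<omega>)))"
proof -
  define g where "g k = real k * ln (real k) powr \<theta>" for k :: nat
  have g: "0 < g n" if "2 \<le> n" for n using that by (simp add: g_def)
  obtain c C where c: "0 < c" "\<And>n. 2 \<le> n \<Longrightarrow> c \<le> w n / g n" "\<And>n. 2 \<le> n \<Longrightarrow> w n / g n \<le> C"
    using as unfolding asymp_from_def g_def by blast
  have lo: "c * g n \<le> w n" and hi: "w n \<le> C * g n" if "2 \<le> n" for n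
    using c(2,3)[OF that] g[OF that] by (auto simp: field_simps)
  have C0: "0 < C" using c(1) c(2,3)[of 2] by simp
  \<comment> \<open>Any exponent strictly between 1 and 2 serves as upper growth rate; it absorbs
    the power of the logarithm.\<close>
  have "(\<lambda>k. real k * ln (real k) powr \<theta> / real k powr (3 / 2)) \<longlonglongrightarrow> 0" by real_asymp
  then have "Bseq (\<lambda>k. g k / real k powr (3 / 2))" unfolding g_def by (intro convergent_imp_Bseq convergentI)
  then obtain L where L: "0 < L" "\<And>k. norm (g k / real k powr (3 / 2)) \<le> L" by (auto elim: BseqE)
  have gL: "g k \<le> L * real k powr (3 / 2)" if "1 \<le> k" for k
    using L(2)[of k] that by (simp add: divide_le_eq abs_le_iff)
  \<comment> \<open>The comparison starts at 2, where \<open>g\<close> becomes positive, so the case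
    \<open>k = 1\<close> is built into \<open>C'\<close> and \<open>K\<close> by the maxima.\<close>
  define C' where "C' = max (w 1) (C * L)"
  define K where "K = max (max 1 (w 2 / w 1)) (C * (2 * 2 powr \<theta>) / c)"
  show ?thesis
  proof (rule pr_infinite_components_pos_of_growth[of K C' "3 / 2"])
    show "summable (\<lambda>k. 1 / w k)"
    proof (rule summable_comparison_test_ev)
      show "\<forall>\<^sub>F n in sequentially. norm (1 / w n) \<le> 1 / c * (1 / g n)"
        using eventually_ge_at_top[of 2]
      proof eventually_elim
        case (elim n)
        have "1 / w n \<le> 1 / (c * g n)"
          using lo[OF elim] c(1) g[OF elim] w_pos[of n] by (intro divide_left_mono mult_pos_pos) auto
        then show ?case using w_pos[of n] by (simp add: less_imp_le)
      qed
      show "summable (\<lambda>n. 1 / c * (1 / g n))"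
        unfolding g_def using summable_log_powr[OF \<theta>] by (rule summable_mult)
    qed
    show "w j \<le> K * w k" if k: "1 \<le> k" "k \<le> j" "j \<le> 2 * k" for k j
    proof (cases "k = 1")
      case True
      then have "j = 1 \<or> j = 2" using k by auto
      then have "w j \<le> max 1 (w 2 / w 1) * w 1"
        using w_pos[of 1] by (auto simp: max_def field_simps)
      also have "\<dots> \<le> K * w 1" unfolding K_def using w_pos[of 1] by (intro mult_right_mono) auto
      finally show ?thesis using True by simp
    next
      case False
      then have k2: "2 \<le> k" using k by simp
      have "ln (real j) \<le> ln (2 * real k)" using k k2 by simp
      also have "\<dots> = ln 2 + ln (real k)" using k2 by (simp add: ln_mult)
      also have "\<dots> \<le> 2 * ln (real k)" using k2 by simp
      finally have "ln (real j) powr \<theta> \<le> (2 * ln (real k)) powr \<theta>"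
        using k k2 \<theta> by (intro powr_mono2) auto
      then have "g j \<le> (2 * real k) * ((2 * ln (real k)) powr \<theta>)"
        unfolding g_def using k by (intro mult_mono) auto
      also have "\<dots> = 2 * 2 powr \<theta> * g k" using k2 by (simp add: g_def powr_mult)
      finally have gj: "g j \<le> 2 * 2 powr \<theta> * g k" .
      have "w j \<le> C * g j" using hi k k2 by simp
      also have "\<dots> \<le> C * (2 * 2 powr \<theta> * g k)" using gj C0 by (intro mult_left_mono) auto
      also have "\<dots> = C * (2 * 2 powr \<theta>) / c * (c * g k)" using c(1) by simp
      also have "\<dots> \<le> C * (2 * 2 powr \<theta>) / c * w k" using lo[OF k2] C0 c(1) by (intro mult_left_mono) auto
      also have "\<dots> \<le> K * w k" unfolding K_def using w_pos[of k] by (intro mult_right_mono) auto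
      finally show ?thesis .
    qed
    show "w k \<le> C' * real k powr (3 / 2)" if k: "1 \<le> k" for k
    proof (cases "k = 1")
      case True
      then show ?thesis by (simp add: C'_def)
    next
      case False
      then have "w k \<le> C * g k" using hi k by simp
      also have "\<dots> \<le> C * (L * real k powr (3 / 2))" using gL[OF k] C0 by (intro mult_left_mono) auto
      also have "\<dots> \<le> C' * real k powr (3 / 2)" unfolding C'_def mult.assoc[symmetric]
        by (intro mult_right_mono) auto
      finally show ?thesis .
    qed
  qed simp
qed

end

section \<open>Static percolation\<close>

context spherical_percolation
begin

lemma summable_of_power_growth:
  assumes \<theta>: "2 < \<theta>" and as: "asymp_from 1 w (\<lambda>k. real k powr \<theta>)"
  shows "summable (\<lambda>k. real (Suc k) * inverse (w (Suc k)))"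
proof -
  obtain c C where c: "0 < c" "\<And>n. 1 \<le> n \<Longrightarrow> c \<le> w n / real n powr \<theta>"
    using as unfolding asymp_from_def by blast
  have "summable (\<lambda>k. 1 / c * real (Suc k) powr (1 - \<theta>))"
    using \<theta> summable_real_powr_iff[of "1 - \<theta>"] summable_Suc_iff[of "\<lambda>k. real k powr (1 - \<theta>)"]
    by (intro summable_mult) simp
  then show ?thesis
  proof (rule summable_comparison_test_ev[rotated], intro always_eventually allI)
    fix k
    have "c * real (Suc k) powr \<theta> \<le> w (Suc k)" using c(2)[of "Suc k"] by (simp add: le_divide_eq)
    then have "inverse (w (Suc k)) \<le> inverse (c * real (Suc k) powr \<theta>)"
      using c(1) by (intro le_imp_inverse_le) auto
    then have "real (Suc k) * inverse (w (Suc k)) \<le> real (Suc k) * inverse (c * real (Suc k) powr \<theta>)"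
      by (intro mult_left_mono) auto
    also have "\<dots> = 1 / c * real (Suc k) powr (1 - \<theta>)"
      by (simp add: powr_diff divide_inverse)
    finally show "norm (real (Suc k) * inverse (w (Suc k))) \<le> 1 / c * real (Suc k) powr (1 - \<theta>)"
      using w_pos[of "Suc k"] by (simp add: less_imp_le)
  qed
qed

section \<open>Percolation at a fixed time and the critical probability\<close>

lemma countable_edges: "countable (edges T)"
proof -
  have "edges T \<subseteq> (\<Union>k. level_set T k)" by (auto simp: edges_def level_set_def)
  moreover have "countable (\<Union>k. level_set T k)" using finite_level by (intro countable_UN)
    (auto intro: countable_finite)
  ultimately show ?thesis using countable_subset by blast
qed

lemma static_measurable_edge:
  assumes "v \<in> edges T"
  shows "Measurable.pred (static_perc T r) (\<lambda>c. c v)"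
proof -
  have "(\<lambda>c. c v) \<in> measurable (static_perc T r) (measure_pmf (bernoulli_pmf (r (level T v))))"
    unfolding static_perc_def using assms by (rule measurable_component_singleton)
  then show ?thesis by (simp cong: measurable_cong_sets)
qed

lemma prob_space_static: "prob_space (static_perc T r)"
  unfolding static_perc_def by (intro prob_space_PiM measure_pmf.prob_space_axioms)

lemma static_measurable_conn: "v \<in> verts T \<Longrightarrow> Measurable.pred (static_perc T r) (\<lambda>c. conn T m c v)"
proof (induction m arbitrary: v)
  case (Suc m)
  have "Measurable.pred (static_perc T r) (\<lambda>c. c u \<and> conn T m c u)" if "u \<in> children T v" for u
    using static_measurable_edge[OF childrenD(1)[OF that]] Suc.IH[OF childrenD(2)[OF that]]
    by (rule pred_intros_logic)
  then show ?case unfolding conn.simps using finite_children[OF Suc.prems] by (intro pred_intros_finite) auto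
qed simp

lemma static_measurable_root_percolates: "Measurable.pred (static_perc T r) (root_percolates T)"
  unfolding root_percolates_iff[abs_def] by (intro pred_intros_countable static_measurable_conn rho_verts)

lemma root_percolates_all_open:
  assumes "\<forall>v\<in>edges T. c v"
  shows "root_percolates T c"
proof -
  have "conn T m c v" if "v \<in> verts T" for m v
    using that
  proof (induction m arbitrary: v)
    case (Suc m)
    have "children T v \<noteq> {}" using card_children[OF Suc.prems] d_pos[of "level T v"] by auto
    then show ?case using Suc.IH assms childrenD by (auto simp: ex_in_conv[symmetric])
  qed simp
  then show ?thesis using root_percolates_iff rho_verts by blast
qed

text \<open>Shows that the set whose infimum is \<open>critical_prob\<close> is nonempty, so that
  elements close to the infimum exist.\<close>

lemma prob_root_percolates_one: "\<P>(c in static_perc T (\<lambda>_. 1). root_percolates T c) = 1"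
proof -
  interpret S: prob_space "static_perc T (\<lambda>_. 1)" by (rule prob_space_static)
  have "AE c in static_perc T (\<lambda>_. 1). \<forall>v\<in>edges T. c v"
  proof (rule AE_ball_countable[THEN iffD2, OF countable_edges], rule ballI)
    fix v assume v: "v \<in> edges T"
    have "AE b in measure_pmf (bernoulli_pmf 1). b"
      unfolding AE_measure_pmf_iff
    proof
      fix b assume "b \<in> set_pmf (bernoulli_pmf 1)"
      then show b by (cases b) (auto simp: set_pmf_iff)
    qed
    then show "AE c in static_perc T (\<lambda>_. 1). c v"
      unfolding static_perc_def
      by (intro AE_PiM_component[where P = "\<lambda>b. b"] v measure_pmf.prob_space_axioms)
  qed
  then have "AE c in static_perc T (\<lambda>_. 1). root_percolates T c"
    by eventually_elim (rule root_percolates_all_open)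
  then show ?thesis
    using static_measurable_root_percolates by (subst S.prob_Collect_eq_1) (auto simp: pred_def)
qed

text \<open>First moment bound: if the root percolates, level \<open>n\<close> contains a vertex of
  its cluster, and \<open>mean_conn_eq_expectation\<close> evaluates the expected number of such
  vertices.\<close>

lemma prob_root_percolates_le:
  assumes r: "r \<in> {0..1}"
  shows "\<P>(c in static_perc T (\<lambda>_. r). root_percolates T c) \<le> real (card (level_set T n)) * r ^ n"
proof -
  let ?S = "static_perc T (\<lambda>_. r)"
  interpret S: prob_space ?S by (rule prob_space_static)
  let ?f = "\<lambda>c. real (card (level_set T n \<inter> cluster T c (rho T)))"
  have f: "?f c = (\<Sum>v\<in>level_set T n. if \<forall>u\<in>ancestors T v. c u then 1 else 0)" for c
  proof -
    have "?f c = (\<Sum>v\<in>level_set T n. if v \<in> cluster T c (rho T) then 1 else 0)"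
      using finite_level by (simp add: sum.If_cases)
    also have "\<dots> = (\<Sum>v\<in>level_set T n. if \<forall>u\<in>ancestors T v. c u then 1 else 0)"
      using in_cluster_iff[OF rt] by (intro sum.cong) (auto simp: level_set_def)
    finally show ?thesis .
  qed
  have mf: "?f \<in> borel_measurable ?S" unfolding f
  proof (intro borel_measurable_sum measurable_If borel_measurable_const)
    fix v assume v: "v \<in> level_set T n"
    then have v': "v \<in> verts T" by (simp add: level_set_def)
    have "Measurable.pred ?S (\<lambda>c. \<forall>u\<in>ancestors T v. c u)"
      using ancestors_edges(1,3)[OF rt v'] by (intro pred_intros_finite static_measurable_edge) auto
    then show "{c \<in> space ?S. \<forall>u\<in>ancestors T v. c u} \<in> sets ?S" by (simp add: pred_def)
  qed
  have int: "integrable ?S ?f"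
    using mf finite_level by (intro S.integrable_const_bound[of _ "real (card (level_set T n))"])
      (auto intro!: card_mono)
  have A: "{c \<in> space ?S. root_percolates T c} \<in> sets ?S"
    using static_measurable_root_percolates by (simp add: pred_def)
  have "\<P>(c in ?S. root_percolates T c) = (\<integral>c. indicator {c \<in> space ?S. root_percolates T c} c \<partial>?S)"
    using A by simp
  also have "\<dots> \<le> (\<integral>c. ?f c \<partial>?S)"
  proof (rule integral_mono[OF _ int])
    show "integrable ?S (indicator {c \<in> space ?S. root_percolates T c} :: _ \<Rightarrow> real)"
      using A by (intro integrable_real_indicator) (auto simp: less_top[symmetric])
    fix c
    have "1 \<le> ?f c" if "root_percolates T c"
    proof -
      have rho: "rho T \<in> cluster T c (rho T)" by (simp add: cluster_def)
      have "\<exists>u\<in>level_set T n. u \<in> cluster T c (rho T)"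
        using conn_imp_cluster[OF rho rho_verts, of n] that root_percolates_iff by simp
      then have "0 < card (level_set T n \<inter> cluster T c (rho T))"
        using finite_level by (auto simp: card_gt_0_iff)
      then show ?thesis by simp
    qed
    then show "indicator {c \<in> space ?S. root_percolates T c} c \<le> ?f c" by (simp add: indicator_def)
  qed
  also have "\<dots> = mean_conn T (\<lambda>_. r) n"
    using r by (intro mean_conn_eq_expectation[OF sst, symmetric]) auto
  finally show ?thesis by (simp add: mean_conn_def)
qed

text \<open>Some \<open>r < q\<close> has percolation probability \<open>\<delta> > 0\<close>. The
  first moment bound at \<open>r\<close> forces
  \<open>card (level_set T n) \<ge> \<delta> / r ^ n\<close>, so that
  \<open>w n \<ge> \<delta> * (q / r) ^ n\<close> grows exponentially.\<close>

lemma summable_of_supercritical: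
  assumes q: "\<And>n. 1 \<le> n \<Longrightarrow> p n = q" and crit: "critical_prob T < q"
  shows "summable (\<lambda>k. real (Suc k) * inverse (w (Suc k)))"
proof -
  let ?A = "{q \<in> {0..1}. \<P>(c in static_perc T (\<lambda>_. q). root_percolates T c) > 0}"
  have "1 \<in> ?A" using prob_root_percolates_one by simp
  then have "?A \<noteq> {}" by blast
  then obtain r where r: "r \<in> ?A" "r < q"
    using crit cInf_lessD[of ?A q] unfolding critical_prob_def by blast
  define \<delta> where "\<delta> = \<P>(c in static_perc T (\<lambda>_. r). root_percolates T c)"
  have \<delta>: "0 < \<delta>" "\<And>n. \<delta> \<le> real (card (level_set T n)) * r ^ n"
    using r prob_root_percolates_le[of r] by (auto simp: \<delta>_def)
  have r0: "0 < r" using \<delta>(1) \<delta>(2)[of 1] r(1) by (cases "r = 0") auto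
  have wq: "w n = real (card (level_set T n)) * q ^ n" for n
  proof -
    have "(\<Prod>i=1..n. p i) = (\<Prod>i=1..n. q)" using q by (intro prod.cong) auto
    then show ?thesis by (simp add: mean_conn_def)
  qed
  define z where "z = r / q"
  have z: "0 < z" "z < 1" using r0 r(2) by (auto simp: z_def)
  have "summable (\<lambda>k. z / \<delta> * (real (Suc k) * z ^ k))"
    using z by (intro summable_mult sums_summable[OF geometric_deriv_sums]) auto
  then show ?thesis
  proof (rule summable_comparison_test_ev[rotated], intro always_eventually allI)
    fix k
    have "\<delta> * (q / r) ^ Suc k \<le> real (card (level_set T (Suc k))) * r ^ Suc k * (q / r) ^ Suc k"
      using \<delta>(2)[of "Suc k"] r0 r(2) by (intro mult_right_mono) auto
    also have "\<dots> = w (Suc k)" unfolding wq using r0 by (simp add: power_divide)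
    finally have "inverse (w (Suc k)) \<le> inverse (\<delta> * (q / r) ^ Suc k)"
      using \<delta>(1) r0 r(2) by (intro le_imp_inverse_le) auto
    also have "q / r = inverse z" by (simp add: z_def)
    also have "inverse (\<delta> * inverse z ^ Suc k) = z / \<delta> * z ^ k"
      by (simp add: power_inverse divide_inverse)
    finally have "real (Suc k) * inverse (w (Suc k)) \<le> real (Suc k) * (z / \<delta> * z ^ k)"
      by (intro mult_left_mono) auto
    then show "norm (real (Suc k) * inverse (w (Suc k))) \<le> z / \<delta> * (real (Suc k) * z ^ k)"
      using w_pos[of "Suc k"] by (simp add: less_imp_le mult_ac)
  qed
qed

end

theorem theorem1p3:
  fixes T :: "'v rtree" and d :: "nat \<Rightarrow> nat" and p :: "nat \<Rightarrow> real"
  assumes "spherically_symmetric_tree T d"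
    and "\<And>n. n \<ge> 1 \<Longrightarrow> p n \<in> {0..1}"
    and "0 < (INF n\<in>{1..}. p n)" and "(SUP n\<in>{1..}. p n) < 1"
  shows
    "(summable (\<lambda>k. real (Suc k) * inverse (mean_conn T p (Suc k))) \<longrightarrow>
        (AE \<omega> in dyn_perc T p. finite (components (perc_times T p \<omega>))))
     \<and> (\<forall>\<theta>>2. asymp_from 1 (mean_conn T p) (\<lambda>k. real k powr \<theta>) \<longrightarrow>
          summable (\<lambda>k. real (Suc k) * inverse (mean_conn T p (Suc k))))
     \<and> (\<forall>q. homogeneous_tree T \<and> (\<forall>n\<ge>1. p n = q) \<and> critical_prob T < q \<longrightarrow>
          summable (\<lambda>k. real (Suc k) * inverse (mean_conn T p (Suc k))))
     \<and> (\<forall>\<theta>. bdd_above (range d) \<and> 1 < \<theta> \<and> \<theta> < 2 \<and>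
          asymp_from 1 (mean_conn T p) (\<lambda>k. real k powr \<theta>) \<longrightarrow>
          \<P>(\<omega> in dyn_perc T p. infinite (components (perc_times T p \<omega>))) > 0)
     \<and> (\<forall>\<theta>>1. asymp_from 2 (mean_conn T p) (\<lambda>k. real k * (ln (real k)) powr \<theta>) \<longrightarrow>
          \<P>(\<omega> in dyn_perc T p. infinite (components (perc_times T p \<omega>))) > 0)"
proof -
  \<comment> \<open>The distance of the edge probabilities from 0 and 1.\<close>
  define e where "e = min (INF n\<in>{1..}. p n) (1 - (SUP n\<in>{1..}. p n))"
  have bdd: "bdd_below (p ` {1..})" "bdd_above (p ` {1..})"
    using assms(2) by (force intro: bdd_belowI2[where m = 0] bdd_aboveI2[where M = 1])+
  interpret spherical_percolation T d p e
  proof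
    show "spherically_symmetric_tree T d" by fact
    show "0 < e" using assms(3,4) by (simp add: e_def)
    show "e \<le> p n" if "1 \<le> n" for n
      using cINF_lower[OF bdd(1), of n] that by (simp add: e_def min_le_iff_disj)
    show "p n \<le> 1 - e" if "1 \<le> n" for n
      using cSUP_upper[of n "{1..}" p, OF _ bdd(2)] that by (simp add: e_def min_def)
  qed
  show ?thesis
    unfolding pr_def[symmetric]
  proof (intro conjI allI impI)
    fix \<theta> q
    show "AE \<omega> in dyn_perc T p. finite (components (perc_times T p \<omega>))"
      if "summable (\<lambda>k. real (Suc k) * inverse (w (Suc k)))"
      using that by (rule AE_finite_components)
    show "summable (\<lambda>k. real (Suc k) * inverse (w (Suc k)))"
      if "2 < \<theta>" "asymp_from 1 w (\<lambda>k. real k powr \<theta>)"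
      using that by (rule summable_of_power_growth)
    show "summable (\<lambda>k. real (Suc k) * inverse (w (Suc k)))"
      if "homogeneous_tree T \<and> (\<forall>n\<ge>1. p n = q) \<and> critical_prob T < q"
      by (rule summable_of_supercritical[of q]) (use that in auto)
    show "0 < pr (\<lambda>\<omega>. infinite (components (perc_times T p \<omega>)))"
      if "bdd_above (range d) \<and> 1 < \<theta> \<and> \<theta> < 2 \<and> asymp_from 1 w (\<lambda>k. real k powr \<theta>)"
      by (rule pr_infinite_components_power[of \<theta>]) (use that in auto)
    show "0 < pr (\<lambda>\<omega>. infinite (components (perc_times T p \<omega>)))"
      if "1 < \<theta>" "asymp_from 2 w (\<lambda>k. real k * ln (real k) powr \<theta>)"
      using that by (rule pr_infinite_components_log)
  qed
qed

end
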